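(* Let $\mu: H^0([0,2\pi]) \to G$ be the monodromy map of the equation $-v''+qv=0$ on $[0,2\pi]$, let $G_0 \subset G$ be the open set defined in the context, and let $\mathbb{H}$ be the real infinite dimensional separable Hilbert space. There exists a diffeomorphism $\Psi: G_0 \times \mathbb{H} \to H^0([0,2\pi])$ such that the composition $\mu \circ \Psi$ is the projection on the first coordinate, i.e. $\mu(\Psi(g,h)) = g$ for all $(g,h) \in G_0\times\mathbb{H}$.
   Context: $H^0([0,2\pi]) = L^2([0,2\pi])$ (real valued functions). Let $\Pi: G = \widetilde{SL(2,\mathbb{R})} \to SL(2,\mathbb{R})$ be the universal cover, a Lie group with identity denoted $I$. Monodromy: for $q \in H^0([0,2\pi])$ let $\Phi: [0,2\pi] \to SL(2,\mathbb{R})$ be the fundamental matrix, i.e. the solution of $\Phi(0) = I$, $\Phi'(t) = \begin{pmatrix} 0 & 1 \\ q(t) & 0 \end{pmatrix}\Phi(t)$. Let $\tilde\Phi: [0,2\pi] \to G$ be its continuous lift with $\tilde\Phi(0) = I$, $\Pi\circ\tilde\Phi = \Phi$. Then $\mu(q) = \tilde\Phi(2\pi) \in G$. The set $G_0$: let $\phi_L: \mathbb{R} \times (0,\infty) \times \mathbb{R} \to G$ be the diffeomorphism (left Iwasawa decomposition) determined by continuity, $\phi_L(0,1,0) = I$ and $$(\Pi \circ \phi_L)(\theta,\rho,\nu) = \begin{pmatrix} \cos\theta & \sin\theta \\ -\sin\theta & \cos\theta \end{pmatrix} \begin{pmatrix} \sqrt{\rho} & 0 \\ 0 & 1/\sqrt{\rho}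 \end{pmatrix} \begin{pmatrix} 1 & 0 \\ \nu/2 & 1 \end{pmatrix}.$$ Then $G_0 = \phi_L((0,+\infty)\times(0,+\infty)\times\mathbb{R})$, an open subset of $G$. *)

theory Defs
  imports "HOL-Analysis.Analysis"
begin

abbreviation leb :: "real measure" where
  "leb \<equiv> lebesgue_on {0..2*pi}"

definition square_integrable :: "(real \<Rightarrow> real) \<Rightarrow> bool" where
  "square_integrable f \<longleftrightarrow> f \<in> borel_measurable leb \<and> integrable leb (\<lambda>t. (f t)\<^sup>2)"

definition L2_eq :: "(real \<Rightarrow> real) \<Rightarrow> (real \<Rightarrow> real) \<Rightarrow> bool" where
  "L2_eq f g \<longleftrightarrow> square_integrable f \<and> square_integrable g \<and> (AE t in leb. f t = g t)"

lemma square_integrable_mult: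
  assumes "square_integrable f" "square_integrable g"
  shows "integrable leb (\<lambda>t. f t * g t)"
proof (rule Bochner_Integration.integrable_bound)
  show "integrable leb (\<lambda>t. (f t)\<^sup>2 + (g t)\<^sup>2)"
    using assms by (simp add: square_integrable_def)
  show "(\<lambda>t. f t * g t) \<in> borel_measurable leb"
    using assms by (auto simp: square_integrable_def intro: borel_measurable_times)
  have "norm (a * b) \<le> norm (a\<^sup>2 + b\<^sup>2)" for a b :: real
  proof -
    have "2 * (\<bar>a\<bar> * \<bar>b\<bar>) \<le> a\<^sup>2 + b\<^sup>2"
      using sum_squares_bound[of "\<bar>a\<bar>" "\<bar>b\<bar>"] by simp
    moreover have "0 \<le> \<bar>a\<bar> * \<bar>b\<bar>"
      by simp
    ultimately have "\<bar>a\<bar> * \<bar>b\<bar> \<le> a\<^sup>2 + b\<^sup>2"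
      by linarith
    then show ?thesis
      by (simp add: abs_mult)
  qed
  then show "AE t in leb. norm (f t * g t) \<le> norm ((f t)\<^sup>2 + (g t)\<^sup>2)"
    by simp
qed

lemma square_integrable_zero: "square_integrable (\<lambda>_. 0)"
  by (simp add: square_integrable_def)

lemma square_integrable_scale:
  "square_integrable f \<Longrightarrow> square_integrable (\<lambda>t. c * f t)"
  by (auto simp: square_integrable_def power_mult_distrib)

lemma square_integrable_add:
  assumes "square_integrable f" "square_integrable g"
  shows "square_integrable (\<lambda>t. f t + g t)"
proof -
  have "integrable leb (\<lambda>t. (f t)\<^sup>2 + (g t)\<^sup>2 + 2 * (f t * g t))"
    using assms square_integrable_mult[OF assms] by (simp add: square_integrable_def)
  moreover have "(\<lambda>t. (f t)\<^sup>2 + (g t)\<^sup>2 + 2 * (f t * g t)) = (\<lambda>t. (f t + g t)\<^sup>2)"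
    by (auto simp: power2_sum)
  ultimately show ?thesis
    using assms by (auto simp: square_integrable_def)
qed

quotient_type H0 = "real \<Rightarrow> real" / partial: L2_eq
proof (rule part_equivpI)
  show "\<exists>f. L2_eq f f"
    using square_integrable_zero by (auto simp: L2_eq_def)
  show "symp L2_eq"
    by (auto simp: symp_def L2_eq_def)
  show "transp L2_eq"
    by (fastforce simp: transp_def L2_eq_def)
qed

instantiation H0 :: real_inner
begin

lift_definition zero_H0 :: H0 is "\<lambda>_. 0"
  using square_integrable_zero by (auto simp: L2_eq_def)

lift_definition plus_H0 :: "H0 \<Rightarrow> H0 \<Rightarrow> H0" is "\<lambda>f g t. f t + g t"
  by (auto simp: L2_eq_def square_integrable_add elim: eventually_elim2)

lift_definition scaleR_H0 :: "real \<Rightarrow> H0 \<Rightarrow> H0" is "\<lambda>c f t. c * f t"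
  by (auto simp: L2_eq_def square_integrable_scale elim: eventually_mono)

lift_definition uminus_H0 :: "H0 \<Rightarrow> H0" is "\<lambda>f t. - f t"
  using square_integrable_scale[of _ "-1"] by (auto simp: L2_eq_def)

definition minus_H0 :: "H0 \<Rightarrow> H0 \<Rightarrow> H0" where
  "minus_H0 a b = a + - b"

lift_definition inner_H0 :: "H0 \<Rightarrow> H0 \<Rightarrow> real" is "\<lambda>f g. (\<integral>t. f t * g t \<partial>leb)"
  by (rule integral_cong_AE)
    (auto simp: L2_eq_def square_integrable_def intro: borel_measurable_times elim: eventually_elim2)

definition norm_H0 :: "H0 \<Rightarrow> real" where
  "norm_H0 a = sqrt (inner a a)"

definition dist_H0 :: "H0 \<Rightarrow> H0 \<Rightarrow> real" where
  "dist_H0 a b = norm (a - b)"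

definition sgn_H0 :: "H0 \<Rightarrow> H0" where
  "sgn_H0 a = inverse (norm a) *\<^sub>R a"

definition uniformity_H0 :: "(H0 \<times> H0) filter" where
  "uniformity_H0 = (INF e\<in>{0<..}. principal {(a, b). dist a b < e})"

definition open_H0 :: "H0 set \<Rightarrow> bool" where
  "open_H0 U \<longleftrightarrow> (\<forall>x\<in>U. eventually (\<lambda>(x', y). x' = x \<longrightarrow> y \<in> U) uniformity)"

instance
proof
  fix a b c :: H0 and r s :: real
  show "a + b + c = a + (b + c)"
    by transfer (auto simp: L2_eq_def square_integrable_add algebra_simps)
  show "a + b = b + a"
    by transfer (auto simp: L2_eq_def square_integrable_add algebra_simps)
  show "0 + a = a"
    by transfer (auto simp: L2_eq_def)
  show "- a + a = 0"
    by transfer (auto simp: L2_eq_def square_integrable_zero)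
  show "a - b = a + - b"
    by (simp add: minus_H0_def)
  show "r *\<^sub>R (a + b) = r *\<^sub>R a + r *\<^sub>R b"
    by transfer (auto simp: L2_eq_def square_integrable_add square_integrable_scale algebra_simps)
  show "(r + s) *\<^sub>R a = r *\<^sub>R a + s *\<^sub>R a"
    by transfer (auto simp: L2_eq_def square_integrable_add square_integrable_scale distrib_right
        intro: square_integrable_scale[of _ "r + s", simplified distrib_right])
  show "r *\<^sub>R s *\<^sub>R a = (r * s) *\<^sub>R a"
    by transfer (auto simp: L2_eq_def square_integrable_scale mult.assoc
        intro: square_integrable_scale[of _ "r * s", simplified mult.assoc])
  show "1 *\<^sub>R a = a"
    by transfer (auto simp: L2_eq_def)
  show "sgn a = inverse (norm a) *\<^sub>R a"
    by (simp add: sgn_H0_def)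
  show "dist a b = norm (a - b)"
    by (simp add: dist_H0_def)
  show "(uniformity :: (H0 \<times> H0) filter) = (INF e\<in>{0<..}. principal {(a, b). dist a b < e})"
    by (rule uniformity_H0_def)
  show "open U \<longleftrightarrow> (\<forall>x\<in>U. eventually (\<lambda>(x', y). x' = x \<longrightarrow> y \<in> U) uniformity)" for U :: "H0 set"
    by (rule open_H0_def)
  show "inner a b = inner b a"
    by transfer (simp add: mult.commute)
  show "inner (a + b) c = inner a c + inner b c"
    by transfer (auto simp: L2_eq_def distrib_right square_integrable_mult)
  show "inner (r *\<^sub>R a) b = r * inner a b"
    by transfer (auto simp: L2_eq_def mult.assoc)
  show "0 \<le> inner a a"
    by transfer simp
  show "inner a a = 0 \<longleftrightarrow> a = 0"
  proof transfer
    fix f assume "L2_eq f f"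
    then have f: "square_integrable f"
      by (simp add: L2_eq_def)
    have "(\<integral>t. (f t)\<^sup>2 \<partial>leb) = 0 \<longleftrightarrow> (AE t in leb. (f t)\<^sup>2 = 0)"
      using f by (intro integral_nonneg_eq_0_iff_AE) (auto simp: square_integrable_def)
    then show "(\<integral>t. f t * f t \<partial>leb) = 0 \<longleftrightarrow> L2_eq f (\<lambda>_. 0)"
      using f square_integrable_zero by (simp add: L2_eq_def power2_eq_square)
  qed
  show "norm a = sqrt (inner a a)"
    by (simp add: norm_H0_def)
qed

end

text \<open>
  The space of bounded $k$-linear maps is represented by functions on lists of length $k$, since the
  types of the iterated Frechet derivatives depend on $k$. The map \<open>D (Suc k) x\<close> is the Frechet
  derivative of \<open>D k\<close> at \<open>x\<close> with respect to the operator norm, under the identification of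
  $L(E, L^k(E; F))$ with $L^{k+1}(E; F)$; the first list entry is the direction of differentiation.
\<close>

definition bounded_multilinear ::
    "nat \<Rightarrow> ('a::real_normed_vector list \<Rightarrow> 'b::real_normed_vector) \<Rightarrow> bool" where
  "bounded_multilinear k m \<longleftrightarrow>
     (\<forall>vs. length vs = k \<longrightarrow> (\<forall>i<k. linear (\<lambda>w. m (vs[i := w])))) \<and>
     (\<exists>C. \<forall>vs. length vs = k \<longrightarrow> norm (m vs) \<le> C * prod_list (map norm vs))"

definition has_multilinear_derivative ::
    "nat \<Rightarrow> ('a::real_normed_vector \<Rightarrow> 'a list \<Rightarrow> 'b::real_normed_vector) \<Rightarrow> ('a list \<Rightarrow> 'b) \<Rightarrow> 'a \<Rightarrow> bool"
  where
  "has_multilinear_derivative k F F' x \<longleftrightarrow>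
     (\<forall>\<epsilon>>0. \<forall>\<^sub>F y in nhds x. \<forall>vs. length vs = k \<longrightarrow>
        norm (F y vs - F x vs - F' ((y - x) # vs)) \<le> \<epsilon> * norm (y - x) * prod_list (map norm vs))"

definition smooth_on :: "'a::real_normed_vector set \<Rightarrow> ('a \<Rightarrow> 'b::real_normed_vector) \<Rightarrow> bool" where
  "smooth_on S f \<longleftrightarrow> open S \<and>
     (\<exists>D :: nat \<Rightarrow> 'a \<Rightarrow> 'a list \<Rightarrow> 'b.
        (\<forall>x\<in>S. D 0 x [] = f x) \<and>
        (\<forall>k. \<forall>x\<in>S. bounded_multilinear k (D k x) \<and>
                      has_multilinear_derivative k (D k) (D (Suc k) x) x))"

definition SL2 :: "(real^2^2) set" where
  "SL2 = {A. det A = 1}"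

text \<open>
  The universal cover is determined up to isomorphism by the projection \<open>p\<close> and the point \<open>e\<close>
  over the identity matrix, which is the identity element of the group structure on \<open>G\<close>.
\<close>

definition universal_cover_SL2 ::
    "'g::topological_space set \<Rightarrow> ('g \<Rightarrow> real^2^2) \<Rightarrow> 'g \<Rightarrow> bool" where
  "universal_cover_SL2 G p e \<longleftrightarrow>
     covering_space G p SL2 \<and> simply_connected G \<and> e \<in> G \<and> p e = mat 1"

definition matrix2 :: "real \<Rightarrow> real \<Rightarrow> real \<Rightarrow> real \<Rightarrow> real^2^2" where
  "matrix2 a b c d = vector [vector [a, b], vector [c, d]]"

definition iwasawa :: "real \<times> real \<times> real \<Rightarrow> real^2^2" where
  "iwasawa = (\<lambda>(\<theta>, \<rho>, \<nu>).
     matrix2 (cos \<theta>) (sin \<theta>) (- sin \<theta>) (cos \<theta>) **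
     matrix2 (sqrt \<rho>) 0 0 (1 / sqrt \<rho>) **
     matrix2 1 0 (\<nu> / 2) 1)"

text \<open>Uniqueness of lifts determines \<open>phi_L\<close> on the half-space where the second coordinate is positive.\<close>

definition phi_L ::
    "'g::topological_space set \<Rightarrow> ('g \<Rightarrow> real^2^2) \<Rightarrow> 'g \<Rightarrow> real \<times> real \<times> real \<Rightarrow> 'g" where
  "phi_L G p e = (SOME \<phi>.
     continuous_on (UNIV \<times> {0<..} \<times> UNIV) \<phi> \<and> \<phi> ` (UNIV \<times> {0<..} \<times> UNIV) \<subseteq> G \<and>
     \<phi> (0, 1, 0) = e \<and> (\<forall>x \<in> UNIV \<times> {0<..} \<times> UNIV. p (\<phi> x) = iwasawa x))"

definition G0 :: "'g::topological_space set \<Rightarrow> ('g \<Rightarrow> real^2^2) \<Rightarrow> 'g \<Rightarrow> 'g set" where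
  "G0 G p e = phi_L G p e ` ({0<..} \<times> {0<..} \<times> UNIV)"

definition absolutely_continuous_on_interval ::
    "real \<Rightarrow> real \<Rightarrow> (real \<Rightarrow> 'a::real_normed_vector) \<Rightarrow> bool" where
  "absolutely_continuous_on_interval a b f \<longleftrightarrow>
     (\<forall>\<epsilon>>0. \<exists>\<delta>>0. \<forall>d T. d division_of T \<longrightarrow> T \<subseteq> {a..b} \<longrightarrow> (\<Sum>K\<in>d. Sup K - Inf K) < \<delta> \<longrightarrow>
        (\<Sum>K\<in>d. norm (f (Sup K) - f (Inf K))) < \<epsilon>)"

text \<open>As \<open>q\<close> is merely square integrable, the equation is understood in the sense of Caratheodory.\<close>

definition fundamental_matrix :: "(real \<Rightarrow> real) \<Rightarrow> (real \<Rightarrow> real^2^2) \<Rightarrow> bool" where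
  "fundamental_matrix q \<Phi> \<longleftrightarrow>
     absolutely_continuous_on_interval 0 (2*pi) \<Phi> \<and> \<Phi> 0 = mat 1 \<and>
     (AE t in leb. (\<Phi> has_vector_derivative (matrix2 0 1 (q t) 0 ** \<Phi> t)) (at t within {0..2*pi}))"

text \<open>
  Solutions do not depend on the representative \<open>rep_H0 q\<close>; they and their lifts are unique on the
  interval from 0 to $2\pi$, so the description below is definite.
\<close>

definition monodromy ::
    "'g::topological_space set \<Rightarrow> ('g \<Rightarrow> real^2^2) \<Rightarrow> 'g \<Rightarrow> H0 \<Rightarrow> 'g" where
  "monodromy G p e q = (THE g. \<exists>\<Phi> \<Phi>'.
     fundamental_matrix (rep_H0 q) \<Phi> \<and>
     continuous_on {0..2*pi} \<Phi>' \<and> \<Phi>' ` {0..2*pi} \<subseteq> G \<and> \<Phi>' 0 = e \<and>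
     (\<forall>t\<in>{0..2*pi}. p (\<Phi>' t) = \<Phi> t) \<and> g = \<Phi>' (2*pi))"

text \<open>
  The smooth structure on \<open>G\<close> is the one making \<open>p\<close> a local diffeomorphism onto the embedded
  submanifold \<open>SL2\<close> of the space of matrices. A map on an open subset of \<open>G \<times> 'h\<close> is therefore smooth
  if it locally extends, through \<open>p\<close>, to a smooth map on an open set of matrices times \<open>'h\<close>; a map into
  \<open>G \<times> 'h\<close> is smooth if it is continuous and smooth after applying \<open>p\<close> to the first component.
\<close>

definition smooth_from_cover ::
    "'g::topological_space set \<Rightarrow> ('g \<Rightarrow> real^2^2) \<Rightarrow> 'g set \<Rightarrow>
     ('g \<times> 'h::real_normed_vector \<Rightarrow> 'b::real_normed_vector) \<Rightarrow> bool" where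
  "smooth_from_cover G p U f \<longleftrightarrow>
     (\<forall>g\<in>U. \<forall>h. \<exists>V N W F. openin (top_of_set G) V \<and> g \<in> V \<and> V \<subseteq> U \<and> open N \<and> h \<in> N \<and>
        p ` V \<times> N \<subseteq> W \<and> smooth_on W F \<and> (\<forall>x\<in>V. \<forall>y\<in>N. f (x, y) = F (p x, y)))"

definition smooth_into_cover ::
    "'g::topological_space set \<Rightarrow> ('g \<Rightarrow> real^2^2) \<Rightarrow> 'g set \<Rightarrow>
     ('b::real_normed_vector \<Rightarrow> 'g \<times> 'h::real_normed_vector) \<Rightarrow> bool" where
  "smooth_into_cover G p U f \<longleftrightarrow>
     range f \<subseteq> U \<times> UNIV \<and> U \<subseteq> G \<and> continuous_on UNIV (fst \<circ> f) \<and>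
     smooth_on UNIV (p \<circ> fst \<circ> f) \<and> smooth_on UNIV (snd \<circ> f)"

definition diffeomorphism_from_cover ::
    "'g::topological_space set \<Rightarrow> ('g \<Rightarrow> real^2^2) \<Rightarrow> 'g set \<Rightarrow>
     ('g \<times> 'h::real_normed_vector \<Rightarrow> 'b::real_normed_vector) \<Rightarrow> bool" where
  "diffeomorphism_from_cover G p U \<Psi> \<longleftrightarrow>
     bij_betw \<Psi> (U \<times> UNIV) UNIV \<and> smooth_from_cover G p U \<Psi> \<and>
     smooth_into_cover G p U (inv_into (U \<times> UNIV) \<Psi>)"

end

(*
  The first row of the fundamental matrix is a planar curve (v1, v2) with v'' = q v and Wronskian 1. In
  polar coordinates r = exp (- w / 2) and theta' = 1 / r^2 = exp w, so that
  q = - w''/2 + (w')^2/4 - exp (2 w) with w (0) = w' (0) = 0. Hence f = w'' is a global smooth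
  coordinate on H0 ("Kepler transform"), and the lifted monodromy of q is the point with Iwasawa
  coordinates determined by w' (2 pi), w (2 pi) and the total angle, the integral of exp w.
  The first two end values are linear functionals of f, namely combinations of the inner products with
  1 and t - pi. Moving f along cos t leaves them unchanged and adds a multiple of 1 - cos t >= 0 to w, so
  the total angle increases strictly from 0 to infinity and may be prescribed by the implicit function
  theorem. The orthogonal complement of 1, t - pi and cos t remains free and is isometric to the given
  Hilbert space.
*)
theory Submission
  imports Defs "HOL-Real_Asymp.Real_Asymp"
begin

text \<open>Two obstacles shape the work around the Kepler transform. The first is smoothness, which
  asks for derivatives of all orders between infinite dimensional spaces. Higher derivatives are
  never computed: each map is shown to have a derivative built from the map itself and from maps
  already known to be smooth, and induction on the order does the rest. This covers the exponential,
  the reciprocal, the implicit function for the angle, and the dependence of the fundamental matrix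
  on the potential, where the derivative of the resolvent of a Volterra operator is quadratic in the
  resolvent. The inverse of the Kepler transform is an explicit expression in the solutions, so its
  smoothness follows from theirs. The second obstacle is that the open set is defined by the angle
  of the second column of a matrix, whereas the planar curve has the angle of the first row. The two
  differ by less than a half turn and their sines have the same sign; hence they are positive
  together, and membership in the set becomes positivity of the total angle.\<close>

subsection \<open>Differentiability of multilinear fields\<close>

lemma bounded_multilinear_bound:
  assumes "bounded_multilinear k m"
  obtains C where "C \<ge> 0" "\<And>vs. length vs = k \<Longrightarrow> norm (m vs) \<le> C * prod_list (map norm vs)"
proof -
  obtain C where C: "\<And>vs. length vs = k \<Longrightarrow> norm (m vs) \<le> C * prod_list (map norm vs)"
    using assms unfolding bounded_multilinear_def by blast
  have pos: "prod_list (map norm vs) \<ge> 0" for vs :: "'a list"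
    by (induction vs) auto
  have "norm (m vs) \<le> max 0 C * prod_list (map norm vs)" if "length vs = k" for vs
    using C[OF that] mult_right_mono[OF max.cobounded2[of C 0] pos[of vs]] by linarith
  then show ?thesis
    using that[of "max 0 C"] by simp
qed

lemma prod_list_norm_nonneg: "prod_list (map norm vs) \<ge> 0"
  for vs :: "'a::real_normed_vector list"
  by (induction vs) auto

lemma bounded_multilinearI:
  assumes "\<And>vs i. length vs = k \<Longrightarrow> i < k \<Longrightarrow> linear (\<lambda>w. m (vs[i := w]))"
    and "\<And>vs. length vs = k \<Longrightarrow> norm (m vs) \<le> C * prod_list (map norm vs)"
  shows "bounded_multilinear k m"
  using assms unfolding bounded_multilinear_def by blast

lemma bounded_multilinear_linear:
  "bounded_multilinear k m \<Longrightarrow> length vs = k \<Longrightarrow> i < k \<Longrightarrow> linear (\<lambda>w. m (vs[i := w]))"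
  unfolding bounded_multilinear_def by blast

lemma bounded_multilinear_linear_hd:
  assumes "bounded_multilinear (Suc k) m" "length vs = k"
  shows "linear (\<lambda>w. m (w # vs))"
  using bounded_multilinear_linear[OF assms(1), of "0 # vs" 0] assms(2) by simp

lemma bounded_multilinear_linear_tl:
  assumes "bounded_multilinear (Suc k) m" "length vs = k" "i < k"
  shows "linear (\<lambda>w. m (v # vs[i := w]))"
  using bounded_multilinear_linear[OF assms(1), of "v # vs" "Suc i"] assms(2,3) by simp

lemma bounded_multilinear_cong:
  assumes "\<And>vs. length vs = k \<Longrightarrow> m vs = m' vs"
  shows "bounded_multilinear k m \<longleftrightarrow> bounded_multilinear k m'"
proof -
  have "linear (\<lambda>w. m (vs[i := w])) \<longleftrightarrow> linear (\<lambda>w. m' (vs[i := w]))" if "length vs = k" for vs i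
    using assms that by simp
  then show ?thesis
    unfolding bounded_multilinear_def using assms by auto
qed

text \<open>Being \<open>n\<close> times differentiable; the derivative of order \<open>n\<close> need not be continuous, so that the
  notion is local at each point and can be proved by induction on \<open>n\<close>.\<close>

primrec nd :: "nat \<Rightarrow> nat \<Rightarrow> 'a::real_normed_vector set \<Rightarrow> ('a \<Rightarrow> 'a list \<Rightarrow> 'b::real_normed_vector) \<Rightarrow> bool" where
  "nd 0 k S M \<longleftrightarrow> (\<forall>x\<in>S. bounded_multilinear k (M x))"
| "nd (Suc n) k S M \<longleftrightarrow> (\<forall>x\<in>S. bounded_multilinear k (M x)) \<and>
     (\<exists>M'. (\<forall>x\<in>S. has_multilinear_derivative k M (M' x) x) \<and> nd n (Suc k) S M')"

lemma nd_imp_bounded_multilinear: "nd n k S M \<Longrightarrow> x \<in> S \<Longrightarrow> bounded_multilinear k (M x)"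
  by (cases n) auto

lemma nd_SucE:
  assumes "nd (Suc n) k S M"
  obtains M' where "\<And>x. x \<in> S \<Longrightarrow> has_multilinear_derivative k M (M' x) x" "nd n (Suc k) S M'"
  using assms unfolding nd.simps(2) by blast

lemma nd_SucI:
  assumes "\<And>x. x \<in> S \<Longrightarrow> bounded_multilinear k (M x)"
    and "\<And>x. x \<in> S \<Longrightarrow> has_multilinear_derivative k M (M' x) x" and "nd n (Suc k) S M'"
  shows "nd (Suc n) k S M"
  using assms unfolding nd.simps(2) by blast

lemma nd_SucD: "nd (Suc n) k S M \<Longrightarrow> nd n k S M"
proof (induction n arbitrary: k M)
  case (Suc n)
  then obtain M' where "\<forall>x\<in>S. has_multilinear_derivative k M (M' x) x" "nd (Suc n) (Suc k) S M'"
    "\<forall>x\<in>S. bounded_multilinear k (M x)"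
    unfolding nd.simps(2)[of "Suc n"] by blast
  with Suc.IH[OF this(2)] show ?case
    unfolding nd.simps(2) by blast
qed auto

lemma has_multilinear_derivative_cong:
  assumes S: "open S" "x \<in> S" and eq: "\<And>y vs. y \<in> S \<Longrightarrow> length vs = k \<Longrightarrow> F y vs = G y vs"
    and eq': "\<And>vs. length vs = Suc k \<Longrightarrow> F' vs = G' vs"
    and d: "has_multilinear_derivative k F F' x"
  shows "has_multilinear_derivative k G G' x"
  unfolding has_multilinear_derivative_def
proof (intro allI impI)
  fix \<epsilon> :: real assume "\<epsilon> > 0"
  with d have "\<forall>\<^sub>F y in nhds x. \<forall>vs. length vs = k \<longrightarrow>
        norm (F y vs - F x vs - F' ((y - x) # vs)) \<le> \<epsilon> * norm (y - x) * prod_list (map norm vs)"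
    unfolding has_multilinear_derivative_def by blast
  moreover have "\<forall>\<^sub>F y in nhds x. y \<in> S"
    using S by (rule eventually_nhds_in_open)
  ultimately show "\<forall>\<^sub>F y in nhds x. \<forall>vs. length vs = k \<longrightarrow>
        norm (G y vs - G x vs - G' ((y - x) # vs)) \<le> \<epsilon> * norm (y - x) * prod_list (map norm vs)"
    by eventually_elim (use S eq eq' in auto)
qed

lemma nd_cong:
  assumes S: "open S" and eq: "\<And>x vs. x \<in> S \<Longrightarrow> length vs = k \<Longrightarrow> M x vs = N x vs" and M: "nd n k S M"
  shows "nd n k S N"
proof (cases n)
  case 0
  have "bounded_multilinear k (N x)" if "x \<in> S" for x
    using bounded_multilinear_cong[of k "M x" "N x"] eq M that by (simp add: 0)
  then show ?thesis
    by (simp add: 0)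
next
  case (Suc m)
  then obtain M' where M': "\<forall>x\<in>S. has_multilinear_derivative k M (M' x) x" "nd m (Suc k) S M'"
    "\<forall>x\<in>S. bounded_multilinear k (M x)"
    using M by auto
  have "bounded_multilinear k (N x)" if "x \<in> S" for x
    using bounded_multilinear_cong[of k "M x" "N x"] eq M'(3) that by simp
  moreover have "\<forall>x\<in>S. has_multilinear_derivative k N (M' x) x"
    using M'(1) eq by (auto intro: has_multilinear_derivative_cong[OF S, where F = M])
  ultimately show ?thesis
    using M'(2) Suc by auto
qed

text \<open>Along the ray \<open>x + t *\<^sub>R v\<close> with t decreasing to 0, both linear parts
  scale with t while the errors are at most a multiple of \<epsilon> times t, so the factor t
  cancels. Uniqueness lets derivatives found separately for each order be identified.\<close>

lemma has_multilinear_derivative_unique: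
  assumes D: "has_multilinear_derivative k F F' x" "has_multilinear_derivative k F G' x"
    and F': "bounded_multilinear (Suc k) F'" and G': "bounded_multilinear (Suc k) G'"
    and len: "length vs = Suc k"
  shows "F' vs = G' vs"
proof -
  obtain v ws where vs: "vs = v # ws" "length ws = k"
    using len by (cases vs) auto
  define K where "K = norm v * prod_list (map norm ws)"
  have K: "K \<ge> 0"
    by (simp add: K_def prod_list_norm_nonneg)
  have *: "norm (F' vs - G' vs) \<le> 2 * \<epsilon> * K" if "\<epsilon> > 0" for \<epsilon>
  proof -
    have "\<forall>\<^sub>F y in nhds x. norm (F y ws - F x ws - F' ((y - x) # ws)) \<le> \<epsilon> * norm (y - x) * prod_list (map norm ws)
       \<and> norm (F y ws - F x ws - G' ((y - x) # ws)) \<le> \<epsilon> * norm (y - x) * prod_list (map norm ws)"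
      using D[unfolded has_multilinear_derivative_def, rule_format, OF that] vs(2)
      by (auto elim: eventually_elim2)
    moreover have "((\<lambda>t::real. x + t *\<^sub>R v) \<longlongrightarrow> x) (at_right 0)"
      by (auto intro!: tendsto_eq_intros)
    ultimately have "\<forall>\<^sub>F t in at_right (0::real). norm (F (x + t *\<^sub>R v) ws - F x ws - F' ((t *\<^sub>R v) # ws)) \<le> \<epsilon> * norm (t *\<^sub>R v) * prod_list (map norm ws)
       \<and> norm (F (x + t *\<^sub>R v) ws - F x ws - G' ((t *\<^sub>R v) # ws)) \<le> \<epsilon> * norm (t *\<^sub>R v) * prod_list (map norm ws)"
      using eventually_compose_filterlim[of _ "nhds x" "\<lambda>t. x + t *\<^sub>R v" "at_right 0"] by fastforce
    moreover have "\<forall>\<^sub>F t in at_right (0::real). t > 0"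
      by (simp add: eventually_at_filter)
    ultimately have "\<forall>\<^sub>F t in at_right (0::real). norm (F' vs - G' vs) \<le> 2 * \<epsilon> * K"
    proof eventually_elim
      case (elim t)
      let ?A = "F (x + t *\<^sub>R v) ws - F x ws"
      have "norm (F' ((t *\<^sub>R v) # ws) - G' ((t *\<^sub>R v) # ws)) = norm ((?A - G' ((t *\<^sub>R v) # ws)) - (?A - F' ((t *\<^sub>R v) # ws)))"
        by simp
      also have "\<dots> \<le> norm (?A - G' ((t *\<^sub>R v) # ws)) + norm (?A - F' ((t *\<^sub>R v) # ws))"
        by (rule norm_triangle_ineq4)
      also have "\<dots> \<le> 2 * (\<epsilon> * norm (t *\<^sub>R v) * prod_list (map norm ws))"
        using elim by linarith
      also have "\<dots> = t * (2 * \<epsilon> * K)"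
        using elim by (simp add: K_def)
      finally have "norm (F' ((t *\<^sub>R v) # ws) - G' ((t *\<^sub>R v) # ws)) \<le> t * (2 * \<epsilon> * K)" .
      moreover have "F' ((t *\<^sub>R v) # ws) - G' ((t *\<^sub>R v) # ws) = t *\<^sub>R (F' vs - G' vs)"
        using linear_cmul[OF bounded_multilinear_linear_hd[OF F' vs(2)]]
          linear_cmul[OF bounded_multilinear_linear_hd[OF G' vs(2)]]
        by (simp add: vs scaleR_diff_right)
      ultimately show ?case
        using elim by simp
    qed
    then show ?thesis
      using eventually_happens trivial_limit_at_right_real by blast
  qed
  have le: "norm (F' vs - G' vs) \<le> e" if "e > 0" for e
  proof -
    define L where "L = K + 1"
    have L: "L > 0" "K \<le> L"
      using K by (auto simp: L_def)
    have "norm (F' vs - G' vs) \<le> 2 * (e / (2 * L)) * K"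
      using L that by (intro *) simp
    also have "\<dots> = e * (K / L)"
      by simp
    also have "\<dots> \<le> e * 1"
      using L that by (intro mult_left_mono) auto
    finally show ?thesis by simp
  qed
  have "norm (F' vs - G' vs) \<le> 0"
    by (rule field_le_epsilon) (simp add: le)
  then show ?thesis
    by simp
qed

definition smooth_field :: "nat \<Rightarrow> 'a::real_normed_vector set \<Rightarrow> ('a \<Rightarrow> 'a list \<Rightarrow> 'b::real_normed_vector) \<Rightarrow> bool" where
  "smooth_field k S M \<longleftrightarrow> (\<forall>n. nd n k S M)"

text \<open>Each order n supplies its own derivative field. They agree on lists of the right length
  by uniqueness, so the one found for n = 0 is differentiable to every order.\<close>

lemma smooth_field_derivative:
  assumes S: "open S" and M: "smooth_field k S M"
  shows "\<exists>M'. (\<forall>x\<in>S. has_multilinear_derivative k M (M' x) x) \<and> smooth_field (Suc k) S M'"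
proof -
  have "\<exists>M'. (\<forall>x\<in>S. has_multilinear_derivative k M (M' x) x) \<and> nd n (Suc k) S M'" for n
    using M[unfolded smooth_field_def, rule_format, of "Suc n"] by simp
  then obtain D where D: "\<And>n x. x \<in> S \<Longrightarrow> has_multilinear_derivative k M (D n x) x" "\<And>n. nd n (Suc k) S (D n)"
    by metis
  have "D n x vs = D 0 x vs" if "x \<in> S" "length vs = Suc k" for n x vs
    by (rule has_multilinear_derivative_unique[OF D(1) D(1)])
      (use that D(2) nd_imp_bounded_multilinear in blast)+
  then have "nd n (Suc k) S (D 0)" for n
    using nd_cong[OF S _ D(2)[of n]] by blast
  then show ?thesis
    using D(1) unfolding smooth_field_def by blast
qed

text \<open>The sequence \<open>D\<close> required by \<open>smooth_on\<close> comes from repeated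
  choice: \<open>nxt\<close> picks a derivative that is again a \<open>smooth_field\<close>, which
  keeps the recursion going.\<close>

lemma smooth_field_imp_smooth_on:
  assumes S: "open S" and M: "smooth_field 0 S (\<lambda>x _. f x)"
  shows "smooth_on S f"
proof -
  define nxt :: "nat \<Rightarrow> ('a \<Rightarrow> 'a list \<Rightarrow> 'b) \<Rightarrow> 'a \<Rightarrow> 'a list \<Rightarrow> 'b" where "nxt = (\<lambda>k M. SOME M'. (\<forall>x\<in>S. has_multilinear_derivative k M (M' x) x) \<and> smooth_field (Suc k) S M')"
  define D where "D = rec_nat (\<lambda>x _. f x) nxt"
  have D0: "D 0 = (\<lambda>x _. f x)" and DS: "D (Suc k) = nxt k (D k)" for k
    by (auto simp: D_def)
  have nxt: "(\<forall>x\<in>S. has_multilinear_derivative k M (nxt k M x) x) \<and> smooth_field (Suc k) S (nxt k M)"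
    if "smooth_field k S M" for k M
    unfolding nxt_def using someI_ex[OF smooth_field_derivative[OF S that]] by blast
  have sm: "smooth_field k S (D k)" for k
    by (induction k) (use M D0 DS nxt in auto)
  show ?thesis
    unfolding smooth_on_def
  proof (intro conjI exI[of _ D] allI ballI)
    show "bounded_multilinear k (D k x)" if "x \<in> S" for k x
      using sm[of k] that nd_imp_bounded_multilinear unfolding smooth_field_def by blast
  qed (use S D0 DS nxt[OF sm] in auto)
qed

subsection \<open>Closure properties\<close>

lemma mult_divide_cancel_left: "x \<noteq> 0 \<Longrightarrow> x * (e / (c * x)) = e / c" for x :: real
  by simp

lemma bounded_multilinear_add:
  assumes "bounded_multilinear k m1" "bounded_multilinear k m2"
  shows "bounded_multilinear k (\<lambda>vs. m1 vs + m2 vs)"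
proof -
  obtain C1 where C1: "\<And>vs. length vs = k \<Longrightarrow> norm (m1 vs) \<le> C1 * prod_list (map norm vs)"
    using bounded_multilinear_bound[OF assms(1)] by metis
  obtain C2 where C2: "\<And>vs. length vs = k \<Longrightarrow> norm (m2 vs) \<le> C2 * prod_list (map norm vs)"
    using bounded_multilinear_bound[OF assms(2)] by metis
  show ?thesis
  proof (rule bounded_multilinearI)
    show "linear (\<lambda>w. m1 (vs[i := w]) + m2 (vs[i := w]))" if "length vs = k" "i < k" for vs i
      using linear_compose_add[OF bounded_multilinear_linear[OF assms(1) that]
         bounded_multilinear_linear[OF assms(2) that]] .
    show "norm (m1 vs + m2 vs) \<le> (C1 + C2) * prod_list (map norm vs)" if "length vs = k" for vs
      using C1[OF that] C2[OF that] norm_triangle_ineq[of "m1 vs" "m2 vs"] by (simp add: distrib_right)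
  qed
qed

lemma has_multilinear_derivative_add:
  assumes "has_multilinear_derivative k F F' x" "has_multilinear_derivative k G G' x"
  shows "has_multilinear_derivative k (\<lambda>x vs. F x vs + G x vs) (\<lambda>vs. F' vs + G' vs) x"
  unfolding has_multilinear_derivative_def
proof (intro allI impI)
  fix \<epsilon> :: real assume "\<epsilon> > 0"
  then have "\<epsilon> / 2 > 0" by simp
  from assms[unfolded has_multilinear_derivative_def, rule_format, OF this]
  show "\<forall>\<^sub>F y in nhds x. \<forall>vs. length vs = k \<longrightarrow>
        norm (F y vs + G y vs - (F x vs + G x vs) - (F' ((y - x) # vs) + G' ((y - x) # vs))) \<le> \<epsilon> * norm (y - x) * prod_list (map norm vs)"
  proof eventually_elim
    case (elim y)
    show ?case
    proof (intro allI impI)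
      fix vs :: "'a list" assume l: "length vs = k"
      have "norm (F y vs + G y vs - (F x vs + G x vs) - (F' ((y - x) # vs) + G' ((y - x) # vs)))
        = norm ((F y vs - F x vs - F' ((y - x) # vs)) + (G y vs - G x vs - G' ((y - x) # vs)))"
        by (simp add: algebra_simps)
      also have "\<dots> \<le> norm (F y vs - F x vs - F' ((y - x) # vs)) + norm (G y vs - G x vs - G' ((y - x) # vs))"
        by (rule norm_triangle_ineq)
      also have "\<dots> \<le> \<epsilon> / 2 * norm (y - x) * prod_list (map norm vs) + \<epsilon> / 2 * norm (y - x) * prod_list (map norm vs)"
        using elim l by (intro add_mono) auto
      also have "\<dots> = \<epsilon> * norm (y - x) * prod_list (map norm vs)"
        by (simp add: field_simps)
      finally show "norm (F y vs + G y vs - (F x vs + G x vs) - (F' ((y - x) # vs) + G' ((y - x) # vs))) \<le> \<epsilon> * norm (y - x) * prod_list (map norm vs)" .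
    qed
  qed
qed

lemma nd_add:
  "nd n k S M \<Longrightarrow> nd n k S N \<Longrightarrow> nd n k S (\<lambda>x vs. M x vs + N x vs)"
proof (induction n arbitrary: k M N)
  case 0
  then show ?case by (auto intro: bounded_multilinear_add)
next
  case (Suc n)
  obtain M' where M': "\<And>x. x \<in> S \<Longrightarrow> has_multilinear_derivative k M (M' x) x" "nd n (Suc k) S M'"
    using Suc.prems(1) by (rule nd_SucE) (erule (1) that)
  obtain N' where "\<And>x. x \<in> S \<Longrightarrow> has_multilinear_derivative k N (N' x) x" "nd n (Suc k) S N'"
    using Suc.prems(2) by (rule nd_SucE) (erule (1) that)
  with M'
  show ?case
    using Suc.prems Suc.IH[of "Suc k" M' N']
    by (auto intro!: bounded_multilinear_add exI[of _ "\<lambda>x vs. M' x vs + N' x vs"] has_multilinear_derivative_add)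
qed

section \<open>Permutation of the arguments of a field\<close>

lemma prod_list_map_perm:
  assumes "mset \<sigma> = mset [0..<length vs]"
  shows "prod_list (map (f \<circ> (!) vs) \<sigma>) = (prod_list (map f vs) :: 'b::comm_monoid_mult)"
proof -
  have "mset (map (f \<circ> (!) vs) \<sigma>) = mset (map (f \<circ> (!) vs) [0..<length vs])"
    by (simp only: mset_map assms)
  also have "map (f \<circ> (!) vs) [0..<length vs] = map f vs"
    by (simp add: map_nth flip: map_map)
  finally show ?thesis
    by (metis prod_mset_prod_list)
qed

text \<open>Overwriting entry i of the argument list overwrites exactly the entry of the permuted
  list whose index is i, so linearity in each slot is preserved.\<close>

lemma bounded_multilinear_perm:
  assumes m: "bounded_multilinear k m" and \<sigma>: "mset \<sigma> = mset [0..<k]"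
  shows "bounded_multilinear k (\<lambda>vs. m (map ((!) vs) \<sigma>))"
proof -
  have len: "length \<sigma> = k"
    using \<sigma> by (metis length_upt minus_nat.diff_0 size_mset)
  have dist: "distinct \<sigma>"
    using \<sigma> mset_eq_imp_distinct_iff[of \<sigma> "[0..<k]"] by simp
  have set: "set \<sigma> = {..<k}"
    using mset_eq_setD[OF \<sigma>] by (auto simp: atLeast0LessThan)
  obtain C where C: "\<And>vs. length vs = k \<Longrightarrow> norm (m vs) \<le> C * prod_list (map norm vs)"
    using bounded_multilinear_bound[OF m] by metis
  show ?thesis
  proof (rule bounded_multilinearI)
    fix vs :: "'a list" and i assume vs: "length vs = k" "i < k"
    then obtain j where j: "j < k" "\<sigma> ! j = i"
      using set len by (metis in_set_conv_nth lessThan_iff)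
    have "map ((!) (vs[i := w])) \<sigma> = (map ((!) vs) \<sigma>)[j := w]" for w
    proof (rule nth_equalityI)
      fix l assume "l < length (map ((!) (vs[i := w])) \<sigma>)"
      then show "map ((!) (vs[i := w])) \<sigma> ! l = (map ((!) vs) \<sigma>)[j := w] ! l"
        using j vs len dist nth_eq_iff_index_eq[OF dist, of l j] by (cases "l = j") (auto simp: nth_list_update)
    qed simp
    then show "linear (\<lambda>w. m (map ((!) (vs[i := w])) \<sigma>))"
      using bounded_multilinear_linear[OF m, of "map ((!) vs) \<sigma>" j] j len by simp
  next
    fix vs :: "'a list" assume vs: "length vs = k"
    show "norm (m (map ((!) vs) \<sigma>)) \<le> C * prod_list (map norm vs)"
      using C[of "map ((!) vs) \<sigma>"] prod_list_map_perm[of \<sigma> vs norm] \<sigma> vs len by simp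
  qed
qed

text \<open>Differentiation puts the new direction at the head of the list, where the permutation
  leaves it, and the old indices move up by one. Hence the permutation for the derivative is
  \<open>0 # map Suc \<sigma>\<close>.\<close>

lemma nd_perm:
  "nd n k S M \<Longrightarrow> mset \<sigma> = mset [0..<k] \<Longrightarrow> nd n k S (\<lambda>x vs. M x (map ((!) vs) \<sigma>))"
proof (induction n arbitrary: k M \<sigma>)
  case 0
  then show ?case by (auto intro: bounded_multilinear_perm)
next
  case (Suc n)
  obtain M' where M': "\<And>x. x \<in> S \<Longrightarrow> has_multilinear_derivative k M (M' x) x" "nd n (Suc k) S M'"
    using Suc.prems(1) by (rule nd_SucE) (erule (1) that)
  have len: "length \<sigma> = k"
    using Suc.prems by (metis length_upt minus_nat.diff_0 size_mset)
  have "mset (0 # map Suc \<sigma>) = mset (0 # map Suc [0..<k])"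
    using Suc.prems(2) by (simp only: mset.simps mset_map)
  also have "0 # map Suc [0..<k] = [0..<Suc k]"
    by (simp add: map_Suc_upt upt_conv_Cons del: upt_Suc)
  finally have \<tau>: "mset (0 # map Suc \<sigma>) = mset [0..<Suc k]" .
  have d: "has_multilinear_derivative k (\<lambda>x vs. M x (map ((!) vs) \<sigma>)) (\<lambda>vs. M' x (map ((!) vs) (0 # map Suc \<sigma>))) x"
    if "x \<in> S" for x
    unfolding has_multilinear_derivative_def
  proof (intro allI impI)
    fix \<epsilon> :: real assume "\<epsilon> > 0"
    from M'(1)[OF that, unfolded has_multilinear_derivative_def, rule_format, OF this]
    show "\<forall>\<^sub>F y in nhds x. \<forall>vs. length vs = k \<longrightarrow>
       norm (M y (map ((!) vs) \<sigma>) - M x (map ((!) vs) \<sigma>) -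
         M' x (map ((!) ((y - x) # vs)) (0 # map Suc \<sigma>))) \<le> \<epsilon> * norm (y - x) * prod_list (map norm vs)"
    proof eventually_elim
      case (elim y)
      show ?case
      proof (intro allI impI)
        fix vs :: "'a list" assume l: "length vs = k"
        have "map ((!) ((y - x) # vs)) (0 # map Suc \<sigma>) = (y - x) # map ((!) vs) \<sigma>"
          by (simp add: o_def)
        then show "norm (M y (map ((!) vs) \<sigma>) - M x (map ((!) vs) \<sigma>) -
         M' x (map ((!) ((y - x) # vs)) (0 # map Suc \<sigma>))) \<le> \<epsilon> * norm (y - x) * prod_list (map norm vs)"
          using elim[rule_format, of "map ((!) vs) \<sigma>"] len l prod_list_map_perm[of \<sigma> vs norm] Suc.prems(2)
          by (simp del: list.map)
      qed
    qed
  qed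
  show ?case
    by (rule nd_SucI[OF bounded_multilinear_perm[OF nd_imp_bounded_multilinear[OF Suc.prems(1)] Suc.prems(2)]
        d Suc.IH[OF M'(2) \<tau>]])
qed

lemma bounded_multilinear_linear_image:
  assumes m: "bounded_multilinear k m" and A: "bounded_linear A" and L: "bounded_linear L"
  shows "bounded_multilinear k (\<lambda>vs. L (m (map A vs)))"
proof -
  obtain C where C: "C \<ge> 0" "\<And>vs. length vs = k \<Longrightarrow> norm (m vs) \<le> C * prod_list (map norm vs)"
    using bounded_multilinear_bound[OF m] by metis
  obtain a where a: "a \<ge> 0" "\<And>x. norm (A x) \<le> norm x * a"
    using bounded_linear.nonneg_bounded[OF A] by blast
  obtain l where l: "l \<ge> 0" "\<And>x. norm (L x) \<le> norm x * l"
    using bounded_linear.nonneg_bounded[OF L] by blast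
  have *: "prod_list (map (norm \<circ> A) vs) \<le> a ^ length vs * prod_list (map norm vs)" for vs
  proof (induction vs)
    case (Cons v vs)
    have "norm (A v) * prod_list (map (norm \<circ> A) vs) \<le> (norm v * a) * (a ^ length vs * prod_list (map norm vs))"
      using Cons a prod_list_norm_nonneg[of "map A vs"] by (intro mult_mono) (auto simp: o_def)
    then show ?case by (simp add: algebra_simps o_def)
  qed simp
  show ?thesis
  proof (rule bounded_multilinearI)
    fix vs :: "'c list" and i assume vs: "length vs = k" "i < k"
    have "linear (\<lambda>w. m ((map A vs)[i := w]))"
      using bounded_multilinear_linear[OF m] vs by simp
    then have "linear (L \<circ> ((\<lambda>w. m ((map A vs)[i := w])) \<circ> A))"
      using A L by (intro linear_compose) (auto simp: bounded_linear.linear)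
    then show "linear (\<lambda>w. L (m (map A (vs[i := w]))))"
      by (simp add: o_def map_update)
  next
    fix vs :: "'c list" assume vs: "length vs = k"
    have "norm (L (m (map A vs))) \<le> norm (m (map A vs)) * l"
      using l by simp
    also have "\<dots> \<le> (C * prod_list (map (norm \<circ> A) vs)) * l"
      using C(2)[of "map A vs"] vs l by (intro mult_right_mono) auto
    also have "\<dots> \<le> (C * (a ^ k * prod_list (map norm vs))) * l"
      using *[of vs] vs l C by (intro mult_right_mono mult_left_mono) auto
    finally show "norm (L (m (map A vs))) \<le> (C * a ^ k * l) * prod_list (map norm vs)"
      by (simp add: algebra_simps)
  qed
qed

lemma has_multilinear_derivative_linear_image:
  assumes d: "has_multilinear_derivative k M M' (A x)" and A: "bounded_linear A" and L: "bounded_linear L"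
  shows "has_multilinear_derivative k (\<lambda>x vs. L (M (A x) (map A vs))) (\<lambda>vs. L (M' (map A vs))) x"
  unfolding has_multilinear_derivative_def
proof (intro allI impI)
  fix \<epsilon> :: real assume \<epsilon>: "\<epsilon> > 0"
  obtain a where a: "a > 0" "\<And>x. norm (A x) \<le> norm x * a"
    using bounded_linear.pos_bounded[OF A] by blast
  obtain l where l: "l > 0" "\<And>x. norm (L x) \<le> norm x * l"
    using bounded_linear.pos_bounded[OF L] by blast
  have *: "prod_list (map (norm \<circ> A) vs) \<le> a ^ length vs * prod_list (map norm vs)" for vs
  proof (induction vs)
    case (Cons v vs)
    have "norm (A v) * prod_list (map (norm \<circ> A) vs) \<le> (norm v * a) * (a ^ length vs * prod_list (map norm vs))"
      using Cons a prod_list_norm_nonneg[of "map A vs"] by (intro mult_mono) (auto simp: o_def)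
    then show ?case by (simp add: algebra_simps o_def)
  qed simp
  \<comment> \<open>One factor \<open>a\<close> comes from the increment \<open>A (y - x)\<close>, k
    more from the arguments, and \<open>l\<close> from L.\<close>
  define \<delta> where "\<delta> = \<epsilon> / (l * a ^ Suc k)"
  have "\<delta> > 0" using \<epsilon> a l by (simp add: \<delta>_def)
  have "(A \<longlongrightarrow> A x) (nhds x)"
    by (rule bounded_linear.tendsto[OF A filterlim_ident])
  with d[unfolded has_multilinear_derivative_def, rule_format, OF \<open>\<delta> > 0\<close>]
  have "\<forall>\<^sub>F y in nhds x. \<forall>vs. length vs = k \<longrightarrow>
       norm (M (A y) vs - M (A x) vs - M' ((A y - A x) # vs)) \<le> \<delta> * norm (A y - A x) * prod_list (map norm vs)"
    by (rule eventually_compose_filterlim)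
  then show "\<forall>\<^sub>F y in nhds x. \<forall>vs. length vs = k \<longrightarrow>
       norm (L (M (A y) (map A vs)) - L (M (A x) (map A vs)) - L (M' (map A ((y - x) # vs))))
         \<le> \<epsilon> * norm (y - x) * prod_list (map norm vs)"
  proof eventually_elim
    case (elim y)
    show ?case
    proof (intro allI impI)
      fix vs :: "'c list" assume vs: "length vs = k"
      have "L (M (A y) (map A vs)) - L (M (A x) (map A vs)) - L (M' (map A ((y - x) # vs)))
        = L (M (A y) (map A vs) - M (A x) (map A vs) - M' ((A y - A x) # map A vs))"
        using A L by (simp add: linear_diff bounded_linear.linear)
      also have "norm \<dots> \<le> norm (M (A y) (map A vs) - M (A x) (map A vs) - M' ((A y - A x) # map A vs)) * l"
        using l by simp
      also have "\<dots> \<le> (\<delta> * norm (A (y - x)) * prod_list (map (norm \<circ> A) vs)) * l"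
        using elim[rule_format, of "map A vs"] vs l A
        by (intro mult_right_mono) (auto simp: linear_diff bounded_linear.linear)
      also have "\<dots> \<le> (\<delta> * (norm (y - x) * a) * (a ^ k * prod_list (map norm vs))) * l"
        using a l *[of vs] vs \<open>\<delta> > 0\<close> prod_list_norm_nonneg[of "map A vs"]
        by (intro mult_right_mono mult_mono) (auto simp: o_def)
      also have "\<dots> = \<epsilon> * norm (y - x) * prod_list (map norm vs)"
        using a l by (simp add: \<delta>_def field_simps)
      finally show "norm (L (M (A y) (map A vs)) - L (M (A x) (map A vs)) - L (M' (map A ((y - x) # vs))))
         \<le> \<epsilon> * norm (y - x) * prod_list (map norm vs)" .
    qed
  qed
qed

text \<open>A and L act on the derivative in the same way as on the field, A being applied to the
  new direction as well, so the induction closes. This moves fields between different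
  spaces.\<close>

lemma nd_linear_image:
  "nd n k S M \<Longrightarrow> bounded_linear A \<Longrightarrow> bounded_linear L \<Longrightarrow> nd n k (A -` S) (\<lambda>x vs. L (M (A x) (map A vs)))"
proof (induction n arbitrary: k M)
  case 0
  then show ?case by (auto intro: bounded_multilinear_linear_image)
next
  case (Suc n)
  obtain M' where M': "\<And>x. x \<in> S \<Longrightarrow> has_multilinear_derivative k M (M' x) x" "nd n (Suc k) S M'"
    using Suc.prems(1) by (rule nd_SucE) (erule (1) that)
  have "bounded_multilinear k (\<lambda>vs. L (M (A x) (map A vs)))"
    "has_multilinear_derivative k (\<lambda>x vs. L (M (A x) (map A vs))) (\<lambda>vs. L (M' (A x) (map A vs))) x"
    if "x \<in> A -` S" for x
    using that bounded_multilinear_linear_image[OF nd_imp_bounded_multilinear[OF Suc.prems(1)] Suc.prems(2,3)]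
      has_multilinear_derivative_linear_image[OF M'(1) Suc.prems(2,3)] by simp_all
  then show ?case
    by (intro nd_SucI[OF _ _ Suc.IH[OF M'(2) Suc.prems(2,3)]])
qed

lemma has_multilinear_derivative_cong':
  assumes "has_multilinear_derivative k F F' x" and "\<And>v vs. length vs = k \<Longrightarrow> F' (v # vs) = G' (v # vs)"
  shows "has_multilinear_derivative k F G' x"
  using assms unfolding has_multilinear_derivative_def by (simp cong: conj_cong)

lemma has_multilinear_derivativeD:
  assumes "has_multilinear_derivative k F F' x" "\<epsilon> > 0"
  shows "\<forall>\<^sub>F y in nhds x. \<forall>vs. length vs = k \<longrightarrow>
        norm (F y vs - F x vs - F' ((y - x) # vs)) \<le> \<epsilon> * norm (y - x) * prod_list (map norm vs)"
  using assms unfolding has_multilinear_derivative_def by blast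

lemma eventually_norm_diff_less:
  fixes x :: "'a::real_normed_vector"
  assumes "e > 0"
  shows "\<forall>\<^sub>F y in nhds x. norm (y - x) < e"
  unfolding eventually_nhds_metric dist_norm using assms by blast

section \<open>Contraction of multilinear fields and the chain rule\<close>

lemma bounded_multilinear_contract:
  fixes P :: "'a::real_normed_vector list \<Rightarrow> 'b::real_normed_vector"
  assumes P: "bounded_multilinear (Suc k) P" and N: "bounded_multilinear l N"
  shows "bounded_multilinear (l + k) (\<lambda>vs. P (N (take l vs) # drop l vs))"
proof -
  obtain C where C: "C \<ge> 0" "\<And>vs. length vs = Suc k \<Longrightarrow> norm (P vs) \<le> C * prod_list (map norm vs)"
    using bounded_multilinear_bound[OF P] by metis
  obtain D where D: "D \<ge> 0" "\<And>vs. length vs = l \<Longrightarrow> norm (N vs) \<le> D * prod_list (map norm vs)"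
    using bounded_multilinear_bound[OF N] by metis
  show ?thesis
  proof (rule bounded_multilinearI)
    fix vs :: "'a list" and i assume vs: "length vs = l + k" "i < l + k"
    show "linear (\<lambda>w. P (N (take l (vs[i := w])) # drop l (vs[i := w])))"
    proof (cases "i < l")
      case True
      have "linear ((\<lambda>w. P (w # drop l vs)) \<circ> (\<lambda>w. N ((take l vs)[i := w])))"
        using vs True by (intro linear_compose bounded_multilinear_linear[OF N] bounded_multilinear_linear_hd[OF P]) auto
      then show ?thesis
        using True vs by (simp add: o_def take_update_swap)
    next
      case False
      then show ?thesis
        using vs bounded_multilinear_linear_tl[OF P, of "drop l vs" "i - l" "N (take l vs)"]
        by (simp add: drop_update_swap)
    qed
  next
    fix vs :: "'a list" assume vs: "length vs = l + k"
    have "norm (P (N (take l vs) # drop l vs)) \<le> C * (norm (N (take l vs)) * prod_list (map norm (drop l vs)))"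
      using C(2)[of "N (take l vs) # drop l vs"] vs by simp
    also have "\<dots> \<le> C * (D * prod_list (map norm (take l vs)) * prod_list (map norm (drop l vs)))"
      using C(1) D(2)[of "take l vs"] vs by (intro mult_left_mono mult_right_mono prod_list_norm_nonneg) auto
    also have "\<dots> = (C * D) * prod_list (map norm (take l vs @ drop l vs))"
      by (simp del: append_take_drop_id)
    finally show "norm (P (N (take l vs) # drop l vs)) \<le> (C * D) * prod_list (map norm vs)"
      by simp
  qed
qed

text \<open>This is the product rule for P and N. With a and b the values of N at y and at x, the
  error is the remainder of P on a, plus \<open>P'\<close> on the increment a - b, plus P on the
  remainder of N.\<close>

lemma has_multilinear_derivative_contract:
  fixes P :: "'a::real_normed_vector \<Rightarrow> 'a list \<Rightarrow> 'b::real_normed_vector"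
  assumes dP: "has_multilinear_derivative (Suc k) P P' x" and dN: "has_multilinear_derivative l N N' x"
    and P: "bounded_multilinear (Suc k) (P x)" and P': "bounded_multilinear (Suc (Suc k)) P'"
    and N: "bounded_multilinear l (N x)" and N': "bounded_multilinear (Suc l) N'"
  shows "has_multilinear_derivative (l + k) (\<lambda>x vs. P x (N x (take l vs) # drop l vs))
     (\<lambda>vs. P' (hd vs # N x (take l (tl vs)) # drop l (tl vs)) + P x (N' (hd vs # take l (tl vs)) # drop l (tl vs))) x"
  unfolding has_multilinear_derivative_def
proof (intro allI impI)
  fix \<epsilon> :: real assume \<epsilon>: "\<epsilon> > 0"
  obtain C where C: "C \<ge> 0" "\<And>vs. length vs = Suc k \<Longrightarrow> norm (P x vs) \<le> C * prod_list (map norm vs)"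
    using bounded_multilinear_bound[OF P] by metis
  obtain C' where C': "C' \<ge> 0" "\<And>vs. length vs = Suc (Suc k) \<Longrightarrow> norm (P' vs) \<le> C' * prod_list (map norm vs)"
    using bounded_multilinear_bound[OF P'] by metis
  obtain D where D: "D \<ge> 0" "\<And>vs. length vs = l \<Longrightarrow> norm (N x vs) \<le> D * prod_list (map norm vs)"
    using bounded_multilinear_bound[OF N] by metis
  obtain D' where D': "D' \<ge> 0" "\<And>vs. length vs = Suc l \<Longrightarrow> norm (N' vs) \<le> D' * prod_list (map norm vs)"
    using bounded_multilinear_bound[OF N'] by metis
  \<comment> \<open>Each of the three constants keeps one of the three error terms below
    \<epsilon>/3. The bounds by 1 in \<eta> and \<open>\<epsilon>2\<close> make the value of N at y
    at most \<open>(D + (D' + 1)) * A\<close> in norm.\<close>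
  define \<epsilon>1 where "\<epsilon>1 = \<epsilon> / (3 * (D + D' + 1))"
  define \<eta> where "\<eta> = min 1 (\<epsilon> / (3 * ((C' + 1) * (D' + 1))))"
  define \<epsilon>2 where "\<epsilon>2 = min 1 (\<epsilon> / (3 * (C + 1)))"
  have pos: "\<epsilon>1 > 0" "\<eta> > 0" "\<epsilon>2 > 0"
    using \<epsilon> C(1) C'(1) D(1) D'(1) by (auto simp: \<epsilon>1_def \<eta>_def \<epsilon>2_def)
  have b1: "\<epsilon>1 * (D + (D' + 1)) \<le> \<epsilon> / 3"
    using D(1) D'(1) \<epsilon> by (simp add: \<epsilon>1_def field_simps)
  have b2: "C' * (D' + 1) * \<eta> \<le> \<epsilon> / 3"
  proof -
    have "C' * (D' + 1) * \<eta> \<le> ((C' + 1) * (D' + 1)) * (\<epsilon> / (3 * ((C' + 1) * (D' + 1))))"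
      using C'(1) D'(1) pos(2) by (intro mult_mono) (auto simp: \<eta>_def)
    also have "\<dots> = \<epsilon> / 3"
      using C'(1) D'(1) by (intro mult_divide_cancel_left) (simp add: add_nonneg_eq_0_iff)
    finally show ?thesis .
  qed
  have b3: "C * \<epsilon>2 \<le> \<epsilon> / 3"
  proof -
    have "C * \<epsilon>2 \<le> (C + 1) * (\<epsilon> / (3 * (C + 1)))"
      using C(1) pos(3) by (intro mult_mono) (auto simp: \<epsilon>2_def)
    also have "\<dots> = \<epsilon> / 3"
      using C(1) by (intro mult_divide_cancel_left) simp
    finally show ?thesis .
  qed
  from has_multilinear_derivativeD[OF dP pos(1)] has_multilinear_derivativeD[OF dN pos(3)]
    eventually_norm_diff_less[OF pos(2)]
  show "\<forall>\<^sub>F y in nhds x. \<forall>vs. length vs = l + k \<longrightarrow>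
      norm (P y (N y (take l vs) # drop l vs) - P x (N x (take l vs) # drop l vs) -
        (P' (hd ((y - x) # vs) # N x (take l (tl ((y - x) # vs))) # drop l (tl ((y - x) # vs))) +
         P x (N' (hd ((y - x) # vs) # take l (tl ((y - x) # vs))) # drop l (tl ((y - x) # vs)))))
      \<le> \<epsilon> * norm (y - x) * prod_list (map norm vs)"
  proof eventually_elim
    case (elim y)
    show ?case
    proof (intro allI impI)
      fix vs :: "'a list" assume vs: "length vs = l + k"
      define us where "us = take l vs"
      define ws where "ws = drop l vs"
      have len: "length us = l" "length ws = k" and vs': "vs = us @ ws"
        using vs by (auto simp: us_def ws_def)
      define h a b A B where "h = y - x" and "a = N y us" and "b = N x us"
        and "A = prod_list (map norm us)" and "B = prod_list (map norm ws)"
      have AB: "A \<ge> 0" "B \<ge> 0" and AB': "prod_list (map norm vs) = A * B"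
        by (auto simp: A_def B_def prod_list_norm_nonneg vs')
      have h: "norm h \<le> \<eta>" "norm h \<le> 1"
        using elim(3) by (auto simp: h_def \<eta>_def)
      have dN: "norm (a - b - N' (h # us)) \<le> \<epsilon>2 * norm h * A"
        using elim(2) len by (simp add: a_def b_def h_def A_def)
      have ab: "norm (a - b) \<le> (D' + 1) * norm h * A"
      proof -
        have "norm (a - b) \<le> norm (N' (h # us)) + norm (a - b - N' (h # us))"
          using norm_triangle_ineq[of "N' (h # us)" "a - b - N' (h # us)"] by simp
        also have "\<dots> \<le> D' * norm h * A + 1 * norm h * A"
          using dN D'(2)[of "h # us"] len
          by (intro add_mono order_trans[OF dN] mult_right_mono) (auto simp: A_def \<epsilon>2_def prod_list_norm_nonneg mult.assoc)
        finally show ?thesis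
          by (simp add: algebra_simps)
      qed
      have a: "norm a \<le> (D + (D' + 1)) * A"
      proof -
        have "norm a \<le> norm b + norm (a - b)"
          using norm_triangle_ineq[of b "a - b"] by simp
        also have "\<dots> \<le> D * A + (D' + 1) * 1 * A"
          using D(2)[of us] len D'(1) AB h by (intro add_mono order_trans[OF ab] mult_right_mono mult_left_mono) (auto simp: b_def A_def)
        finally show ?thesis
          by (simp add: algebra_simps)
      qed
      have E1: "norm (P y (a # ws) - P x (a # ws) - P' (h # a # ws)) \<le> (\<epsilon> / 3) * norm h * (A * B)"
      proof -
        have "norm (P y (a # ws) - P x (a # ws) - P' (h # a # ws)) \<le> \<epsilon>1 * norm h * (norm a * B)"
          using elim(1)[rule_format, of "a # ws"] len by (simp add: h_def B_def)
        also have "\<dots> \<le> \<epsilon>1 * norm h * (((D + (D' + 1)) * A) * B)"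
          using a AB pos by (intro mult_left_mono mult_right_mono) auto
        also have "\<dots> = (\<epsilon>1 * (D + (D' + 1))) * (norm h * (A * B))"
          by (simp add: algebra_simps)
        also have "\<dots> \<le> \<epsilon> / 3 * (norm h * (A * B))"
          using b1 AB by (intro mult_right_mono) auto
        finally show ?thesis by simp
      qed
      have E2: "norm (P' (h # (a - b) # ws)) \<le> (\<epsilon> / 3) * norm h * (A * B)"
      proof -
        have "norm (P' (h # (a - b) # ws)) \<le> C' * (norm h * (norm (a - b) * B))"
          using C'(2)[of "h # (a - b) # ws"] len by (simp add: B_def)
        also have "\<dots> \<le> C' * (norm h * (((D' + 1) * \<eta> * A) * B))"
          using ab AB C'(1) D'(1) h by (intro mult_left_mono mult_right_mono order_trans[OF ab]) auto
        also have "\<dots> = (C' * (D' + 1) * \<eta>) * (norm h * (A * B))"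
          by (simp add: algebra_simps)
        also have "\<dots> \<le> \<epsilon> / 3 * (norm h * (A * B))"
          using b2 AB by (intro mult_right_mono) auto
        finally show ?thesis by simp
      qed
      have E3: "norm (P x ((a - b - N' (h # us)) # ws)) \<le> (\<epsilon> / 3) * norm h * (A * B)"
      proof -
        have "norm (P x ((a - b - N' (h # us)) # ws)) \<le> C * (norm (a - b - N' (h # us)) * B)"
          using C(2)[of "(a - b - N' (h # us)) # ws"] len by (simp add: B_def)
        also have "\<dots> \<le> C * ((\<epsilon>2 * norm h * A) * B)"
          using dN AB C(1) by (intro mult_left_mono mult_right_mono) auto
        also have "\<dots> = (C * \<epsilon>2) * (norm h * (A * B))"
          by (simp add: algebra_simps)
        also have "\<dots> \<le> \<epsilon> / 3 * (norm h * (A * B))"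
          using b3 AB by (intro mult_right_mono) auto
        finally show ?thesis by simp
      qed
      have lP': "P' (h # (a - b) # ws) = P' (h # a # ws) - P' (h # b # ws)"
        using linear_diff[OF bounded_multilinear_linear_tl[OF P', of "0 # ws" 0 h]] len by simp
      have lP: "P x ((a - b - N' (h # us)) # ws) = P x (a # ws) - P x (b # ws) - P x (N' (h # us) # ws)"
        using linear_diff[OF bounded_multilinear_linear_hd[OF P, of ws]] len by simp
      have "P y (a # ws) - P x (b # ws) - (P' (h # b # ws) + P x (N' (h # us) # ws))
        = (P y (a # ws) - P x (a # ws) - P' (h # a # ws)) + P' (h # (a - b) # ws) + P x ((a - b - N' (h # us)) # ws)"
        unfolding lP lP' by simp
      also have "norm \<dots> \<le> (\<epsilon> / 3) * norm h * (A * B) + (\<epsilon> / 3) * norm h * (A * B) + (\<epsilon> / 3) * norm h * (A * B)"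
        using E1 E2 E3 by (meson add_mono norm_triangle_le order_trans order_refl)
      also have "\<dots> = \<epsilon> * norm h * (A * B)"
        by (simp add: algebra_simps)
      finally show "norm (P y (N y (take l vs) # drop l vs) - P x (N x (take l vs) # drop l vs) -
        (P' (hd ((y - x) # vs) # N x (take l (tl ((y - x) # vs))) # drop l (tl ((y - x) # vs))) +
         P x (N' (hd ((y - x) # vs) # take l (tl ((y - x) # vs))) # drop l (tl ((y - x) # vs)))))
        \<le> \<epsilon> * norm (y - x) * prod_list (map norm vs)"
        by (simp add: AB' a_def b_def h_def us_def ws_def)
    qed
  qed
qed

text \<open>Both terms of the product rule are again contractions, of the derivative of P with N and
  of P with the derivative of N, up to the position of the new direction.\<close>

lemma nd_contract:
  fixes P :: "'a::real_normed_vector \<Rightarrow> 'a list \<Rightarrow> 'b::real_normed_vector"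
  shows "nd n (Suc k) S P \<Longrightarrow> nd n l S N \<Longrightarrow> nd n (l + k) S (\<lambda>x vs. P x (N x (take l vs) # drop l vs))"
proof (induction n arbitrary: k l P N)
  case 0
  then show ?case by (simp add: bounded_multilinear_contract)
next
  case (Suc n)
  obtain P' where P': "\<And>x. x \<in> S \<Longrightarrow> has_multilinear_derivative (Suc k) P (P' x) x" "nd n (Suc (Suc k)) S P'"
    using Suc.prems(1) by (rule nd_SucE) (erule (1) that)
  obtain N' where N': "\<And>x. x \<in> S \<Longrightarrow> has_multilinear_derivative l N (N' x) x" "nd n (Suc l) S N'"
    using Suc.prems(2) by (rule nd_SucE) (erule (1) that)
  \<comment> \<open>A contraction has the value of N in the first slot, but \<open>P'\<close> has
    the direction there: \<tau> swaps the first two slots. The direction, which is the head of the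
    argument list, must then follow the l arguments of N: \<sigma> moves it there.\<close>
  define \<tau> where "\<tau> = 1 # 0 # [2..<Suc (Suc k)]"
  define \<sigma> where "\<sigma> = [1..<Suc l] @ 0 # [Suc l..<Suc (l + k)]"
  have \<tau>: "mset \<tau> = mset [0..<Suc (Suc k)]"
    by (simp add: \<tau>_def upt_conv_Cons numeral_2_eq_2 del: upt_Suc)
  have "mset [0..<Suc (l + k)] = mset (0 # [1..<Suc l] @ [Suc l..<Suc (l + k)])"
    by (metis One_nat_def Suc_le_mono add_Suc le_add1 upt_add_eq_append upt_conv_Cons zero_less_Suc le_0_eq nat_le_linear plus_1_eq_Suc)
  then have \<sigma>: "mset \<sigma> = mset [0..<Suc (l + k)]"
    by (simp add: \<sigma>_def del: upt_Suc)
  have \<tau>_map: "map ((!) (w # v # ws)) \<tau> = v # w # ws" if "length ws = k" for v w and ws :: "'a list"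
    using that by (auto simp: \<tau>_def nth_Cons' list_eq_iff_nth_eq simp del: upt_Suc)
  have \<sigma>_map: "map ((!) (v # vs)) \<sigma> = take l vs @ v # drop l vs" if "length vs = l + k" for v and vs :: "'a list"
    using that by (auto simp: \<sigma>_def nth_append nth_Cons' list_eq_iff_nth_eq simp del: upt_Suc)
  define Q where "Q = (\<lambda>x vs. P' x (map ((!) vs) \<tau>))"
  have "nd n (Suc (Suc k)) S Q"
    unfolding Q_def by (rule nd_perm[OF P'(2) \<tau>])
  then have "nd n (l + Suc k) S (\<lambda>x vs. Q x (N x (take l vs) # drop l vs))"
    by (rule Suc.IH) (rule nd_SucD[OF Suc.prems(2)])
  then have "nd n (Suc (l + k)) S (\<lambda>x vs. Q x (N x (take l vs) # drop l vs))"
    by simp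
  from nd_perm[OF this \<sigma>] have 1: "nd n (Suc (l + k)) S (\<lambda>x vs. Q x (N x (take l (map ((!) vs) \<sigma>)) # drop l (map ((!) vs) \<sigma>)))" .
  have 2: "nd n (Suc (l + k)) S (\<lambda>x vs. P x (N' x (take (Suc l) vs) # drop (Suc l) vs))"
    using Suc.IH[OF nd_SucD[OF Suc.prems(1)] N'(2)] by simp
  have d: "has_multilinear_derivative (l + k) (\<lambda>x vs. P x (N x (take l vs) # drop l vs))
     (\<lambda>vs. Q x (N x (take l (map ((!) vs) \<sigma>)) # drop l (map ((!) vs) \<sigma>)) + P x (N' x (take (Suc l) vs) # drop (Suc l) vs)) x"
    if x: "x \<in> S" for x
  proof (rule has_multilinear_derivative_cong'[OF has_multilinear_derivative_contract[OF P'(1) N'(1)]])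
    show "P' x (hd (v # vs) # N x (take l (tl (v # vs))) # drop l (tl (v # vs))) +
        P x (N' x (hd (v # vs) # take l (tl (v # vs))) # drop l (tl (v # vs))) =
       Q x (N x (take l (map ((!) (v # vs)) \<sigma>)) # drop l (map ((!) (v # vs)) \<sigma>)) +
        P x (N' x (take (Suc l) (v # vs)) # drop (Suc l) (v # vs))" if "length vs = l + k" for v and vs :: "'a list"
      using that by (simp add: \<sigma>_map Q_def \<tau>_map)
  qed (use x nd_imp_bounded_multilinear P' N' Suc.prems in blast)+
  show ?case
    by (rule nd_SucI[OF bounded_multilinear_contract[OF nd_imp_bounded_multilinear[OF Suc.prems(1)]
          nd_imp_bounded_multilinear[OF Suc.prems(2)]] d nd_add[OF 1 2]])
qed

text \<open>The derivative is the contraction of \<open>G'\<close> with \<open>f'\<close>. The error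
  consists of the remainder of G at \<open>f y\<close> and of \<open>G'\<close> on the remainder of
  f, with half of \<epsilon> for each.\<close>

lemma has_multilinear_derivative_compose:
  fixes f :: "'a::real_normed_vector \<Rightarrow> 'a"
  assumes f: "has_multilinear_derivative 0 (\<lambda>x _. f x) f' x" and f': "bounded_multilinear (Suc 0) f'"
    and G: "has_multilinear_derivative k G G' (f x)" and G': "bounded_multilinear (Suc k) G'"
  shows "has_multilinear_derivative k (\<lambda>x vs. G (f x) vs) (\<lambda>vs. G' (f' (take 1 vs) # drop 1 vs)) x"
  unfolding has_multilinear_derivative_def
proof (intro allI impI)
  fix \<epsilon> :: real assume \<epsilon>: "\<epsilon> > 0"
  obtain C where C: "C \<ge> 0" "\<And>vs. length vs = Suc k \<Longrightarrow> norm (G' vs) \<le> C * prod_list (map norm vs)"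
    using bounded_multilinear_bound[OF G'] by metis
  obtain D where D: "D \<ge> 0" "\<And>vs. length vs = Suc 0 \<Longrightarrow> norm (f' vs) \<le> D * prod_list (map norm vs)"
    using bounded_multilinear_bound[OF f'] by metis
  define \<epsilon>1 where "\<epsilon>1 = \<epsilon> / (2 * (D + 1))"
  define \<epsilon>2 where "\<epsilon>2 = min 1 (\<epsilon> / (2 * (C + 1)))"
  have pos: "\<epsilon>1 > 0" "\<epsilon>2 > 0"
    using \<epsilon> C(1) D(1) by (auto simp: \<epsilon>1_def \<epsilon>2_def)
  have b1: "\<epsilon>1 * (D + 1) = \<epsilon> / 2"
    using D(1) by (simp add: \<epsilon>1_def field_simps)
  have b2: "C * \<epsilon>2 \<le> \<epsilon> / 2"
  proof -
    have "C * \<epsilon>2 \<le> (C + 1) * (\<epsilon> / (2 * (C + 1)))"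
      using C(1) pos(2) by (intro mult_mono) (auto simp: \<epsilon>2_def)
    also have "\<dots> = \<epsilon> / 2"
      using C(1) by (intro mult_divide_cancel_left) simp
    finally show ?thesis .
  qed
  have lip: "norm (f y - f x) \<le> (D + 1) * norm (y - x)" if "norm (f y - f x - f' [y - x]) \<le> \<epsilon>2 * norm (y - x)" for y
  proof -
    have "norm (f y - f x) \<le> norm (f' [y - x]) + norm (f y - f x - f' [y - x])"
      using norm_triangle_ineq[of "f' [y - x]" "f y - f x - f' [y - x]"] by simp
    also have "\<dots> \<le> D * norm (y - x) + 1 * norm (y - x)"
      using that D(2)[of "[y - x]"] by (intro add_mono order_trans[OF that] mult_right_mono) (auto simp: \<epsilon>2_def)
    finally show ?thesis
      by (simp add: algebra_simps)
  qed
  have df: "\<forall>\<^sub>F y in nhds x. norm (f y - f x - f' [y - x]) \<le> \<epsilon>2 * norm (y - x)"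
    using has_multilinear_derivativeD[OF f pos(2)] by simp
  have "((\<lambda>y. f y - f x) \<longlongrightarrow> 0) (nhds x)"
  proof (rule Lim_null_comparison)
    show "\<forall>\<^sub>F y in nhds x. norm (f y - f x) \<le> (D + 1) * norm (y - x)"
      using df by eventually_elim (rule lip)
    have "((\<lambda>y. (D + 1) * norm (y - x)) \<longlongrightarrow> (D + 1) * norm (x - x)) (nhds x)"
      by (intro tendsto_intros filterlim_ident)
    then show "((\<lambda>y. (D + 1) * norm (y - x)) \<longlongrightarrow> 0) (nhds x)"
      by simp
  qed
  then have "(f \<longlongrightarrow> f x) (nhds x)"
    by (simp add: LIM_zero_iff)
  from eventually_compose_filterlim[OF has_multilinear_derivativeD[OF G pos(1)] this] df
  show "\<forall>\<^sub>F y in nhds x. \<forall>vs. length vs = k \<longrightarrow>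
      norm (G (f y) vs - G (f x) vs - G' (f' (take 1 ((y - x) # vs)) # drop 1 ((y - x) # vs)))
      \<le> \<epsilon> * norm (y - x) * prod_list (map norm vs)"
  proof eventually_elim
    case (elim y)
    show ?case
    proof (intro allI impI)
      fix vs :: "'a list" assume vs: "length vs = k"
      define h B where "h = y - x" and "B = prod_list (map norm vs)"
      have B: "B \<ge> 0"
        by (simp add: B_def prod_list_norm_nonneg)
      have E1: "norm (G (f y) vs - G (f x) vs - G' ((f y - f x) # vs)) \<le> \<epsilon> / 2 * norm h * B"
      proof -
        have "norm (G (f y) vs - G (f x) vs - G' ((f y - f x) # vs)) \<le> \<epsilon>1 * norm (f y - f x) * B"
          using elim(1) vs by (simp add: B_def)
        also have "\<dots> \<le> \<epsilon>1 * ((D + 1) * norm h) * B"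
          using lip[OF elim(2)] pos B by (intro mult_right_mono mult_left_mono) (auto simp: h_def)
        also have "\<dots> = (\<epsilon>1 * (D + 1)) * norm h * B"
          by simp
        finally show ?thesis
          unfolding b1 .
      qed
      have E2: "norm (G' ((f y - f x - f' [h]) # vs)) \<le> \<epsilon> / 2 * norm h * B"
      proof -
        have "norm (G' ((f y - f x - f' [h]) # vs)) \<le> C * (norm (f y - f x - f' [h]) * B)"
          using C(2)[of "(f y - f x - f' [h]) # vs"] vs by (simp add: B_def)
        also have "\<dots> \<le> C * ((\<epsilon>2 * norm h) * B)"
          using elim(2) C(1) B by (intro mult_right_mono mult_left_mono) (auto simp: h_def)
        also have "\<dots> = (C * \<epsilon>2) * (norm h * B)"
          by simp
        also have "\<dots> \<le> \<epsilon> / 2 * (norm h * B)"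
          using b2 B by (intro mult_right_mono) auto
        finally show ?thesis by simp
      qed
      have "G (f y) vs - G (f x) vs - G' (f' [h] # vs) =
        (G (f y) vs - G (f x) vs - G' ((f y - f x) # vs)) + G' ((f y - f x - f' [h]) # vs)"
        using linear_diff[OF bounded_multilinear_linear_hd[OF G' vs]] by simp
      also have "norm \<dots> \<le> \<epsilon> / 2 * norm h * B + \<epsilon> / 2 * norm h * B"
        using E1 E2 by (meson add_mono norm_triangle_le)
      also have "\<dots> = \<epsilon> * norm h * B"
        by (simp add: field_simps)
      finally show "norm (G (f y) vs - G (f x) vs - G' (f' (take 1 ((y - x) # vs)) # drop 1 ((y - x) # vs)))
        \<le> \<epsilon> * norm (y - x) * prod_list (map norm vs)"
        by (simp add: h_def B_def)
    qed
  qed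
qed

text \<open>Only one derivative is taken at a time: by induction the composition of the derivative
  of G with f has order n, and contracting it with the derivative of f keeps the order. In a
  contraction the value of the inner field is an argument of the outer one, hence the
  self-map.\<close>

lemma nd_compose_self:
  fixes f :: "'a::real_normed_vector \<Rightarrow> 'a"
  assumes "f ` S \<subseteq> T"
  shows "nd n 0 S (\<lambda>x _. f x) \<Longrightarrow> nd n k T G \<Longrightarrow> nd n k S (\<lambda>x vs. G (f x) vs)"
proof (induction n arbitrary: k G)
  case 0
  then show ?case using assms by auto
next
  case (Suc n)
  obtain f' where f': "\<And>x. x \<in> S \<Longrightarrow> has_multilinear_derivative 0 (\<lambda>x _. f x) (f' x) x" "nd n (Suc 0) S f'"
    using Suc.prems(1) by (rule nd_SucE) (erule (1) that)
  obtain G' where G': "\<And>x. x \<in> T \<Longrightarrow> has_multilinear_derivative k G (G' x) x" "nd n (Suc k) T G'"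
    using Suc.prems(2) by (rule nd_SucE) (erule (1) that)
  have "nd n (Suc k) S (\<lambda>x vs. G' (f x) vs)"
    using Suc.IH[OF nd_SucD[OF Suc.prems(1)] G'(2)] .
  then have "nd n (Suc 0 + k) S (\<lambda>x vs. G' (f x) (f' x (take (Suc 0) vs) # drop (Suc 0) vs))"
    using f'(2) by (rule nd_contract)
  then have "nd n (Suc k) S (\<lambda>x vs. G' (f x) (f' x (take 1 vs) # drop 1 vs))"
    by simp
  moreover have "has_multilinear_derivative k (\<lambda>x vs. G (f x) vs) (\<lambda>vs. G' (f x) (f' x (take 1 vs) # drop 1 vs)) x"
    if "x \<in> S" for x
    using that assms
    by (intro has_multilinear_derivative_compose[OF f'(1) nd_imp_bounded_multilinear[OF f'(2)]
          G'(1) nd_imp_bounded_multilinear[OF G'(2)]]) auto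
  moreover have "bounded_multilinear k (G (f x))" if "x \<in> S" for x
    using that assms nd_imp_bounded_multilinear[OF Suc.prems(2)] by auto
  ultimately show ?case
    by (intro nd_SucI)
qed

section \<open>Functions seen as fields without arguments\<close>

definition ndf :: "nat \<Rightarrow> 'a::real_normed_vector set \<Rightarrow> ('a \<Rightarrow> 'b::real_normed_vector) \<Rightarrow> bool" where
  "ndf n S f \<longleftrightarrow> nd n 0 S (\<lambda>x _. f x)"

lemma ndf_smooth_on: "open S \<Longrightarrow> (\<And>n. ndf n S f) \<Longrightarrow> smooth_on S f"
  by (rule smooth_field_imp_smooth_on) (auto simp: smooth_field_def ndf_def)

lemma ndf_linear_image: "ndf n S f \<Longrightarrow> bounded_linear A \<Longrightarrow> bounded_linear L \<Longrightarrow> ndf n (A -` S) (\<lambda>x. L (f (A x)))"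
  unfolding ndf_def by (rule nd_linear_image)

lemma ndf_bounded_linear_compose: "bounded_linear L \<Longrightarrow> ndf n S f \<Longrightarrow> ndf n S (\<lambda>x. L (f x))"
  using ndf_linear_image[OF _ bounded_linear_ident, of n S f L] by (simp add: vimage_def)

text \<open>Composition of fields needs equal source and target types, so \<open>f\<close> and \<open>g\<close> are turned into
  self-maps of a product.\<close>

lemma ndf_compose:
  fixes f :: "'a::real_normed_vector \<Rightarrow> 'b::real_normed_vector" and g :: "'b \<Rightarrow> 'c::real_normed_vector"
  assumes f: "ndf n S f" and g: "ndf n T g" and "f ` S \<subseteq> T"
  shows "ndf n S (\<lambda>x. g (f x))"
proof -
  define F :: "'a \<times> 'b \<times> 'c \<Rightarrow> 'a \<times> 'b \<times> 'c" where "F = (\<lambda>z. (0, f (fst z), 0))"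
  define G :: "'a \<times> 'b \<times> 'c \<Rightarrow> 'a \<times> 'b \<times> 'c" where "G = (\<lambda>z. (0, 0, g (fst (snd z))))"
  have 1: "nd n 0 (fst -` S) (\<lambda>x _. F x)"
    using ndf_linear_image[OF f bounded_linear_fst, of "\<lambda>y. (0, y, 0)"]
    by (simp add: F_def ndf_def bounded_linear_Pair bounded_linear_zero bounded_linear_ident)
  have 2: "nd n 0 ((\<lambda>z. fst (snd z)) -` T) (\<lambda>x _. G x)"
    using ndf_linear_image[OF g, of "\<lambda>z. fst (snd z)" "\<lambda>y. (0, 0, y)"]
    by (simp add: G_def ndf_def bounded_linear_Pair bounded_linear_zero bounded_linear_ident
        bounded_linear_compose[OF bounded_linear_fst bounded_linear_snd])
  have "nd n 0 (fst -` S) (\<lambda>x _. G (F x))"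
    by (rule nd_compose_self[OF _ 1 2]) (use assms(3) in \<open>auto simp: F_def\<close>)
  then have "ndf n (fst -` S) (\<lambda>x. G (F x))"
    by (simp add: ndf_def)
  then have "ndf n ((\<lambda>x. (x, 0, 0)) -` (fst -` S :: ('a \<times> 'b \<times> 'c) set)) (\<lambda>x. snd (snd (G (F (x, 0, 0)))))"
    by (rule ndf_linear_image[where A = "\<lambda>x. (x, 0, 0)" and L = "\<lambda>z. snd (snd z)"]) (intro bounded_linear_Pair bounded_linear_zero bounded_linear_ident
        bounded_linear_compose[OF bounded_linear_snd bounded_linear_snd])+
  then show ?thesis
    by (simp add: F_def G_def vimage_def)
qed

lemma nd_zero: "nd n k S (\<lambda>_ _. 0)"
proof (induction n arbitrary: k)
  case 0
  show ?case
    by (auto intro!: bounded_multilinearI[where C = 0] linear_zero)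
next
  case (Suc n)
  show ?case
    by (rule nd_SucI[OF _ _ Suc.IH])
      (auto intro!: bounded_multilinearI[where C = 0] linear_zero
        simp: has_multilinear_derivative_def prod_list_norm_nonneg eventually_True)
qed

lemma ndf_const: "ndf n S (\<lambda>_. c)"
proof (cases n)
  case (Suc m)
  have "has_multilinear_derivative 0 (\<lambda>_ _. c) (\<lambda>_. 0) x" for x :: 'a
    by (auto simp: has_multilinear_derivative_def)
  then show ?thesis
    unfolding ndf_def Suc
    by (intro nd_SucI[OF _ _ nd_zero]) (auto intro!: bounded_multilinearI[where C = "norm c"])
qed (auto simp: ndf_def intro!: bounded_multilinearI[where C = "norm c"])

lemma ndf_subset: "ndf n S f \<Longrightarrow> T \<subseteq> S \<Longrightarrow> ndf n T f"
proof -
  have "nd n k S M \<Longrightarrow> T \<subseteq> S \<Longrightarrow> nd n k T M" for k and M :: "'a \<Rightarrow> 'a list \<Rightarrow> 'b"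
    by (induction n arbitrary: k M) (auto, blast)
  then show "ndf n S f \<Longrightarrow> T \<subseteq> S \<Longrightarrow> ndf n T f"
    unfolding ndf_def by blast
qed

text \<open>An operator-valued field is read as a field with one more argument. The operator acts on
  the last entry, because differentiation adds directions at the head and so never disturbs
  it.\<close>

lemma nd_blinfun_apply:
  fixes M :: "'a::real_normed_vector \<Rightarrow> 'a list \<Rightarrow> 'a \<Rightarrow>\<^sub>L 'b::real_normed_vector"
  shows "nd n k S M \<Longrightarrow> nd n (Suc k) S (\<lambda>x vs. blinfun_apply (M x (butlast vs)) (last vs))"
proof (induction n arbitrary: k M)
  have *: "bounded_multilinear (Suc k) (\<lambda>vs. blinfun_apply (m (butlast vs)) (last vs))"
    if m: "bounded_multilinear k m" for k and m :: "'a list \<Rightarrow> 'a \<Rightarrow>\<^sub>L 'b"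
  proof -
    obtain C where C: "C \<ge> 0" "\<And>vs. length vs = k \<Longrightarrow> norm (m vs) \<le> C * prod_list (map norm vs)"
      using bounded_multilinear_bound[OF m] by metis
    show ?thesis
    proof (rule bounded_multilinearI)
      fix vs :: "'a list" and i assume vs: "length vs = Suc k" "i < Suc k"
      then obtain us u where us: "vs = us @ [u]"
        by (metis length_0_conv nat.simps(3) rev_exhaust)
      show "linear (\<lambda>w. blinfun_apply (m (butlast (vs[i := w]))) (last (vs[i := w])))"
      proof (cases "i = k")
        case True
        then have "(\<lambda>w. blinfun_apply (m (butlast (vs[i := w]))) (last (vs[i := w]))) = blinfun_apply (m us)"
          using vs us by (auto simp: list_update_append)
        then show ?thesis
          by (simp add: blinfun.bounded_linear_right bounded_linear.linear)
      next
        case False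
        then have "(\<lambda>w. blinfun_apply (m (butlast (vs[i := w]))) (last (vs[i := w])))
          = (\<lambda>A. blinfun_apply A u) \<circ> (\<lambda>w. m (us[i := w]))"
          using vs us by (auto simp: list_update_append)
        moreover have "linear \<dots>"
          using vs us False
          by (intro linear_compose bounded_multilinear_linear[OF m])
            (auto simp: blinfun.bounded_linear_left bounded_linear.linear)
        ultimately show ?thesis by simp
      qed
    next
      fix vs :: "'a list" assume vs: "length vs = Suc k"
      then obtain us u where us: "vs = us @ [u]"
        by (metis length_0_conv nat.simps(3) rev_exhaust)
      have "norm (blinfun_apply (m us) u) \<le> norm (m us) * norm u"
        by (rule norm_blinfun)
      also have "\<dots> \<le> C * prod_list (map norm us) * norm u"
        using C vs us by (intro mult_right_mono) auto
      finally show "norm (blinfun_apply (m (butlast vs)) (last vs)) \<le> C * prod_list (map norm vs)"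
        by (simp add: us mult_ac)
    qed
  qed
  {
    case 0
    then show ?case
      using * by simp
  next
    case (Suc n)
    obtain M' where M': "\<And>x. x \<in> S \<Longrightarrow> has_multilinear_derivative k M (M' x) x" "nd n (Suc k) S M'"
      using Suc.prems(1) by (rule nd_SucE) (erule (1) that)
    have d: "has_multilinear_derivative (Suc k) (\<lambda>x vs. blinfun_apply (M x (butlast vs)) (last vs))
        (\<lambda>vs. blinfun_apply (M' x (butlast vs)) (last vs)) x" if x: "x \<in> S" for x
      unfolding has_multilinear_derivative_def
    proof (intro allI impI)
      fix \<epsilon> :: real assume \<epsilon>: "\<epsilon> > 0"
      from has_multilinear_derivativeD[OF M'(1)[OF x] \<epsilon>]
      show "\<forall>\<^sub>F y in nhds x. \<forall>vs. length vs = Suc k \<longrightarrow>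
           norm (blinfun_apply (M y (butlast vs)) (last vs) - blinfun_apply (M x (butlast vs)) (last vs) -
             blinfun_apply (M' x (butlast ((y - x) # vs))) (last ((y - x) # vs)))
           \<le> \<epsilon> * norm (y - x) * prod_list (map norm vs)"
      proof eventually_elim
        case (elim y)
        show ?case
        proof (intro allI impI)
          fix vs :: "'a list" assume vs: "length vs = Suc k"
          then obtain us u where us: "vs = us @ [u]"
            by (metis length_0_conv nat.simps(3) rev_exhaust)
          have "norm (blinfun_apply (M y us - M x us - M' x ((y - x) # us)) u)
              \<le> norm (M y us - M x us - M' x ((y - x) # us)) * norm u"
            by (rule norm_blinfun)
          also have "\<dots> \<le> \<epsilon> * norm (y - x) * prod_list (map norm us) * norm u"
            using elim vs us by (intro mult_right_mono) auto
          finally show "norm (blinfun_apply (M y (butlast vs)) (last vs) - blinfun_apply (M x (butlast vs)) (last vs) -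
             blinfun_apply (M' x (butlast ((y - x) # vs))) (last ((y - x) # vs)))
           \<le> \<epsilon> * norm (y - x) * prod_list (map norm vs)"
            by (simp add: us mult_ac blinfun.diff_left)
        qed
      qed
    qed
    show ?case
      by (rule nd_SucI[OF *[OF nd_imp_bounded_multilinear[OF Suc.prems(1)]] d Suc.IH[OF M'(2)]])
  }
qed

text \<open>This bootstrap turns any formula for the derivative in terms of the function itself into
  differentiability of all orders.\<close>

lemma ndf_Suc:
  fixes f :: "'a::real_normed_vector \<Rightarrow> 'b::real_normed_vector"
  assumes d: "\<And>x. x \<in> S \<Longrightarrow> (f has_derivative blinfun_apply (f' x)) (at x)" and f': "ndf n S f'"
  shows "ndf (Suc n) S f"
proof -
  have "nd n (Suc 0) S (\<lambda>x vs. blinfun_apply (f' x) (last vs))"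
    using nd_blinfun_apply[OF f'[unfolded ndf_def]] .
  moreover have "has_multilinear_derivative 0 (\<lambda>x _. f x) (\<lambda>vs. blinfun_apply (f' x) (last vs)) x" if x: "x \<in> S" for x
    unfolding has_multilinear_derivative_def
  proof (intro allI impI)
    fix \<epsilon> :: real assume "\<epsilon> > 0"
    then obtain \<delta> where "\<delta> > 0" "\<And>y. norm (y - x) < \<delta> \<Longrightarrow> norm (f y - f x - blinfun_apply (f' x) (y - x)) \<le> \<epsilon> * norm (y - x)"
      using d[OF x] unfolding has_derivative_at_alt by blast
    then show "\<forall>\<^sub>F y in nhds x. \<forall>vs. length vs = 0 \<longrightarrow>
         norm (f y - f x - blinfun_apply (f' x) (last ((y - x) # vs))) \<le> \<epsilon> * norm (y - x) * prod_list (map norm vs)"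
      unfolding eventually_nhds_metric by (auto simp: dist_norm)
  qed
  ultimately show ?thesis
    unfolding ndf_def by (intro nd_SucI) (auto intro!: bounded_multilinearI[where C = "norm (f _)"])
qed

lemma ndf_0: "ndf 0 S f"
  by (auto simp: ndf_def intro!: bounded_multilinearI[where C = "norm (f _)"])

lemma ndf_bounded_linear:
  assumes "bounded_linear f"
  shows "ndf n S f"
proof (cases n)
  case (Suc m)
  have "ndf (Suc m) S f"
    by (rule ndf_Suc[where f' = "\<lambda>_. Blinfun f"])
      (auto simp: bounded_linear_Blinfun_apply assms bounded_linear_imp_has_derivative intro: ndf_const)
  then show ?thesis using Suc by simp
qed (simp add: ndf_0)

lemma ndf_add: "ndf n S f \<Longrightarrow> ndf n S g \<Longrightarrow> ndf n S (\<lambda>x. f x + g x)"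
  unfolding ndf_def by (rule nd_add)

lemma ndf_minus: "ndf n S f \<Longrightarrow> ndf n S (\<lambda>x. - f x)"
  by (rule ndf_bounded_linear_compose[OF bounded_linear_minus[OF bounded_linear_ident]])

lemma ndf_diff: "ndf n S f \<Longrightarrow> ndf n S g \<Longrightarrow> ndf n S (\<lambda>x. f x - g x)"
  using ndf_add[OF _ ndf_minus, of n S f g] by simp

lemma ndf_Pair:
  assumes "ndf n S f" "ndf n S g"
  shows "ndf n S (\<lambda>x. (f x, g x))"
proof -
  have "ndf n S (\<lambda>x. (f x, 0))"
    by (rule ndf_bounded_linear_compose[OF bounded_linear_Pair[OF bounded_linear_ident bounded_linear_zero] assms(1)])
  moreover have "ndf n S (\<lambda>x. (0, g x))"
    by (rule ndf_bounded_linear_compose[OF bounded_linear_Pair[OF bounded_linear_zero bounded_linear_ident] assms(2)])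
  ultimately have "ndf n S (\<lambda>x. (f x, 0) + (0, g x))"
    by (rule ndf_add)
  then show ?thesis by simp
qed

text \<open>The derivative at a pair depends linearly on the pair, and bounded linear maps have all
  orders.\<close>

lemma (in bounded_bilinear) ndf_bilinear:
  "ndf n S (\<lambda>z. prod (fst z) (snd z))"
proof (cases n)
  case (Suc m)
  have bl: "bounded_linear (\<lambda>z. (prod_left (snd z) o\<^sub>L fst_blinfun) + (prod_right (fst z) o\<^sub>L snd_blinfun))"
    by (intro bounded_linear_add bounded_linear_compose[OF bounded_bilinear.bounded_linear_left[OF bounded_bilinear_blinfun_compose]]
        bounded_linear_compose[OF bounded_linear_prod_left] bounded_linear_compose[OF bounded_linear_prod_right]
        bounded_linear_fst bounded_linear_snd)
  have "ndf (Suc m) S (\<lambda>z. prod (fst z) (snd z))"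
  proof (rule ndf_Suc[OF _ ndf_bounded_linear[OF bl]])
    fix x :: "'a \<times> 'b"
    have "((\<lambda>z. prod (fst z) (snd z)) has_derivative (\<lambda>h. prod (fst x) (snd h) + prod (fst h) (snd x))) (at x)"
      by (intro FDERIV has_derivative_fst has_derivative_snd has_derivative_ident)
    moreover have "blinfun_apply ((prod_left (snd x) o\<^sub>L fst_blinfun) + (prod_right (fst x) o\<^sub>L snd_blinfun))
        = (\<lambda>h. prod (fst x) (snd h) + prod (fst h) (snd x))"
      by (auto simp: blinfun.add_left prod_left.rep_eq prod_right.rep_eq)
    ultimately show "((\<lambda>z. prod (fst z) (snd z)) has_derivative
        blinfun_apply ((prod_left (snd x) o\<^sub>L fst_blinfun) + (prod_right (fst x) o\<^sub>L snd_blinfun))) (at x)"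
      by simp
  qed
  then show ?thesis using Suc by simp
qed (simp add: ndf_0)

lemma (in bounded_bilinear) ndf_prod:
  assumes "ndf n S f" "ndf n S g"
  shows "ndf n S (\<lambda>x. prod (f x) (g x))"
  using ndf_compose[OF ndf_Pair[OF assms] ndf_bilinear[of n UNIV]] by simp

lemmas ndf_mult = bounded_bilinear.ndf_prod[OF bounded_bilinear_mult]
lemmas ndf_scaleR = bounded_bilinear.ndf_prod[OF bounded_bilinear_scaleR]

text \<open>The hypothesis is the resolvent identity; it covers reciprocals and operator inverses.\<close>

lemma ndf_resolvent:
  fixes R a :: "'e::real_normed_vector \<Rightarrow> 'f::real_normed_vector" and pr :: "'f \<Rightarrow> 'f \<Rightarrow> 'f"
  assumes pr: "bounded_bilinear pr" and S: "open S" and a: "\<And>n. ndf n S a"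
    and a': "\<And>x. x \<in> S \<Longrightarrow> (a has_derivative blinfun_apply (a' x)) (at x)" and a'': "\<And>n. ndf n S a'"
    and R: "\<And>x y. x \<in> S \<Longrightarrow> y \<in> S \<Longrightarrow> R y - R x = - pr (R y) (pr (a y - a x) (R x))"
  shows "ndf n S R" "\<And>x. x \<in> S \<Longrightarrow> (R has_derivative (\<lambda>h. - pr (R x) (pr (a' x h) (R x)))) (at x)"
proof -
  interpret pr: bounded_bilinear pr by (rule pr)
  obtain K where K: "K > 0" "\<And>u v. norm (pr u v) \<le> norm u * norm v * K"
    using pr.pos_bounded by blast
  show d: "(R has_derivative (\<lambda>h. - pr (R x) (pr (a' x h) (R x)))) (at x)" if x: "x \<in> S" for x
  proof -
    have ax: "(a \<longlongrightarrow> a x) (at x)"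
      by (rule isContD[OF has_derivative_continuous[OF a'[OF x]]])
    have "((\<lambda>y. K * (K * norm (a y - a x) * norm (R x))) \<longlongrightarrow> K * (K * norm (a x - a x) * norm (R x))) (at x)"
      by (intro tendsto_intros ax)
    then have ev: "\<forall>\<^sub>F y in at x. K * (K * norm (a y - a x) * norm (R x)) < 1 / 2"
      by (rule order_tendstoD) simp
    have evS: "\<forall>\<^sub>F y in at x. y \<in> S"
      using S x by (rule eventually_at_in_open')
    have bd: "norm (pr u (pr v w)) \<le> K * (K * norm v * norm w) * norm u" for u v w
    proof -
      have "norm (pr u (pr v w)) \<le> norm u * (norm v * norm w * K) * K"
        using K by (intro order_trans[OF K(2)] mult_right_mono mult_left_mono) auto
      then show ?thesis by (simp add: mult_ac)
    qed
    \<comment> \<open>Continuity of R comes out of the identity: where the factor q is below 1/2,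
      \<open>R y\<close> is at most twice \<open>R x\<close> in norm, and then the difference is
      small with \<open>a y - a x\<close>.\<close>
    have cont: "(R \<longlongrightarrow> R x) (at x)"
    proof -
      have "\<forall>\<^sub>F y in at x. norm (R y - R x) \<le> K * (K * norm (a y - a x) * norm (R x)) * (2 * norm (R x))"
        using ev evS
      proof eventually_elim
        case (elim y)
        define q where "q = K * (K * norm (a y - a x) * norm (R x))"
        have q: "0 \<le> q" "q < 1 / 2"
          using elim K by (auto simp: q_def)
        have *: "norm (R y - R x) \<le> q * norm (R y)"
          using bd[of "R y" "a y - a x" "R x"] R[OF x elim(2)] by (simp add: q_def)
        have "norm (R y) \<le> norm (R x) + norm (R y - R x)"
          using norm_triangle_ineq[of "R x" "R y - R x"] by simp
        also have "\<dots> \<le> norm (R x) + 1 / 2 * norm (R y)"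
          using q by (intro add_left_mono order_trans[OF *] mult_right_mono) auto
        finally have "norm (R y) \<le> 2 * norm (R x)" by simp
        then have "norm (R y - R x) \<le> q * (2 * norm (R x))"
          using q by (intro order_trans[OF *] mult_left_mono)
        then show ?case by (simp add: q_def)
      qed
      moreover have "((\<lambda>y. K * (K * norm (a y - a x) * norm (R x)) * (2 * norm (R x))) \<longlongrightarrow>
          K * (K * norm (a x - a x) * norm (R x)) * (2 * norm (R x))) (at x)"
        by (intro tendsto_intros ax)
      ultimately have "((\<lambda>y. R y - R x) \<longlongrightarrow> 0) (at x)"
        by (auto intro: Lim_null_comparison)
      then show ?thesis
        by (simp add: LIM_zero_iff)
    qed
    have "((\<lambda>y. R x - pr (R y) (pr (a y - a x) (R x))) has_derivative (\<lambda>h. - pr (R x) (pr (a' x h) (R x)))) (at x)"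
    proof -
      have "((\<lambda>y. pr (a y - a x) (R x)) has_derivative (\<lambda>h. pr (a' x h) (R x))) (at x)"
        by (rule bounded_linear.has_derivative[OF pr.bounded_linear_left]) (use a'[OF x] in \<open>auto intro!: derivative_eq_intros\<close>)
      then have g: "pr (a x - a x) (R x) = 0" "bounded_linear (\<lambda>h. pr (a' x h) (R x))"
        "((\<lambda>y. norm (pr (a y - a x) (R x) - pr (a x - a x) (R x) - pr (a' x (y - x)) (R x)) / norm (y - x)) \<longlongrightarrow> 0) (at x)"
        unfolding has_derivative_iff_norm by (simp_all add: pr.zero_left)
      obtain B where B: "B \<ge> 0" "\<And>h. norm (pr (a' x h) (R x)) \<le> norm h * B"
        using bounded_linear.nonneg_bounded[OF g(2)] by blast
      have bR: "\<forall>\<^sub>F y in at x. norm (R y) \<le> norm (R x) + 1"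
        using order_tendstoD(2)[OF tendsto_norm[OF cont], of "norm (R x) + 1"]
        by (auto elim: eventually_mono)
      show ?thesis
        unfolding has_derivative_iff_norm
      proof (intro conjI)
        show "bounded_linear (\<lambda>h. - pr (R x) (pr (a' x h) (R x)))"
          by (intro bounded_linear_minus bounded_linear_compose[OF pr.bounded_linear_right] g(2))
        show "((\<lambda>y. norm (R x - pr (R y) (pr (a y - a x) (R x)) - (R x - pr (R x) (pr (a x - a x) (R x))) -
             - pr (R x) (pr (a' x (y - x)) (R x))) / norm (y - x)) \<longlongrightarrow> 0) (at x)"
        proof (rule Lim_null_comparison)
          let ?e = "\<lambda>y. norm (pr (a y - a x) (R x) - pr (a' x (y - x)) (R x)) / norm (y - x)"
          show "\<forall>\<^sub>F y in at x. norm (norm (R x - pr (R y) (pr (a y - a x) (R x)) - (R x - pr (R x) (pr (a x - a x) (R x))) -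
             - pr (R x) (pr (a' x (y - x)) (R x))) / norm (y - x))
             \<le> K * (norm (R x) + 1) * ?e y + K * norm (R y - R x) * B"
            using bR eventually_at_filter[of "\<lambda>y. y \<noteq> x" x UNIV, simplified]
          proof eventually_elim
            case (elim y)
            define u v where "u = pr (a y - a x) (R x)" and "v = pr (a' x (y - x)) (R x)"
            \<comment> \<open>Of the two parts, the first is small by differentiability of a and the
              second by continuity of R.\<close>
            have "norm (- pr (R y) u + pr (R x) v) = norm (pr (R y) (u - v) + pr (R y - R x) v)"
              by (subst norm_minus_cancel[symmetric]) (simp add: pr.diff_left pr.diff_right)
            also have "\<dots> \<le> norm (R y) * norm (u - v) * K + norm (R y - R x) * norm v * K"
              by (intro order_trans[OF norm_triangle_ineq] add_mono K)
            also have "\<dots> \<le> (norm (R x) + 1) * norm (u - v) * K + norm (R y - R x) * (norm (y - x) * B) * K"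
              using elim K B by (intro add_mono mult_right_mono mult_left_mono) (auto simp: v_def)
            finally have *: "norm (- pr (R y) u + pr (R x) v) \<le> (norm (R x) + 1) * norm (u - v) * K + norm (R y - R x) * (norm (y - x) * B) * K" .
            have "norm (- pr (R y) u + pr (R x) v) / norm (y - x) \<le>
               ((norm (R x) + 1) * norm (u - v) * K + norm (R y - R x) * (norm (y - x) * B) * K) / norm (y - x)"
              by (rule divide_right_mono[OF *]) simp
            also have "\<dots> = K * (norm (R x) + 1) * (norm (u - v) / norm (y - x)) + K * norm (R y - R x) * B"
              using elim by (simp add: field_simps)
            finally show ?case
              by (simp add: g(1) pr.zero_right pr.zero_left u_def v_def)
          qed
          have "((\<lambda>y. K * (norm (R x) + 1) * ?e y + K * norm (R y - R x) * B) \<longlongrightarrow>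
             K * (norm (R x) + 1) * 0 + K * norm (R x - R x) * B) (at x)"
            using g cont by (intro tendsto_intros) (simp_all add: pr.zero_left)
          then show "((\<lambda>y. K * (norm (R x) + 1) * ?e y + K * norm (R y - R x) * B) \<longlongrightarrow> 0) (at x)"
            by simp
        qed
      qed
    qed
    then show ?thesis
      by (rule has_derivative_transform_within_open[OF _ S x]) (use R[OF x] in \<open>simp add: algebra_simps\<close>)
  qed
  show "ndf n S R"
  proof (induction n)
    case (Suc n)
    \<comment> \<open>The derivative is an expression in R and \<open>a'\<close>, so order n of R
      yields order n + 1.\<close>
    let ?f' = "\<lambda>x. - (pr.prod_right (R x) o\<^sub>L (pr.prod_left (R x) o\<^sub>L a' x))"
    have pl: "ndf n S (\<lambda>x. pr.prod_left (R x))" and pri: "ndf n S (\<lambda>x. pr.prod_right (R x))"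
      by (intro ndf_bounded_linear_compose[OF _ Suc] pr.bounded_linear_prod_left pr.bounded_linear_prod_right)+
    have "ndf n S ?f'"
      by (intro ndf_minus bounded_bilinear.ndf_prod[OF bounded_bilinear_blinfun_compose] pl pri a'')
    moreover have "(R has_derivative blinfun_apply (?f' x)) (at x)" if "x \<in> S" for x
    proof -
      have "blinfun_apply (?f' x) = (\<lambda>h. - pr (R x) (pr (a' x h) (R x)))"
        by (auto simp: blinfun.minus_left pr.prod_left.rep_eq pr.prod_right.rep_eq)
      then show ?thesis
        using d[OF that] by simp
    qed
    ultimately show ?case
      by (intro ndf_Suc)
  qed (rule ndf_0)
qed

subsection \<open>Absolutely continuous functions\<close>

lemma absolutely_continuous_subinterval:
  assumes "absolutely_continuous_on_interval a b f" "a \<le> c" "d \<le> b"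
  shows "absolutely_continuous_on_interval c d f"
proof -
  have "{c..d} \<subseteq> {a..b}"
    using assms by auto
  then show ?thesis
    using assms(1) unfolding absolutely_continuous_on_interval_def by (meson subset_trans)
qed

lemma division_of_interval_endpoints:
  assumes "d division_of T" "T \<subseteq> {a..b::real}" "K \<in> d"
  shows "Inf K \<in> {a..b}" "Sup K \<in> {a..b}" "Inf K \<le> Sup K" "K = {Inf K..Sup K}"
proof -
  obtain u v where K: "K = cbox u v" "K \<noteq> {}" "K \<subseteq> T"
    using division_ofD[OF assms(1)] assms(3) by metis
  then have "u \<le> v" "K = {u..v}" by auto
  then show "Inf K \<in> {a..b}" "Sup K \<in> {a..b}" "Inf K \<le> Sup K" "K = {Inf K..Sup K}"
    using subset_trans[OF K(3) assms(2)] by (auto simp del: atLeastatMost_subset_iff)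
qed

text \<open>One estimate serves for sums, products and compositions: the increments of h over a
  division are dominated by those of f and g. The constant is enlarged to a positive one before
  dividing by it.\<close>

lemma absolutely_continuous_bound:
  fixes f :: "real \<Rightarrow> 'a::real_normed_vector" and g :: "real \<Rightarrow> 'b::real_normed_vector" and h :: "real \<Rightarrow> 'c::real_normed_vector"
  assumes f: "absolutely_continuous_on_interval a b f" and g: "absolutely_continuous_on_interval a b g"
    and h: "\<And>u v. u \<in> {a..b} \<Longrightarrow> v \<in> {a..b} \<Longrightarrow> norm (h v - h u) \<le> C * (norm (f v - f u) + norm (g v - g u))"
  shows "absolutely_continuous_on_interval a b h"
  unfolding absolutely_continuous_on_interval_def
proof (intro allI impI)
  fix \<epsilon> :: real assume \<epsilon>: "\<epsilon> > 0"
  define D where "D = \<bar>C\<bar> + 1"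
  have D: "D > 0" "C \<le> D" by (auto simp: D_def)
  then have e: "\<epsilon> / (2 * D) > 0" using \<epsilon> by simp
  obtain \<delta>1 where \<delta>1: "\<delta>1 > 0" "\<And>d T. d division_of T \<Longrightarrow> T \<subseteq> {a..b} \<Longrightarrow> (\<Sum>K\<in>d. Sup K - Inf K) < \<delta>1 \<Longrightarrow>
        (\<Sum>K\<in>d. norm (f (Sup K) - f (Inf K))) < \<epsilon> / (2 * D)"
    using f e unfolding absolutely_continuous_on_interval_def by blast
  obtain \<delta>2 where \<delta>2: "\<delta>2 > 0" "\<And>d T. d division_of T \<Longrightarrow> T \<subseteq> {a..b} \<Longrightarrow> (\<Sum>K\<in>d. Sup K - Inf K) < \<delta>2 \<Longrightarrow>
        (\<Sum>K\<in>d. norm (g (Sup K) - g (Inf K))) < \<epsilon> / (2 * D)"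
    using g e unfolding absolutely_continuous_on_interval_def by blast
  show "\<exists>\<delta>>0. \<forall>d T. d division_of T \<longrightarrow> T \<subseteq> {a..b} \<longrightarrow> (\<Sum>K\<in>d. Sup K - Inf K) < \<delta> \<longrightarrow>
        (\<Sum>K\<in>d. norm (h (Sup K) - h (Inf K))) < \<epsilon>"
  proof (intro exI[of _ "min \<delta>1 \<delta>2"] conjI allI impI)
    fix d T assume d: "d division_of T" "T \<subseteq> {a..b}" "(\<Sum>K\<in>d. Sup K - Inf K) < min \<delta>1 \<delta>2"
    have "(\<Sum>K\<in>d. norm (h (Sup K) - h (Inf K))) \<le>
       (\<Sum>K\<in>d. D * (norm (f (Sup K) - f (Inf K)) + norm (g (Sup K) - g (Inf K))))"
    proof (rule sum_mono)
      fix K assume "K \<in> d"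
      from h[OF division_of_interval_endpoints(1,2)[OF d(1,2) this]]
      show "norm (h (Sup K) - h (Inf K)) \<le> D * (norm (f (Sup K) - f (Inf K)) + norm (g (Sup K) - g (Inf K)))"
        by (rule order_trans) (use D in \<open>auto intro: mult_right_mono\<close>)
    qed
    also have "\<dots> = D * ((\<Sum>K\<in>d. norm (f (Sup K) - f (Inf K))) + (\<Sum>K\<in>d. norm (g (Sup K) - g (Inf K))))"
      by (simp add: sum.distrib flip: sum_distrib_left)
    also have "\<dots> < D * (\<epsilon> / (2 * D) + \<epsilon> / (2 * D))"
      using \<delta>1(2)[OF d(1,2)] \<delta>2(2)[OF d(1,2)] d(3) D by (intro mult_strict_left_mono add_strict_mono) auto
    also have "\<dots> = \<epsilon>"
      using D by (simp add: field_simps)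
    finally show "(\<Sum>K\<in>d. norm (h (Sup K) - h (Inf K))) < \<epsilon>" .
  qed (use \<delta>1 \<delta>2 in auto)
qed

lemma absolutely_continuous_imp_continuous:
  fixes f :: "real \<Rightarrow> 'a::real_normed_vector"
  assumes f: "absolutely_continuous_on_interval a b f"
  shows "continuous_on {a..b} f"
  unfolding continuous_on_iff
proof (intro ballI allI impI)
  fix x \<epsilon> :: real assume x: "x \<in> {a..b}" and \<epsilon>: "0 < \<epsilon>"
  obtain \<delta> where \<delta>: "\<delta> > 0" "\<And>d T. d division_of T \<Longrightarrow> T \<subseteq> {a..b} \<Longrightarrow> (\<Sum>K\<in>d. Sup K - Inf K) < \<delta> \<Longrightarrow>
        (\<Sum>K\<in>d. norm (f (Sup K) - f (Inf K))) < \<epsilon>"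
    using f \<epsilon> unfolding absolutely_continuous_on_interval_def by blast
  have *: "norm (f v - f u) < \<epsilon>" if "u \<in> {a..b}" "v \<in> {a..b}" "u \<le> v" "v - u < \<delta>" for u v
  proof -
    have "{cbox u v} division_of cbox u v"
      using that by (intro division_of_self) auto
    from \<delta>(2)[OF this] show ?thesis
      using that by auto
  qed
  show "\<exists>d>0. \<forall>x'\<in>{a..b}. dist x' x < d \<longrightarrow> dist (f x') (f x) < \<epsilon>"
  proof (intro exI[of _ \<delta>] conjI ballI impI)
    fix y assume y: "y \<in> {a..b}" "dist y x < \<delta>"
    show "dist (f y) (f x) < \<epsilon>"
      using *[of x y] *[of y x] x y by (cases "x \<le> y") (auto simp: dist_norm norm_minus_commute)
  qed (rule \<delta>(1))
qed

text \<open>A gauge makes the tags outside the null set see the vanishing derivative, while the intervals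
  tagged in the null set have small total length.\<close>

lemma absolutely_continuous_zero_derivative:
  fixes f :: "real \<Rightarrow> 'a::real_normed_vector"
  assumes ab: "a \<le> b" and f: "absolutely_continuous_on_interval a b f" and N: "negligible N"
    and d: "\<And>t. t \<in> {a..b} - N \<Longrightarrow> (f has_vector_derivative 0) (at t within {a..b})"
  shows "f b = f a"
proof -
  have "norm (f b - f a) \<le> 0 + e" if "e > 0" for e
  proof -
    \<comment> \<open>The summand 1 keeps the denominator positive for a = b.\<close>
    define \<eta> where "\<eta> = e / (2 * (b - a + 1))"
    have \<eta>: "\<eta> > 0" "\<eta> * (b - a) \<le> e / 2"
      using that ab by (auto simp: \<eta>_def field_simps)
    have "e / 2 > 0" using that by simp
    then obtain \<delta> where \<delta>: "\<delta> > 0" "\<And>d T. d division_of T \<Longrightarrow> T \<subseteq> {a..b} \<Longrightarrow> (\<Sum>K\<in>d. Sup K - Inf K) < \<delta> \<Longrightarrow>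
        (\<Sum>K\<in>d. norm (f (Sup K) - f (Inf K))) < e / 2"
      using f unfolding absolutely_continuous_on_interval_def by blast
    obtain U where U: "open U" "N \<subseteq> U" "(U - N) \<in> lmeasurable" "emeasure lebesgue (U - N) < ennreal \<delta>"
      using sets_lebesgue_outer_open[OF negligible_imp_sets[OF N] \<delta>(1)] by blast
    have Om: "U \<in> lmeasurable" and Od: "measure lebesgue U < \<delta>"
    proof -
      have U': "U = (U - N) \<union> N"
        using U(2) by auto
      have "N \<in> lmeasurable" using N by (rule negligible_imp_measurable)
      then show Om: "U \<in> lmeasurable"
        using U(3) U' by (metis fmeasurable.Un)
      have "measure lebesgue U = measure lebesgue (U - N)"
        using N Om by (simp add: measure_Diff_null_set fmeasurableD negligible_iff_null_sets)
      also have "\<dots> < \<delta>"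
        using U(3,4) by (simp add: emeasure_eq_measure2 ennreal_less_iff)
      finally show "measure lebesgue U < \<delta>" .
    qed
    have "\<exists>r>0. \<forall>y\<in>{a..b}. norm (y - t) < r \<longrightarrow> norm (f y - f t) \<le> \<eta> * norm (y - t)" if "t \<in> {a..b} - N" for t
      using d[OF that] \<eta>(1) unfolding has_vector_derivative_def has_derivative_within_alt by auto
    then obtain r where r: "\<And>t. t \<in> {a..b} - N \<Longrightarrow> r t > 0"
      "\<And>t y. t \<in> {a..b} - N \<Longrightarrow> y \<in> {a..b} \<Longrightarrow> norm (y - t) < r t \<Longrightarrow> norm (f y - f t) \<le> \<eta> * norm (y - t)"
      by metis
    define \<gamma> where "\<gamma> = (\<lambda>t. if t \<in> N then U else if t \<in> {a..b} then ball t (r t) else ball t 1)"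
    have "gauge \<gamma>"
      using U r by (auto simp: gauge_def \<gamma>_def)
    then obtain p where p: "p tagged_division_of {a..b}" "\<gamma> fine p"
      by (rule fine_division_exists_real)
    have fin: "finite p" using p(1) by blast
    have K: "Inf K \<le> t \<and> t \<le> Sup K \<and> Inf K \<in> {a..b} \<and> Sup K \<in> {a..b} \<and> t \<in> {a..b} \<and> K = {Inf K..Sup K} \<and> K \<subseteq> \<gamma> t"
      if tK: "(t, K) \<in> p" for t K
    proof -
      obtain u v where uv: "K = cbox u v" "t \<in> K" "K \<subseteq> {a..b}"
        using tagged_division_ofD(2,3,4)[OF p(1) tK] by blast
      have "u \<le> v"
        using uv(1,2) by simp
      then have "K = {u..v}" "Inf K = u" "Sup K = v"
        using uv(1) by simp_all
      moreover have "K \<subseteq> \<gamma> t"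
        using p(2) that by (rule fineD)
      moreover have "u \<in> {a..b}" "v \<in> {a..b}" "t \<in> {u..v}" "t \<in> {a..b}"
        using uv(2,3) \<open>u \<le> v\<close> unfolding \<open>K = {u..v}\<close> by auto
      ultimately show ?thesis
        by (metis atLeastAtMost_iff)
    qed
    define q where "q = {z \<in> p. fst z \<in> N}"
    let ?g = "\<lambda>K. norm (f (Sup K) - f (Inf K))"
    have "norm (f b - f a) = norm (\<Sum>(t, K)\<in>p. f (Sup K) - f (Inf K))"
      using additive_tagged_division_1[OF ab p(1), of f] by simp
    also have "\<dots> \<le> (\<Sum>(t, K)\<in>p. ?g K)"
      by (rule order_trans[OF norm_sum]) (simp add: split_beta)
    also have "\<dots> = (\<Sum>(t, K)\<in>q. ?g K) + (\<Sum>(t, K)\<in>p - q. ?g K)"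
      using fin by (subst sum.subset_diff[of q]) (auto simp: q_def)
    also have "(\<Sum>(t, K)\<in>q. ?g K) \<le> e / 2"
    proof -
      have q: "q tagged_partial_division_of {a..b}"
        using p(1) unfolding tagged_division_of_def q_def by (blast intro: tagged_partial_division_subset)
      note q' = tagged_partial_division_of_Union_self[OF q]
      have D: "(snd ` q) division_of \<Union>(snd ` q)"
        by (rule partial_division_of_tagged_division[OF q])
      have sub: "\<Union>(snd ` q) \<subseteq> U"
        using K by (fastforce simp: q_def \<gamma>_def)
      have sub': "\<Union>(snd ` q) \<subseteq> {a..b}"
        using tagged_partial_division_ofD(3)[OF q] by fastforce
      have "(\<Sum>K\<in>snd ` q. Sup K - Inf K) = (\<Sum>K\<in>snd ` q. measure lborel K)"
      proof (rule sum.cong[OF refl])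
        fix L assume "L \<in> snd ` q"
        then have "L = {Inf L..Sup L}" "Inf L \<le> Sup L"
          using division_of_interval_endpoints[OF D sub'] by auto
        then show "Sup L - Inf L = measure lborel L"
          by (metis content_real)
      qed
      also have "\<dots> = measure lebesgue (\<Union>(snd ` q))"
        using content_division[OF D] division_of_interval_endpoints(4)[OF D sub']
        by (metis (no_types, lifting) borel_closed closed_atLeastAtMost measure_completion sets_lborel sum.cong)
      also have "\<dots> \<le> measure lebesgue U"
        using sub Om D by (intro measure_mono_fmeasurable) (auto simp: fmeasurableD lmeasurable_division)
      finally have "(\<Sum>K\<in>snd ` q. Sup K - Inf K) < \<delta>"
        using Od by simp
      then have "(\<Sum>K\<in>snd ` q. ?g K) < e / 2"
        using \<delta>(2)[OF D sub'] by simp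
      moreover have "(\<Sum>(t, K)\<in>q. ?g K) = (\<Sum>K\<in>snd ` q. ?g K)"
      proof -
        \<comment> \<open>Passing from tagged intervals to intervals asks for a summand that
          vanishes on every degenerate box. On the empty box \<open>Sup\<close> and
          \<open>Inf\<close> say nothing, so the value 0 is put there; no interval of
          \<open>q\<close> is empty.\<close>
        let ?d = "\<lambda>K. if K = {} then 0 else ?g K"
        have "(\<Sum>(t, K)\<in>q. ?g K) = (\<Sum>(t, K)\<in>q. ?d K)"
          using tagged_partial_division_ofD(2)[OF q] by (intro sum.cong) fastforce+
        also have "\<dots> = (\<Sum>K\<in>snd ` q. ?d K)"
        proof (rule sum.over_tagged_division_lemma[OF q'])
          fix u v :: real assume "box u v = {}"
          then show "?d (cbox u v) = 0"
            by (cases "u = v") auto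
        qed
        also have "\<dots> = (\<Sum>K\<in>snd ` q. ?g K)"
          using tagged_partial_division_ofD(2)[OF q] by (intro sum.cong) fastforce+
        finally show ?thesis .
      qed
      ultimately show ?thesis by simp
    qed
    also have "(\<Sum>(t, K)\<in>p - q. ?g K) \<le> (\<Sum>(t, K)\<in>p - q. \<eta> * measure lborel K)"
    proof (rule sum_mono, clarify)
      fix t K assume tK: "(t, K) \<in> p" "(t, K) \<notin> q"
      then have t: "t \<in> {a..b} - N" "K \<subseteq> ball t (r t)"
        using K[OF tK(1)] by (auto simp: q_def \<gamma>_def)
      have "norm (f (Sup K) - f t) \<le> \<eta> * norm (Sup K - t)" "norm (f (Inf K) - f t) \<le> \<eta> * norm (Inf K - t)"
      proof -
        have "Sup K \<in> K" "Inf K \<in> K"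
          using K[OF tK(1)] by (metis atLeastAtMost_iff order.refl order.trans)+
        then have "norm (Sup K - t) < r t" "norm (Inf K - t) < r t"
          using subsetD[OF t(2), of "Sup K"] subsetD[OF t(2), of "Inf K"]
          by (metis mem_ball dist_norm norm_minus_commute)+
        then show "norm (f (Sup K) - f t) \<le> \<eta> * norm (Sup K - t)" "norm (f (Inf K) - f t) \<le> \<eta> * norm (Inf K - t)"
          using K[OF tK(1)] r(2)[OF t(1)] by blast+
      qed
      then have "?g K \<le> \<eta> * norm (Sup K - t) + \<eta> * norm (Inf K - t)"
        by (smt (verit) norm_triangle_ineq4 diff_diff_eq2 diff_add_cancel add_diff_cancel_right)
      also have "\<dots> = \<eta> * (Sup K - Inf K)"
        using K[OF tK(1)] by (simp add: algebra_simps)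
      also have "Sup K - Inf K = measure lborel K"
        using K[OF tK(1)] by (metis content_real order.trans)
      finally show "?g K \<le> \<eta> * measure lborel K" .
    qed
    also have "\<dots> \<le> (\<Sum>(t, K)\<in>p. \<eta> * measure lborel K)"
      using fin \<eta> by (intro sum_mono2) (auto simp: split_beta)
    also have "\<dots> = \<eta> * (b - a)"
      using additive_content_tagged_division[of p a b] p(1) ab by (simp add: split_beta flip: sum_distrib_left)
    finally show ?thesis
      using \<eta>(2) by simp
  qed
  then have "norm (f b - f a) \<le> 0"
    by (rule field_le_epsilon)
  then show ?thesis by simp
qed

text \<open>The inequality
  \<open>2 * l * \<bar>f t\<bar> \<le> l\<^sup>2 * (f t)\<^sup>2 + 1\<close> bounds the increments
  by the integral of the square, which is finite, and by the total length, with weights that l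
  balances.\<close>

lemma absolutely_continuous_integral:
  fixes f :: "real \<Rightarrow> real"
  assumes f: "f integrable_on {a..b}" and f2: "(\<lambda>t. (f t)\<^sup>2) integrable_on {a..b}"
  shows "absolutely_continuous_on_interval a b (\<lambda>t. integral {a..t} f)"
  unfolding absolutely_continuous_on_interval_def
proof (intro allI impI)
  fix \<epsilon> :: real assume \<epsilon>: "\<epsilon> > 0"
  define I where "I = integral {a..b} (\<lambda>t. (f t)\<^sup>2)"
  have I: "I \<ge> 0" unfolding I_def by (rule integral_nonneg[OF f2]) simp
  \<comment> \<open>With this l the part with the square is at most \<epsilon>/2 in total, and total
    length below \<open>\<epsilon> * l\<close> makes the other part less than \<epsilon>/2.\<close>
  define l where "l = \<epsilon> / (I + 1)"
  have l: "l > 0" "l / 2 * I \<le> \<epsilon> / 2"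
    using \<epsilon> I by (auto simp: l_def field_simps)
  show "\<exists>\<delta>>0. \<forall>d T. d division_of T \<longrightarrow> T \<subseteq> {a..b} \<longrightarrow> (\<Sum>K\<in>d. Sup K - Inf K) < \<delta> \<longrightarrow>
        (\<Sum>K\<in>d. norm (integral {a..Sup K} f - integral {a..Inf K} f)) < \<epsilon>"
  proof (intro exI[of _ "\<epsilon> * l"] conjI allI impI)
    show "\<epsilon> * l > 0" using \<epsilon> l by simp
    fix d T assume d: "d division_of T" "T \<subseteq> {a..b}" and small: "(\<Sum>K\<in>d. Sup K - Inf K) < \<epsilon> * l"
    let ?g = "\<lambda>t. l / 2 * (f t)\<^sup>2"
    have gi: "?g integrable_on {a..b}"
      using integrable_on_mult_right[OF f2, of "l / 2"] by simp
    have gK: "?g integrable_on K" if "K \<in> d" for K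
    proof -
      note K' = division_of_interval_endpoints[OF d that]
      have "{Inf K..Sup K} \<subseteq> {a..b}"
        using K'(1,2) by simp
      then have "?g integrable_on {Inf K..Sup K}"
        by (rule integrable_on_subinterval[OF gi])
      then show ?thesis
        by (subst K'(4))
    qed
    have "(\<Sum>K\<in>d. norm (integral {a..Sup K} f - integral {a..Inf K} f)) \<le>
       (\<Sum>K\<in>d. integral K ?g + 1 / (2 * l) * (Sup K - Inf K))"
    proof (rule sum_mono)
      fix K assume K: "K \<in> d"
      note K' = division_of_interval_endpoints[OF d K]
      have sub: "{Inf K..Sup K} \<subseteq> {a..b}"
        using K'(1,2) by simp
      have "integral {a..Inf K} f + integral {Inf K..Sup K} f = integral {a..Sup K} f"
        using K' by (intro Henstock_Kurzweil_Integration.integral_combine integrable_on_subinterval[OF f]) auto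
      then have "norm (integral {a..Sup K} f - integral {a..Inf K} f) = norm (integral {Inf K..Sup K} f)"
        by (simp add: algebra_simps)
      also have "\<dots> \<le> integral {Inf K..Sup K} (\<lambda>t. ?g t + 1 / (2 * l))"
      proof (rule integral_norm_bound_integral)
        show "f integrable_on {Inf K..Sup K}"
          by (rule integrable_on_subinterval[OF f sub])
        show "(\<lambda>t. ?g t + 1 / (2 * l)) integrable_on {Inf K..Sup K}"
          by (intro integrable_add integrable_on_subinterval[OF gi sub]) (simp add: integrable_const_ivl)
        show "norm (f t) \<le> ?g t + 1 / (2 * l)" for t
        proof -
          have "0 \<le> (l * \<bar>f t\<bar> - 1)\<^sup>2" by simp
          then have "2 * l * \<bar>f t\<bar> \<le> l\<^sup>2 * (f t)\<^sup>2 + 1"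
            by (simp add: power2_diff power_mult_distrib)
          then show ?thesis
            using l(1) by (simp add: field_simps power2_eq_square)
        qed
      qed
      also have "\<dots> = integral {Inf K..Sup K} ?g + 1 / (2 * l) * (Sup K - Inf K)"
        using K'(3) by (subst Henstock_Kurzweil_Integration.integral_add[OF integrable_on_subinterval[OF gi sub] integrable_const_ivl])
          simp
      finally show "norm (integral {a..Sup K} f - integral {a..Inf K} f) \<le> integral K ?g + 1 / (2 * l) * (Sup K - Inf K)"
        using K'(4) by simp
    qed
    also have "\<dots> = (\<Sum>K\<in>d. integral K ?g) + 1 / (2 * l) * (\<Sum>K\<in>d. Sup K - Inf K)"
      by (simp add: sum.distrib sum_divide_distrib)
    also have "(\<Sum>K\<in>d. integral K ?g) = integral T ?g"
      by (rule integral_combine_division_bottomup[OF d(1) gK, symmetric])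
    also have "integral T ?g \<le> integral {a..b} ?g"
    proof (rule integral_subset_le[OF d(2) _ gi])
      show "?g integrable_on T"
        by (rule integrable_combine_division[OF d(1) gK])
    qed (use l in simp)
    also have "integral {a..b} ?g = l / 2 * I"
      by (simp add: I_def)
    also have "\<dots> \<le> \<epsilon> / 2" by (rule l)
    also have "1 / (2 * l) * (\<Sum>K\<in>d. Sup K - Inf K) < 1 / (2 * l) * (\<epsilon> * l)"
      using small l by (intro mult_strict_left_mono) auto
    finally show "(\<Sum>K\<in>d. norm (integral {a..Sup K} f - integral {a..Inf K} f)) < \<epsilon>"
      using l(1) by simp
  qed
qed

subsection \<open>Differentiation of the indefinite integral\<close>

text \<open>Lebesgue differentiation from two covering results. A point near which the difference
  quotient keeps missing the value of f by more than \<eta> is an end point of arbitrarily short bad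
  segments. By Vitali, disjoint ones cover almost all such points; the Henstock lemma, with these
  points as tags, bounds their total length.\<close>

lemma integral_differentiable_ae:
  fixes f :: "real \<Rightarrow> real"
  assumes f: "f integrable_on {a..b}"
  shows "\<exists>N. negligible N \<and> (\<forall>t\<in>{a..b} - N. ((\<lambda>t. integral {a..t} f) has_vector_derivative f t) (at t within {a..b}))"
proof -
  define F where "F = (\<lambda>t. integral {a..t} f)"
  have FF: "F v - F u = integral {u..v} f" if "a \<le> u" "u \<le> v" "v \<le> b" for u v
  proof -
    have "F u + integral {u..v} f = F v"
      unfolding F_def using that
      by (intro Henstock_Kurzweil_Integration.integral_combine integrable_on_subinterval[OF f]) auto
    then show ?thesis by simp
  qed
  define bad where "bad = (\<lambda>\<eta> x y. x \<in> {a..b} \<and> y \<in> {a..b} \<and> x \<noteq> y \<and> \<bar>F y - F x - f x * (y - x)\<bar> > \<eta> * \<bar>y - x\<bar>)"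
  define E where "E = (\<lambda>\<eta>. {x. \<forall>d>0. \<exists>y. \<bar>y - x\<bar> < d \<and> bad \<eta> x y})"
  have neg: "negligible (E \<eta>)" if \<eta>: "\<eta> > 0" for \<eta>
    unfolding negligible_outer_le
  proof (intro allI impI)
    fix e :: real assume e: "e > 0"
    \<comment> \<open>Each bad segment contributes at least \<eta> times its length to the sum in
      the Henstock lemma, so the tolerance \<open>e * \<eta>\<close> leaves total length at most
      e.\<close>
    obtain \<gamma> where \<gamma>: "gauge \<gamma>"
      "\<And>p. p tagged_partial_division_of (cbox a b) \<Longrightarrow> \<gamma> fine p \<Longrightarrow>
             sum (\<lambda>(x,k). norm(measure lborel k *\<^sub>R f x - integral k f)) p < e * \<eta>"
      using Henstock_lemma[of f a b "e * \<eta>"] f e \<eta> by (auto simp: box_real)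
    define J where "J = {(x, y). bad \<eta> x y \<and> closed_segment x y \<subseteq> \<gamma> x}"
    \<comment> \<open>The covering theorem speaks of balls, so a segment is presented as the ball
      around its midpoint.\<close>
    define c where "c = (\<lambda>(x::real, y). (x + y) / 2)"
    define r where "r = (\<lambda>(x::real, y). \<bar>y - x\<bar> / 2)"
    have cb: "cball (c z) (r z) = closed_segment (fst z) (snd z)" for z
    proof -
      obtain x y where z: "z = (x, y)" by (cases z)
      have "cball ((x + y) / 2) (\<bar>y - x\<bar> / 2) = closed_segment x y"
        unfolding cball_eq_atLeastAtMost closed_segment_eq_real_ivl by (cases "x \<le> y") (simp_all add: field_simps)
      then show ?thesis
        by (simp add: z c_def r_def)
    qed
    obtain C where C: "countable C" "C \<subseteq> J"
      "pairwise (\<lambda>i j. disjnt (cball (c i) (r i)) (cball (c j) (r j))) C"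
      "negligible (E \<eta> - (\<Union>i\<in>C. cball (c i) (r i)))"
    proof (rule Vitali_covering_theorem_cballs[of J r "E \<eta>" c])
      show "0 < r i" if "i \<in> J" for i
        using that by (auto simp: J_def r_def bad_def)
      show "\<exists>i. i \<in> J \<and> x \<in> cball (c i) (r i) \<and> r i < d" if x: "x \<in> E \<eta>" and d: "0 < d" for x d
      proof -
        obtain e' where e': "e' > 0" "ball x e' \<subseteq> \<gamma> x"
          using gaugeD[OF \<gamma>(1), of x] by (meson openE)
        obtain y where y: "\<bar>y - x\<bar> < min d e'" "bad \<eta> x y"
        proof -
          have "\<exists>y. \<bar>y - x\<bar> < min d e' \<and> bad \<eta> x y"
            using x[unfolded E_def, simplified, rule_format, of "min d e'"] d e'(1) by simp
          then show thesis
            using that by blast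
        qed
        have "closed_segment x y \<subseteq> ball x e'"
          using y e' by (auto simp: closed_segment_eq_real_ivl dist_norm split: if_splits)
        then have "(x, y) \<in> J" "r (x, y) < d"
          using y e' d by (auto simp: J_def r_def)
        then show ?thesis
          using cb[of "(x, y)"] by (intro exI[of _ "(x, y)"]) auto
      qed
    qed
    have fin: "measure lebesgue (\<Union>i\<in>C'. cball (c i) (r i)) \<le> e" if C': "C' \<subseteq> C" "finite C'" for C'
    proof -
      define I where "I = (\<lambda>z::real \<times> real. closed_segment (fst z) (snd z))"
      define p where "p = (\<lambda>z. (fst z, I z)) ` C'"
      have I: "I z = cbox (min (fst z) (snd z)) (max (fst z) (snd z))" for z
        by (auto simp: I_def closed_segment_eq_real_ivl)
      have disj: "disjnt (I y) (I z)" if "y \<in> C'" "z \<in> C'" "y \<noteq> z" for y z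
        using C(3) C'(1) that by (auto simp: cb I_def pairwise_def)
      have zJ: "bad \<eta> (fst z) (snd z)" "I z \<subseteq> \<gamma> (fst z)" if "z \<in> C'" for z
      proof -
        have "z \<in> J" using that C' C(2) by blast
        then show "bad \<eta> (fst z) (snd z)" "I z \<subseteq> \<gamma> (fst z)"
          by (simp_all add: J_def I_def split_beta)
      qed
      have "p tagged_partial_division_of (cbox a b)"
        unfolding tagged_partial_division_of_def
      proof (intro conjI allI impI)
        show "finite p" using C' by (simp add: p_def)
      next
        fix x K assume "(x, K) \<in> p"
        then obtain z where z: "z \<in> C'" "x = fst z" "K = I z" by (auto simp: p_def)
        then show "x \<in> K" "\<exists>a b. K = cbox a b"
          using I[of z] by (auto simp: I_def)
        show "K \<subseteq> cbox a b"
          using zJ(1)[OF z(1)] z by (auto simp: bad_def I_def closed_segment_eq_real_ivl split: if_splits)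
      next
        fix x1 K1 x2 K2 assume *: "(x1, K1) \<in> p \<and> (x2, K2) \<in> p \<and> (x1, K1) \<noteq> (x2, K2)"
        then obtain y z where "y \<in> C'" "K1 = I y" "x1 = fst y" "z \<in> C'" "K2 = I z" "x2 = fst z" by (auto simp: p_def)
        then have "disjnt K1 K2"
          using * disj[of y z] by auto
        then show "interior K1 \<inter> interior K2 = {}"
          using interior_subset by (fastforce simp: disjnt_def)
      qed
      moreover have "\<gamma> fine p"
        using zJ by (auto simp: fine_def p_def)
      ultimately have "(\<Sum>(x,k)\<in>p. norm(measure lborel k *\<^sub>R f x - integral k f)) < e * \<eta>"
        by (rule \<gamma>(2))
      moreover have "(\<Sum>(x,k)\<in>p. norm(measure lborel k *\<^sub>R f x - integral k f)) = (\<Sum>z\<in>C'. norm (measure lborel (I z) *\<^sub>R f (fst z) - integral (I z) f))"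
      proof -
        have "inj_on (\<lambda>z. (fst z, I z)) C'"
        proof (rule inj_onI)
          fix y z assume "y \<in> C'" "z \<in> C'" "(fst y, I y) = (fst z, I z)"
          moreover have "I y \<noteq> {}" by (auto simp: I_def)
          ultimately show "y = z"
            using disj[of y z] by (auto simp: disjnt_def)
        qed
        then show ?thesis
          unfolding p_def by (simp add: sum.reindex)
      qed
      moreover have "(\<Sum>z\<in>C'. \<eta> * measure lborel (I z)) \<le> (\<Sum>z\<in>C'. norm (measure lborel (I z) *\<^sub>R f (fst z) - integral (I z) f))"
      proof (rule sum_mono)
        fix z assume z: "z \<in> C'"
        define x y where "x = fst z" and "y = snd z"
        have b: "x \<in> {a..b}" "y \<in> {a..b}" "\<bar>F y - F x - f x * (y - x)\<bar> > \<eta> * \<bar>y - x\<bar>"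
          using zJ(1)[OF z] by (auto simp: bad_def x_def y_def)
        have ct: "measure lborel (I z) = \<bar>y - x\<bar>"
          by (auto simp: I x_def y_def max_def min_def)
        show "\<eta> * measure lborel (I z) \<le> norm (measure lborel (I z) *\<^sub>R f (fst z) - integral (I z) f)"
        proof (cases "x \<le> y")
          case True
          then have "integral (I z) f = F y - F x"
            using b FF[of x y] by (simp add: I_def closed_segment_eq_real_ivl flip: x_def y_def)
          then show ?thesis
            using b True unfolding ct by (simp add: algebra_simps abs_minus_commute flip: x_def y_def)
        next
          case False
          then have "integral (I z) f = F x - F y"
            using b FF[of y x] by (simp add: I_def closed_segment_eq_real_ivl flip: x_def y_def)
          then show ?thesis
            using b False unfolding ct by (simp add: algebra_simps abs_minus_commute flip: x_def y_def)
        qed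
      qed
      ultimately have "\<eta> * (\<Sum>z\<in>C'. measure lborel (I z)) < e * \<eta>"
        by (simp flip: sum_distrib_left)
      then have 1: "(\<Sum>z\<in>C'. measure lborel (I z)) \<le> e"
        using \<eta> by (simp add: mult.commute)
      have "measure lebesgue (\<Union>i\<in>C'. cball (c i) (r i)) \<le> (\<Sum>i\<in>C'. measure lebesgue (cball (c i) (r i)))"
        using C' by (intro measure_UNION_le) auto
      also have "\<dots> = (\<Sum>z\<in>C'. measure lborel (I z))"
        by (simp add: cb I_def)
      finally show ?thesis using 1 by simp
    qed
    have meas: "(\<Union>i\<in>C. cball (c i) (r i)) \<in> lmeasurable" "measure lebesgue (\<Union>i\<in>C. cball (c i) (r i)) \<le> e"
      using fmeasurable_UN_bound[OF C(1) _ fin] measure_UN_bound[OF C(1) _ fin] by simp_all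
    \<comment> \<open>The null set missed by the segments is added, so that T contains all of
      \<open>E \<eta>\<close>.\<close>
    define T where "T = (\<Union>i\<in>C. cball (c i) (r i)) \<union> (E \<eta> - (\<Union>i\<in>C. cball (c i) (r i)))"
    have "negligible ((T - (\<Union>i\<in>C. cball (c i) (r i))) \<union> ((\<Union>i\<in>C. cball (c i) (r i)) - T))"
      by (rule negligible_subset[OF C(4)]) (auto simp: T_def)
    then have "T \<in> lmeasurable" "measure lebesgue T \<le> e"
      using lmeasurable_negligible_symdiff[OF meas(1), of T] measure_negligible_symdiff[OF meas(1), of T] meas(2)
      by (simp_all add: Un_commute)
    moreover have "E \<eta> \<subseteq> T"
      by (auto simp: T_def)
    ultimately show "\<exists>T. E \<eta> \<subseteq> T \<and> T \<in> lmeasurable \<and> measure lebesgue T \<le> e"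
      by blast
  qed
  define N where "N = (\<Union>n::nat. E (1 / Suc n))"
  have "negligible N"
    unfolding N_def by (intro negligible_Union_nat neg) auto
  moreover have "(F has_vector_derivative f t) (at t within {a..b})" if t: "t \<in> {a..b} - N" for t
    unfolding has_vector_derivative_def has_derivative_within_alt
  proof (intro conjI allI impI)
    show "bounded_linear (\<lambda>x. x *\<^sub>R f t)"
      by (rule bounded_linear_scaleR_left)
    fix e :: real assume "e > 0"
    then obtain n :: nat where n: "1 / Suc n < e"
      using nat_approx_posE by blast
    have "t \<notin> E (1 / Suc n)"
      using t by (auto simp: N_def)
    then obtain d where d: "d > 0" "\<And>y. \<bar>y - t\<bar> < d \<Longrightarrow> \<not> bad (1 / Suc n) t y"
      unfolding E_def by blast
    show "\<exists>d>0. \<forall>y\<in>{a..b}. norm (y - t) < d \<longrightarrow> norm (F y - F t - (y - t) *\<^sub>R f t) \<le> e * norm (y - t)"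
    proof (intro exI[of _ d] conjI ballI impI d(1))
      fix y assume y: "y \<in> {a..b}" "norm (y - t) < d"
      have "\<bar>F y - F t - f t * (y - t)\<bar> \<le> (1 / Suc n) * \<bar>y - t\<bar>"
        using d(2)[of y] y t by (cases "y = t") (auto simp: bad_def)
      also have "\<dots> \<le> e * \<bar>y - t\<bar>"
        using n by (intro mult_right_mono) auto
      finally show "norm (F y - F t - (y - t) *\<^sub>R f t) \<le> e * norm (y - t)"
        by (simp add: mult.commute)
    qed
  qed
  ultimately show ?thesis
    unfolding F_def by blast
qed

section \<open>Null sets of the interval and primitives of square integrable functions\<close>

lemma AE_leb_iff: "(AE t in leb. P t) \<longleftrightarrow> (\<exists>N. negligible N \<and> (\<forall>t\<in>{0..2*pi} - N. P t))"
proof -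
  have "(AE t in leb. P t) \<longleftrightarrow> (AE t in lebesgue. t \<in> {0..2*pi} \<longrightarrow> P t)"
    by (rule AE_restrict_space_iff) simp
  also have "\<dots> \<longleftrightarrow> (\<exists>N. negligible N \<and> (\<forall>t\<in>{0..2*pi} - N. P t))"
    unfolding eventually_ae_filter negligible_iff_null_sets
  proof safe
    fix N assume N: "N \<in> null_sets lebesgue" "{x \<in> space lebesgue. \<not> (x \<in> {0..2*pi} \<longrightarrow> P x)} \<subseteq> N"
    then show "\<exists>N. N \<in> null_sets lebesgue \<and> (\<forall>t\<in>{0..2*pi} - N. P t)"
      by (intro exI[of _ N]) auto
  next
    fix N assume N: "N \<in> null_sets lebesgue" "\<forall>t\<in>{0..2*pi} - N. P t"
    then show "\<exists>N\<in>null_sets lebesgue. {x \<in> space lebesgue. \<not> (x \<in> {0..2*pi} \<longrightarrow> P x)} \<subseteq> N"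
      by (intro bexI[of _ N]) auto
  qed
  finally show ?thesis .
qed

lemma square_integrable_integrable:
  assumes "square_integrable f"
  shows "integrable leb f" "f integrable_on {0..2*pi}" "(\<lambda>t. (f t)\<^sup>2) integrable_on {0..2*pi}"
    "integral\<^sup>L leb f = integral {0..2*pi} f"
proof -
  have "square_integrable (\<lambda>_. 1)"
    by (simp add: square_integrable_def)
  from square_integrable_mult[OF assms this] show i: "integrable leb f"
    by simp
  then show "f integrable_on {0..2*pi}"
    by (simp add: integrable_on_lebesgue_on)
  show "(\<lambda>t. (f t)\<^sup>2) integrable_on {0..2*pi}"
    using assms by (intro integrable_on_lebesgue_on) (auto simp: square_integrable_def)
  show "integral\<^sup>L leb f = integral {0..2*pi} f"
    by (rule lebesgue_integral_eq_integral[OF i]) simp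
qed

definition primitive_of :: "(real \<Rightarrow> real) \<Rightarrow> (real \<Rightarrow> real) \<Rightarrow> bool" where
  "primitive_of g M \<longleftrightarrow> square_integrable g \<and> (\<forall>t\<in>{0..2*pi}. M t = M 0 + integral {0..t} g)"

text \<open>An indefinite integral is absolutely continuous with derivative g almost everywhere, and
  the difference of M and the integral has derivative 0 off a null set. Later rules are proved in
  whichever of the two forms, integral equation or Caratheodory, is easier.\<close>

lemma primitive_of_iff:
  "primitive_of g M \<longleftrightarrow> square_integrable g \<and> absolutely_continuous_on_interval 0 (2*pi) M \<and>
     (AE t in leb. (M has_vector_derivative g t) (at t within {0..2*pi}))"
proof (cases "square_integrable g")
  case True
  note g = square_integrable_integrable[OF True]
  define F where "F = (\<lambda>t. integral {0..t} g)"
  have F: "absolutely_continuous_on_interval 0 (2*pi) F"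
    unfolding F_def by (rule absolutely_continuous_integral[OF g(2,3)])
  obtain N where N: "negligible N" "\<And>t. t \<in> {0..2*pi} - N \<Longrightarrow> (F has_vector_derivative g t) (at t within {0..2*pi})"
    using integral_differentiable_ae[OF g(2)] unfolding F_def by blast
  show ?thesis
  proof
    assume "primitive_of g M"
    then have M: "\<And>t. t \<in> {0..2*pi} \<Longrightarrow> M t = M 0 + F t"
      unfolding primitive_of_def F_def by blast
    have "absolutely_continuous_on_interval 0 (2*pi) M"
    proof (rule absolutely_continuous_bound[OF F F, where C = 1])
      fix u v :: real assume "u \<in> {0..2*pi}" "v \<in> {0..2*pi}"
      then have "M v - M u = F v - F u"
        using M[of u] M[of v] by linarith
      then show "norm (M v - M u) \<le> 1 * (norm (F v - F u) + norm (F v - F u))"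
        by simp
    qed
    moreover have "(M has_vector_derivative g t) (at t within {0..2*pi})" if "t \<in> {0..2*pi} - N" for t
    proof (rule has_vector_derivative_transform[where g = M and f = "\<lambda>t. M 0 + F t"])
      show "((\<lambda>t. M 0 + F t) has_vector_derivative g t) (at t within {0..2*pi})"
        using N(2)[OF that] by (auto intro!: derivative_eq_intros)
    qed (use M that in blast)+
    ultimately show "square_integrable g \<and> absolutely_continuous_on_interval 0 (2*pi) M \<and>
     (AE t in leb. (M has_vector_derivative g t) (at t within {0..2*pi}))"
      using True negligible_subset[OF N(1) order_refl] by (auto simp: AE_leb_iff intro!: exI[of _ N])
  next
    assume "square_integrable g \<and> absolutely_continuous_on_interval 0 (2*pi) M \<and>
     (AE t in leb. (M has_vector_derivative g t) (at t within {0..2*pi}))"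
    then obtain N' where M: "absolutely_continuous_on_interval 0 (2*pi) M"
      and N': "negligible N'" "\<And>t. t \<in> {0..2*pi} - N' \<Longrightarrow> (M has_vector_derivative g t) (at t within {0..2*pi})"
      by (auto simp: AE_leb_iff)
    define D where "D = (\<lambda>t. M t - F t)"
    have D: "absolutely_continuous_on_interval 0 (2*pi) D"
    proof (rule absolutely_continuous_bound[OF M F, where C = 1])
      show "norm (D v - D u) \<le> 1 * (norm (M v - M u) + norm (F v - F u))" for u v
        using abs_triangle_ineq4[of "M v - M u" "F v - F u"] by (simp add: D_def algebra_simps)
    qed
    have D': "(D has_vector_derivative 0) (at t within {0..2*pi})" if "t \<in> {0..2*pi} - (N \<union> N')" for t
      using has_vector_derivative_diff[OF N'(2)[of t] N(2)[of t]] that unfolding D_def by simp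
    have "D t = D 0" if t: "t \<in> {0..2*pi}" for t
    proof (rule absolutely_continuous_zero_derivative[where N = "N \<union> N'" and f = D and a = 0 and b = t])
      show "negligible (N \<union> N')" using N(1) N'(1) by (rule negligible_Un)
      show "absolutely_continuous_on_interval 0 t D"
        using t by (intro absolutely_continuous_subinterval[OF D]) auto
      show "(D has_vector_derivative 0) (at s within {0..t})" if "s \<in> {0..t} - (N \<union> N')" for s
        using t that by (intro has_vector_derivative_within_subset[OF D']) auto
    qed (use t in auto)
    moreover have "F 0 = 0"
      by (simp add: F_def)
    ultimately have "M t = M 0 + F t" if "t \<in> {0..2*pi}" for t
      using that unfolding D_def by fastforce
    then show "primitive_of g M"
      using True unfolding primitive_of_def F_def by blast
  qed
qed (auto simp: primitive_of_def)

subsection \<open>The Hilbert space \<open>H0\<close>\<close>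

lemma square_integrable_bounded:
  assumes f: "f \<in> borel_measurable leb" and B: "\<And>t. t \<in> {0..2*pi} \<Longrightarrow> \<bar>f t\<bar> \<le> B"
  shows "square_integrable f"
proof -
  interpret finite_measure leb
    by (rule finite_measure_lebesgue_on) simp
  have "\<bar>f t\<bar>\<^sup>2 \<le> B\<^sup>2" if "t \<in> {0..2*pi}" for t
    using B[OF that] by (rule power_mono) simp
  then have "integrable leb (\<lambda>t. (f t)\<^sup>2)"
    using f by (intro integrable_const_bound[of _ "B\<^sup>2"] AE_I2) auto
  with f show ?thesis
    by (simp add: square_integrable_def)
qed

lemma square_integrable_indicator:
  "A \<in> sets lebesgue \<Longrightarrow> square_integrable (indicator A)"
  by (rule square_integrable_bounded[where B = 1])
    (auto simp: indicator_def measurable_restrict_space1 intro!: borel_measurable_indicator[THEN measurable_restrict_space1, unfolded indicator_def])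

lemma L2_eq_rep: "L2_eq (rep_H0 x) (rep_H0 x)"
  using Quotient_rep_reflp[OF Quotient_H0] .

lemma square_integrable_rep [simp]: "square_integrable (rep_H0 x)"
  using L2_eq_rep by (simp add: L2_eq_def)

lemma abs_rep_H0 [simp]: "abs_H0 (rep_H0 x) = x"
  using Quotient_abs_rep[OF Quotient_H0] .

lemma rep_abs_H0: "square_integrable f \<Longrightarrow> AE t in leb. rep_H0 (abs_H0 f) t = f t"
  using Quotient_rep_abs[OF Quotient_H0, of f] by (simp add: L2_eq_def)

lemma abs_H0_eqI: "square_integrable f \<Longrightarrow> square_integrable g \<Longrightarrow> AE t in leb. f t = g t \<Longrightarrow> abs_H0 f = abs_H0 g"
  using Quotient_rel_abs[OF Quotient_H0, of f g] by (simp add: L2_eq_def)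

lemma H0_eqI: "AE t in leb. rep_H0 x t = rep_H0 y t \<Longrightarrow> x = y"
  using abs_H0_eqI[of "rep_H0 x" "rep_H0 y"] by simp

lemma rep_H0_add: "AE t in leb. rep_H0 (x + y) t = rep_H0 x t + rep_H0 y t"
proof -
  have "x + y = abs_H0 (\<lambda>t. rep_H0 x t + rep_H0 y t)"
    using plus_H0.abs_eq[of "rep_H0 x" "rep_H0 y"] L2_eq_rep by simp
  then show ?thesis
    using rep_abs_H0[OF square_integrable_add, of "rep_H0 x" "rep_H0 y"] by simp
qed

lemma rep_H0_scaleR: "AE t in leb. rep_H0 (c *\<^sub>R x) t = c * rep_H0 x t"
proof -
  have "c *\<^sub>R x = abs_H0 (\<lambda>t. c * rep_H0 x t)"
    using scaleR_H0.abs_eq[of "rep_H0 x" c] L2_eq_rep by simp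
  then show ?thesis
    using rep_abs_H0[OF square_integrable_scale, of "rep_H0 x" c] by simp
qed

lemma rep_H0_diff: "AE t in leb. rep_H0 (x - y) t = rep_H0 x t - rep_H0 y t"
proof -
  have "AE t in leb. rep_H0 (x + (-1) *\<^sub>R y) t = rep_H0 x t - rep_H0 y t"
    using rep_H0_add[of x "(-1) *\<^sub>R y"] rep_H0_scaleR[of "-1" y] by eventually_elim simp
  then show ?thesis by simp
qed

lemma inner_H0_rep: "inner x y = (\<integral>t. rep_H0 x t * rep_H0 y t \<partial>leb)"
  using inner_H0.abs_eq[OF L2_eq_rep L2_eq_rep, of x y] by simp

lemma inner_abs_H0: "square_integrable f \<Longrightarrow> square_integrable g \<Longrightarrow> inner (abs_H0 f) (abs_H0 g) = (\<integral>t. f t * g t \<partial>leb)"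
  by (rule inner_H0.abs_eq) (simp_all add: L2_eq_def)

lemma norm_H0_rep: "(norm x)\<^sup>2 = (\<integral>t. (rep_H0 x t)\<^sup>2 \<partial>leb)"
  by (simp add: power2_norm_eq_inner inner_H0_rep flip: power2_eq_square)

lemma nn_integral_rep_H0: "(\<integral>\<^sup>+t. ennreal ((rep_H0 x t)\<^sup>2) \<partial>leb) = ennreal ((norm x)\<^sup>2)"
  using square_integrable_rep[of x] unfolding norm_H0_rep square_integrable_def
  by (intro nn_integral_eq_integral) auto

lemma rep_H0_measurable [measurable]: "rep_H0 x \<in> borel_measurable leb"
  using square_integrable_rep[of x] by (simp add: square_integrable_def)

lemma integral_abs_rep_H0_le: "(\<integral>t. \<bar>rep_H0 x t\<bar> \<partial>leb) \<le> sqrt (2 * pi) * norm x"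
proof -
  have sq: "square_integrable (\<lambda>t. \<bar>rep_H0 x t\<bar>)" "square_integrable (\<lambda>_. 1)"
    using square_integrable_rep[of x] by (auto simp: square_integrable_def)
  have "(\<integral>t. \<bar>rep_H0 x t\<bar> \<partial>leb) = inner (abs_H0 (\<lambda>t. \<bar>rep_H0 x t\<bar>)) (abs_H0 (\<lambda>_. 1))"
    by (simp add: inner_abs_H0[OF sq])
  also have "\<dots> \<le> norm (abs_H0 (\<lambda>t. \<bar>rep_H0 x t\<bar>)) * norm (abs_H0 (\<lambda>_. 1))"
    by (rule norm_cauchy_schwarz)
  also have "norm (abs_H0 (\<lambda>t. \<bar>rep_H0 x t\<bar>)) = norm x"
    unfolding norm_eq_sqrt_inner inner_abs_H0[OF sq(1) sq(1)] inner_H0_rep[of x x] by simp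
  also have "norm (abs_H0 (\<lambda>_. 1)) = sqrt (2 * pi)"
    by (simp add: norm_eq_sqrt_inner inner_abs_H0[OF sq(2) sq(2)] measure_restrict_space)
  finally show ?thesis
    by (simp add: mult.commute)
qed

text \<open>Riesz-Fischer: a subsequence with geometrically small steps converges almost everywhere,
  since its steps are summable in the mean; Fatou's lemma then bounds the distance of the pointwise
  limit from each member of the subsequence.\<close>

lemma H0_Cauchy_convergent:
  fixes X :: "nat \<Rightarrow> H0"
  assumes "Cauchy X"
  shows "convergent X"
proof -
  have "\<exists>N. \<forall>m\<ge>N. \<forall>k\<ge>N. norm (X m - X k) < (1/2) ^ n" for n :: nat
    using CauchyD[OF assms, of "(1/2) ^ n"] by simp
  then obtain N where N: "\<And>n m k. m \<ge> N n \<Longrightarrow> k \<ge> N n \<Longrightarrow> norm (X m - X k) < (1/2) ^ n"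
    by metis
  \<comment> \<open>The sum is at least each of \<open>N 0\<close> up to \<open>N n\<close>, so the
    index \<open>r n\<close> meets all tolerances up to the n-th.\<close>
  define r where "r = (\<lambda>n. sum N {..n})"
  have r: "N n \<le> r m" if "n \<le> m" for n m
    unfolding r_def using that by (intro member_le_sum) auto
  define g where "g = (\<lambda>n. rep_H0 (X (r n)))"
  have [measurable]: "g n \<in> borel_measurable leb" for n
    by (simp add: g_def)
  define D where "D = (\<lambda>n. X (r (Suc n)) - X (r n))"
  have D: "norm (D n) < (1/2) ^ n" for n
    unfolding D_def by (intro N r) auto
  have conv: "AE t in leb. convergent (\<lambda>n. g n t)"
  proof -
    have "(\<integral>\<^sup>+t. ennreal \<bar>rep_H0 (D n) t\<bar> \<partial>leb) \<le> ennreal (sqrt (2 * pi) * (1/2) ^ n)" for n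
    proof -
      have "(\<integral>\<^sup>+t. ennreal \<bar>rep_H0 (D n) t\<bar> \<partial>leb) = ennreal (\<integral>t. \<bar>rep_H0 (D n) t\<bar> \<partial>leb)"
        using square_integrable_integrable(1)[OF square_integrable_rep[of "D n"]]
        by (intro nn_integral_eq_integral) auto
      also have "\<dots> \<le> ennreal (sqrt (2 * pi) * (1/2) ^ n)"
        using D[of n] by (intro ennreal_leI order_trans[OF integral_abs_rep_H0_le] mult_left_mono) auto
      finally show ?thesis .
    qed
    then have "(\<Sum>n. \<integral>\<^sup>+t. ennreal \<bar>rep_H0 (D n) t\<bar> \<partial>leb) \<le> (\<Sum>n. ennreal (sqrt (2 * pi) * (1/2) ^ n))"
      by (intro suminf_le) auto
    also have "\<dots> = ennreal (\<Sum>n. sqrt (2 * pi) * (1/2) ^ n)"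
      by (rule suminf_ennreal2) (auto intro: summable_mult summable_geometric)
    also have "\<dots> < \<infinity>" by simp
    finally have "(\<integral>\<^sup>+t. (\<Sum>n. ennreal \<bar>rep_H0 (D n) t\<bar>) \<partial>leb) \<noteq> \<infinity>"
      by (subst nn_integral_suminf) auto
    then have "AE t in leb. (\<Sum>n. ennreal \<bar>rep_H0 (D n) t\<bar>) \<noteq> \<infinity>"
      by (intro nn_integral_noteq_infinite) auto
    moreover have "AE t in leb. \<forall>n. rep_H0 (D n) t = g (Suc n) t - g n t"
      unfolding AE_all_countable D_def g_def by (intro allI rep_H0_diff)
    ultimately show ?thesis
    proof eventually_elim
      case (elim t)
      have "summable (\<lambda>n. \<bar>rep_H0 (D n) t\<bar>)"
        using elim(1) by (intro summable_suminf_not_top) auto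
      then have "summable (\<lambda>n. rep_H0 (D n) t)"
        by (rule summable_rabs_cancel)
      then have "summable (\<lambda>n. g (Suc n) t - g n t)"
        using elim(2) by (metis (mono_tags, lifting) summable_cong eventuallyI)
      then have "convergent (\<lambda>n. \<Sum>i<n. g (Suc i) t - g i t)"
        by (simp add: summable_iff_convergent)
      then have "convergent (\<lambda>n. g n t - g 0 t)"
        unfolding sum_lessThan_telescope[of "\<lambda>n. g n t"] .
      then show "convergent (\<lambda>n. g n t)"
        by (simp add: convergent_diff_const_right_iff)
    qed
  qed
  define G where "G = (\<lambda>t. lim (\<lambda>n. g n t))"
  have [measurable]: "G \<in> borel_measurable leb"
    unfolding G_def by measurable
  have lim: "AE t in leb. (\<lambda>n. g n t) \<longlonglongrightarrow> G t"
    using conv by eventually_elim (simp add: G_def convergent_LIMSEQ_iff)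
  have fatou: "(\<integral>\<^sup>+t. ennreal ((G t - g n t)\<^sup>2) \<partial>leb) \<le> ennreal (((1/2) ^ n)\<^sup>2)" for n
  proof -
    have "(\<integral>\<^sup>+t. ennreal ((G t - g n t)\<^sup>2) \<partial>leb) = (\<integral>\<^sup>+t. liminf (\<lambda>m. ennreal ((g m t - g n t)\<^sup>2)) \<partial>leb)"
    proof (rule nn_integral_cong_AE)
      show "AE t in leb. ennreal ((G t - g n t)\<^sup>2) = liminf (\<lambda>m. ennreal ((g m t - g n t)\<^sup>2))"
        using lim
      proof eventually_elim
        case (elim t)
        then have "(\<lambda>m. ennreal ((g m t - g n t)\<^sup>2)) \<longlonglongrightarrow> ennreal ((G t - g n t)\<^sup>2)"
          by (intro tendsto_intros) auto
        then show ?case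
          by (rule lim_imp_Liminf[OF sequentially_bot, symmetric])
      qed
    qed
    also have "\<dots> \<le> liminf (\<lambda>m. \<integral>\<^sup>+t. ennreal ((g m t - g n t)\<^sup>2) \<partial>leb)"
      by (rule nn_integral_liminf) auto
    also have "\<dots> \<le> liminf (\<lambda>m. ennreal (((1/2) ^ n)\<^sup>2))"
    proof (rule Liminf_mono)
      show "\<forall>\<^sub>F m in sequentially. (\<integral>\<^sup>+t. ennreal ((g m t - g n t)\<^sup>2) \<partial>leb) \<le> ennreal (((1/2) ^ n)\<^sup>2)"
        using eventually_ge_at_top[of n]
      proof eventually_elim
        case (elim m)
        have "(\<integral>\<^sup>+t. ennreal ((g m t - g n t)\<^sup>2) \<partial>leb) = (\<integral>\<^sup>+t. ennreal ((rep_H0 (X (r m) - X (r n)) t)\<^sup>2) \<partial>leb)"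
          using rep_H0_diff[of "X (r m)" "X (r n)"] by (intro nn_integral_cong_AE) (auto simp: g_def elim: eventually_mono)
        also have "\<dots> = ennreal ((norm (X (r m) - X (r n)))\<^sup>2)"
          by (rule nn_integral_rep_H0)
        also have "\<dots> \<le> ennreal (((1/2) ^ n)\<^sup>2)"
          using N[of n "r m" "r n"] r elim by (intro ennreal_leI power_mono) (auto simp: less_imp_le)
        finally show ?case .
      qed
    qed
    finally show ?thesis
      by (simp add: Liminf_const)
  qed
  have sqd: "square_integrable (\<lambda>t. G t - g n t)" for n
    unfolding square_integrable_def
  proof (intro conjI)
    have "(\<integral>\<^sup>+t. ennreal ((G t - g n t)\<^sup>2) \<partial>leb) < \<infinity>"
      using fatou[of n] by (metis ennreal_less_top infinity_ennreal_def le_less_trans)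
    then show "integrable leb (\<lambda>t. (G t - g n t)\<^sup>2)"
      by (intro integrableI_nonneg) auto
  qed measurable
  have sqG: "square_integrable G"
    using square_integrable_add[OF sqd[of 0] square_integrable_rep[of "X (r 0)"]] by (simp add: g_def)
  have close: "norm (abs_H0 G - X (r n)) \<le> (1/2) ^ n" for n
  proof -
    have "AE t in leb. rep_H0 (abs_H0 G - X (r n)) t = G t - g n t"
      using rep_H0_diff[of "abs_H0 G" "X (r n)"] rep_abs_H0[OF sqG] by eventually_elim (simp add: g_def)
    then have "(\<integral>\<^sup>+t. ennreal ((rep_H0 (abs_H0 G - X (r n)) t)\<^sup>2) \<partial>leb) = (\<integral>\<^sup>+t. ennreal ((G t - g n t)\<^sup>2) \<partial>leb)"
      by (intro nn_integral_cong_AE) (auto elim: eventually_mono)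
    then have "ennreal ((norm (abs_H0 G - X (r n)))\<^sup>2) \<le> ennreal (((1/2) ^ n)\<^sup>2)"
      using fatou[of n] by (simp add: nn_integral_rep_H0)
    then have "(norm (abs_H0 G - X (r n)))\<^sup>2 \<le> ((1/2) ^ n)\<^sup>2"
      by (subst (asm) ennreal_le_iff) auto
    then show ?thesis
      by (rule power2_le_imp_le) simp
  qed
  have "X \<longlonglongrightarrow> abs_H0 G"
  proof (rule LIMSEQ_I)
    fix e :: real assume "e > 0"
    then obtain n where n: "(1/2) ^ n < e / 2"
      using real_arch_pow_inv[of "e / 2" "1/2"] by auto
    have "norm (X k - abs_H0 G) < e" if "k \<ge> N n" for k
    proof -
      have "norm (X k - abs_H0 G) \<le> norm (X k - X (r n)) + norm (abs_H0 G - X (r n))"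
        using norm_triangle_ineq4[of "X k - X (r n)" "abs_H0 G - X (r n)"] by simp
      also have "\<dots> < (1/2) ^ n + (1/2) ^ n"
        using N[of n k "r n"] that r[of n n] close[of n] by (intro add_less_le_mono) auto
      finally show ?thesis
        using n by simp
    qed
    then show "\<exists>no. \<forall>k\<ge>no. norm (X k - abs_H0 G) < e"
      by blast
  qed
  then show ?thesis
    by (auto simp: convergent_def)
qed

instance H0 :: complete_space
  by standard (rule H0_Cauchy_convergent)

subsection \<open>Orthonormal families\<close>

definition orthonormal :: "'a::real_inner set \<Rightarrow> bool" where
  "orthonormal B \<longleftrightarrow> (\<forall>x\<in>B. norm x = 1) \<and> (\<forall>x\<in>B. \<forall>y\<in>B. x \<noteq> y \<longrightarrow> inner x y = 0)"

text \<open>By Zorn's lemma; a nonzero vector orthogonal to a maximal family could be normalized and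
  added. That only 0 is orthogonal to the family is the form in which a basis is used below.\<close>

lemma orthonormal_extend_maximal:
  fixes E :: "'a::real_inner set"
  assumes "orthonormal E"
  obtains M where "E \<subseteq> M" "orthonormal M" "\<And>x. (\<And>m. m \<in> M \<Longrightarrow> inner x m = 0) \<Longrightarrow> x = 0"
proof -
  let ?A = "{M. E \<subseteq> M \<and> orthonormal M}"
  have "\<exists>M\<in>?A. \<forall>X\<in>?A. M \<subseteq> X \<longrightarrow> X = M"
  proof (rule subset_Zorn_nonempty)
    show "?A \<noteq> {}" using assms by blast
    fix C assume "C \<noteq> {}" and C: "subset.chain ?A C"
    have "orthonormal (\<Union>C)"
      unfolding orthonormal_def
    proof (intro conjI ballI impI)
      fix x assume "x \<in> \<Union>C"
      then show "norm x = 1"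
        using C by (auto simp: subset_chain_def orthonormal_def)
    next
      fix x y assume "x \<in> \<Union>C" "y \<in> \<Union>C" and ne: "x \<noteq> y"
      then obtain S T where "x \<in> S" "S \<in> C" "y \<in> T" "T \<in> C" by blast
      moreover have "S \<subseteq> T \<or> T \<subseteq> S"
        using C \<open>S \<in> C\<close> \<open>T \<in> C\<close> by (auto simp: subset_chain_def)
      ultimately obtain R where "x \<in> R" "y \<in> R" "R \<in> C" by blast
      then show "inner x y = 0"
        using C ne by (auto simp: subset_chain_def orthonormal_def)
    qed
    moreover obtain T where "T \<in> C"
      using \<open>C \<noteq> {}\<close> by blast
    moreover have "E \<subseteq> T"
      using C \<open>T \<in> C\<close> by (auto simp: subset_chain_def)
    ultimately show "\<Union>C \<in> ?A"
      by blast
  qed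
  then obtain M where M0: "M \<in> ?A" "\<forall>X\<in>?A. M \<subseteq> X \<longrightarrow> X = M"
    by blast
  then have M: "E \<subseteq> M" "orthonormal M" "\<And>X. E \<subseteq> X \<Longrightarrow> orthonormal X \<Longrightarrow> M \<subseteq> X \<Longrightarrow> X = M"
    by auto
  show ?thesis
  proof (rule that[OF M(1,2)])
    fix x :: 'a assume x: "\<And>m. m \<in> M \<Longrightarrow> inner x m = 0"
    show "x = 0"
    proof (rule ccontr)
      assume "x \<noteq> 0"
      define y where "y = x /\<^sub>R norm x"
      have y: "norm y = 1" "\<And>m. m \<in> M \<Longrightarrow> inner y m = 0" "\<And>m. m \<in> M \<Longrightarrow> inner m y = 0"
        using x \<open>x \<noteq> 0\<close> by (auto simp: y_def inner_commute)
      then have "orthonormal (insert y M)"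
        using M(2) by (auto simp: orthonormal_def)
      then have "insert y M = M"
        using M(1) by (intro M(3)) auto
      then have "inner y y = 0"
        using y(2) by blast
      then show False
        using y(1) by simp
    qed
  qed
qed

lemma orthonormal_finite_expansion:
  fixes M :: "'a::real_inner set"
  assumes M: "orthonormal M" "finite F" "F \<subseteq> M" "m \<in> F"
  shows "inner (x - (\<Sum>f\<in>F. inner x f *\<^sub>R f)) m = 0"
proof -
  have "(\<Sum>f\<in>F. inner x f * inner f m) = (\<Sum>f\<in>F. if f = m then inner x m else 0)"
    using M by (intro sum.cong) (auto simp: orthonormal_def subset_iff dot_square_norm)
  also have "\<dots> = inner x m"
    using M by simp
  finally show ?thesis
    by (simp add: inner_diff_left inner_sum_left)
qed

text \<open>If M were finite, subtracting the Fourier expansion from any vector would leave a vector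
  orthogonal to M, hence 0, and M would span the space.\<close>

lemma orthonormal_infinite:
  fixes M :: "'a::real_inner set"
  assumes M: "orthonormal M" "\<And>x. (\<And>m. m \<in> M \<Longrightarrow> inner x m = 0) \<Longrightarrow> x = 0"
    and inf: "\<not> (\<exists>B::'a set. finite B \<and> span B = UNIV)"
  shows "infinite M"
proof
  assume fin: "finite M"
  have "x \<in> span M" for x
  proof -
    have "x - (\<Sum>f\<in>M. inner x f *\<^sub>R f) = 0"
      by (rule M(2)) (rule orthonormal_finite_expansion[OF M(1) fin order_refl])
    then have "x = (\<Sum>f\<in>M. inner x f *\<^sub>R f)" by simp
    also have "\<dots> \<in> span M"
      by (intro span_sum span_scale span_base)
    finally show ?thesis .
  qed
  then have "span M = UNIV" by blast
  then show False
    using inf fin by blast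
qed

lemma orthonormal_bessel:
  fixes M :: "'a::real_inner set"
  assumes M: "orthonormal M" "finite F" "F \<subseteq> M"
  shows "(\<Sum>f\<in>F. (inner x f)\<^sup>2) \<le> (norm x)\<^sup>2"
proof -
  define y where "y = (\<Sum>f\<in>F. inner x f *\<^sub>R f)"
  have "inner (x - y) y = 0"
    unfolding y_def inner_sum_right
    using orthonormal_finite_expansion[OF M] by (intro sum.neutral) auto
  then have "inner x y = inner y y"
    by (simp add: inner_diff_left)
  moreover have "inner x y = (\<Sum>f\<in>F. (inner x f)\<^sup>2)"
    by (simp add: y_def inner_sum_right power2_eq_square)
  moreover have "0 \<le> inner (x - y) (x - y)" by simp
  moreover have "inner (x - y) (x - y) = inner x x - 2 * inner x y + inner y y"
    by (simp add: inner_diff_left inner_diff_right inner_commute)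
  ultimately show ?thesis
    by (simp add: power2_norm_eq_inner)
qed

text \<open>Bessel's inequality allows, for each n, only finitely many coefficients above
  \<open>1 / Suc n\<close> in modulus.\<close>

lemma orthonormal_countable_nonzero:
  fixes M :: "'a::real_inner set"
  assumes M: "orthonormal M"
  shows "countable {m \<in> M. inner x m \<noteq> 0}"
proof -
  have fin: "finite {m \<in> M. \<bar>inner x m\<bar> > 1 / Suc n}" (is "finite ?S") for n
  proof (rule ccontr)
    assume "infinite ?S"
    obtain k :: nat where k: "(norm x)\<^sup>2 < real k * (1 / Suc n)\<^sup>2"
    proof -
      have "(1 / real (Suc n))\<^sup>2 > 0" by simp
      then show ?thesis
        using reals_Archimedean3[of "(1 / real (Suc n))\<^sup>2"] that by (auto simp: mult.commute)
    qed
    obtain F where F: "finite F" "card F = k" "F \<subseteq> ?S"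
      using infinite_arbitrarily_large[OF \<open>infinite ?S\<close>] by metis
    have "real k * (1 / Suc n)\<^sup>2 = (\<Sum>f\<in>F. (1 / Suc n)\<^sup>2)"
      using F by simp
    also have "\<dots> \<le> (\<Sum>f\<in>F. (inner x f)\<^sup>2)"
    proof (rule sum_mono)
      fix f assume "f \<in> F"
      then have "1 / Suc n \<le> \<bar>inner x f\<bar>" using F by force
      then have "(1 / Suc n)\<^sup>2 \<le> \<bar>inner x f\<bar>\<^sup>2"
        by (rule power_mono) simp
      then show "(1 / Suc n)\<^sup>2 \<le> (inner x f)\<^sup>2" by simp
    qed
    also have "\<dots> \<le> (norm x)\<^sup>2"
      using F by (intro orthonormal_bessel[OF M]) auto
    finally show False using k by simp
  qed
  have "{m \<in> M. inner x m \<noteq> 0} \<subseteq> (\<Union>n. {m \<in> M. \<bar>inner x m\<bar> > 1 / Suc n})"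
  proof
    fix m assume m: "m \<in> {m \<in> M. inner x m \<noteq> 0}"
    then obtain n where "1 / Suc n < \<bar>inner x m\<bar>"
      using nat_approx_posE[of "\<bar>inner x m\<bar>"] by auto
    then show "m \<in> (\<Union>n. {m \<in> M. \<bar>inner x m\<bar> > 1 / Suc n})"
      using m by auto
  qed
  then show ?thesis
    using fin by (meson countable_UN countable_finite countable_subset countableI_type)
qed

text \<open>Two members are at distance sqrt 2, so points of a countable dense set chosen within 1/2
  of them are distinct.\<close>

lemma orthonormal_countable_separable:
  fixes M :: "'a::real_inner set"
  assumes M: "orthonormal M" and sep: "separable_space (euclidean :: 'a topology)"
  shows "countable M"
proof -
  obtain C :: "'a set" where C: "countable C" "closure C = UNIV"
    using sep unfolding separable_space_def by auto
  have "\<exists>c\<in>C. dist c m < 1 / 2" for m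
    using C(2) closure_approachable[of m C] by (metis UNIV_I half_gt_zero zero_less_one)
  then obtain f where f: "\<And>m. f m \<in> C" "\<And>m. dist (f m) m < 1 / 2"
    by metis
  have "inj_on f M"
  proof (rule inj_onI, rule ccontr)
    fix x y assume xy: "x \<in> M" "y \<in> M" "f x = f y" "x \<noteq> y"
    have "dist x y < 1"
      using f(2)[of x] f(2)[of y] xy(3) dist_triangle_half_r by (metis dist_triangle_half_l dist_commute)
    then have "(norm (x - y))\<^sup>2 \<le> 1"
      by (simp add: dist_norm power_le_one)
    moreover have "(norm (x - y))\<^sup>2 = 2"
    proof -
      have "inner x y = 0" "inner y x = 0" "inner x x = 1" "inner y y = 1"
        using M xy unfolding orthonormal_def by (auto simp: dot_square_norm)
      then show ?thesis
        by (simp add: power2_norm_eq_inner inner_diff_left inner_diff_right)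
    qed
    ultimately show False by simp
  qed
  then show ?thesis
    using f(1) C(1) by (metis countable_image_inj_on countable_subset image_subsetI)
qed

lemma orthonormal_enumerate:
  fixes M :: "'a::real_inner set"
  assumes M: "orthonormal M" and "countable M" "infinite M"
  obtains b :: "nat \<Rightarrow> 'a" where "range b = M" "\<And>i j. inner (b i) (b j) = (if i = j then 1 else 0)"
proof -
  obtain b :: "nat \<Rightarrow> 'a" where b: "bij_betw b UNIV M"
    using assms bij_betw_from_nat_into by blast
  then have r: "range b = M" "inj b"
    by (auto simp: bij_betw_def)
  then have "inner (b i) (b j) = (if i = j then 1 else 0)" for i j
    using M by (auto simp: orthonormal_def dot_square_norm inj_eq)
  with r(1) show ?thesis by (rule that)
qed

text \<open>Fourier coefficients along one sequence are reused along the other, and completeness of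
  the target makes the series converge. The locale is instantiated in both orders.\<close>

locale orthonormal_pair =
  fixes a :: "nat \<Rightarrow> 'a::real_inner" and b :: "nat \<Rightarrow> 'b::{real_inner, complete_space}"
  assumes a: "inner (a i) (a j) = (if i = j then 1 else 0)"
    and b: "inner (b i) (b j) = (if i = j then 1 else 0)"
begin

lemma norm_sum_b: "finite F \<Longrightarrow> (norm (\<Sum>i\<in>F. c i *\<^sub>R b i))\<^sup>2 = (\<Sum>i\<in>F. (c i)\<^sup>2)"
proof -
  assume F: "finite F"
  have "(norm (\<Sum>i\<in>F. c i *\<^sub>R b i))\<^sup>2 = (\<Sum>i\<in>F. \<Sum>j\<in>F. c i * c j * inner (b i) (b j))"
    unfolding power2_norm_eq_inner inner_sum_left inner_sum_right
    by (subst sum.swap) (simp add: sum_distrib_left mult.assoc mult.left_commute)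
  also have "\<dots> = (\<Sum>i\<in>F. \<Sum>j\<in>F. if i = j then (c i)\<^sup>2 else 0)"
    by (intro sum.cong) (auto simp: b power2_eq_square)
  also have "\<dots> = (\<Sum>i\<in>F. (c i)\<^sup>2)"
    using F by simp
  finally show ?thesis .
qed

lemma bessel: "finite F \<Longrightarrow> (\<Sum>i\<in>F. (inner x (a i))\<^sup>2) \<le> (norm x)\<^sup>2"
proof -
  assume F: "finite F"
  have inj: "inj a"
  proof (rule injI)
    fix i j assume "a i = a j"
    then show "i = j" using a[of i j] a[of i i] by (auto split: if_splits)
  qed
  have "orthonormal (range a)"
    unfolding orthonormal_def using a by (auto simp: norm_eq_sqrt_inner)
  from orthonormal_bessel[OF this finite_imageI[OF F] image_mono[OF subset_UNIV], of x] show ?thesis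
    using inj_on_subset[OF inj subset_UNIV] by (simp add: sum.reindex)
qed

definition partial :: "'a \<Rightarrow> nat \<Rightarrow> 'b" where
  "partial x n = (\<Sum>i<n. inner x (a i) *\<^sub>R b i)"

definition transfer :: "'a \<Rightarrow> 'b" where
  "transfer x = lim (partial x)"

text \<open>The squared distance of two partial sums is a block of the series of squared
  coefficients, which converges by Bessel's inequality.\<close>

lemma partial_tendsto: "partial x \<longlonglongrightarrow> transfer x"
proof -
  have "summable (\<lambda>i. (inner x (a i))\<^sup>2)"
    by (rule bounded_imp_summable[of _ "(norm x)\<^sup>2"]) (auto intro: bessel)
  then have S: "Cauchy (\<lambda>n. \<Sum>i<n. (inner x (a i))\<^sup>2)"
    by (simp add: summable_iff_convergent convergent_Cauchy)
  have "Cauchy (partial x)"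
  proof (rule metric_CauchyI)
    fix e :: real assume e: "e > 0"
    then obtain N where N: "\<And>m n. m \<ge> N \<Longrightarrow> n \<ge> N \<Longrightarrow> dist (\<Sum>i<m. (inner x (a i))\<^sup>2) (\<Sum>i<n. (inner x (a i))\<^sup>2) < e\<^sup>2"
      using metric_CauchyD[OF S, of "e\<^sup>2"] by auto
    have *: "dist (partial x m) (partial x n) < e" if "m \<ge> N" "n \<ge> m" for m n
    proof -
      have split: "(\<Sum>i<n. f i) - (\<Sum>i<m. f i) = (\<Sum>i\<in>{m..<n}. f i)" for f :: "nat \<Rightarrow> 'c::ab_group_add"
        using that sum_diff_nat_ivl[of 0 m n f] by (simp add: atLeast0LessThan)
      have "(dist (partial x m) (partial x n))\<^sup>2 = (norm (\<Sum>i\<in>{m..<n}. inner x (a i) *\<^sub>R b i))\<^sup>2"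
        by (simp add: dist_norm partial_def norm_minus_commute flip: split)
      also have "\<dots> = (\<Sum>i\<in>{m..<n}. (inner x (a i))\<^sup>2)"
        by (simp add: norm_sum_b)
      also have "\<dots> = \<bar>(\<Sum>i\<in>{m..<n}. (inner x (a i))\<^sup>2)\<bar>"
        by (simp add: sum_nonneg)
      also have "\<dots> = dist (\<Sum>i<m. (inner x (a i))\<^sup>2) (\<Sum>i<n. (inner x (a i))\<^sup>2)"
        by (simp add: dist_real_def abs_minus_commute flip: split)
      also have "\<dots> < e\<^sup>2"
        using that by (intro N) auto
      finally show ?thesis
        using e by (simp add: power2_less_imp_less)
    qed
    show "\<exists>M. \<forall>m\<ge>M. \<forall>n\<ge>M. dist (partial x m) (partial x n) < e"
      by (metis * dist_commute nat_le_linear)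
  qed
  then have "convergent (partial x)"
    by (rule Cauchy_convergent)
  then show ?thesis
    by (simp add: transfer_def convergent_LIMSEQ_iff)
qed

lemma transfer_bounded_linear: "bounded_linear transfer"
proof (rule bounded_linear_intro[where K = 1])
  fix x y r
  have "(\<lambda>n. partial x n + partial y n) \<longlonglongrightarrow> transfer x + transfer y"
    by (intro tendsto_add partial_tendsto)
  moreover have "(\<lambda>n. partial x n + partial y n) = partial (x + y)"
    by (auto simp: partial_def inner_add_left scaleR_add_left sum.distrib)
  ultimately show "transfer (x + y) = transfer x + transfer y"
    using LIMSEQ_unique partial_tendsto by metis
  have "(\<lambda>n. r *\<^sub>R partial x n) \<longlonglongrightarrow> r *\<^sub>R transfer x"
    by (intro tendsto_scaleR tendsto_const partial_tendsto)
  moreover have "(\<lambda>n. r *\<^sub>R partial x n) = partial (r *\<^sub>R x)"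
    by (auto simp: partial_def scaleR_right.sum)
  ultimately show "transfer (r *\<^sub>R x) = r *\<^sub>R transfer x"
    using LIMSEQ_unique partial_tendsto by metis
  have "norm (partial x n) \<le> norm x" for n
    by (rule power2_le_imp_le) (simp_all add: partial_def norm_sum_b bessel)
  then show "norm (transfer x) \<le> norm x * 1"
    using tendsto_norm[OF partial_tendsto[of x]] by (simp add: LIMSEQ_le_const2)
qed

lemma inner_transfer: "inner (transfer x) (b j) = inner x (a j)"
proof -
  have "(\<lambda>n. inner (partial x n) (b j)) \<longlonglongrightarrow> inner (transfer x) (b j)"
    by (intro tendsto_inner partial_tendsto tendsto_const)
  moreover have "inner (partial x n) (b j) = inner x (a j)" if "n > j" for n
  proof -
    have "inner (partial x n) (b j) = (\<Sum>i<n. if i = j then inner x (a j) else 0)"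
      unfolding partial_def inner_sum_left by (intro sum.cong) (auto simp: b)
    then show ?thesis using that by simp
  qed
  then have "(\<lambda>n. inner (partial x n) (b j)) \<longlonglongrightarrow> inner x (a j)"
    by (intro tendsto_eventually) (auto simp: eventually_sequentially intro: exI[of _ "Suc j"])
  ultimately show ?thesis
    by (rule LIMSEQ_unique)
qed

lemma inner_transfer_orthogonal:
  assumes "\<And>n. inner (b n) e = 0"
  shows "inner (transfer x) e = 0"
proof -
  have "(\<lambda>n. inner (partial x n) e) \<longlonglongrightarrow> inner (transfer x) e"
    by (intro tendsto_inner partial_tendsto tendsto_const)
  moreover have "inner (partial x n) e = 0" for n
    by (simp add: partial_def inner_sum_left assms)
  ultimately show ?thesis
    by (simp add: LIMSEQ_const_iff)
qed

end

text \<open>Each of the countably many test vectors \<open>v t\<close> with rational t meets only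
  countably many members of M. A member orthogonal to all of them has a primitive that vanishes at
  the rationals of the interval, hence on all of it by continuity, and so is 0 almost
  everywhere.\<close>

lemma H0_orthonormal_countable:
  fixes M :: "H0 set"
  assumes M: "orthonormal M"
  shows "countable M"
proof -
  define v where "v = (\<lambda>t::real. abs_H0 (indicator {0..t}))"
  have sq: "square_integrable (indicator {0..t})" for t :: real
    by (rule square_integrable_indicator) simp
  have iv: "inner m (v t) = integral {0..t} (rep_H0 m)" if t: "t \<in> {0..2*pi}" for m t
  proof -
    have "inner m (v t) = inner (abs_H0 (rep_H0 m)) (v t)" by simp
    also have "\<dots> = (\<integral>s. rep_H0 m s * indicator {0..t} s \<partial>leb)"
      unfolding v_def by (rule inner_abs_H0[OF square_integrable_rep sq])
    also have "\<dots> = integral {0..2*pi} (\<lambda>s. rep_H0 m s * indicator {0..t} s)"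
      by (rule lebesgue_integral_eq_integral[OF square_integrable_mult[OF square_integrable_rep sq]]) simp
    also have "\<dots> = integral {0..2*pi} (\<lambda>s. if s \<in> {0..t} then rep_H0 m s else 0)"
      by (intro Henstock_Kurzweil_Integration.integral_cong) (auto simp: indicator_def)
    also have "\<dots> = integral {0..t} (rep_H0 m)"
    proof -
      have "{0..t} \<inter> {0..2*pi} = {0..t}" using t by auto
      then show ?thesis
        by (simp only: integral_restrict_Int)
    qed
    finally show ?thesis .
  qed
  have "M \<subseteq> (\<Union>t\<in>\<rat>. {m \<in> M. inner (v t) m \<noteq> 0})"
  proof
    fix m assume m: "m \<in> M"
    show "m \<in> (\<Union>t\<in>\<rat>. {m \<in> M. inner (v t) m \<noteq> 0})"
    proof (rule ccontr)
      assume "m \<notin> (\<Union>t\<in>\<rat>. {m \<in> M. inner (v t) m \<noteq> 0})"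
      then have zero: "inner m (v t) = 0" if "t \<in> \<rat>" for t
        using m that by (auto simp: inner_commute)
      define F where "F = (\<lambda>t. integral {0..t} (rep_H0 m))"
      have cont: "continuous_on {0..2*pi} F"
        unfolding F_def by (rule indefinite_integral_continuous_1[OF square_integrable_integrable(2)]) simp
      have "F t = 0" if t: "t \<in> {0..2*pi}" for t
      proof (rule continuous_constant_on_closure[of "{0..2*pi} \<inter> \<rat>" F 0 t])
        have cl: "closure ({0..2*pi} \<inter> \<rat>) = {0..2*pi}"
        proof
          show "closure ({0..2*pi} \<inter> \<rat>) \<subseteq> {0..2*pi}"
            by (rule closure_minimal) auto
          have "closure {0<..<2*pi} \<subseteq> closure ({0<..<2*pi} \<inter> \<rat>)"
            using open_Int_closure_subset[of "{0<..<2*pi}" \<rat>]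
            by (intro closure_minimal) (auto simp: Rats_closure_real)
          also have "\<dots> \<subseteq> closure ({0..2*pi} \<inter> \<rat>)"
            by (rule closure_mono) auto
          finally show "{0..2*pi} \<subseteq> closure ({0..2*pi} \<inter> \<rat>)"
            by simp
        qed
        show "continuous_on (closure ({0..2*pi} \<inter> \<rat>)) F" "t \<in> closure ({0..2*pi} \<inter> \<rat>)"
          using cl cont t by simp_all
        show "F s = 0" if "s \<in> {0..2*pi} \<inter> \<rat>" for s
          using that zero[of s] iv[of s m] by (simp add: F_def)
      qed
      then have "primitive_of (rep_H0 m) (\<lambda>_. 0)"
        unfolding primitive_of_def F_def by simp
      then have "AE t in leb. ((\<lambda>_. 0) has_vector_derivative rep_H0 m t) (at t within {0..2*pi})"
        by (simp add: primitive_of_iff)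
      then obtain N where N: "negligible N" "\<And>t. t \<in> {0..2*pi} - N \<Longrightarrow> ((\<lambda>_. 0) has_vector_derivative rep_H0 m t) (at t within {0..2*pi})"
        unfolding AE_leb_iff by blast
      have "rep_H0 m t = 0" if "t \<in> {0..2*pi} - N" for t
        using vector_derivative_unique_within[OF _ N(2)[OF that] has_vector_derivative_const] that
        by (simp add: trivial_limit_within islimpt_Icc)
      then have "AE t in leb. rep_H0 m t = 0"
        using N(1) unfolding AE_leb_iff by blast
      then have "(norm m)\<^sup>2 = (\<integral>t. 0 \<partial>leb)"
        unfolding norm_H0_rep by (intro integral_cong_AE) (auto elim: eventually_mono)
      then show False
        using m M by (auto simp: orthonormal_def)
    qed
  qed
  moreover have "countable (\<Union>t\<in>\<rat>. {m \<in> M. inner (v t) m \<noteq> 0})"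
    by (intro countable_UN countable_rat orthonormal_countable_nonzero[OF M])
  ultimately show ?thesis
    by (rule countable_subset)
qed

text \<open>Indicators of infinitely many disjoint intervals are orthogonal and nonzero, hence
  independent.\<close>

lemma H0_infinite_dimensional: "\<not> (\<exists>B::H0 set. finite B \<and> span B = UNIV)"
proof
  assume "\<exists>B::H0 set. finite B \<and> span B = UNIV"
  then obtain B :: "H0 set" where B: "finite B" "span B = UNIV" by blast
  \<comment> \<open>Consecutive reciprocals bound disjoint intervals inside [0, 1], which lies in
    [0, 2 pi].\<close>
  define I where "I = (\<lambda>k::nat. {1 / (k + 2)<..<1 / (k + 1) :: real})"
  define v where "v = (\<lambda>k. abs_H0 (indicator (I k)))"
  have I: "I k \<subseteq> {0..2*pi}" for k
  proof -
    have "1 / (real k + 1) \<le> 1" by simp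
    also have "1 \<le> 2 * pi" using pi_gt3 by simp
    finally have "1 / (real k + 1) \<le> 2 * pi" .
    moreover have "0 \<le> 1 / (real k + 2)" by simp
    ultimately show ?thesis
      unfolding I_def greaterThanLessThan_iff atLeastAtMost_iff subset_iff by (meson less_imp_le less_le_trans le_less_trans)
  qed
  have sq: "square_integrable (indicator (I k))" for k
    by (rule square_integrable_indicator) (simp add: I_def)
  have orth: "inner (v i) (v j) = 0" if "i \<noteq> j" for i j
  proof -
    have "I i \<inter> I j = {}"
    proof -
      have *: "I i \<inter> I j = {}" if "i < j" for i j
      proof -
        have "1 / (real j + 1) \<le> 1 / (real i + 2)"
          using that by (intro divide_left_mono) auto
        then show ?thesis by (auto simp: I_def)
      qed
      show ?thesis using *[of i j] *[of j i] that by (cases "i < j") auto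
    qed
    then have "(\<lambda>t. indicator (I i) t * indicator (I j) t :: real) = (\<lambda>t. 0)"
      by (auto simp: indicator_def disjoint_iff)
    then show ?thesis
      unfolding v_def inner_abs_H0[OF sq sq] by simp
  qed
  have nz: "inner (v k) (v k) \<noteq> 0" for k
  proof -
    have "inner (v k) (v k) = (\<integral>t. indicator (I k) t \<partial>leb)"
      unfolding v_def inner_abs_H0[OF sq sq]
      by (intro Bochner_Integration.integral_cong) (auto simp: indicator_def)
    also have "\<dots> = measure leb (I k \<inter> space leb)"
      by simp
    also have "\<dots> = measure lebesgue (I k)"
      using I[of k] by (subst measure_restrict_space) (auto simp: Int_absorb2)
    also have "\<dots> = 1 / (k + 1) - 1 / (k + 2)"
      unfolding I_def by (simp add: frac_le add_ac)
    moreover have "1 / (real k + 2) < 1 / (real k + 1)"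
      by (intro divide_strict_left_mono) auto
    ultimately show ?thesis
      by (simp add: add_ac)
  qed
  have inj: "inj v"
  proof (rule injI)
    fix i j assume "v i = v j"
    then show "i = j" using orth[of i j] nz[of i] by auto
  qed
  have "independent (range v)"
  proof (rule pairwise_orthogonal_independent)
    show "pairwise orthogonal (range v)"
      using orth by (auto simp: pairwise_def orthogonal_def) metis
    show "0 \<notin> range v"
      using nz by (metis imageE inner_zero_left)
  qed
  then have "finite (range v)"
    using independent_span_bound[OF B(1), of "range v"] B(2) by simp
  then show False
    using finite_imageD[OF _ inj] by simp
qed

text \<open>U carries a maximal orthonormal sequence of the given space to an enumeration of M - E,
  where M is a maximal orthonormal family of \<open>H0\<close> that contains E; V carries it back.
  As both families are maximal, U is onto the orthogonal complement of E and V inverts it there,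
  while V kills E.\<close>

proposition Hilbert_space_split:
  fixes E :: "H0 set"
  assumes sep: "separable_space (euclidean :: 'h::{real_inner, complete_space} topology)"
    and inf: "\<not> (\<exists>B :: 'h::{real_inner, complete_space} set. finite B \<and> span B = UNIV)"
    and E: "orthonormal E" "finite E"
  obtains U :: "'h::{real_inner, complete_space} \<Rightarrow> H0" and V where "bounded_linear U" "bounded_linear V" "\<And>h. V (U h) = h"
    "\<And>h e. e \<in> E \<Longrightarrow> inner (U h) e = 0" "\<And>e. e \<in> E \<Longrightarrow> V e = 0"
    "\<And>x. U (V x) = x - (\<Sum>e\<in>E. inner x e *\<^sub>R e)"
proof -
  have "orthonormal ({} :: 'h set)" by (simp add: orthonormal_def)
  then obtain A :: "'h set" where A: "orthonormal A" "\<And>x. (\<And>m. m \<in> A \<Longrightarrow> inner x m = 0) \<Longrightarrow> x = 0"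
    by (rule orthonormal_extend_maximal) blast
  have Ainf: "infinite A"
    by (rule orthonormal_infinite[OF A(1) _ inf]) (rule A(2))
  obtain a :: "nat \<Rightarrow> 'h" where a: "range a = A" "\<And>i j. inner (a i) (a j) = (if i = j then 1 else 0)"
    by (rule orthonormal_enumerate[OF A(1) orthonormal_countable_separable[OF A(1) sep] Ainf]) (rule that)
  obtain M where M: "E \<subseteq> M" "orthonormal M" "\<And>x. (\<And>m. m \<in> M \<Longrightarrow> inner x m = 0) \<Longrightarrow> x = 0"
    using orthonormal_extend_maximal[OF E(1)] by blast
  have inf': "infinite (M - E)"
  proof -
    have "infinite M"
      by (rule orthonormal_infinite[OF M(2) _ H0_infinite_dimensional]) (rule M(3))
    then show ?thesis
      using E(2) by simp
  qed
  have o': "orthonormal (M - E)"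
    using M(2) by (auto simp: orthonormal_def)
  obtain b :: "nat \<Rightarrow> H0" where b: "range b = M - E" "\<And>i j. inner (b i) (b j) = (if i = j then 1 else 0)"
    by (rule orthonormal_enumerate[OF o' H0_orthonormal_countable[OF o'] inf']) (rule that)
  have bE: "inner (b n) e = 0" if "e \<in> E" for n e
  proof -
    have "b n \<in> M - E" using b(1) by blast
    then show ?thesis
      using M that unfolding orthonormal_def by (metis DiffD1 DiffD2 subsetD)
  qed
  interpret ab: orthonormal_pair a b
    using a b by unfold_locales
  interpret ba: orthonormal_pair b a
    using a b by unfold_locales
  show ?thesis
  proof (rule that[of ab.transfer ba.transfer])
    show "ba.transfer (ab.transfer h) = h" for h
    proof -
      have "inner (h - ba.transfer (ab.transfer h)) m = 0" if "m \<in> A" for m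
        using that a(1) by (auto simp: inner_diff_left ba.inner_transfer ab.inner_transfer)
      then have "h - ba.transfer (ab.transfer h) = 0"
        by (rule A(2))
      then show ?thesis by simp
    qed
    show "inner (ab.transfer h) e = 0" if "e \<in> E" for h e
      by (rule ab.inner_transfer_orthogonal[OF bE[OF that]])
    show "ba.transfer e = 0" if "e \<in> E" for e
    proof -
      have "inner (ba.transfer e) m = 0" if m: "m \<in> A" for m
      proof -
        obtain n where "m = a n" using m a(1) by blast
        then show ?thesis
          using bE[OF \<open>e \<in> E\<close>, of n] by (simp add: ba.inner_transfer inner_commute[of e])
      qed
      then show ?thesis by (rule A(2))
    qed
    show "ab.transfer (ba.transfer x) = x - (\<Sum>e\<in>E. inner x e *\<^sub>R e)" for x
    proof -
      define y where "y = x - (\<Sum>e\<in>E. inner x e *\<^sub>R e)"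
      have "inner (y - ab.transfer (ba.transfer x)) m = 0" if m: "m \<in> M" for m
      proof (cases "m \<in> E")
        case True
        then show ?thesis
          using orthonormal_finite_expansion[OF E(1,2) order_refl True, of x]
            ab.inner_transfer_orthogonal[OF bE[OF True]]
          by (simp add: y_def inner_diff_left)
      next
        case False
        then obtain n where n: "m = b n" using m b(1) by blast
        have "inner (\<Sum>e\<in>E. inner x e *\<^sub>R e) m = 0"
          unfolding inner_sum_left
          by (intro sum.neutral ballI) (simp add: bE n inner_commute[of _ "b n"])
        then show ?thesis
          by (simp add: y_def inner_diff_left n ab.inner_transfer ba.inner_transfer)
      qed
      then have "y - ab.transfer (ba.transfer x) = 0"
        by (rule M(3))
      then show ?thesis by (simp add: y_def)
    qed
  qed (rule ab.transfer_bounded_linear ba.transfer_bounded_linear)+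
qed

subsection \<open>Calculus of primitives\<close>

lemma square_integrable_continuous: "continuous_on {0..2*pi} g \<Longrightarrow> square_integrable g"
proof -
  assume g: "continuous_on {0..2*pi} g"
  then have "compact (g ` {0..2*pi})"
    by (intro compact_continuous_image) auto
  then obtain B where "\<And>t. t \<in> {0..2*pi} \<Longrightarrow> \<bar>g t\<bar> \<le> B"
    by (metis compact_imp_bounded bounded_iff imageI real_norm_def)
  then show ?thesis
    using continuous_imp_measurable_on_sets_lebesgue[OF g] by (intro square_integrable_bounded) auto
qed

lemma square_integrable_continuous_mult:
  assumes "continuous_on {0..2*pi} m" "square_integrable g"
  shows "square_integrable (\<lambda>t. m t * g t)"
proof -
  have "compact (m ` {0..2*pi})"
    using assms by (intro compact_continuous_image) auto
  then obtain B where B: "\<And>t. t \<in> {0..2*pi} \<Longrightarrow> \<bar>m t\<bar> \<le> B"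
    by (metis compact_imp_bounded bounded_iff imageI real_norm_def)
  have meas [measurable]: "m \<in> borel_measurable leb" "g \<in> borel_measurable leb"
    using square_integrable_continuous[OF assms(1)] assms(2) by (auto simp: square_integrable_def)
  have "integrable leb (\<lambda>t. (m t * g t)\<^sup>2)"
  proof (rule Bochner_Integration.integrable_bound)
    show "integrable leb (\<lambda>t. B\<^sup>2 * (g t)\<^sup>2)"
      using assms(2) by (simp add: square_integrable_def)
    show "AE t in leb. norm ((m t * g t)\<^sup>2) \<le> norm (B\<^sup>2 * (g t)\<^sup>2)"
    proof (rule AE_I2)
      fix t assume "t \<in> space leb"
      then have "\<bar>m t\<bar>\<^sup>2 \<le> B\<^sup>2"
        using B[of t] by (intro power_mono) auto
      then show "norm ((m t * g t)\<^sup>2) \<le> norm (B\<^sup>2 * (g t)\<^sup>2)"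
        by (simp add: power_mult_distrib mult_right_mono)
    qed
  qed measurable
  then show ?thesis
    by (simp add: square_integrable_def)
qed

lemma primitive_of_continuous: "primitive_of g M \<Longrightarrow> continuous_on {0..2*pi} M"
  by (auto simp: primitive_of_iff absolutely_continuous_imp_continuous)

lemma primitive_of_cong:
  assumes "primitive_of g M" "\<And>t. t \<in> {0..2*pi} \<Longrightarrow> M t = N t"
    and "square_integrable h" "AE t in leb. g t = h t"
  shows "primitive_of h N"
proof -
  obtain Z where Z: "negligible Z" "\<And>t. t \<in> {0..2*pi} - Z \<Longrightarrow> g t = h t"
    using assms(4) unfolding AE_leb_iff by blast
  have "integral {0..t} g = integral {0..t} h" if "t \<in> {0..2*pi}" for t
    using that by (intro integral_spike[OF Z(1)]) (auto simp: Z(2))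
  then show ?thesis
    using assms(1-3) unfolding primitive_of_def by (metis atLeastAtMost_iff order_refl pi_ge_zero zero_le_mult_iff zero_le_numeral)
qed

lemma primitive_of_const: "primitive_of (\<lambda>_. 0) (\<lambda>_. c)"
  using square_integrable_zero by (simp add: primitive_of_def)

lemma primitive_of_add:
  assumes "primitive_of g M" "primitive_of h N"
  shows "primitive_of (\<lambda>t. g t + h t) (\<lambda>t. M t + N t)"
  unfolding primitive_of_def
proof (intro conjI ballI)
  have sq: "square_integrable g" "square_integrable h"
    using assms by (auto simp: primitive_of_def)
  then show "square_integrable (\<lambda>t. g t + h t)"
    by (rule square_integrable_add)
  fix t assume t: "t \<in> {0..2*pi}"
  have "g integrable_on {0..t}" "h integrable_on {0..t}"
    using t by (auto intro!: integrable_on_subinterval[OF square_integrable_integrable(2)] sq)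
  moreover have "M t = M 0 + integral {0..t} g" "N t = N 0 + integral {0..t} h"
    using assms t unfolding primitive_of_def by blast+
  ultimately show "M t + N t = M 0 + N 0 + integral {0..t} (\<lambda>t. g t + h t)"
    by (simp add: Henstock_Kurzweil_Integration.integral_add)
qed

lemma primitive_of_scale:
  assumes "primitive_of g M"
  shows "primitive_of (\<lambda>t. c * g t) (\<lambda>t. c * M t)"
  unfolding primitive_of_def
proof (intro conjI ballI)
  show "square_integrable (\<lambda>t. c * g t)"
    using assms by (auto simp: primitive_of_def square_integrable_scale)
  fix t assume t: "t \<in> {0..2*pi}"
  have "M t = M 0 + integral {0..t} g"
    using assms t unfolding primitive_of_def by blast
  then have "c * M t = c * (M 0 + integral {0..t} g)"
    by simp
  then show "c * M t = c * M 0 + integral {0..t} (\<lambda>t. c * g t)"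
    by (simp add: distrib_left)
qed

lemma primitive_of_mult:
  assumes M: "primitive_of g M" and N: "primitive_of h N"
  shows "primitive_of (\<lambda>t. M t * h t + g t * N t) (\<lambda>t. M t * N t)"
proof -
  note cM = primitive_of_continuous[OF M] and cN = primitive_of_continuous[OF N]
  obtain B where B: "\<And>t. t \<in> {0..2*pi} \<Longrightarrow> \<bar>M t\<bar> \<le> B" "\<And>t. t \<in> {0..2*pi} \<Longrightarrow> \<bar>N t\<bar> \<le> B"
  proof -
    have "bounded (M ` {0..2*pi})" "bounded (N ` {0..2*pi})"
      using cM cN by (auto intro!: compact_imp_bounded compact_continuous_image)
    then obtain B1 B2 where "\<And>t. t \<in> {0..2*pi} \<Longrightarrow> \<bar>M t\<bar> \<le> B1" "\<And>t. t \<in> {0..2*pi} \<Longrightarrow> \<bar>N t\<bar> \<le> B2"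
      unfolding bounded_iff by (metis imageI real_norm_def)
    then show ?thesis
      using that[of "max B1 B2"] by (meson max.coboundedI1 max.coboundedI2)
  qed
  have M': "absolutely_continuous_on_interval 0 (2*pi) M" and N': "absolutely_continuous_on_interval 0 (2*pi) N"
    using M N by (auto simp: primitive_of_iff)
  have "absolutely_continuous_on_interval 0 (2*pi) (\<lambda>t. M t * N t)"
  proof (rule absolutely_continuous_bound[OF M' N', where C = B])
    fix u v :: real assume uv: "u \<in> {0..2*pi}" "v \<in> {0..2*pi}"
    have "M v * N v - M u * N u = (M v - M u) * N v + M u * (N v - N u)"
      by (simp add: algebra_simps)
    also have "norm \<dots> \<le> \<bar>M v - M u\<bar> * \<bar>N v\<bar> + \<bar>M u\<bar> * \<bar>N v - N u\<bar>"
      by (simp flip: abs_mult)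
    also have "\<dots> \<le> \<bar>M v - M u\<bar> * B + B * \<bar>N v - N u\<bar>"
      using B uv by (intro add_mono mult_left_mono mult_right_mono) auto
    finally show "norm (M v * N v - M u * N u) \<le> B * (norm (M v - M u) + norm (N v - N u))"
      by (simp add: algebra_simps)
  qed
  moreover have "square_integrable (\<lambda>t. M t * h t + g t * N t)"
    using square_integrable_add[OF square_integrable_continuous_mult[OF cM, of h] square_integrable_continuous_mult[OF cN, of g]] M N
    by (simp add: primitive_of_def mult.commute)
  moreover have "AE t in leb. ((\<lambda>t. M t * N t) has_vector_derivative M t * h t + g t * N t) (at t within {0..2*pi})"
  proof -
    have "AE t in leb. (M has_vector_derivative g t) (at t within {0..2*pi})"
      "AE t in leb. (N has_vector_derivative h t) (at t within {0..2*pi})"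
      using M N by (auto simp: primitive_of_iff)
    then show ?thesis
      by eventually_elim (rule has_vector_derivative_mult)
  qed
  ultimately show ?thesis
    by (simp add: primitive_of_iff)
qed

text \<open>The values of M lie in a compact convex subset of S, on which the derivative is bounded
  and \<phi> is therefore Lipschitz; so absolute continuity is preserved. The set S admits functions
  such as the reciprocal and the logarithm on the positive half-line.\<close>

lemma primitive_of_compose:
  assumes M: "primitive_of g M" and S: "convex S" "M ` {0..2*pi} \<subseteq> S"
    and d: "\<And>x. x \<in> S \<Longrightarrow> (\<phi> has_real_derivative \<phi>' x) (at x)" and c: "continuous_on S \<phi>'"
  shows "primitive_of (\<lambda>t. \<phi>' (M t) * g t) (\<lambda>t. \<phi> (M t))"
proof -
  note cM = primitive_of_continuous[OF M]
  have M': "absolutely_continuous_on_interval 0 (2*pi) M"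
    using M by (auto simp: primitive_of_iff)
  define K where "K = convex hull (M ` {0..2*pi})"
  have K: "compact K" "convex K" "K \<subseteq> S" "M ` {0..2*pi} \<subseteq> K"
    unfolding K_def using cM hull_minimal[of "M ` {0..2*pi}" S convex] S
    by (auto intro!: compact_convex_hull compact_continuous_image simp: hull_inc)
  have "bounded (\<phi>' ` K)"
    using K c by (intro compact_imp_bounded compact_continuous_image) (auto intro: continuous_on_subset)
  then obtain B where B: "\<And>x. x \<in> K \<Longrightarrow> \<bar>\<phi>' x\<bar> \<le> B"
    unfolding bounded_iff by (metis imageI real_norm_def)
  have lip: "norm (\<phi> x - \<phi> y) \<le> B * norm (x - y)" if "x \<in> K" "y \<in> K" for x y
  proof (rule field_differentiable_bound[OF K(2) _ _ that])
    show "(\<phi> has_field_derivative \<phi>' z) (at z within K)" if "z \<in> K" for z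
      using d[of z] that K(3) by (auto intro: has_field_derivative_at_within)
  qed (use B in auto)
  have "absolutely_continuous_on_interval 0 (2*pi) (\<lambda>t. \<phi> (M t))"
  proof (rule absolutely_continuous_bound[OF M' M', where C = "max B 0"])
    fix u v :: real assume "u \<in> {0..2*pi}" "v \<in> {0..2*pi}"
    then have "norm (\<phi> (M v) - \<phi> (M u)) \<le> B * norm (M v - M u)"
      using K(4) by (intro lip) auto
    also have "\<dots> \<le> max B 0 * (norm (M v - M u) + norm (M v - M u))"
      by (intro mult_mono) auto
    finally show "norm (\<phi> (M v) - \<phi> (M u)) \<le> max B 0 * (norm (M v - M u) + norm (M v - M u))" .
  qed
  moreover have "square_integrable (\<lambda>t. \<phi>' (M t) * g t)"
    using M by (intro square_integrable_continuous_mult continuous_on_compose2[OF c cM S(2)]) (auto simp: primitive_of_def)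
  moreover have "AE t in leb. ((\<lambda>t. \<phi> (M t)) has_vector_derivative \<phi>' (M t) * g t) (at t within {0..2*pi})"
  proof -
    have "AE t in leb. (M has_vector_derivative g t) (at t within {0..2*pi})"
      using M by (auto simp: primitive_of_iff)
    moreover have "AE t in leb. t \<in> {0..2*pi}"
      by (rule AE_I2) simp
    ultimately show ?thesis
    proof eventually_elim
      case (elim t)
      have "((\<phi> \<circ> M) has_field_derivative \<phi>' (M t) * g t) (at t within {0..2*pi})"
      proof (rule DERIV_image_chain)
        show "(\<phi> has_field_derivative \<phi>' (M t)) (at (M t) within M ` {0..2*pi})"
          by (rule has_field_derivative_at_within[OF d]) (use S(2) elim(2) in blast)
        show "(M has_field_derivative g t) (at t within {0..2*pi})"
          using elim(1) by (simp add: has_real_derivative_iff_has_vector_derivative)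
      qed
      then show ?case
        by (simp add: has_real_derivative_iff_has_vector_derivative o_def)
    qed
  qed
  ultimately show ?thesis
    by (simp add: primitive_of_iff)
qed

lemma primitive_of_C1:
  assumes "\<And>t. t \<in> {0..2*pi} \<Longrightarrow> (M has_vector_derivative g t) (at t within {0..2*pi})"
    and "continuous_on {0..2*pi} g"
  shows "primitive_of g M"
  unfolding primitive_of_def
proof (intro conjI ballI square_integrable_continuous assms(2))
  fix t assume t: "t \<in> {0..2*pi}"
  have "(g has_integral (M t - M 0)) {0..t}"
    using t by (intro fundamental_theorem_of_calculus has_vector_derivative_within_subset[OF assms(1)]) auto
  then show "M t = M 0 + integral {0..t} g"
    by (simp add: integral_unique)
qed

lemma primitive_of_zero_imp_const: "primitive_of (\<lambda>_. 0) M \<Longrightarrow> t \<in> {0..2*pi} \<Longrightarrow> M t = M 0"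
  unfolding primitive_of_def by fastforce

lemma primitive_of_mono:
  assumes M: "primitive_of g M" and N: "primitive_of h N" and "N 0 \<ge> \<bar>M 0\<bar>"
    and "\<And>t. t \<in> {0..2*pi} \<Longrightarrow> \<bar>g t\<bar> \<le> h t" and t: "t \<in> {0..2*pi}"
  shows "\<bar>M t\<bar> \<le> N t"
proof -
  have sq: "square_integrable g" "square_integrable h" and
    eq: "M t = M 0 + integral {0..t} g" "N t = N 0 + integral {0..t} h"
    using M N t unfolding primitive_of_def by blast+
  have "\<bar>integral {0..t} g\<bar> \<le> integral {0..t} h"
    using integral_norm_bound_integral[of g "{0..t}" h] assms(4) t
      integrable_on_subinterval[OF square_integrable_integrable(2)[OF sq(1)], of 0 t]
      integrable_on_subinterval[OF square_integrable_integrable(2)[OF sq(2)], of 0 t] by simp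
  then show ?thesis
    using assms(3) unfolding eq by linarith
qed

subsection \<open>Operators between continuous and square integrable functions\<close>

type_synonym C = "real \<Rightarrow>\<^sub>C real"

text \<open>Elements of \<open>C\<close> are bounded continuous functions on the whole line. A
  function on [0, 2 pi] enters as its constant extension to both sides, that is, through this
  retraction.\<close>

definition clip :: "real \<Rightarrow> real" where
  "clip t = max 0 (min t (2*pi))"

lemma clip [simp]: "clip t \<in> {0..2*pi}" "t \<in> {0..2*pi} \<Longrightarrow> clip t = t" "clip (clip t) = clip t"
  by (auto simp: clip_def)

lemma clip_bounds [simp]: "0 \<le> clip t" "clip t \<le> 2 * pi"
  by (auto simp: clip_def)

lemma clip_0 [simp]: "clip 0 = 0"
  by (simp add: clip_def)

lemma continuous_clip: "continuous_on S clip"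
  unfolding clip_def by (intro continuous_intros)

definition ext :: "(real \<Rightarrow> real) \<Rightarrow> C" where
  "ext f = Bcontfun (\<lambda>t. f (clip t))"

lemma ext_apply:
  assumes "continuous_on {0..2*pi} f"
  shows "apply_bcontfun (ext f) t = f (clip t)"
proof -
  have "compact (f ` {0..2*pi})"
    using assms by (intro compact_continuous_image) auto
  then have "bounded (range (\<lambda>t. f (clip t)))"
    using clip(1) by (intro bounded_subset[OF compact_imp_bounded]) auto
  moreover have "continuous_on UNIV (\<lambda>t. f (clip t))"
    by (rule continuous_on_compose2[OF assms continuous_clip]) (use clip(1) in blast)
  ultimately show ?thesis
    by (simp add: ext_def Bcontfun_inverse bcontfun_def)
qed

lemma abs_apply_C_le: "\<bar>apply_bcontfun (g::C) t\<bar> \<le> norm g"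
  using norm_bounded[of g t] by simp

definition mulC :: "C \<Rightarrow> C \<Rightarrow> C" where
  "mulC f g = Bcontfun (\<lambda>t. apply_bcontfun f t * apply_bcontfun g t)"

lemma mulC_apply [simp]: "apply_bcontfun (mulC f g) t = apply_bcontfun f t * apply_bcontfun g t"
proof -
  have "(\<lambda>t. apply_bcontfun f t * apply_bcontfun g t) \<in> bcontfun"
    by (rule bcontfun_normI[where b = "norm f * norm g"])
      (auto intro!: continuous_intros mult_mono simp: abs_mult abs_apply_C_le)
  then show ?thesis
    by (simp add: mulC_def Bcontfun_inverse)
qed

lemma bounded_bilinear_mulC: "bounded_bilinear mulC"
proof
  show "\<exists>K. \<forall>a b. norm (mulC a b) \<le> norm a * norm b * K"
    by (intro exI[of _ 1] allI)
      (auto intro!: norm_bound mult_mono simp: abs_mult abs_apply_C_le)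
qed (auto intro!: bcontfun_eqI simp: algebra_simps)

lemma square_integrable_C [simp]: "square_integrable (apply_bcontfun (g::C))"
  by (rule square_integrable_continuous) simp

definition emb :: "C \<Rightarrow> H0" where
  "emb g = abs_H0 (apply_bcontfun g)"

lemma rep_emb: "AE t in leb. rep_H0 (emb g) t = apply_bcontfun g t"
  unfolding emb_def by (rule rep_abs_H0) simp

definition mulH :: "C \<Rightarrow> H0 \<Rightarrow> H0" where
  "mulH g f = abs_H0 (\<lambda>t. apply_bcontfun g t * rep_H0 f t)"

lemma square_integrable_mulH: "square_integrable (\<lambda>t. apply_bcontfun (g::C) t * rep_H0 f t)"
  by (rule square_integrable_continuous_mult) auto

lemma rep_mulH: "AE t in leb. rep_H0 (mulH g f) t = apply_bcontfun g t * rep_H0 f t"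
  unfolding mulH_def by (rule rep_abs_H0[OF square_integrable_mulH])

lemma norm_H0_le:
  assumes "AE t in leb. \<bar>rep_H0 x t\<bar> \<le> c * \<bar>rep_H0 y t\<bar>" "c \<ge> 0"
  shows "norm x \<le> c * norm y"
proof (rule power2_le_imp_le)
  have "(norm x)\<^sup>2 \<le> (\<integral>t. c\<^sup>2 * (rep_H0 y t)\<^sup>2 \<partial>leb)"
    unfolding norm_H0_rep
  proof (rule integral_mono_AE)
    show "AE t in leb. (rep_H0 x t)\<^sup>2 \<le> c\<^sup>2 * (rep_H0 y t)\<^sup>2"
      using assms(1)
    proof eventually_elim
      case (elim t)
      then have "\<bar>rep_H0 x t\<bar>\<^sup>2 \<le> (c * \<bar>rep_H0 y t\<bar>)\<^sup>2"
        by (intro power_mono) auto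
      then show ?case by (simp add: power_mult_distrib)
    qed
  qed (use square_integrable_rep in \<open>auto simp: square_integrable_def\<close>)
  then show "(norm x)\<^sup>2 \<le> (c * norm y)\<^sup>2"
    by (simp add: power_mult_distrib norm_H0_rep)
qed (use assms in auto)

lemma bounded_bilinear_mulH: "bounded_bilinear mulH"
proof
  fix a b :: C and f g :: H0 and r :: real
  show "mulH (a + b) f = mulH a f + mulH b f"
  proof (rule H0_eqI)
    show "AE t in leb. rep_H0 (mulH (a + b) f) t = rep_H0 (mulH a f + mulH b f) t"
      using rep_mulH[of "a + b" f] rep_H0_add[of "mulH a f" "mulH b f"] rep_mulH[of a f] rep_mulH[of b f]
      by eventually_elim (simp add: algebra_simps)
  qed
  show "mulH a (f + g) = mulH a f + mulH a g"
  proof (rule H0_eqI)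
    show "AE t in leb. rep_H0 (mulH a (f + g)) t = rep_H0 (mulH a f + mulH a g) t"
      using rep_mulH[of a "f + g"] rep_H0_add[of f g] rep_H0_add[of "mulH a f" "mulH a g"] rep_mulH[of a f] rep_mulH[of a g]
      by eventually_elim (simp add: algebra_simps)
  qed
  show "mulH (r *\<^sub>R a) f = r *\<^sub>R mulH a f"
  proof (rule H0_eqI)
    show "AE t in leb. rep_H0 (mulH (r *\<^sub>R a) f) t = rep_H0 (r *\<^sub>R mulH a f) t"
      using rep_mulH[of "r *\<^sub>R a" f] rep_H0_scaleR[of r "mulH a f"] rep_mulH[of a f]
      by eventually_elim simp
  qed
  show "mulH a (r *\<^sub>R f) = r *\<^sub>R mulH a f"
  proof (rule H0_eqI)
    show "AE t in leb. rep_H0 (mulH a (r *\<^sub>R f)) t = rep_H0 (r *\<^sub>R mulH a f) t"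
      using rep_mulH[of a "r *\<^sub>R f"] rep_H0_scaleR[of r "mulH a f"] rep_H0_scaleR[of r f] rep_mulH[of a f]
      by eventually_elim simp
  qed
  have "norm (mulH a f) \<le> norm a * norm f" for a f
  proof (rule norm_H0_le)
    show "AE t in leb. \<bar>rep_H0 (mulH a f) t\<bar> \<le> norm a * \<bar>rep_H0 f t\<bar>"
      using rep_mulH[of a f]
      by eventually_elim (auto simp: abs_mult intro: mult_right_mono abs_apply_C_le)
  qed simp
  then show "\<exists>K. \<forall>a f. norm (mulH a f) \<le> norm a * norm f * K"
    by (intro exI[of _ 1]) simp
qed

definition oneC :: C where "oneC = const_bcontfun 1"

lemma oneC_apply [simp]: "apply_bcontfun oneC t = 1"
  by (simp add: oneC_def)

text \<open>In this form \<open>emb\<close> inherits linearity and boundedness from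
  \<open>mulH\<close>.\<close>

lemma emb_eq_mulH: "emb g = mulH g (emb oneC)"
proof (rule H0_eqI)
  show "AE t in leb. rep_H0 (emb g) t = rep_H0 (mulH g (emb oneC)) t"
    using rep_mulH[of g "emb oneC"] rep_emb[of oneC] rep_emb[of g] by eventually_elim simp
qed

lemma bounded_linear_emb: "bounded_linear emb"
  using bounded_bilinear.bounded_linear_left[OF bounded_bilinear_mulH, of "emb oneC"]
  by (simp flip: emb_eq_mulH)

definition Iop :: "H0 \<Rightarrow> C" where
  "Iop f = ext (\<lambda>t. integral {0..t} (rep_H0 f))"

lemma Iop_apply: "apply_bcontfun (Iop f) t = integral {0..clip t} (rep_H0 f)"
  unfolding Iop_def
  by (rule ext_apply, rule indefinite_integral_continuous_1[OF square_integrable_integrable(2)]) simp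

lemma Iop_0 [simp]: "apply_bcontfun (Iop f) 0 = 0"
  by (simp add: Iop_apply)

lemma Iop_clip: "apply_bcontfun (Iop f) (clip t) = apply_bcontfun (Iop f) t"
  by (simp add: Iop_apply)

lemma primitive_of_Iop: "primitive_of (rep_H0 f) (apply_bcontfun (Iop f))"
  unfolding primitive_of_def by (simp add: Iop_apply)

lemma primitive_of_Iop': "square_integrable g \<Longrightarrow> AE t in leb. rep_H0 f t = g t \<Longrightarrow> primitive_of g (apply_bcontfun (Iop f))"
  by (rule primitive_of_cong[OF primitive_of_Iop]) auto

text \<open>This evaluates \<open>Iop\<close> as soon as any primitive is known; the value at 0 is
  subtracted since \<open>Iop\<close> starts at 0.\<close>

lemma Iop_unique:
  assumes "primitive_of g M" "AE t in leb. rep_H0 f t = g t"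
  shows "apply_bcontfun (Iop f) t = M (clip t) - M 0"
proof -
  have "primitive_of g (apply_bcontfun (Iop f))"
    using assms by (intro primitive_of_Iop') (auto simp: primitive_of_def)
  from primitive_of_add[OF assms(1) primitive_of_scale[OF this, of "-1"]]
  have "primitive_of (\<lambda>_. 0) (\<lambda>t. M t + -1 * apply_bcontfun (Iop f) t)"
    by simp
  from primitive_of_zero_imp_const[OF this clip(1)[of t]] show ?thesis
    by (simp add: Iop_clip)
qed

lemma bounded_linear_Iop: "bounded_linear Iop"
proof (rule bounded_linear_intro[where K = "sqrt (2 * pi)"])
  fix f g :: H0 and r :: real
  show "Iop (f + g) = Iop f + Iop g"
    using Iop_unique[OF primitive_of_add[OF primitive_of_Iop primitive_of_Iop] rep_H0_add, of f g]
    by (intro bcontfun_eqI) (simp add: Iop_clip)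
  show "Iop (r *\<^sub>R f) = r *\<^sub>R Iop f"
    using Iop_unique[OF primitive_of_scale[OF primitive_of_Iop] rep_H0_scaleR, of r f]
    by (intro bcontfun_eqI) (simp add: Iop_clip)
  show "norm (Iop f) \<le> norm f * sqrt (2 * pi)"
  proof (rule norm_bound)
    fix t
    have sq: "square_integrable (\<lambda>t. \<bar>rep_H0 f t\<bar>)"
      using square_integrable_rep[of f] by (auto simp: square_integrable_def)
    have "\<bar>integral {0..clip t} (rep_H0 f)\<bar> \<le> integral {0..clip t} (\<lambda>t. \<bar>rep_H0 f t\<bar>)"
      using integral_norm_bound_integral[of "rep_H0 f" "{0..clip t}" "\<lambda>t. \<bar>rep_H0 f t\<bar>"] clip_bounds[of t]
        integrable_on_subinterval[OF square_integrable_integrable(2)[OF square_integrable_rep], of 0 "clip t" f]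
        integrable_on_subinterval[OF square_integrable_integrable(2)[OF sq], of 0 "clip t"] by simp
    also have "\<dots> \<le> integral {0..2*pi} (\<lambda>t. \<bar>rep_H0 f t\<bar>)"
      using clip(1)[of t] by (intro integral_subset_le integrable_on_subinterval[OF square_integrable_integrable(2)] sq) auto
    also have "\<dots> = (\<integral>t. \<bar>rep_H0 f t\<bar> \<partial>leb)"
      using square_integrable_integrable(4)[OF sq] by simp
    also have "\<dots> \<le> norm f * sqrt (2 * pi)"
      using integral_abs_rep_H0_le[of f] by (simp add: mult.commute)
    finally show "norm (apply_bcontfun (Iop f) t) \<le> norm f * sqrt (2 * pi)"
      by (simp add: Iop_apply)
  qed
qed

definition evalC :: "real \<Rightarrow> C \<Rightarrow> real" where
  "evalC t g = apply_bcontfun g t"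

lemma bounded_linear_evalC: "bounded_linear (evalC t)"
  by (rule bounded_linear_intro[where K = 1]) (auto simp: evalC_def abs_apply_C_le)

subsection \<open>Superposition operators\<close>

definition expC :: "C \<Rightarrow> C" where
  "expC g = Bcontfun (\<lambda>t. exp (apply_bcontfun g t))"

lemma expC_apply [simp]: "apply_bcontfun (expC g) t = exp (apply_bcontfun g t)"
proof -
  have "apply_bcontfun g t \<le> norm g" for t
    using abs_apply_C_le[of g t] by simp
  then have "(\<lambda>t. exp (apply_bcontfun g t)) \<in> bcontfun"
    by (intro bcontfun_normI[where b = "exp (norm g)"]) (auto intro!: continuous_intros)
  then show ?thesis
    by (simp add: expC_def Bcontfun_inverse)
qed

text \<open>From exp (- h) \<ge> 1 - h one gets exp h \<le> 1 / (1 - h), whose excess over 1 + h is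
  h^2 / (1 - h); the constant 2 is 1 / (1 - h) at h = 1/2.\<close>

lemma exp_minus_linear_bound:
  fixes h :: real
  assumes "\<bar>h\<bar> \<le> 1 / 2"
  shows "\<bar>exp h - 1 - h\<bar> \<le> 2 * h\<^sup>2"
proof -
  have "1 - h \<le> exp (- h)"
    using exp_ge_add_one_self[of "- h"] by simp
  then have "exp h \<le> 1 / (1 - h)"
    using assms by (simp add: exp_minus field_simps)
  moreover have "1 / (1 - h) - 1 - h = h\<^sup>2 / (1 - h)"
    using assms by (simp add: field_simps power2_eq_square)
  moreover have "h\<^sup>2 / (1 - h) \<le> 2 * h\<^sup>2"
  proof -
    have "h\<^sup>2 / (1 - h) \<le> h\<^sup>2 / (1 / 2)"
      using assms by (intro divide_left_mono) auto
    then show ?thesis by simp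
  qed
  ultimately show ?thesis
    using exp_ge_add_one_self[of h] zero_le_power2[of h] unfolding abs_le_iff by (intro conjI; linarith)
qed

text \<open>The sup norm bounds the increment at every t at once, so the quadratic remainder of the
  exponential is uniform in t.\<close>

lemma has_derivative_expC: "(expC has_derivative mulC (expC g)) (at g)"
  unfolding has_derivative_at_alt
proof (intro conjI allI impI)
  show "bounded_linear (mulC (expC g))"
    by (rule bounded_bilinear.bounded_linear_right[OF bounded_bilinear_mulC])
  fix e :: real assume e: "e > 0"
  define d where "d = min (1 / 2) (e / (2 * (norm (expC g) + 1)))"
  have d: "d > 0" "d \<le> 1 / 2" "norm (expC g) * (2 * d) \<le> e"
  proof -
    show "d \<le> 1 / 2"
      unfolding d_def by (rule min.cobounded1)
    show "d > 0"
      using e by (auto simp: d_def intro!: divide_pos_pos add_nonneg_pos min.coboundedI1)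
    have "norm (expC g) * (2 * d) \<le> (norm (expC g) + 1) * (2 * (e / (2 * (norm (expC g) + 1))))"
      using \<open>d > 0\<close> by (intro mult_mono) (auto simp: d_def)
    also have "\<dots> = e"
      using norm_ge_zero[of "expC g"] by (simp add: add_nonneg_eq_0_iff field_simps)
    finally show "norm (expC g) * (2 * d) \<le> e" .
  qed
  show "\<exists>d>0. \<forall>y. norm (y - g) < d \<longrightarrow> norm (expC y - expC g - mulC (expC g) (y - g)) \<le> e * norm (y - g)"
  proof (intro exI[of _ d] conjI allI impI d(1) norm_bound)
    fix y t assume y: "norm (y - g) < d"
    define h where "h = apply_bcontfun (y - g) t"
    have h: "\<bar>h\<bar> \<le> norm (y - g)"
      unfolding h_def by (rule abs_apply_C_le)
    have "apply_bcontfun (expC y - expC g - mulC (expC g) (y - g)) t = exp (apply_bcontfun g t) * (exp h - 1 - h)"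
      by (simp add: h_def algebra_simps exp_diff)
    also have "norm \<dots> = exp (apply_bcontfun g t) * \<bar>exp h - 1 - h\<bar>"
      by (simp add: abs_mult)
    also have "\<dots> \<le> norm (expC g) * (2 * h\<^sup>2)"
      using h y d abs_apply_C_le[of "expC g" t]
      by (intro mult_mono exp_minus_linear_bound) auto
    also have "\<dots> = norm (expC g) * (2 * \<bar>h\<bar>) * \<bar>h\<bar>"
      by (simp add: power2_eq_square)
    also have "\<dots> \<le> norm (expC g) * (2 * d) * norm (y - g)"
      using h y by (intro mult_mono) auto
    also have "\<dots> \<le> e * norm (y - g)"
      using d(3) by (rule mult_right_mono) simp
    finally show "norm (apply_bcontfun (expC y - expC g - mulC (expC g) (y - g)) t) \<le> e * norm (y - g)" .
  qed
qed

text \<open>The derivative is multiplication by the value itself, so each order yields the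
  next.\<close>

lemma ndf_expC: "ndf n S expC"
proof -
  interpret mulC: bounded_bilinear mulC by (rule bounded_bilinear_mulC)
  have "ndf n UNIV expC"
  proof (induction n)
    case (Suc n)
    have "ndf n UNIV (\<lambda>g. mulC.prod_right (expC g))"
      by (rule ndf_bounded_linear_compose[OF mulC.bounded_linear_prod_right Suc])
    then show ?case
      by (rule ndf_Suc[rotated]) (simp add: has_derivative_expC mulC.prod_right.rep_eq)
  qed (rule ndf_0)
  then show ?thesis
    by (rule ndf_subset) simp
qed

text \<open>A uniform lower bound, rather than mere positivity at each point, makes the set open and
  the reciprocals bounded.\<close>

definition posC :: "C set" where
  "posC = {g. \<exists>e>0. \<forall>t. e \<le> apply_bcontfun g t}"

definition recC :: "C \<Rightarrow> C" where
  "recC g = Bcontfun (\<lambda>t. 1 / apply_bcontfun g t)"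

lemma recC_apply: "g \<in> posC \<Longrightarrow> apply_bcontfun (recC g) t = 1 / apply_bcontfun g t"
proof -
  assume "g \<in> posC"
  then obtain e where e: "e > 0" "\<And>t. e \<le> apply_bcontfun g t"
    unfolding posC_def by blast
  then have nz: "apply_bcontfun g t \<noteq> 0" "\<bar>1 / apply_bcontfun g t\<bar> \<le> 1 / e" for t
  proof -
    have "0 < apply_bcontfun g t" using e(1) e(2)[of t] by linarith
    then show "apply_bcontfun g t \<noteq> 0" "\<bar>1 / apply_bcontfun g t\<bar> \<le> 1 / e"
      using e(1) e(2)[of t] by (auto simp: frac_le)
  qed
  have "(\<lambda>t. 1 / apply_bcontfun g t) \<in> bcontfun"
    by (rule bcontfun_normI[where b = "1 / e"]) (use nz in \<open>auto intro!: continuous_intros\<close>)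
  then show ?thesis
    by (simp add: recC_def Bcontfun_inverse)
qed

lemma open_posC: "open posC"
  unfolding open_dist
proof
  fix g assume "g \<in> posC"
  then obtain e where e: "e > 0" "\<And>t. e \<le> apply_bcontfun g t"
    unfolding posC_def by blast
  show "\<exists>d>0. \<forall>y. dist y g < d \<longrightarrow> y \<in> posC"
  proof (intro exI[of _ "e / 2"] conjI allI impI)
    fix y assume "dist y g < e / 2"
    then have that: "\<bar>apply_bcontfun (y - g) t\<bar> < e / 2" for t
      using abs_apply_C_le[of "y - g" t] by (simp add: dist_norm)
    have "e / 2 \<le> apply_bcontfun y t" for t
    proof -
      have "\<bar>apply_bcontfun y t - apply_bcontfun g t\<bar> < e / 2"
        using that[of t] by simp
      then show ?thesis
        using e(2)[of t] by linarith
    qed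
    then show "y \<in> posC"
      using e(1) unfolding posC_def by (intro CollectI exI[of _ "e / 2"]) auto
  qed (use e in simp)
qed

lemma posC_nonzero: "g \<in> posC \<Longrightarrow> apply_bcontfun g t \<noteq> 0"
  unfolding posC_def by (auto simp: not_le dest: spec[of _ t])

lemma ndf_recC: "ndf n posC recC"
proof (rule ndf_resolvent(1)[where a = "\<lambda>x. x" and a' = "\<lambda>_. id_blinfun", OF bounded_bilinear_mulC open_posC])
  show "recC y - recC x = - mulC (recC y) (mulC (y - x) (recC x))" if "x \<in> posC" "y \<in> posC" for x y
    using posC_nonzero[OF that(1)] posC_nonzero[OF that(2)]
    by (intro bcontfun_eqI) (simp add: recC_apply that field_simps)
qed (auto intro: ndf_bounded_linear ndf_const bounded_linear_ident simp: id_blinfun.rep_eq)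

subsection \<open>The Volterra resolvent\<close>

text \<open>The inverse of the identity minus T is obtained from the fixed points of y \<mapsto> x +
  T y; the factor 1/2 gives it norm at most 2.\<close>

lemma neumann_half:
  fixes T :: "'a::{real_normed_vector, complete_space} \<Rightarrow> 'a"
  assumes T: "bounded_linear T" "\<And>x. norm (T x) \<le> (1/2) * norm x"
  obtains R where "bounded_linear R" "\<And>x. R x = x + T (R x)" "\<And>x. R (x - T x) = x"
proof -
  interpret T: bounded_linear T by fact
  have ex: "\<exists>!y. x + T y = y" for x
  proof (rule banach_fix_type[of "1/2"])
    show "\<forall>y z. dist (x + T y) (x + T z) \<le> 1/2 * dist y z"
      using T(2) by (metis T.diff add_diff_cancel_left dist_norm)
  qed auto
  define R where "R = (\<lambda>x. THE y. x + T y = y)"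
  have R: "x + T (R x) = R x" for x
    unfolding R_def using theI'[OF ex] .
  have uniq: "y = R x" if "x + T y = y" for x y
    using ex R that by blast
  show ?thesis
  proof (rule that[of R])
    show "bounded_linear R"
    proof (rule bounded_linear_intro[where K = 2])
      fix x y and r :: real
      show "R (x + y) = R x + R y"
        using R[of x] R[of y] by (intro uniq[symmetric]) (metis T.add add.assoc add.left_commute)
      show "R (r *\<^sub>R x) = r *\<^sub>R R x"
        using R[of x] by (intro uniq[symmetric]) (metis T.scale scaleR_right_distrib)
      have "norm (R x) \<le> norm x + norm (T (R x))"
        using R[of x] norm_triangle_ineq by metis
      then show "norm (R x) \<le> norm x * 2"
        using T(2)[of "R x"] by simp
    qed
    show "R (x - T x) = x" for x
      by (rule uniq[symmetric]) simp
  qed (simp add: R)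
qed

text \<open>The first order system v' = u, u' = q v integrated from 0. Solutions with initial values
  c are the fixed points of \<open>\<lambda>z. c + Volterra q z\<close>, with c as a pair of
  constant functions.\<close>

definition Volterra :: "H0 \<Rightarrow> C \<times> C \<Rightarrow> C \<times> C" where
  "Volterra q z = (Iop (emb (snd z)), Iop (mulH (fst z) q))"

lemma bounded_linear_Volterra: "bounded_linear (Volterra q)"
  unfolding Volterra_def[abs_def]
  by (intro bounded_linear_Pair bounded_linear_compose[OF bounded_linear_Iop]
      bounded_linear_compose[OF bounded_linear_emb] bounded_linear_snd
      bounded_linear_compose[OF bounded_bilinear.bounded_linear_left[OF bounded_bilinear_mulH]] bounded_linear_fst)

text \<open>Conjugation with an exponential weight turns the Volterra operator into a contraction.\<close>

lemma Volterra_resolvent: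
  obtains R where "bounded_linear R" "\<And>x. R x = x + Volterra q (R x)" "\<And>x. R (x - Volterra q x) = x"
proof -
  \<comment> \<open>One weight dominates both coefficients of the system, 1 and q; its integral m
    becomes the exponent.\<close>
  define p where "p = (\<lambda>t. 1 + \<bar>rep_H0 q t\<bar>)"
  have sqp: "square_integrable p"
  proof -
    have "square_integrable (\<lambda>_. 1)" "square_integrable (\<lambda>t. \<bar>rep_H0 q t\<bar>)"
      using square_integrable_rep[of q] by (auto simp: square_integrable_def)
    then show ?thesis
      unfolding p_def by (rule square_integrable_add)
  qed
  define m where "m = (\<lambda>t. integral {0..t} p)"
  have m: "primitive_of p m"
    using sqp by (simp add: primitive_of_def m_def)
  have cm: "continuous_on {0..2*pi} m"
    by (rule primitive_of_continuous[OF m])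
  have m0: "m 0 = 0" by (simp add: m_def)
  \<comment> \<open>The rate 4 gives each component of the conjugated operator a factor 1/4, hence
    the two together a factor 1/2.\<close>
  define E where "E = expC (4 *\<^sub>R ext m)"
  define E' where "E' = expC (- 4 *\<^sub>R ext m)"
  have E: "apply_bcontfun E t = exp (4 * m (clip t))" "apply_bcontfun E' t = exp (- 4 * m (clip t))" for t
    by (simp_all add: E_def E'_def ext_apply[OF cm])
  have EE: "mulC E (mulC E' g) = g" "mulC E' (mulC E g) = g" for g
    by (auto intro!: bcontfun_eqI simp: E simp flip: exp_add mult.assoc)
  have pe: "primitive_of (\<lambda>t. 4 * p t * exp (4 * m t)) (\<lambda>t. exp (4 * m t))"
  proof -
    have "primitive_of (\<lambda>t. exp (4 * m t) * (4 * p t)) (\<lambda>t. exp (4 * m t))"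
      by (rule primitive_of_compose[OF primitive_of_scale[OF m], where S = UNIV])
        (auto intro!: DERIV_exp continuous_intros)
    then show ?thesis
      by (simp add: mult_ac)
  qed
  have key: "norm (mulC E' (Iop f)) \<le> (1/4) * K"
    if f: "AE t in leb. \<bar>rep_H0 f t\<bar> \<le> K * (p t * exp (4 * m t))" and "K \<ge> 0" for f K
  proof (rule norm_bound)
    fix t
    define s where "s = clip t"
    have s: "s \<in> {0..2*pi}" by (simp add: s_def)
    \<comment> \<open>The bound on f holds only almost everywhere, whereas the comparison of
      primitives asks for it at each point; the truncation changes f on a null set.\<close>
    define f' where "f' = (\<lambda>t. if \<bar>rep_H0 f t\<bar> \<le> K * (p t * exp (4 * m t)) then rep_H0 f t else 0)"
    have ff: "AE t in leb. rep_H0 f t = f' t"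
      using f by eventually_elim (simp add: f'_def)
    have sqf: "square_integrable f'"
    proof -
      have [measurable]: "p \<in> borel_measurable leb" "m \<in> borel_measurable leb"
        using sqp square_integrable_continuous[OF cm] by (auto simp: square_integrable_def)
      have [measurable]: "f' \<in> borel_measurable leb"
        unfolding f'_def by measurable
      have "integrable leb (\<lambda>t. (f' t)\<^sup>2)"
        by (rule Bochner_Integration.integrable_bound[of _ "\<lambda>t. (rep_H0 f t)\<^sup>2"])
          (use square_integrable_rep[of f] in \<open>auto simp: square_integrable_def f'_def\<close>)
      then show ?thesis
        by (simp add: square_integrable_def)
    qed
    have "\<bar>apply_bcontfun (Iop f) s\<bar> \<le> (K / 4) * exp (4 * m s)"
    proof (rule primitive_of_mono[OF primitive_of_Iop'[OF sqf ff] primitive_of_scale[OF pe] _ _ s])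
      show "\<bar>f' t\<bar> \<le> K / 4 * (4 * p t * exp (4 * m t))" for t
      proof -
        have "p t \<ge> 0" by (simp add: p_def)
        then have "0 \<le> K * (p t * exp (4 * m t))"
          using \<open>K \<ge> 0\<close> by simp
        moreover have "K / 4 * (4 * p t * exp (4 * m t)) = K * (p t * exp (4 * m t))"
          by simp
        ultimately show ?thesis
          unfolding f'_def by (simp del: mult_eq_0_iff zero_le_mult_iff)
      qed
    qed (use \<open>K \<ge> 0\<close> in auto)
    then have "exp (- 4 * m s) * \<bar>apply_bcontfun (Iop f) s\<bar> \<le> exp (- 4 * m s) * ((K / 4) * exp (4 * m s))"
      by (intro mult_left_mono) auto
    also have "\<dots> = (1/4) * K"
      by (simp flip: exp_add)
    finally show "norm (apply_bcontfun (mulC E' (Iop f)) t) \<le> (1/4) * K"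
      by (simp add: E abs_mult s_def Iop_clip)
  qed
  define W where "W = (\<lambda>z. (mulC E (fst z), mulC E (snd z)))"
  define W' where "W' = (\<lambda>z. (mulC E' (fst z), mulC E' (snd z)))"
  have W: "bounded_linear W" "bounded_linear W'"
    unfolding W_def W'_def
    by (intro bounded_linear_Pair bounded_linear_compose[OF bounded_bilinear.bounded_linear_right[OF bounded_bilinear_mulC]]
        bounded_linear_fst bounded_linear_snd)+
  have WW: "W (W' z) = z" "W' (W z) = z" for z
    by (auto simp: W_def W'_def EE)
  define S where "S = (\<lambda>z. W' (Volterra q (W z)))"
  have S: "bounded_linear S"
    unfolding S_def by (intro bounded_linear_compose[OF W(2)] bounded_linear_compose[OF bounded_linear_Volterra] W(1))
  have Sn: "norm (S z) \<le> (1/2) * norm z" for z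
  proof -
    have cl: "AE t in leb. clip t = t"
      by (rule AE_I2) simp
    have p1: "1 \<le> p t" "\<bar>rep_H0 q t\<bar> \<le> p t" for t
      by (auto simp: p_def)
    have "norm (mulC E' (Iop (emb (mulC E (snd z))))) \<le> (1/4) * norm (snd z)"
    proof (rule key)
      show "AE t in leb. \<bar>rep_H0 (emb (mulC E (snd z))) t\<bar> \<le> norm (snd z) * (p t * exp (4 * m t))"
        using rep_emb[of "mulC E (snd z)"] cl
      proof eventually_elim
        case (elim t)
        have "exp (4 * m t) * \<bar>apply_bcontfun (snd z) t\<bar> \<le> (p t * exp (4 * m t)) * norm (snd z)"
          using p1[of t] by (intro mult_mono abs_apply_C_le) auto
        then show ?case
          using elim by (simp add: E abs_mult mult_ac)
      qed
    qed simp
    moreover have "norm (mulC E' (Iop (mulH (mulC E (fst z)) q))) \<le> (1/4) * norm (fst z)"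
    proof (rule key)
      show "AE t in leb. \<bar>rep_H0 (mulH (mulC E (fst z)) q) t\<bar> \<le> norm (fst z) * (p t * exp (4 * m t))"
        using rep_mulH[of "mulC E (fst z)" q] cl
      proof eventually_elim
        case (elim t)
        have "\<bar>apply_bcontfun (fst z) t\<bar> * (\<bar>rep_H0 q t\<bar> * exp (4 * m t)) \<le> norm (fst z) * (p t * exp (4 * m t))"
          using p1[of t] by (intro mult_mono abs_apply_C_le) auto
        then show ?case
          unfolding elim(1) mulC_apply E elim(2) abs_mult by (simp only: abs_exp_cancel mult_ac)
      qed
    qed simp
    ultimately have "norm (fst (S z)) + norm (snd (S z)) \<le> (1/4) * norm (snd z) + (1/4) * norm (fst z)"
      by (intro add_mono) (simp_all add: S_def W_def W'_def Volterra_def)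
    also have "\<dots> \<le> (1/2) * norm z"
      using norm_fst_le[of "fst z" "snd z"] norm_snd_le[of "snd z" "fst z"] by simp
    finally show ?thesis
      using norm_Pair_le[of "fst (S z)" "snd (S z)"] by simp
  qed
  obtain R where R: "bounded_linear R" "\<And>x. R x = x + S (R x)" "\<And>x. R (x - S x) = x"
    using neumann_half[OF S Sn] by metis
  interpret W: bounded_linear W by (rule W)
  interpret W': bounded_linear W' by (rule W)
  show ?thesis
  proof (rule that[of "\<lambda>x. W (R (W' x))"])
    show "bounded_linear (\<lambda>x. W (R (W' x)))"
      by (intro bounded_linear_compose[OF W(1)] bounded_linear_compose[OF R(1)] W(2))
    show "W (R (W' x)) = x + Volterra q (W (R (W' x)))" for x
    proof -
      have "W (R (W' x)) = W (W' x) + W (S (R (W' x)))"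
        using R(2)[of "W' x"] W.add by metis
      then show ?thesis
        by (simp add: WW S_def)
    qed
    show "W (R (W' (x - Volterra q x))) = x" for x
    proof -
      have "W' (x - Volterra q x) = W' x - S (W' x)"
        by (simp add: W'.diff S_def WW)
      then show ?thesis
        by (simp add: R(3) WW)
    qed
  qed
qed

text \<open>The two conditions say that R is the inverse of the identity minus
  \<open>Volterra q\<close>, and so determine it.\<close>

definition resol :: "H0 \<Rightarrow> (C \<times> C) \<Rightarrow>\<^sub>L (C \<times> C)" where
  "resol q = (SOME R. (\<forall>x. blinfun_apply R x = x + Volterra q (blinfun_apply R x)) \<and> (\<forall>x. blinfun_apply R (x - Volterra q x) = x))"

lemma resol: "blinfun_apply (resol q) x = x + Volterra q (blinfun_apply (resol q) x)"
  "blinfun_apply (resol q) (x - Volterra q x) = x"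
proof -
  obtain R where "bounded_linear R" "\<And>x. R x = x + Volterra q (R x)" "\<And>x. R (x - Volterra q x) = x"
    using Volterra_resolvent[of q] by metis
  then have "\<exists>R. (\<forall>x. blinfun_apply R x = x + Volterra q (blinfun_apply R x)) \<and> (\<forall>x. blinfun_apply R (x - Volterra q x) = x)"
    by (intro exI[of _ "Blinfun R"]) (simp add: bounded_linear_Blinfun_apply)
  from someI_ex[OF this] show "blinfun_apply (resol q) x = x + Volterra q (blinfun_apply (resol q) x)"
    "blinfun_apply (resol q) (x - Volterra q x) = x"
    unfolding resol_def by blast+
qed

text \<open>\<open>Volterra q\<close> is affine in q with linear part A, so \<open>- A q\<close> has
  the same increments as the identity minus \<open>Volterra q\<close>, and the resolvent identity
  applies. Smooth dependence of the solutions on the potential originates here.\<close>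

lemma ndf_resol: "ndf n UNIV resol"
proof -
  interpret mulH: bounded_bilinear mulH by (rule bounded_bilinear_mulH)
  define J where "J = Blinfun (\<lambda>w. (0, Iop w) :: C \<times> C)"
  have J: "blinfun_apply J w = (0, Iop w)" for w
    unfolding J_def
    by (subst bounded_linear_Blinfun_apply) (auto intro!: bounded_linear_Pair bounded_linear_Iop bounded_linear_zero)
  define A :: "H0 \<Rightarrow> (C \<times> C) \<Rightarrow>\<^sub>L (C \<times> C)" where "A = (\<lambda>q. J o\<^sub>L (mulH.prod_left q o\<^sub>L fst_blinfun))"
  have A: "bounded_linear A"
    unfolding A_def
    by (intro bounded_linear_compose[OF bounded_bilinear.bounded_linear_right[OF bounded_bilinear_blinfun_compose]]
        bounded_linear_compose[OF bounded_bilinear.bounded_linear_left[OF bounded_bilinear_blinfun_compose]]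
        mulH.bounded_linear_prod_left)
  have A_apply: "blinfun_apply (A q) z = (0, Iop (mulH (fst z) q))" for q z
    by (simp add: A_def J mulH.prod_left.rep_eq)
  have TA: "Volterra y z - Volterra x z = blinfun_apply (A (y - x)) z" for x y z
    by (simp add: Volterra_def A_apply mulH.diff_right linear_diff[OF bounded_linear.linear[OF bounded_linear_Iop]])
  show ?thesis
  proof (rule ndf_resolvent(1)[where a = "\<lambda>q. - A q" and a' = "\<lambda>_. Blinfun (\<lambda>q. - A q)", OF bounded_bilinear_blinfun_compose open_UNIV])
    have A': "bounded_linear (\<lambda>q. - A q)"
      using A by (rule bounded_linear_minus)
    show "ndf n UNIV (\<lambda>q. - A q)" for n
      by (rule ndf_bounded_linear[OF A'])
    show "((\<lambda>q. - A q) has_derivative blinfun_apply (Blinfun (\<lambda>q. - A q))) (at x)" for x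
      using bounded_linear_imp_has_derivative[OF A'] by (simp add: bounded_linear_Blinfun_apply[OF A'])
    show "ndf n UNIV (\<lambda>_. Blinfun (\<lambda>q. - A q))" for n
      by (rule ndf_const)
    fix x y
    have "blinfun_apply (resol y - resol x) z = blinfun_apply (resol y o\<^sub>L (A (y - x) o\<^sub>L resol x)) z" for z
    proof -
      define w where "w = blinfun_apply (resol x) z"
      have "z = w - Volterra x w"
        using resol(1)[of x z] by (simp add: w_def algebra_simps)
      also have "\<dots> = (w - Volterra y w) + blinfun_apply (A (y - x)) w"
        by (simp flip: TA)
      finally have "blinfun_apply (resol y) z = w + blinfun_apply (resol y) (blinfun_apply (A (y - x)) w)"
        using resol(2)[of y w] by (simp add: blinfun.add_right)
      then show ?thesis
        by (simp add: blinfun.diff_left w_def)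
    qed
    then have "resol y - resol x = resol y o\<^sub>L (A (y - x) o\<^sub>L resol x)"
      by (rule blinfun_eqI)
    moreover have "- A y - - A x = - A (y - x)"
      using linear_diff[OF bounded_linear.linear[OF A]] by simp
    moreover have "resol y o\<^sub>L (- A (y - x) o\<^sub>L resol x) = - (resol y o\<^sub>L (A (y - x) o\<^sub>L resol x))"
      by (intro blinfun_eqI) (simp add: blinfun.minus_left blinfun.minus_right)
    ultimately show "resol y - resol x = - (resol y o\<^sub>L (- A y - - A x o\<^sub>L resol x))"
      by simp
  qed
qed

subsection \<open>The fundamental matrix\<close>

text \<open>\<open>v1\<close> and \<open>v2\<close> are the solutions of v'' = q v with initial data
  (1, 0) and (0, 1); \<open>u1\<close> and \<open>u2\<close> are their derivatives.\<close>

definition v1 :: "H0 \<Rightarrow> C" where "v1 q = fst (blinfun_apply (resol q) (oneC, 0))"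
definition u1 :: "H0 \<Rightarrow> C" where "u1 q = snd (blinfun_apply (resol q) (oneC, 0))"
definition v2 :: "H0 \<Rightarrow> C" where "v2 q = fst (blinfun_apply (resol q) (0, oneC))"
definition u2 :: "H0 \<Rightarrow> C" where "u2 q = snd (blinfun_apply (resol q) (0, oneC))"

lemma vu_eqs: "v1 q = oneC + Iop (emb (u1 q))" "u1 q = Iop (mulH (v1 q) q)"
  "v2 q = Iop (emb (u2 q))" "u2 q = oneC + Iop (mulH (v2 q) q)"
proof -
  note a = resol(1)[of q "(oneC, 0)"] and b = resol(1)[of q "(0, oneC)"]
  show "v1 q = oneC + Iop (emb (u1 q))" "u1 q = Iop (mulH (v1 q) q)"
    unfolding v1_def u1_def
    by (rule trans[OF arg_cong[OF a, of fst]] trans[OF arg_cong[OF a, of snd]], simp add: Volterra_def)+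
  show "v2 q = Iop (emb (u2 q))" "u2 q = oneC + Iop (mulH (v2 q) q)"
    unfolding v2_def u2_def
    by (rule trans[OF arg_cong[OF b, of fst]] trans[OF arg_cong[OF b, of snd]], simp add: Volterra_def)+
qed

lemma ndf_vu: "ndf n S v1" "ndf n S u1" "ndf n S v2" "ndf n S u2"
proof -
  have *: "ndf n S (\<lambda>q. L (blinfun_apply (resol q) z))" if "bounded_linear L" for z and L :: "C \<times> C \<Rightarrow> C"
  proof -
    have "bounded_linear (\<lambda>R. L (blinfun_apply R z))"
      by (rule bounded_linear_compose[OF that blinfun.bounded_linear_left])
    then have "ndf n UNIV (\<lambda>q. L (blinfun_apply (resol q) z))"
      by (rule ndf_bounded_linear_compose) (rule ndf_resol)
    then show ?thesis by (rule ndf_subset) simp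
  qed
  show "ndf n S v1" "ndf n S u1" "ndf n S v2" "ndf n S u2"
    unfolding v1_def[abs_def] u1_def[abs_def] v2_def[abs_def] u2_def[abs_def]
    by (rule *[OF bounded_linear_fst] *[OF bounded_linear_snd])+
qed

lemma vu_0 [simp]: "apply_bcontfun (v1 q) 0 = 1" "apply_bcontfun (u1 q) 0 = 0"
  "apply_bcontfun (v2 q) 0 = 0" "apply_bcontfun (u2 q) 0 = 1"
  by (subst vu_eqs, simp)+

lemma vu_clip: "apply_bcontfun (v1 q) (clip t) = apply_bcontfun (v1 q) t" "apply_bcontfun (u1 q) (clip t) = apply_bcontfun (u1 q) t"
  "apply_bcontfun (v2 q) (clip t) = apply_bcontfun (v2 q) t" "apply_bcontfun (u2 q) (clip t) = apply_bcontfun (u2 q) t"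
  by (subst (1 2) vu_eqs, simp add: Iop_clip)+

lemma primitive_of_vu:
  "primitive_of (apply_bcontfun (u1 q)) (apply_bcontfun (v1 q))"
  "primitive_of (\<lambda>t. apply_bcontfun (v1 q) t * rep_H0 q t) (apply_bcontfun (u1 q))"
  "primitive_of (apply_bcontfun (u2 q)) (apply_bcontfun (v2 q))"
  "primitive_of (\<lambda>t. apply_bcontfun (v2 q) t * rep_H0 q t) (apply_bcontfun (u2 q))"
proof -
  have *: "primitive_of g (apply_bcontfun (oneC + Iop f))" if "square_integrable g" "AE t in leb. rep_H0 f t = g t" for f g
    using primitive_of_add[OF primitive_of_const[of 1] primitive_of_Iop'[OF that]] by simp
  show "primitive_of (apply_bcontfun (u1 q)) (apply_bcontfun (v1 q))"
    by (subst vu_eqs(1)) (rule *[OF square_integrable_C rep_emb])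
  show "primitive_of (\<lambda>t. apply_bcontfun (v1 q) t * rep_H0 q t) (apply_bcontfun (u1 q))"
    by (subst vu_eqs(2)) (rule primitive_of_Iop'[OF square_integrable_mulH rep_mulH])
  show "primitive_of (apply_bcontfun (u2 q)) (apply_bcontfun (v2 q))"
    by (subst vu_eqs(3)) (rule primitive_of_Iop'[OF square_integrable_C rep_emb])
  show "primitive_of (\<lambda>t. apply_bcontfun (v2 q) t * rep_H0 q t) (apply_bcontfun (u2 q))"
    by (subst vu_eqs(4)) (rule *[OF square_integrable_mulH rep_mulH])
qed

text \<open>The pair (V, U) minus its Volterra image is the constant vector of initial values. So
  (V, U) is the resolvent applied to this vector, and the resolvent is linear.\<close>

lemma solution_unique:
  assumes V: "primitive_of U V" and U: "primitive_of (\<lambda>t. V t * rep_H0 q t) U" and t: "t \<in> {0..2*pi}"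
  shows "V t = V 0 * apply_bcontfun (v1 q) t + U 0 * apply_bcontfun (v2 q) t"
    and "U t = V 0 * apply_bcontfun (u1 q) t + U 0 * apply_bcontfun (u2 q) t"
proof -
  note cV = primitive_of_continuous[OF V] and cU = primitive_of_continuous[OF U]
  define X where "X = (ext V, ext U)"
  have cl: "AE t in leb. clip t = t"
    by (rule AE_I2) simp
  have "ext V = V 0 *\<^sub>R oneC + Iop (emb (ext U))"
  proof (rule bcontfun_eqI)
    fix t
    have "AE t in leb. rep_H0 (emb (ext U)) t = U t"
      using rep_emb[of "ext U"] cl by eventually_elim (simp add: ext_apply[OF cU])
    from Iop_unique[OF V this] show "apply_bcontfun (ext V) t = apply_bcontfun (V 0 *\<^sub>R oneC + Iop (emb (ext U))) t"
      by (simp add: ext_apply[OF cV])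
  qed
  moreover have "ext U = U 0 *\<^sub>R oneC + Iop (mulH (ext V) q)"
  proof (rule bcontfun_eqI)
    fix t
    have "AE t in leb. rep_H0 (mulH (ext V) q) t = V t * rep_H0 q t"
      using rep_mulH[of "ext V" q] cl by eventually_elim (simp add: ext_apply[OF cV])
    from Iop_unique[OF U this] show "apply_bcontfun (ext U) t = apply_bcontfun (U 0 *\<^sub>R oneC + Iop (mulH (ext V) q)) t"
      by (simp add: ext_apply[OF cU])
  qed
  ultimately have "X - Volterra q X = V 0 *\<^sub>R (oneC, 0) + U 0 *\<^sub>R (0, oneC)"
    unfolding X_def Volterra_def by (metis (no_types, lifting) add_diff_cancel_right' diff_Pair fst_conv snd_conv
        add_Pair scaleR_Pair scaleR_zero_right add_0 add.right_neutral)
  then have "X = blinfun_apply (resol q) (V 0 *\<^sub>R (oneC, 0) + U 0 *\<^sub>R (0, oneC))"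
    by (metis resol(2))
  also have "\<dots> = V 0 *\<^sub>R blinfun_apply (resol q) (oneC, 0) + U 0 *\<^sub>R blinfun_apply (resol q) (0, oneC)"
    by (simp only: blinfun.add_right blinfun.scaleR_right)
  finally have X: "X = V 0 *\<^sub>R blinfun_apply (resol q) (oneC, 0) + U 0 *\<^sub>R blinfun_apply (resol q) (0, oneC)" .
  have "ext V = V 0 *\<^sub>R v1 q + U 0 *\<^sub>R v2 q"
    using arg_cong[OF X, of fst] by (simp only: X_def v1_def v2_def fst_conv fst_add fst_scaleR)
  then show "V t = V 0 * apply_bcontfun (v1 q) t + U 0 * apply_bcontfun (v2 q) t"
    using ext_apply[OF cV, of t] t by simp
  have "ext U = V 0 *\<^sub>R u1 q + U 0 *\<^sub>R u2 q"
    using arg_cong[OF X, of snd] by (simp only: X_def u1_def u2_def snd_conv snd_add snd_scaleR)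
  then show "U t = V 0 * apply_bcontfun (u1 q) t + U 0 * apply_bcontfun (u2 q) t"
    using ext_apply[OF cU, of t] t by simp
qed

lemma Wronskian: "apply_bcontfun (v1 q) t * apply_bcontfun (u2 q) t - apply_bcontfun (v2 q) t * apply_bcontfun (u1 q) t = 1"
proof -
  let ?v1 = "apply_bcontfun (v1 q)" and ?v2 = "apply_bcontfun (v2 q)" and ?u1 = "apply_bcontfun (u1 q)" and ?u2 = "apply_bcontfun (u2 q)"
  have "primitive_of (\<lambda>t. (?v1 t * (?v2 t * rep_H0 q t) + ?u1 t * ?u2 t) + -1 * (?v2 t * (?v1 t * rep_H0 q t) + ?u2 t * ?u1 t))
     (\<lambda>t. ?v1 t * ?u2 t + -1 * (?v2 t * ?u1 t))"
    by (intro primitive_of_add primitive_of_scale primitive_of_mult primitive_of_vu)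
  then have "primitive_of (\<lambda>_. 0) (\<lambda>t. ?v1 t * ?u2 t + -1 * (?v2 t * ?u1 t))"
    by (simp add: algebra_simps)
  from primitive_of_zero_imp_const[OF this clip(1)[of t]] show ?thesis
    by (simp add: vu_clip)
qed

text \<open>The squared radius of the planar curve \<open>(v1, v2)\<close>; \<open>pC\<close> below
  is half its derivative.\<close>

definition rhoC :: "H0 \<Rightarrow> C" where
  "rhoC q = mulC (v1 q) (v1 q) + mulC (v2 q) (v2 q)"

definition pC :: "H0 \<Rightarrow> C" where
  "pC q = mulC (v1 q) (u1 q) + mulC (v2 q) (u2 q)"

text \<open>The Wronskian excludes a common zero of \<open>v1\<close> and \<open>v2\<close>.
  Compactness of the interval turns positivity into a lower bound, which \<open>clip\<close> carries
  to the whole line.\<close>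

lemma rhoC_posC: "rhoC q \<in> posC"
proof -
  have c: "continuous_on {0..2*pi} (apply_bcontfun (rhoC q))" by simp
  have "{0..2*pi} \<noteq> {}" by simp
  then obtain s where s: "s \<in> {0..2*pi}" "\<And>t. t \<in> {0..2*pi} \<Longrightarrow> apply_bcontfun (rhoC q) s \<le> apply_bcontfun (rhoC q) t"
    using continuous_attains_inf[OF compact_Icc _ c] by blast
  have pos: "apply_bcontfun (rhoC q) s > 0"
  proof (rule ccontr)
    assume "\<not> apply_bcontfun (rhoC q) s > 0"
    then have "apply_bcontfun (v1 q) s * apply_bcontfun (v1 q) s + apply_bcontfun (v2 q) s * apply_bcontfun (v2 q) s \<le> 0"
      by (simp add: rhoC_def)
    then have "apply_bcontfun (v1 q) s = 0 \<and> apply_bcontfun (v2 q) s = 0"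
      by (simp add: sum_squares_le_zero_iff)
    then show False
      using Wronskian[of q s] by simp
  qed
  have cl: "apply_bcontfun (rhoC q) t = apply_bcontfun (rhoC q) (clip t)" for t
    by (simp add: rhoC_def vu_clip)
  show ?thesis
    unfolding posC_def
  proof (intro CollectI exI[of _ "apply_bcontfun (rhoC q) s"] conjI allI pos)
    show "apply_bcontfun (rhoC q) s \<le> apply_bcontfun (rhoC q) t" for t
      using s(2)[of "clip t"] cl[of t] by simp
  qed
qed

lemma rho_nonzero: "apply_bcontfun (rhoC q) t \<noteq> 0"
  by (rule posC_nonzero[OF rhoC_posC])

lemma rho_pos: "apply_bcontfun (rhoC q) t > 0"
  using rho_nonzero[of q t] by (simp add: rhoC_def sum_squares_gt_zero_iff)

lemma rhoC_clip: "apply_bcontfun (rhoC q) (clip t) = apply_bcontfun (rhoC q) t"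
  and pC_clip: "apply_bcontfun (pC q) (clip t) = apply_bcontfun (pC q) t"
  by (simp_all add: rhoC_def pC_def vu_clip)

lemma rhoC_0 [simp]: "apply_bcontfun (rhoC q) 0 = 1" and pC_0 [simp]: "apply_bcontfun (pC q) 0 = 0"
  by (simp_all add: rhoC_def pC_def)

lemma ndf_mulC: "ndf n S f \<Longrightarrow> ndf n S g \<Longrightarrow> ndf n S (\<lambda>x. mulC (f x) (g x))"
  by (rule bounded_bilinear.ndf_prod[OF bounded_bilinear_mulC])

lemma ndf_rhoC: "ndf n S rhoC"
  unfolding rhoC_def[abs_def] by (intro ndf_add ndf_mulC ndf_vu)

lemma ndf_pC: "ndf n S pC"
  unfolding pC_def[abs_def] by (intro ndf_add ndf_mulC ndf_vu)

lemma ndf_rec_rho: "ndf n S (\<lambda>q. recC (rhoC q))"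
  by (rule ndf_compose[OF ndf_rhoC ndf_recC]) (use rhoC_posC in blast)

section \<open>The solutions assembled into the fundamental matrix\<close>

definition PhiM :: "H0 \<Rightarrow> real \<Rightarrow> real^2^2" where
  "PhiM q t = matrix2 (apply_bcontfun (v1 q) t) (apply_bcontfun (v2 q) t) (apply_bcontfun (u1 q) t) (apply_bcontfun (u2 q) t)"

lemma matrix2_nth [simp]: "matrix2 a b c d $ 1 $ 1 = a" "matrix2 a b c d $ 1 $ 2 = b"
  "matrix2 a b c d $ 2 $ 1 = c" "matrix2 a b c d $ 2 $ 2 = d"
  by (simp_all add: matrix2_def)

lemma matrix2_eqI: "A $ 1 $ 1 = B $ 1 $ 1 \<Longrightarrow> A $ 1 $ 2 = B $ 1 $ 2 \<Longrightarrow> A $ 2 $ 1 = B $ 2 $ 1 \<Longrightarrow> A $ 2 $ 2 = B $ 2 $ 2 \<Longrightarrow> A = (B::real^2^2)"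
  by (simp add: vec_eq_iff forall_2)

lemma matrix2_mult: "matrix2 a b c d ** A = matrix2 (a * A $ 1 $ 1 + b * A $ 2 $ 1) (a * A $ 1 $ 2 + b * A $ 2 $ 2)
    (c * A $ 1 $ 1 + d * A $ 2 $ 1) (c * A $ 1 $ 2 + d * A $ 2 $ 2)"
  by (rule matrix2_eqI) (simp_all add: matrix_matrix_mult_def sum_2)

lemma matrix2_scaleR: "matrix2 a b c d = a *\<^sub>R matrix2 1 0 0 0 + b *\<^sub>R matrix2 0 1 0 0 + c *\<^sub>R matrix2 0 0 1 0 + d *\<^sub>R matrix2 0 0 0 1"
  by (rule matrix2_eqI) simp_all

lemma mat_1_matrix2: "mat 1 = matrix2 1 0 0 1"
  by (rule matrix2_eqI) (simp_all add: mat_def)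

lemma bounded_linear_entry: "bounded_linear (\<lambda>A::real^2^2. A $ i $ j)"
  by (rule bounded_linear_compose[OF bounded_linear_vec_nth bounded_linear_vec_nth])

lemma has_vector_derivative_matrix2:
  assumes "(a has_vector_derivative a') F" "(b has_vector_derivative b') F" "(c has_vector_derivative c') F" "(d has_vector_derivative d') F"
  shows "((\<lambda>t. matrix2 (a t) (b t) (c t) (d t)) has_vector_derivative matrix2 a' b' c' d') F"
proof -
  have *: "((\<lambda>t. f t *\<^sub>R A) has_vector_derivative f' *\<^sub>R A) F" if "(f has_vector_derivative f') F" for f f' and A :: "real^2^2"
    using bounded_linear.has_vector_derivative[OF bounded_linear_scaleR_left that] .
  show ?thesis
    by (subst (1 2) matrix2_scaleR) (intro has_vector_derivative_add * assms)
qed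

lemma fundamental_matrix_PhiM: "fundamental_matrix (rep_H0 q) (PhiM q)"
  unfolding fundamental_matrix_def
proof (intro conjI)
  have scale: "absolutely_continuous_on_interval 0 (2*pi) (\<lambda>t. f t *\<^sub>R A)"
    if "absolutely_continuous_on_interval 0 (2*pi) f" for f :: "real \<Rightarrow> real" and A :: "real^2^2"
    by (rule absolutely_continuous_bound[OF that that, where C = "norm A"]) (simp flip: scaleR_diff_left)
  have add: "absolutely_continuous_on_interval 0 (2*pi) (\<lambda>t. f t + g t)"
    if "absolutely_continuous_on_interval 0 (2*pi) f" "absolutely_continuous_on_interval 0 (2*pi) g" for f g :: "real \<Rightarrow> real^2^2"
    by (rule absolutely_continuous_bound[OF that, where C = 1]) (simp add: add_diff_add norm_triangle_ineq)
  have ac: "absolutely_continuous_on_interval 0 (2*pi) M" if "primitive_of g M" for g M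
    using that by (simp add: primitive_of_iff)
  show "absolutely_continuous_on_interval 0 (2 * pi) (PhiM q)"
    unfolding PhiM_def[abs_def] by (subst matrix2_scaleR) (intro add scale ac[OF primitive_of_vu(1)] ac[OF primitive_of_vu(2)]
      ac[OF primitive_of_vu(3)] ac[OF primitive_of_vu(4)])
  show "PhiM q 0 = mat 1"
    by (simp add: PhiM_def mat_1_matrix2)
  have d: "AE t in leb. (M has_vector_derivative g t) (at t within {0..2*pi})" if "primitive_of g M" for g M
    using that by (simp add: primitive_of_iff)
  show "AE t in leb. (PhiM q has_vector_derivative matrix2 0 1 (rep_H0 q t) 0 ** PhiM q t) (at t within {0..2 * pi})"
    using d[OF primitive_of_vu(1)[of q]] d[OF primitive_of_vu(2)[of q]] d[OF primitive_of_vu(3)[of q]] d[OF primitive_of_vu(4)[of q]]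
  proof eventually_elim
    case (elim t)
    from has_vector_derivative_matrix2[OF elim(1) elim(3) elim(2) elim(4)] show ?case
      by (simp add: matrix2_mult PhiM_def PhiM_def[abs_def] mult.commute)
  qed
qed

text \<open>Every column solves the integrated system with initial data (1, 0) or (0, 1), to which
  \<open>solution_unique\<close> applies.\<close>

lemma fundamental_matrix_unique:
  assumes Phi: "fundamental_matrix (rep_H0 q) \<Phi>" and t: "t \<in> {0..2*pi}"
  shows "\<Phi> t = PhiM q t"
proof -
  let ?e = "\<lambda>i j t. \<Phi> t $ i $ j"
  have ac: "absolutely_continuous_on_interval 0 (2*pi) \<Phi>" and d: "AE t in leb. (\<Phi> has_vector_derivative (matrix2 0 1 (rep_H0 q t) 0 ** \<Phi> t)) (at t within {0..2*pi})"
    and i: "\<Phi> 0 = mat 1"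
    using Phi by (auto simp: fundamental_matrix_def)
  have ace: "absolutely_continuous_on_interval 0 (2*pi) (?e i j)" for i j
  proof (rule absolutely_continuous_bound[OF ac ac, where C = 1])
    fix u v
    have "norm (?e i j v - ?e i j u) = norm ((\<Phi> v - \<Phi> u) $ i $ j)" by simp
    also have "\<dots> \<le> norm (\<Phi> v - \<Phi> u)"
      using Finite_Cartesian_Product.norm_nth_le[of "(\<Phi> v - \<Phi> u) $ i" j] Finite_Cartesian_Product.norm_nth_le[of "\<Phi> v - \<Phi> u" i] by linarith
    finally show "norm (?e i j v - ?e i j u) \<le> 1 * (norm (\<Phi> v - \<Phi> u) + norm (\<Phi> v - \<Phi> u))"
      by (rule order_trans) simp
  qed
  note ce = absolutely_continuous_imp_continuous[OF ace]
  have de: "AE t in leb. (?e i j has_vector_derivative (matrix2 0 1 (rep_H0 q t) 0 ** \<Phi> t) $ i $ j) (at t within {0..2*pi})" for i j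
    using d by eventually_elim (rule bounded_linear.has_vector_derivative[OF bounded_linear_entry])
  have mm: "(matrix2 0 1 c 0 ** A) $ 1 $ j = A $ 2 $ j" "(matrix2 0 1 c 0 ** A) $ 2 $ j = A $ 1 $ j * c" for c A j
    by (simp_all add: matrix_matrix_mult_def sum_2)
  have p1: "primitive_of (?e 2 j) (?e 1 j)" for j
    unfolding primitive_of_iff using ace square_integrable_continuous[OF ce] de[of 1 j] by (simp add: mm)
  have p2: "primitive_of (\<lambda>t. ?e 1 j t * rep_H0 q t) (?e 2 j)" for j
    unfolding primitive_of_iff using ace square_integrable_continuous_mult[OF ce square_integrable_rep] de[of 2 j] by (simp add: mm)
  show ?thesis
    using solution_unique[OF p1[of 1] p2[of 1] t] solution_unique[OF p1[of 2] p2[of 2] t]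
    by (intro matrix2_eqI) (simp_all add: i mat_def PhiM_def)
qed

subsection \<open>The Kepler transform\<close>

definition Jop :: "H0 \<Rightarrow> C" where
  "Jop f = Iop (emb (Iop f))"

lemma bounded_linear_Jop: "bounded_linear Jop"
  unfolding Jop_def[abs_def]
  by (intro bounded_linear_compose[OF bounded_linear_Iop] bounded_linear_compose[OF bounded_linear_emb] bounded_linear_Iop)

text \<open>Writing \<open>w = Jop f\<close>, so that \<open>w'' = f\<close>, the potential is \<open>- w''/2 + (w')\<^sup>2/4 - exp (2 w)\<close>: a planar
  solution \<open>(v1, v2)\<close> with Wronskian 1 has squared radius \<open>exp (- w)\<close> and, by Kepler's second law,
  angular velocity \<open>exp w\<close>.\<close>

definition Kepler :: "H0 \<Rightarrow> H0" where
  "Kepler f = - (1/2) *\<^sub>R f + emb ((1/4) *\<^sub>R mulC (Iop f) (Iop f) - expC (2 *\<^sub>R Jop f))"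

text \<open>With \<rho> the squared radius, w = - ln \<rho> and \<rho>' = 2 p, this is w'.\<close>

definition bC :: "H0 \<Rightarrow> C" where
  "bC q = - 2 *\<^sub>R mulC (pC q) (recC (rhoC q))"

text \<open>Solving the Kepler formula for w'' gives w'' = - 2 q + (w')^2 / 2 - 2 exp (2 w), here
  with exp w = 1 / \<rho>.\<close>

definition Kepler_inv :: "H0 \<Rightarrow> H0" where
  "Kepler_inv q = - 2 *\<^sub>R q + emb ((1/2) *\<^sub>R mulC (bC q) (bC q) - 2 *\<^sub>R mulC (recC (rhoC q)) (recC (rhoC q)))"

definition thetaC :: "H0 \<Rightarrow> C" where
  "thetaC f = Iop (emb (expC (Jop f)))"

lemma rep_Kepler: "AE t in leb. rep_H0 (Kepler f) t =
   - (1/2) * rep_H0 f t + (1/4) * (apply_bcontfun (Iop f) t)\<^sup>2 - exp (2 * apply_bcontfun (Jop f) t)"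
  unfolding Kepler_def
  using rep_H0_add[of "- (1/2) *\<^sub>R f" "emb ((1/4) *\<^sub>R mulC (Iop f) (Iop f) - expC (2 *\<^sub>R Jop f))"]
    rep_H0_scaleR[of "- (1/2)" f] rep_emb[of "(1/4) *\<^sub>R mulC (Iop f) (Iop f) - expC (2 *\<^sub>R Jop f)"]
  by eventually_elim (simp add: power2_eq_square)

lemma rep_Kepler_inv: "AE t in leb. rep_H0 (Kepler_inv q) t =
   - 2 * rep_H0 q t + (1/2) * (apply_bcontfun (bC q) t)\<^sup>2 - 2 * (1 / apply_bcontfun (rhoC q) t)\<^sup>2"
  unfolding Kepler_inv_def
  using rep_H0_add[of "- 2 *\<^sub>R q" "emb ((1/2) *\<^sub>R mulC (bC q) (bC q) - 2 *\<^sub>R mulC (recC (rhoC q)) (recC (rhoC q)))"]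
    rep_H0_scaleR[of "- 2" q] rep_emb[of "(1/2) *\<^sub>R mulC (bC q) (bC q) - 2 *\<^sub>R mulC (recC (rhoC q)) (recC (rhoC q))"]
  by eventually_elim (simp add: power2_eq_square recC_apply[OF rhoC_posC])

lemma ndf_emb: "ndf n S f \<Longrightarrow> ndf n S (\<lambda>x. emb (f x))"
  by (rule ndf_bounded_linear_compose[OF bounded_linear_emb])

lemma ndf_Iop: "ndf n S f \<Longrightarrow> ndf n S (\<lambda>x. Iop (f x))"
  by (rule ndf_bounded_linear_compose[OF bounded_linear_Iop])

lemma ndf_scaleR_const: "ndf n S f \<Longrightarrow> ndf n S (\<lambda>x. c *\<^sub>R f x)"
  by (rule ndf_bounded_linear_compose[OF bounded_linear_scaleR_right])

lemma ndf_exp: "ndf n S f \<Longrightarrow> ndf n S (\<lambda>x. expC (f x))"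
  by (rule ndf_compose[OF _ ndf_expC[of n UNIV]]) auto

lemma ndf_id: "ndf n S (\<lambda>x. x)"
  by (rule ndf_bounded_linear[OF bounded_linear_ident])

lemma ndf_Jop: "ndf n S f \<Longrightarrow> ndf n S (\<lambda>x. Jop (f x))"
  by (rule ndf_bounded_linear_compose[OF bounded_linear_Jop])

lemma ndf_Kepler: "ndf n S Kepler"
  unfolding Kepler_def[abs_def]
  by (intro ndf_add ndf_scaleR_const ndf_id ndf_emb ndf_diff ndf_mulC ndf_Iop ndf_exp ndf_Jop)

lemma ndf_Kepler_inv: "ndf n S Kepler_inv"
  unfolding Kepler_inv_def[abs_def] bC_def[abs_def]
  by (intro ndf_add ndf_scaleR_const ndf_id ndf_emb ndf_diff ndf_mulC ndf_rec_rho ndf_pC)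

text \<open>The polar expressions satisfy the system by the product rule, with w' = a, w'' = f and
  \<theta>' = exp w. Their initial values are those of the fundamental system, so uniqueness
  identifies them.\<close>

lemma Kepler_solution:
  fixes f :: H0
  defines "w \<equiv> apply_bcontfun (Jop f)" and "a \<equiv> apply_bcontfun (Iop f)" and "\<theta> \<equiv> apply_bcontfun (thetaC f)"
  assumes t: "t \<in> {0..2*pi}"
  shows "apply_bcontfun (v1 (Kepler f)) t = exp (- w t / 2) * cos (\<theta> t)"
    "apply_bcontfun (v2 (Kepler f)) t = exp (- w t / 2) * sin (\<theta> t)"
    "apply_bcontfun (u1 (Kepler f)) t = exp (- w t / 2) * (- a t / 2 * cos (\<theta> t) - exp (w t) * sin (\<theta> t))"
    "apply_bcontfun (u2 (Kepler f)) t = exp (- w t / 2) * (- a t / 2 * sin (\<theta> t) + exp (w t) * cos (\<theta> t))"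
proof -
  have pa: "primitive_of (rep_H0 f) a"
    unfolding a_def by (rule primitive_of_Iop)
  have pw: "primitive_of a w"
    unfolding w_def a_def Jop_def by (rule primitive_of_Iop'[OF square_integrable_C rep_emb])
  have p\<theta>: "primitive_of (\<lambda>t. exp (w t)) \<theta>"
    unfolding \<theta>_def thetaC_def w_def
    using primitive_of_Iop'[OF square_integrable_C rep_emb, of "expC (Jop f)"] by simp
  have pr: "primitive_of (\<lambda>t. exp (- w t / 2) * (- (1/2) * a t)) (\<lambda>t. exp (- w t / 2))"
  proof -
    have "primitive_of (\<lambda>t. exp (- (1/2) * w t) * (- (1/2) * a t)) (\<lambda>t. exp (- (1/2) * w t))"
      by (rule primitive_of_compose[OF primitive_of_scale[OF pw], where S = UNIV]) (auto intro!: continuous_intros DERIV_exp)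
    then show ?thesis by simp
  qed
  have pe: "primitive_of (\<lambda>t. exp (w t) * a t) (\<lambda>t. exp (w t))"
    by (rule primitive_of_compose[OF pw, where S = UNIV]) (auto intro!: continuous_intros DERIV_exp)
  have pc: "primitive_of (\<lambda>t. - sin (\<theta> t) * exp (w t)) (\<lambda>t. cos (\<theta> t))"
    by (rule primitive_of_compose[OF p\<theta>, where S = UNIV]) (auto intro!: continuous_intros DERIV_cos)
  have ps: "primitive_of (\<lambda>t. cos (\<theta> t) * exp (w t)) (\<lambda>t. sin (\<theta> t))"
    by (rule primitive_of_compose[OF p\<theta>, where S = UNIV]) (auto intro!: continuous_intros DERIV_sin)
  define V1 where "V1 = (\<lambda>t. exp (- w t / 2) * cos (\<theta> t))"
  define V2 where "V2 = (\<lambda>t. exp (- w t / 2) * sin (\<theta> t))"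
  define U1 where "U1 = (\<lambda>t. exp (- w t / 2) * (- (1/2) * (a t * cos (\<theta> t)) + -1 * (exp (w t) * sin (\<theta> t))))"
  define U2 where "U2 = (\<lambda>t. exp (- w t / 2) * (- (1/2) * (a t * sin (\<theta> t)) + exp (w t) * cos (\<theta> t)))"
  have V1: "primitive_of U1 V1"
  proof -
    have "primitive_of (\<lambda>t. exp (- w t / 2) * (- sin (\<theta> t) * exp (w t)) + exp (- w t / 2) * (- (1/2) * a t) * cos (\<theta> t)) V1"
      unfolding V1_def by (rule primitive_of_mult[OF pr pc])
    moreover have "(\<lambda>t. exp (- w t / 2) * (- sin (\<theta> t) * exp (w t)) + exp (- w t / 2) * (- (1/2) * a t) * cos (\<theta> t)) = U1"
      by (auto simp: U1_def algebra_simps)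
    ultimately show ?thesis by simp
  qed
  have V2: "primitive_of U2 V2"
  proof -
    have "primitive_of (\<lambda>t. exp (- w t / 2) * (cos (\<theta> t) * exp (w t)) + exp (- w t / 2) * (- (1/2) * a t) * sin (\<theta> t)) V2"
      unfolding V2_def by (rule primitive_of_mult[OF pr ps])
    moreover have "(\<lambda>t. exp (- w t / 2) * (cos (\<theta> t) * exp (w t)) + exp (- w t / 2) * (- (1/2) * a t) * sin (\<theta> t)) = U2"
      by (auto simp: U2_def algebra_simps)
    ultimately show ?thesis by simp
  qed
  have cV: "continuous_on {0..2*pi} V1" "continuous_on {0..2*pi} V2"
    by (rule primitive_of_continuous[OF V1] primitive_of_continuous[OF V2])+
  note sqV = square_integrable_continuous_mult[OF cV(1) square_integrable_rep, of "Kepler f"]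
    square_integrable_continuous_mult[OF cV(2) square_integrable_rep, of "Kepler f"]
  have K: "AE t in leb. rep_H0 (Kepler f) t = - (1/2) * rep_H0 f t + (1/4) * (a t)\<^sup>2 - (exp (w t))\<^sup>2"
    using rep_Kepler[of f] by eventually_elim (simp add: a_def w_def exp_double)
  have U1: "primitive_of (\<lambda>t. V1 t * rep_H0 (Kepler f) t) U1"
  proof (rule primitive_of_cong[OF _ _ sqV(1)])
    show "primitive_of (\<lambda>t. exp (- w t / 2) * (- (1/2) * (a t * (- sin (\<theta> t) * exp (w t)) + rep_H0 f t * cos (\<theta> t))
          + -1 * (exp (w t) * (cos (\<theta> t) * exp (w t)) + exp (w t) * a t * sin (\<theta> t)))
        + exp (- w t / 2) * (- (1/2) * a t) * (- (1/2) * (a t * cos (\<theta> t)) + -1 * (exp (w t) * sin (\<theta> t)))) U1"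
      unfolding U1_def
      by (intro primitive_of_mult[OF pr] primitive_of_add primitive_of_scale primitive_of_mult[OF pa pc] primitive_of_mult[OF pe ps])
    \<comment> \<open>The terms with sin \<theta> cancel because r^2 \<theta>' is constant; what
      remains is radial and matches the potential.\<close>
    show "AE t in leb. exp (- w t / 2) * (- (1/2) * (a t * (- sin (\<theta> t) * exp (w t)) + rep_H0 f t * cos (\<theta> t))
          + -1 * (exp (w t) * (cos (\<theta> t) * exp (w t)) + exp (w t) * a t * sin (\<theta> t)))
        + exp (- w t / 2) * (- (1/2) * a t) * (- (1/2) * (a t * cos (\<theta> t)) + -1 * (exp (w t) * sin (\<theta> t)))
       = V1 t * rep_H0 (Kepler f) t"
      using K
    proof eventually_elim
      case (elim t)
      show ?case
        unfolding elim V1_def by (simp add: algebra_simps power2_eq_square)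
    qed
  qed simp
  have U2: "primitive_of (\<lambda>t. V2 t * rep_H0 (Kepler f) t) U2"
  proof (rule primitive_of_cong[OF _ _ sqV(2)])
    show "primitive_of (\<lambda>t. exp (- w t / 2) * (- (1/2) * (a t * (cos (\<theta> t) * exp (w t)) + rep_H0 f t * sin (\<theta> t))
          + (exp (w t) * (- sin (\<theta> t) * exp (w t)) + exp (w t) * a t * cos (\<theta> t)))
        + exp (- w t / 2) * (- (1/2) * a t) * (- (1/2) * (a t * sin (\<theta> t)) + exp (w t) * cos (\<theta> t))) U2"
      unfolding U2_def
      by (intro primitive_of_mult[OF pr] primitive_of_add primitive_of_scale primitive_of_mult[OF pa ps] primitive_of_mult[OF pe pc])
    show "AE t in leb. exp (- w t / 2) * (- (1/2) * (a t * (cos (\<theta> t) * exp (w t)) + rep_H0 f t * sin (\<theta> t))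
          + (exp (w t) * (- sin (\<theta> t) * exp (w t)) + exp (w t) * a t * cos (\<theta> t)))
        + exp (- w t / 2) * (- (1/2) * a t) * (- (1/2) * (a t * sin (\<theta> t)) + exp (w t) * cos (\<theta> t))
       = V2 t * rep_H0 (Kepler f) t"
      using K
    proof eventually_elim
      case (elim t)
      show ?case
        unfolding elim V2_def by (simp add: algebra_simps power2_eq_square)
    qed
  qed simp
  have "V1 0 = 1" "V2 0 = 0" "U1 0 = 0" "U2 0 = 1"
    by (simp_all add: V1_def V2_def U1_def U2_def w_def a_def \<theta>_def Jop_def thetaC_def)
  then show "apply_bcontfun (v1 (Kepler f)) t = exp (- w t / 2) * cos (\<theta> t)"
    "apply_bcontfun (v2 (Kepler f)) t = exp (- w t / 2) * sin (\<theta> t)"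
    "apply_bcontfun (u1 (Kepler f)) t = exp (- w t / 2) * (- a t / 2 * cos (\<theta> t) - exp (w t) * sin (\<theta> t))"
    "apply_bcontfun (u2 (Kepler f)) t = exp (- w t / 2) * (- a t / 2 * sin (\<theta> t) + exp (w t) * cos (\<theta> t))"
    using solution_unique[OF V1 U1 t] solution_unique[OF V2 U2 t]
    by (simp_all add: V1_def V2_def U1_def U2_def)
qed

text \<open>In polar form the squared radius is exp (- w) and \<open>pC\<close> is - w' / 2 times
  it, so \<open>bC\<close> returns w', after which the formulas for q and for w'' cancel.\<close>

lemma Kepler_inv_Kepler: "Kepler_inv (Kepler f) = f"
proof -
  let ?q = "Kepler f"
  have rho: "apply_bcontfun (rhoC ?q) t = exp (- apply_bcontfun (Jop f) t)"
    and p: "apply_bcontfun (pC ?q) t = exp (- apply_bcontfun (Jop f) t) * (- apply_bcontfun (Iop f) t / 2)" for t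
  proof -
    define s where "s = clip t"
    have s: "s \<in> {0..2*pi}" by (simp add: s_def)
    define w a \<theta> where "w = apply_bcontfun (Jop f) s" and "a = apply_bcontfun (Iop f) s" and "\<theta> = apply_bcontfun (thetaC f) s"
    have alg1: "E * x * (E * x) + E * y * (E * y) = (E * E) * (x\<^sup>2 + y\<^sup>2)"
      and alg2: "E * x * (E * (- a / 2 * x - e * y)) + E * y * (E * (- a / 2 * y + e * x)) = (E * E) * (- a / 2) * (x\<^sup>2 + y\<^sup>2)"
      for E x y a e :: real
      by (simp_all add: field_simps power2_eq_square)
    note sol = Kepler_solution[OF s, of f, folded w_def a_def \<theta>_def]
    have e: "exp (- w / 2) * exp (- w / 2) = exp (- w)"
      by (simp flip: exp_add)
    have "exp (- w / 2) * cos \<theta> * (exp (- w / 2) * cos \<theta>) + exp (- w / 2) * sin \<theta> * (exp (- w / 2) * sin \<theta>)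
       = (exp (- w / 2) * exp (- w / 2)) * ((cos \<theta>)\<^sup>2 + (sin \<theta>)\<^sup>2)"
      by (rule alg1)
    then have "apply_bcontfun (rhoC ?q) s = exp (- w)"
      by (simp only: rhoC_def plus_bcontfun.rep_eq mulC_apply sol e) simp
    then show "apply_bcontfun (rhoC ?q) t = exp (- apply_bcontfun (Jop f) t)"
      by (simp add: s_def w_def rhoC_def vu_clip Jop_def Iop_clip)
    have "exp (- w / 2) * cos \<theta> * (exp (- w / 2) * (- a / 2 * cos \<theta> - exp w * sin \<theta>)) +
        exp (- w / 2) * sin \<theta> * (exp (- w / 2) * (- a / 2 * sin \<theta> + exp w * cos \<theta>))
       = (exp (- w / 2) * exp (- w / 2)) * (- a / 2) * ((cos \<theta>)\<^sup>2 + (sin \<theta>)\<^sup>2)"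
      by (rule alg2)
    then have "apply_bcontfun (pC ?q) s = exp (- w) * (- a / 2)"
      by (simp only: pC_def plus_bcontfun.rep_eq mulC_apply sol e) simp
    then show "apply_bcontfun (pC ?q) t = exp (- apply_bcontfun (Jop f) t) * (- apply_bcontfun (Iop f) t / 2)"
      by (simp add: s_def w_def a_def pC_def vu_clip Jop_def Iop_clip)
  qed
  have b: "bC ?q = Iop f"
    by (intro bcontfun_eqI) (simp add: bC_def p rho recC_apply[OF rhoC_posC])
  show ?thesis
  proof (rule H0_eqI)
    show "AE t in leb. rep_H0 (Kepler_inv ?q) t = rep_H0 f t"
      using rep_Kepler_inv[of ?q] rep_Kepler[of f]
      by eventually_elim (simp add: b rho exp_minus exp_double power_divide field_simps)
  qed
qed

text \<open>Differentiating w' = - 2 p / \<rho> must give the formula of \<open>Kepler_inv\<close>.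
  The derivative of p contains the squared speed of the curve, which the Wronskian expresses through
  p and \<rho>.\<close>

lemma Iop_Kepler_inv: "Iop (Kepler_inv q) = bC q"
proof -
  let ?v1 = "apply_bcontfun (v1 q)" and ?v2 = "apply_bcontfun (v2 q)" and ?u1 = "apply_bcontfun (u1 q)" and ?u2 = "apply_bcontfun (u2 q)"
  let ?rho = "apply_bcontfun (rhoC q)" and ?p = "apply_bcontfun (pC q)" and ?q = "rep_H0 q"
  have prho: "primitive_of (\<lambda>t. 2 * ?p t) ?rho"
  proof -
    have "primitive_of (\<lambda>t. (?v1 t * ?u1 t + ?u1 t * ?v1 t) + (?v2 t * ?u2 t + ?u2 t * ?v2 t)) (\<lambda>t. ?v1 t * ?v1 t + ?v2 t * ?v2 t)"
      by (intro primitive_of_add primitive_of_mult primitive_of_vu)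
    then show ?thesis
      by (simp add: rhoC_def pC_def algebra_simps)
  qed
  have pp: "primitive_of (\<lambda>t. (?v1 t * (?v1 t * ?q t) + ?u1 t * ?u1 t) + (?v2 t * (?v2 t * ?q t) + ?u2 t * ?u2 t)) ?p"
  proof -
    have "primitive_of (\<lambda>t. (?v1 t * (?v1 t * ?q t) + ?u1 t * ?u1 t) + (?v2 t * (?v2 t * ?q t) + ?u2 t * ?u2 t)) (\<lambda>t. ?v1 t * ?u1 t + ?v2 t * ?u2 t)"
      by (intro primitive_of_add primitive_of_mult primitive_of_vu)
    then show ?thesis
      by (simp add: pC_def)
  qed
  have pinv: "primitive_of (\<lambda>t. (- (1 / (?rho t)\<^sup>2)) * (2 * ?p t)) (\<lambda>t. 1 / ?rho t)"
  proof (rule primitive_of_compose[OF prho, where S = "{0<..}"])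
    show "((\<lambda>x. 1 / x) has_real_derivative - (1 / x\<^sup>2)) (at x)" if "x \<in> {0<..}" for x :: real
      using that by (auto intro!: derivative_eq_intros simp: power2_eq_square)
  qed (auto simp: rho_pos intro!: continuous_intros)
  have "primitive_of (\<lambda>t. -2 * (?p t * ((- (1 / (?rho t)\<^sup>2)) * (2 * ?p t)) +
      ((?v1 t * (?v1 t * ?q t) + ?u1 t * ?u1 t) + (?v2 t * (?v2 t * ?q t) + ?u2 t * ?u2 t)) * (1 / ?rho t))) (\<lambda>t. -2 * (?p t * (1 / ?rho t)))"
    by (intro primitive_of_scale primitive_of_mult[OF pp pinv])
  then have pb: "primitive_of (\<lambda>t. -2 * (?p t * ((- (1 / (?rho t)\<^sup>2)) * (2 * ?p t)) +
      ((?v1 t * (?v1 t * ?q t) + ?u1 t * ?u1 t) + (?v2 t * (?v2 t * ?q t) + ?u2 t * ?u2 t)) * (1 / ?rho t))) (apply_bcontfun (bC q))"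
    by (simp add: bC_def recC_apply[OF rhoC_posC])
  have ae: "AE t in leb. rep_H0 (Kepler_inv q) t = -2 * (?p t * ((- (1 / (?rho t)\<^sup>2)) * (2 * ?p t)) +
      ((?v1 t * (?v1 t * ?q t) + ?u1 t * ?u1 t) + (?v2 t * (?v2 t * ?q t) + ?u2 t * ?u2 t)) * (1 / ?rho t))"
    using rep_Kepler_inv[of q]
  proof eventually_elim
    case (elim t)
    define r where "r = ?rho t"
    have r: "r \<noteq> 0" using rho_nonzero by (simp add: r_def)
    have r': "r = ?v1 t * ?v1 t + ?v2 t * ?v2 t"
      by (simp add: r_def rhoC_def)
    define p where "p = ?p t"
    have p: "p = ?v1 t * ?u1 t + ?v2 t * ?u2 t"
      by (simp add: p_def pC_def)
    have W: "?v1 t * ?u2 t - ?v2 t * ?u1 t = 1" by (rule Wronskian)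
    \<comment> \<open>Lagrange's identity for the vectors \<open>(v1, v2)\<close> and
      \<open>(u1, u2)\<close>.\<close>
    have "(?u1 t * ?u1 t + ?u2 t * ?u2 t) * r = p\<^sup>2 + (?v1 t * ?u2 t - ?v2 t * ?u1 t)\<^sup>2"
      unfolding r' p by (simp add: algebra_simps power2_eq_square)
    then have "(?u1 t * ?u1 t + ?u2 t * ?u2 t) * r = p\<^sup>2 + 1"
      unfolding W by simp
    then have key: "?u1 t * ?u1 t + ?u2 t * ?u2 t = (p\<^sup>2 + 1) / r"
      using r by (simp add: eq_divide_eq)
    have "(?v1 t * (?v1 t * ?q t) + ?u1 t * ?u1 t) + (?v2 t * (?v2 t * ?q t) + ?u2 t * ?u2 t) = r * ?q t + (p\<^sup>2 + 1) / r"
    proof -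
      have "(?v1 t * (?v1 t * ?q t) + ?u1 t * ?u1 t) + (?v2 t * (?v2 t * ?q t) + ?u2 t * ?u2 t)
          = (?v1 t * ?v1 t + ?v2 t * ?v2 t) * ?q t + (?u1 t * ?u1 t + ?u2 t * ?u2 t)"
        by (simp add: algebra_simps)
      then show ?thesis
        unfolding key r'[symmetric] .
    qed
    then have "-2 * (p * ((- (1 / r\<^sup>2)) * (2 * p)) +
      ((?v1 t * (?v1 t * ?q t) + ?u1 t * ?u1 t) + (?v2 t * (?v2 t * ?q t) + ?u2 t * ?u2 t)) * (1 / r))
      = -2 * (p * ((- (1 / r\<^sup>2)) * (2 * p)) + (r * ?q t + (p\<^sup>2 + 1) / r) * (1 / r))"
      by simp
    also have "\<dots> = - 2 * ?q t + (1/2) * (-2 * (p * (1 / r)))\<^sup>2 - 2 * (1 / r)\<^sup>2"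
      using r by (simp add: field_simps power2_eq_square)
    finally show ?case
      using elim by (simp add: bC_def recC_apply[OF rhoC_posC] flip: r_def p_def)
  qed
  show ?thesis
  proof (rule bcontfun_eqI)
    fix t
    have "apply_bcontfun (bC q) 0 = 0" "apply_bcontfun (bC q) (clip t) = apply_bcontfun (bC q) t"
      by (simp_all add: bC_def recC_apply[OF rhoC_posC] rhoC_clip pC_clip)
    then show "apply_bcontfun (Iop (Kepler_inv q)) t = apply_bcontfun (bC q) t"
      using Iop_unique[OF pb ae, of t] by simp
  qed
qed

text \<open>Both sides vanish at 0, where \<rho> = 1, and both have derivative
  \<open>bC q\<close>.\<close>

lemma Jop_Kepler_inv: "apply_bcontfun (Jop (Kepler_inv q)) t = - ln (apply_bcontfun (rhoC q) t)"
proof -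
  let ?v1 = "apply_bcontfun (v1 q)" and ?v2 = "apply_bcontfun (v2 q)" and ?u1 = "apply_bcontfun (u1 q)" and ?u2 = "apply_bcontfun (u2 q)"
  let ?rho = "apply_bcontfun (rhoC q)" and ?p = "apply_bcontfun (pC q)"
  have prho: "primitive_of (\<lambda>t. 2 * ?p t) ?rho"
  proof -
    have "primitive_of (\<lambda>t. (?v1 t * ?u1 t + ?u1 t * ?v1 t) + (?v2 t * ?u2 t + ?u2 t * ?v2 t)) (\<lambda>t. ?v1 t * ?v1 t + ?v2 t * ?v2 t)"
      by (intro primitive_of_add primitive_of_mult primitive_of_vu)
    then show ?thesis
      by (simp add: rhoC_def pC_def algebra_simps)
  qed
  have "primitive_of (\<lambda>t. (- (1 / ?rho t)) * (2 * ?p t)) (\<lambda>t. - ln (?rho t))"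
  proof (rule primitive_of_compose[OF prho, where S = "{0<..}"])
    show "((\<lambda>x. - ln x) has_real_derivative - (1 / x)) (at x)" if "x \<in> {0<..}" for x :: real
      using that by (auto intro!: derivative_eq_intros simp: field_simps)
  qed (auto simp: rho_pos intro!: continuous_intros)
  moreover have "AE t in leb. rep_H0 (emb (bC q)) t = (- (1 / ?rho t)) * (2 * ?p t)"
    using rep_emb[of "bC q"] by eventually_elim (simp add: bC_def recC_apply[OF rhoC_posC])
  ultimately have "apply_bcontfun (Iop (emb (bC q))) t = - ln (?rho (clip t)) - - ln (?rho 0)"
    by (rule Iop_unique)
  then show ?thesis
    by (simp add: Jop_def Iop_Kepler_inv rhoC_clip)
qed

lemma Kepler_Kepler_inv: "Kepler (Kepler_inv q) = q"
proof (rule H0_eqI)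
  have alg: "- (1 / 2) * (- 2 * a + 1 / 2 * b - 2 * c) + 1 / 4 * b - c = a" for a b c :: real
    by (simp add: field_simps)
  show "AE t in leb. rep_H0 (Kepler (Kepler_inv q)) t = rep_H0 q t"
    using rep_Kepler[of "Kepler_inv q"] rep_Kepler_inv[of q]
  proof eventually_elim
    case (elim t)
    have "exp (2 * - ln (apply_bcontfun (rhoC q) t)) = (1 / apply_bcontfun (rhoC q) t)\<^sup>2"
      using rho_pos[of q t] by (simp add: exp_double exp_minus power_one_over inverse_eq_divide)
    then show ?case
      unfolding elim Iop_Kepler_inv Jop_Kepler_inv by (simp only: alg)
  qed
qed

subsection \<open>Lifting to a covering space\<close>

text \<open>The lifting theorems of the library require the total space to lie in a normed space.\<close>

lemma covering_lift_unique:
  fixes p :: "'g::topological_space \<Rightarrow> 'b::topological_space" and g1 g2 :: "'a::topological_space \<Rightarrow> 'g"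
  assumes cov: "covering_space c p S" and T: "connected T"
    and g1: "continuous_on T g1" "g1 ` T \<subseteq> c" and g2: "continuous_on T g2" "g2 ` T \<subseteq> c"
    and eq: "\<And>x. x \<in> T \<Longrightarrow> p (g1 x) = p (g2 x)" and a: "a \<in> T" "g1 a = g2 a" and x: "x \<in> T"
  shows "g1 x = g2 x"
proof -
  define E where "E = {x \<in> T. g1 x = g2 x}"
  have pre: "openin (top_of_set T) (T \<inter> g1 -` U \<inter> g2 -` V)"
    if "openin (top_of_set c) U" "openin (top_of_set c) V" for U V
  proof -
    have "openin (top_of_set T) (T \<inter> g1 -` U)" "openin (top_of_set T) (T \<inter> g2 -` V)"
      using continuous_openin_preimage[OF g1(1) _ that(1)] continuous_openin_preimage[OF g2(1) _ that(2)] g1(2) g2(2) by auto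
    moreover have "T \<inter> g1 -` U \<inter> g2 -` V = (T \<inter> g1 -` U) \<inter> (T \<inter> g2 -` V)" by auto
    ultimately show ?thesis
      by (simp add: openin_Int)
  qed
  \<comment> \<open>Near a coincidence both lifts stay in one open set on which p is
    injective.\<close>
  have "openin (top_of_set T) E"
    unfolding openin_subopen[of _ E]
  proof
    fix y assume y: "y \<in> E"
    then have "g1 y \<in> c" using g1 by (auto simp: E_def)
    then obtain U u q where U: "g1 y \<in> U" "openin (top_of_set c) U" "homeomorphism U u p q"
      using covering_space_local_homeomorphism[OF cov] by metis
    have "T \<inter> g1 -` U \<inter> g2 -` U \<subseteq> E"
    proof
      fix z assume "z \<in> T \<inter> g1 -` U \<inter> g2 -` U"
      then show "z \<in> E"
        using U(3) eq[of z] unfolding E_def homeomorphism_def by (metis (mono_tags, lifting) IntE mem_Collect_eq vimageE)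
    qed
    then show "\<exists>N. openin (top_of_set T) N \<and> y \<in> N \<and> N \<subseteq> E"
      using pre[OF U(2) U(2)] y U(1) by (intro exI[of _ "T \<inter> g1 -` U \<inter> g2 -` U"]) (auto simp: E_def)
  qed
  \<comment> \<open>Where the lifts differ over the same base point they lie in different sheets,
    and sheets are disjoint.\<close>
  moreover have "openin (top_of_set T) (T - E)"
    unfolding openin_subopen[of _ "T - E"]
  proof
    fix y assume y: "y \<in> T - E"
    then have gy: "g1 y \<in> c" "g2 y \<in> c" "g1 y \<noteq> g2 y" "p (g1 y) = p (g2 y)"
      using g1 g2 eq by (auto simp: E_def)
    then have "p (g1 y) \<in> S"
      using covering_space_imp_surjective[OF cov] by blast
    then obtain W v where W: "p (g1 y) \<in> W" "\<Union>v = c \<inter> p -` W" "\<forall>u\<in>v. openin (top_of_set c) u"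
      "pairwise disjnt v" "\<forall>u\<in>v. \<exists>q. homeomorphism u W p q"
      using cov unfolding covering_space_def by metis
    obtain U1 U2 where U: "U1 \<in> v" "g1 y \<in> U1" "U2 \<in> v" "g2 y \<in> U2"
      using W(1,2) gy by (metis IntI UnionE vimageI)
    have "U1 \<noteq> U2"
    proof
      assume "U1 = U2"
      then show False
        using W(5) U gy(3,4) unfolding homeomorphism_def by metis
    qed
    then have "U1 \<inter> U2 = {}"
      using W(4) U by (auto simp: pairwise_def disjnt_def)
    then have "T \<inter> g1 -` U1 \<inter> g2 -` U2 \<subseteq> T - E"
      by (auto simp: E_def)
    then show "\<exists>N. openin (top_of_set T) N \<and> y \<in> N \<and> N \<subseteq> T - E"
      using pre[of U1 U2] W(3) y U by (intro exI[of _ "T \<inter> g1 -` U1 \<inter> g2 -` U2"]) auto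
  qed
  then have "closedin (top_of_set T) E"
    unfolding closedin_def by (auto simp: E_def)
  ultimately have "E = {} \<or> E = T"
    using T unfolding connected_clopen by blast
  then show ?thesis
    using a x by (auto simp: E_def)
qed

text \<open>The lift is constructed simultaneously on a neighbourhood of each segment issuing from the base point.\<close>

lemma covering_lift_convex:
  fixes p :: "'g::topological_space \<Rightarrow> 'b::topological_space" and f :: "'a::real_normed_vector \<Rightarrow> 'b"
  assumes cov: "covering_space c p S" and D: "convex D" "a \<in> D" and f: "continuous_on D f" "f ` D \<subseteq> S"
    and e: "e \<in> c" "p e = f a"
  obtains \<phi> where "continuous_on D \<phi>" "\<phi> ` D \<subseteq> c" "\<phi> a = e" "\<And>x. x \<in> D \<Longrightarrow> p (\<phi> x) = f x"
proof -
  define seg where "seg = (\<lambda>z::real \<times> 'a. a + fst z *\<^sub>R (snd z - a))"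
  have seg: "seg (s, x) \<in> D" if "s \<in> {0..1}" "x \<in> D" for s x
  proof -
    have "seg (s, x) = (1 - s) *\<^sub>R a + s *\<^sub>R x"
      by (simp add: seg_def algebra_simps)
    then show ?thesis
      using convexD_alt[OF D(1) D(2) that(2), of s] that(1) by simp
  qed
  define h where "h = f \<circ> seg"
  have ch: "continuous_on ({0..1} \<times> D) h"
    unfolding h_def
  proof (rule continuous_on_compose)
    show "continuous_on ({0..1} \<times> D) seg"
      unfolding seg_def by (intro continuous_intros)
    show "continuous_on (seg ` ({0..1} \<times> D)) f"
      by (rule continuous_on_subset[OF f(1)]) (use seg in auto)
  qed
  have hS: "h (s, x) \<in> S" if "s \<in> {0..1}" "x \<in> D" for s x
    using seg[OF that] f(2) by (auto simp: h_def)
  define Lift where "Lift = (\<lambda>N t k. continuous_on ({0..t} \<times> N) k \<and> k ` ({0..t} \<times> N) \<subseteq> c \<and>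
     (\<forall>s\<in>{0..t}. \<forall>x\<in>N. p (k (s, x)) = h (s, x)) \<and> (\<forall>x\<in>N. k (0, x) = e))"
  have local: "\<exists>N k. openin (top_of_set D) N \<and> x0 \<in> N \<and> Lift N (1::real) k" if x0: "x0 \<in> D" for x0
  proof -
    define A where "A = {t\<in>{0..1}. \<exists>N k. openin (top_of_set D) N \<and> x0 \<in> N \<and> Lift N t k}"
    have "0 \<in> A"
    proof -
      have "Lift D 0 (\<lambda>_. e)"
        using e by (auto simp: Lift_def h_def seg_def)
      then show ?thesis
        using x0 by (auto simp: A_def intro!: exI[of _ D])
    qed
    \<comment> \<open>Near \<tau> and x0 the map h stays in one evenly covered set, so a lift that
      reaches s extends to t. Applied at the supremum of A, this leads from some s close to it past
      the supremum, which forces the parameter 1 to be reached.\<close>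
    have step: "\<exists>\<delta>>0. \<forall>s\<in>A. \<bar>s - \<tau>\<bar> < \<delta> \<longrightarrow> (\<forall>t\<in>{s..1}. \<bar>t - \<tau>\<bar> < \<delta> \<longrightarrow> t \<in> A)" if \<tau>: "\<tau> \<in> {0..1}" for \<tau>
    proof -
      have "h (\<tau>, x0) \<in> S" using hS \<tau> x0 by blast
      then obtain W v where W: "h (\<tau>, x0) \<in> W" "openin (top_of_set S) W" "\<Union>v = c \<inter> p -` W" "\<forall>u\<in>v. openin (top_of_set c) u"
        "\<forall>u\<in>v. \<exists>q. homeomorphism u W p q"
        using cov unfolding covering_space_def by metis
      have "openin (top_of_set ({0..1} \<times> D)) (({0..1} \<times> D) \<inter> h -` W)"
        by (rule continuous_openin_preimage[OF ch _ W(2)]) (use hS in auto)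
      then obtain \<epsilon> where \<epsilon>: "\<epsilon> > 0" "ball (\<tau>, x0) \<epsilon> \<inter> ({0..1} \<times> D) \<subseteq> ({0..1} \<times> D) \<inter> h -` W"
        using W(1) \<tau> x0 unfolding openin_contains_ball by (metis IntI SigmaI vimageI2)
      have hW: "h (s, x) \<in> W" if "s \<in> {0..1}" "\<bar>s - \<tau>\<bar> < \<epsilon> / 2" "x \<in> D" "dist x0 x < \<epsilon> / 2" for s x
      proof -
        have "dist (\<tau>, x0) (s, x) \<le> \<bar>\<tau> - s\<bar> + dist x0 x"
          unfolding dist_Pair_Pair dist_real_def
          using sqrt_sum_squares_le_sum_abs[of "\<bar>\<tau> - s\<bar>" "dist x0 x"] by simp
        then have "dist (\<tau>, x0) (s, x) < \<epsilon>"
          using that by (simp add: abs_minus_commute)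
        then show ?thesis
          using \<epsilon>(2) that by (auto simp: subset_iff)
      qed
      show ?thesis
      proof (intro exI[of _ "\<epsilon> / 2"] conjI ballI impI)
        fix s t assume s: "s \<in> A" "\<bar>s - \<tau>\<bar> < \<epsilon> / 2" and t: "t \<in> {s..1}" "\<bar>t - \<tau>\<bar> < \<epsilon> / 2"
        have s01: "s \<in> {0..1}" using s by (simp add: A_def)
        obtain N k where N: "openin (top_of_set D) N" "x0 \<in> N" "Lift N s k"
          using s by (auto simp: A_def)
        have k: "continuous_on ({0..s} \<times> N) k" "k ` ({0..s} \<times> N) \<subseteq> c"
          "\<And>r x. r \<in> {0..s} \<Longrightarrow> x \<in> N \<Longrightarrow> p (k (r, x)) = h (r, x)" "\<And>x. x \<in> N \<Longrightarrow> k (0, x) = e"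
          using N(3) by (auto simp: Lift_def)
        have ND: "N \<subseteq> D" using N(1) openin_imp_subset by blast
        have "k (s, x0) \<in> c \<inter> p -` W"
          using k(2,3) N(2) s01 hW[of s x0] s x0 \<epsilon> by (auto simp: image_subset_iff)
        then obtain u where u: "u \<in> v" "k (s, x0) \<in> u"
          using W(3) by blast
        then obtain q where q: "homeomorphism u W p q"
          using W(5) by blast
        \<comment> \<open>Shrunk so that at parameter s all lifted points lie in the same sheet u;
          the local inverse q of p on u then continues the lift.\<close>
        define N' where "N' = N \<inter> ball x0 (\<epsilon> / 2) \<inter> (\<lambda>x. k (s, x)) -` u"
        have cks: "continuous_on N (\<lambda>x. k (s, x))"
          by (rule continuous_on_compose2[OF k(1)]) (use s01 in \<open>auto intro!: continuous_intros\<close>)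
        have "openin (top_of_set N) (N \<inter> (\<lambda>x. k (s, x)) -` u)"
          by (rule continuous_openin_preimage[OF cks, of c u]) (use k(2) s01 W(4) u(1) in auto)
        then have "openin (top_of_set D) (N \<inter> (\<lambda>x. k (s, x)) -` u)"
          using N(1) openin_trans by blast
        then have "openin (top_of_set D) ((N \<inter> (\<lambda>x. k (s, x)) -` u) \<inter> ball x0 (\<epsilon> / 2))"
          by (rule openin_Int_open) simp
        then have N'1: "openin (top_of_set D) N'"
          by (simp add: N'_def Int_ac)
        have N'2: "x0 \<in> N'"
          using N(2) u(2) \<epsilon>(1) by (simp add: N'_def)
        have N'N: "N' \<subseteq> N" "N' \<subseteq> D"
          using ND by (auto simp: N'_def)
        have inW: "h (r, x) \<in> W" if "r \<in> {s..t}" "x \<in> N'" for r x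
        proof -
          have "\<bar>r - \<tau>\<bar> < \<epsilon> / 2"
            using that s(2) t unfolding abs_less_iff by auto
          then show ?thesis
            using that t s01 N'N by (intro hW) (auto simp: N'_def)
        qed
        define k' where "k' = (\<lambda>z. if fst z \<le> s then k z else q (h z))"
        have "Lift N' t k'"
          unfolding Lift_def
        proof (intro conjI ballI)
          show "continuous_on ({0..t} \<times> N') k'"
            unfolding k'_def
          proof (rule continuous_on_cases_le)
            show "continuous_on {z \<in> {0..t} \<times> N'. fst z \<le> s} k"
              by (rule continuous_on_subset[OF k(1)]) (use N'N in auto)
            have sub: "h ` {z \<in> {0..t} \<times> N'. s \<le> fst z} \<subseteq> W"
              using inW by auto
            show "continuous_on {z \<in> {0..t} \<times> N'. s \<le> fst z} (\<lambda>z. q (h z))"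
              by (rule continuous_on_compose2[OF _ _ sub])
                (use q t s01 N'N in \<open>auto simp: homeomorphism_def intro!: continuous_on_subset[OF ch]\<close>)
            show "continuous_on ({0..t} \<times> N') fst"
              by (intro continuous_intros)
            show "k z = q (h z)" if "z \<in> {0..t} \<times> N'" "fst z = s" for z
            proof -
              define x where "x = snd z"
              have z: "z = (s, x)" "x \<in> N'"
                using that by (auto simp: x_def prod_eq_iff)
              then have "k z \<in> u" "p (k z) = h z"
                using k(3)[of s x] s01 N'N by (auto simp: N'_def)
              then show ?thesis
                using q unfolding homeomorphism_def by metis
            qed
          qed
          show "k' ` ({0..t} \<times> N') \<subseteq> c"
          proof (clarify)
            fix r x assume rx: "r \<in> {0..t}" "x \<in> N'"
            show "k' (r, x) \<in> c"
            proof (cases "r \<le> s")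
              case True
              then have "(r, x) \<in> {0..s} \<times> N"
                using rx N'N by auto
              then have "k (r, x) \<in> c" using k(2) by blast
              then show ?thesis using True by (simp add: k'_def)
            next
              case False
              then have "q (h (r, x)) \<in> u"
                using q inW[of r x] rx by (auto simp: homeomorphism_def)
              then show ?thesis
                using W(3) u(1) False by (auto simp: k'_def)
            qed
          qed
          show "p (k' (r, x)) = h (r, x)" if "r \<in> {0..t}" "x \<in> N'" for r x
          proof (cases "r \<le> s")
            case True
            then show ?thesis using k(3)[of r x] that N'N by (auto simp: k'_def)
          next
            case False
            then show ?thesis
              using q inW[of r x] that unfolding homeomorphism_def by (auto simp: k'_def)
          qed
          show "k' (0, x) = e" if "x \<in> N'" for x
            using k(4)[of x] that N'N s01 by (auto simp: k'_def)
        qed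
        then show "t \<in> A"
          using N'1 N'2 t s01 unfolding A_def by auto
      qed (use \<epsilon> in simp)
    qed
    define \<tau> where "\<tau> = Sup A"
    have A1: "s \<le> 1" if "s \<in> A" for s
      using that by (simp add: A_def)
    have bdd: "bdd_above A" "A \<noteq> {}"
      using bdd_aboveI[of A 1] A1 \<open>0 \<in> A\<close> by auto
    have up: "s \<le> \<tau>" if "s \<in> A" for s
      unfolding \<tau>_def using that bdd by (simp add: cSup_upper)
    have "\<tau> \<le> 1"
      unfolding \<tau>_def using bdd A1 by (intro cSup_least) auto
    then have "\<tau> \<in> {0..1}"
      using up[OF \<open>0 \<in> A\<close>] by simp
    then obtain \<delta> where \<delta>: "\<delta> > 0" "\<And>s t. s \<in> A \<Longrightarrow> \<bar>s - \<tau>\<bar> < \<delta> \<Longrightarrow> t \<in> {s..1} \<Longrightarrow> \<bar>t - \<tau>\<bar> < \<delta> \<Longrightarrow> t \<in> A"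
      using step by meson
    obtain s where s: "s \<in> A" "\<tau> - \<delta> < s"
      using less_cSupD[of A "\<tau> - \<delta>"] bdd \<delta>(1) unfolding \<tau>_def by auto
    have "min 1 (\<tau> + \<delta> / 2) \<in> A"
      using s up[OF s(1)] \<delta>(1) \<open>\<tau> \<le> 1\<close> A1[OF s(1)] by (intro \<delta>(2)[OF s(1)]) (auto simp: min_def)
    with up[OF this] have "1 \<in> A"
      using \<delta>(1) by (auto simp: min_def split: if_splits)
    then show ?thesis
      by (auto simp: A_def)
  qed
  then obtain N k where N: "\<And>x. x \<in> D \<Longrightarrow> openin (top_of_set D) (N x)" "\<And>x. x \<in> D \<Longrightarrow> x \<in> N x"
    "\<And>x. x \<in> D \<Longrightarrow> Lift (N x) 1 (k x)"
    by metis
  define \<phi> where "\<phi> = (\<lambda>x. k x (1, x))"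
  have kc: "continuous_on ({0..1} \<times> N x) (k x)" "k x ` ({0..1} \<times> N x) \<subseteq> c"
      "\<And>r y. r \<in> {0..1} \<Longrightarrow> y \<in> N x \<Longrightarrow> p (k x (r, y)) = h (r, y)" "\<And>y. y \<in> N x \<Longrightarrow> k x (0, y) = e" if "x \<in> D" for x
    using N(3)[OF that] by (auto simp: Lift_def)
  have \<phi>: "\<phi> y = k x (1, y)" if "x \<in> D" "y \<in> N x" for x y
  proof -
    have y: "y \<in> D" using that N(1) openin_imp_subset by blast
    have cc: "continuous_on {0..1} (\<lambda>s. k z (s, y))" if "z \<in> D" "y \<in> N z" for z
      by (rule continuous_on_compose2[OF kc(1)[OF that(1)]]) (use that in \<open>auto intro!: continuous_intros\<close>)
    \<comment> \<open>Lifts built around different centres agree along each segment by uniqueness,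
      hence they glue.\<close>
    have "k y (1, y) = k x (1, y)"
    proof (rule covering_lift_unique[OF cov, where T = "{0..1::real}" and ?g1.0 = "\<lambda>s. k y (s, y)" and ?g2.0 = "\<lambda>s. k x (s, y)" and a = 0])
      show "(\<lambda>s. k y (s, y)) ` {0..1} \<subseteq> c" "(\<lambda>s. k x (s, y)) ` {0..1} \<subseteq> c"
        using kc(2)[OF y] kc(2)[OF that(1)] that N(2)[OF y] by auto
    qed (use cc y that N(2)[OF y] kc(3,4) in auto)
    then show ?thesis by (simp add: \<phi>_def)
  qed
  show ?thesis
  proof (rule that[of \<phi>])
    show "continuous_on D \<phi>"
      unfolding continuous_on_def
    proof
      fix x assume x: "x \<in> D"
      obtain U where U: "open U" "N x = D \<inter> U"
        using N(1)[OF x] by (auto simp: openin_open)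
      have "continuous_on (N x) (\<lambda>y. k x (1, y))"
        by (rule continuous_on_compose2[OF kc(1)[OF x]]) (auto intro!: continuous_intros)
      then have "continuous_on (N x) \<phi>"
        by (rule continuous_on_eq) (simp add: \<phi>[OF x])
      then have "(\<phi> \<longlongrightarrow> \<phi> x) (at x within N x)"
        using N(2)[OF x] by (simp add: continuous_on_def)
      moreover have "at x within N x = at x within D"
        using N(2)[OF x] U by (intro at_within_nhd[where S = U]) auto
      ultimately show "(\<phi> \<longlongrightarrow> \<phi> x) (at x within D)" by simp
    qed
    show "\<phi> ` D \<subseteq> c"
      using kc(2) N(2) by (force simp: \<phi>_def)
    show "\<phi> a = e"
    proof -
      have "k a (1, a) = k a (0, a)"
      proof (rule covering_lift_unique[OF cov, where T = "{0..1::real}" and ?g1.0 = "\<lambda>s. k a (s, a)" and ?g2.0 = "\<lambda>s. k a (0, a)" and a = 0])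
        show "continuous_on {0..1} (\<lambda>s. k a (s, a))"
          by (rule continuous_on_compose2[OF kc(1)[OF D(2)]]) (use N(2)[OF D(2)] in \<open>auto intro!: continuous_intros\<close>)
        show "(\<lambda>s. k a (s, a)) ` {0..1} \<subseteq> c" "(\<lambda>s. k a (0, a)) ` {0..1} \<subseteq> c"
          using kc(2)[OF D(2)] N(2)[OF D(2)] by (auto simp: image_subset_iff)
      qed (use kc(3)[OF D(2)] N(2)[OF D(2)] in \<open>auto simp: h_def seg_def\<close>)
      then show ?thesis
        using kc(4)[OF D(2) N(2)[OF D(2)]] by (simp add: \<phi>_def)
    qed
    show "p (\<phi> x) = f x" if "x \<in> D" for x
      using kc(3)[OF that _ N(2)[OF that], of 1] by (simp add: \<phi>_def h_def seg_def)
  qed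
qed

subsection \<open>Iwasawa coordinates\<close>

definition Dom :: "(real \<times> real \<times> real) set" where
  "Dom = UNIV \<times> {0<..} \<times> UNIV"

lemma convex_Dom: "convex Dom"
  unfolding Dom_def by (intro convex_Times) auto

text \<open>The angle of the first row, its length and the component of the second row along it.\<close>

definition iwR :: "real \<times> real \<times> real \<Rightarrow> real^2^2" where
  "iwR = (\<lambda>(\<theta>, r, \<nu>). matrix2 (r * cos \<theta>) (r * sin \<theta>) (\<nu> * cos \<theta> - sin \<theta> / r) (\<nu> * sin \<theta> + cos \<theta> / r))"

definition row_length :: "real^2^2 \<Rightarrow> real" where
  "row_length A = sqrt ((A $ 1 $ 1)\<^sup>2 + (A $ 1 $ 2)\<^sup>2)"

definition row_shear :: "real^2^2 \<Rightarrow> real" where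
  "row_shear A = (A $ 1 $ 1 * A $ 2 $ 1 + A $ 1 $ 2 * A $ 2 $ 2) / row_length A"

lemma SL2_iff: "A \<in> SL2 \<longleftrightarrow> A $ 1 $ 1 * A $ 2 $ 2 - A $ 1 $ 2 * A $ 2 $ 1 = 1"
  by (simp add: SL2_def det_2)

lemma continuous_on_matrix2:
  assumes "continuous_on S a" "continuous_on S b" "continuous_on S c" "continuous_on S d"
  shows "continuous_on S (\<lambda>x. matrix2 (a x) (b x) (c x) (d x))"
  by (subst matrix2_scaleR) (intro continuous_intros assms)

lemma continuous_on_iwR: "continuous_on Dom iwR"
  unfolding iwR_def split_beta Dom_def by (intro continuous_on_matrix2 continuous_intros) auto

lemma iwR_SL2: "x \<in> Dom \<Longrightarrow> iwR x \<in> SL2"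
proof -
  assume "x \<in> Dom"
  then obtain \<theta> r \<nu> where x: "x = (\<theta>, r, \<nu>)" "r > 0" by (auto simp: Dom_def)
  have "r * C * (\<nu> * S + C / r) - r * S * (\<nu> * C - S / r) = C\<^sup>2 + S\<^sup>2" for C S
    using x(2) by (simp add: field_simps power2_eq_square)
  from this[of "cos \<theta>" "sin \<theta>"] show ?thesis
    by (simp add: SL2_iff iwR_def x)
qed

lemma iwR_row: 
  assumes "r > 0"
  shows "row_length (iwR (\<theta>, r, \<nu>)) = r" "row_shear (iwR (\<theta>, r, \<nu>)) = \<nu>"
proof -
  have "(r * cos \<theta>)\<^sup>2 + (r * sin \<theta>)\<^sup>2 = r\<^sup>2 * ((cos \<theta>)\<^sup>2 + (sin \<theta>)\<^sup>2)"
    by (simp only: power_mult_distrib distrib_left)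
  then show l: "row_length (iwR (\<theta>, r, \<nu>)) = r"
    using assms by (simp add: row_length_def iwR_def)
  have "r * C * (\<nu> * C - S / r) + r * S * (\<nu> * S + C / r) = r * \<nu> * (C\<^sup>2 + S\<^sup>2)" for C S
    using assms by (simp add: field_simps power2_eq_square)
  from this[of "cos \<theta>" "sin \<theta>"] show "row_shear (iwR (\<theta>, r, \<nu>)) = \<nu>"
    using assms by (simp add: row_shear_def l) (simp add: iwR_def)
qed

text \<open>The determinant fixes the component of the second row orthogonal to the first as 1 / r;
  the component along it is the shear.\<close>

lemma iwR_eqI:
  assumes A: "A \<in> SL2" and r: "r > 0" and row: "A $ 1 $ 1 = r * cos \<theta>" "A $ 1 $ 2 = r * sin \<theta>"
  shows "A = iwR (\<theta>, r, row_shear A)" "row_length A = r"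
proof -
  have "(r * cos \<theta>)\<^sup>2 + (r * sin \<theta>)\<^sup>2 = r\<^sup>2 * ((cos \<theta>)\<^sup>2 + (sin \<theta>)\<^sup>2)"
    by (simp only: power_mult_distrib distrib_left)
  then show l: "row_length A = r"
    using r by (simp add: row_length_def row)
  define c d where "c = A $ 2 $ 1" and "d = A $ 2 $ 2"
  have det: "r * cos \<theta> * d - r * sin \<theta> * c = 1"
    using A by (simp add: SL2_iff row c_def d_def)
  define C S where "C = cos \<theta>" and "S = sin \<theta>"
  have CS: "C * C + S * S = 1"
    using sin_cos_squared_add2[of \<theta>] by (simp add: C_def S_def power2_eq_square)
  have sh: "row_shear A = C * c + S * d"
    using r by (simp add: row_shear_def l row c_def d_def C_def S_def field_simps)
  have inv: "1 / r = C * d - S * c"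
    using det r by (simp add: C_def S_def field_simps)
  have "c = (C * C + S * S) * c" "d = (C * C + S * S) * d"
    by (simp_all add: CS)
  then have "c = (C * c + S * d) * C - S * (C * d - S * c)" "d = (C * c + S * d) * S + C * (C * d - S * c)"
    by (simp_all add: algebra_simps)
  then have "c = row_shear A * C - S / r" "d = row_shear A * S + C / r"
    unfolding sh by (simp_all flip: inv)
  then show "A = iwR (\<theta>, r, row_shear A)"
    by (intro matrix2_eqI) (simp_all add: iwR_def row C_def S_def c_def d_def)
qed

definition row1 :: "real^2^2 \<Rightarrow> complex" where
  "row1 A = Complex (A $ 1 $ 1) (A $ 1 $ 2)"

lemma continuous_on_row1: "continuous_on S f \<Longrightarrow> continuous_on S (\<lambda>x. row1 (f x))"
  unfolding row1_def by (intro continuous_intros)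

lemma row1_nonzero: "A \<in> SL2 \<Longrightarrow> row1 A \<noteq> 0"
  by (auto simp: row1_def SL2_iff complex_eq_iff)

lemma row1_iwR: "r > 0 \<Longrightarrow> row1 (iwR (\<theta>, r, \<nu>)) = exp (Complex (ln r) \<theta>)"
  by (simp add: row1_def iwR_def complex_eq_iff Re_exp Im_exp)

lemma continuous_on_row_shear: "continuous_on S f \<Longrightarrow> (\<And>x. x \<in> S \<Longrightarrow> f x \<in> SL2) \<Longrightarrow> continuous_on S (\<lambda>x. row_shear (f x))"
proof -
  assume f: "continuous_on S f" "\<And>x. x \<in> S \<Longrightarrow> f x \<in> SL2"
  have "row_length (f x) \<noteq> 0" if "x \<in> S" for x
    using row1_nonzero[OF f(2)[OF that]] by (auto simp: row_length_def row1_def complex_eq_iff)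
  then show ?thesis
    using f(1) unfolding row_shear_def row_length_def by (auto intro!: continuous_intros)
qed

section \<open>The left Iwasawa decomposition in coordinates\<close>

lemma iwasawa_eq: "iwasawa (\<theta>, \<rho>, \<nu>) = matrix2 (cos \<theta> * sqrt \<rho> + sin \<theta> * \<nu> / (2 * sqrt \<rho>)) (sin \<theta> / sqrt \<rho>)
    (- sin \<theta> * sqrt \<rho> + cos \<theta> * \<nu> / (2 * sqrt \<rho>)) (cos \<theta> / sqrt \<rho>)"
  by (simp add: iwasawa_def matrix2_mult mult.commute)

lemma continuous_on_iwasawa: "continuous_on Dom iwasawa"
proof -
  have "continuous_on Dom (\<lambda>x. iwasawa (fst x, fst (snd x), snd (snd x)))"
    unfolding iwasawa_eq Dom_def by (intro continuous_on_matrix2 continuous_intros) auto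
  then show ?thesis by simp
qed

lemma iwasawa_SL2: "x \<in> Dom \<Longrightarrow> iwasawa x \<in> SL2"
proof -
  assume "x \<in> Dom"
  then obtain \<theta> r \<nu> where x: "x = (\<theta>, r, \<nu>)" "r > 0" by (auto simp: Dom_def)
  define s where "s = sqrt r"
  have s: "s > 0" using x by (simp add: s_def)
  have "(C * s + S * \<nu> / (2 * s)) * (C / s) - (S / s) * (- S * s + C * \<nu> / (2 * s)) = C\<^sup>2 + S\<^sup>2" for C S
    using s by (simp add: field_simps power2_eq_square)
  from this[of "cos \<theta>" "sin \<theta>"] show ?thesis
    by (simp add: SL2_iff iwasawa_eq x flip: s_def)
qed

text \<open>The second column of \<open>iwasawa\<close> has length 1 / sqrt \<rho> and direction
  (sin \<theta>, cos \<theta>); this yields \<rho> and \<theta>, and the first column then yields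
  \<nu>.\<close>

lemma iwasawa_surj:
  assumes "A \<in> SL2"
  obtains x where "x \<in> Dom" "iwasawa x = A"
proof -
  define a b c d where "a = A $ 1 $ 1" and "b = A $ 1 $ 2" and "c = A $ 2 $ 1" and "d = A $ 2 $ 2"
  have det: "a * d - b * c = 1" using assms by (simp add: SL2_iff a_def b_def c_def d_def)
  define n where "n = sqrt (b\<^sup>2 + d\<^sup>2)"
  have "b\<^sup>2 + d\<^sup>2 > 0"
    using det by (auto simp: sum_power2_gt_zero_iff)
  then have n: "n > 0" "n\<^sup>2 = b\<^sup>2 + d\<^sup>2" by (auto simp: n_def)
  have "(d / n)\<^sup>2 + (b / n)\<^sup>2 = n\<^sup>2 / n\<^sup>2"
    by (simp only: power_divide n(2) add_divide_distrib[symmetric] add.commute)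
  then have "(d / n)\<^sup>2 + (b / n)\<^sup>2 = 1"
    using n(1) by simp
  then obtain \<theta> where \<theta>: "d / n = cos \<theta>" "b / n = sin \<theta>"
    using sincos_total_2pi by metis
  then have bd: "b = n * sin \<theta>" "d = n * cos \<theta>"
    using n by (simp_all add: field_simps)
  define \<nu> where "\<nu> = 2 / n * (a * sin \<theta> + c * cos \<theta>)"
  define C S where "C = cos \<theta>" and "S = sin \<theta>"
  have CS: "C * C + S * S = 1"
    using sin_cos_squared_add2[of \<theta>] by (simp add: C_def S_def power2_eq_square)
  have inv: "1 / n = a * C - c * S"
    using det n by (simp add: bd C_def S_def field_simps)
  have "a = (C * C + S * S) * a" "c = (C * C + S * S) * c"
    by (simp_all add: CS)
  then have "a = C * (a * C - c * S) + S * (a * S + c * C)" "c = - S * (a * C - c * S) + C * (a * S + c * C)"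
    by (simp_all add: algebra_simps)
  then have ac: "a = C * (1 / n) + S * (a * S + c * C)" "c = - S * (1 / n) + C * (a * S + c * C)"
    by (simp_all flip: inv)
  have sq: "sqrt (1 / n\<^sup>2) = 1 / n"
    using n(1) by (simp add: real_sqrt_divide)
  have nu: "x * \<nu> / (2 * (1 / n)) = x * (a * S + c * C)" for x
    using n(1) by (simp add: \<nu>_def C_def S_def)
  have "iwasawa (\<theta>, 1 / n\<^sup>2, \<nu>) = A"
  proof (rule matrix2_eqI)
    show "iwasawa (\<theta>, 1 / n\<^sup>2, \<nu>) $ 1 $ 1 = A $ 1 $ 1"
      unfolding iwasawa_eq sq nu using ac(1) by (simp add: a_def[symmetric] C_def[symmetric] S_def[symmetric])
    show "iwasawa (\<theta>, 1 / n\<^sup>2, \<nu>) $ 2 $ 1 = A $ 2 $ 1"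
      unfolding iwasawa_eq sq nu using ac(2) by (simp add: c_def[symmetric] C_def[symmetric] S_def[symmetric])
  qed (unfold iwasawa_eq sq, use bd n in \<open>simp_all add: mult.commute flip: b_def d_def\<close>)
  moreover have "(\<theta>, 1 / n\<^sup>2, \<nu>) \<in> Dom"
    using n(1) by (simp add: Dom_def)
  ultimately show ?thesis using that by blast
qed

text \<open>The angles of the first row and of the second column differ by less than a half turn, which
  makes the change from left to right coordinates explicit.\<close>

definition zetaL :: "real \<times> real \<times> real \<Rightarrow> complex" where
  "zetaL x = row1 (iwasawa x) * exp (- \<i> * of_real (fst x))"

text \<open>If \<open>zetaL x\<close> were a real k \<le> 0, the first row would be k (cos \<theta>,
  sin \<theta>). Its second entry is sin \<theta> / sqrt \<rho>, which forces sin \<theta> = 0; its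
  first entry is then sqrt \<rho> cos \<theta>, so k = sqrt \<rho> > 0.\<close>

lemma zetaL_slit: "x \<in> Dom \<Longrightarrow> zetaL x \<notin> \<real>\<^sub>\<le>\<^sub>0"
proof
  assume "x \<in> Dom" "zetaL x \<in> \<real>\<^sub>\<le>\<^sub>0"
  then obtain \<theta> \<rho> \<nu> where x: "x = (\<theta>, \<rho>, \<nu>)" "\<rho> > 0" by (auto simp: Dom_def)
  obtain k where k: "zetaL x = of_real k" "k \<le> 0"
    using \<open>zetaL x \<in> \<real>\<^sub>\<le>\<^sub>0\<close> by (auto elim: nonpos_Reals_cases)
  have "row1 (iwasawa x) = zetaL x * exp (\<i> * of_real \<theta>)"
    by (simp add: zetaL_def x mult.assoc flip: exp_add)
  then have eq: "row1 (iwasawa x) = of_real k * exp (\<i> * of_real \<theta>)"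
    by (simp add: k)
  have "sin \<theta> / sqrt \<rho> = k * sin \<theta>"
    using arg_cong[OF eq, of Im] by (simp add: row1_def iwasawa_eq x Im_exp)
  then have "sin \<theta> * (1 / sqrt \<rho> - k) = 0"
    by (simp add: algebra_simps)
  moreover have "1 / sqrt \<rho> - k > 0"
    using x k by (smt (verit) divide_pos_pos real_sqrt_gt_zero)
  ultimately have s: "sin \<theta> = 0" by simp
  then have c: "cos \<theta> \<noteq> 0"
    using sin_cos_squared_add[of \<theta>] by auto
  have "cos \<theta> * sqrt \<rho> = k * cos \<theta>"
    using arg_cong[OF eq, of Re] s by (simp add: row1_def iwasawa_eq x Re_exp)
  then have "sqrt \<rho> = k" using c by simp
  then show False using x k by (smt (verit) real_sqrt_gt_zero)
qed

text \<open>Off the slit the principal logarithm is continuous. Its imaginary part is the turn from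
  the angle of the column to that of the row, its real part the logarithm of the row length.\<close>

definition toR :: "real \<times> real \<times> real \<Rightarrow> real \<times> real \<times> real" where
  "toR x = (fst x + Im (Ln (zetaL x)), exp (Re (Ln (zetaL x))), row_shear (iwasawa x))"

lemma toR_Dom: "toR x \<in> Dom"
  by (simp add: toR_def Dom_def)

lemma iwR_toR: "x \<in> Dom \<Longrightarrow> iwR (toR x) = iwasawa x"
proof -
  assume x: "x \<in> Dom"
  define L where "L = Ln (zetaL x)"
  have "zetaL x \<noteq> 0" using zetaL_slit[OF x] by auto
  then have "exp L = zetaL x" by (simp add: L_def)
  then have "exp (L + \<i> * of_real (fst x)) = row1 (iwasawa x)"
  proof -
    have "exp (- \<i> * of_real (fst x)) * exp (\<i> * of_real (fst x)) = 1"
      by (simp flip: exp_add)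
    then show ?thesis
      unfolding exp_add \<open>exp L = zetaL x\<close> zetaL_def mult.assoc by simp
  qed
  then have row: "exp (Re L) * cos (fst x + Im L) = iwasawa x $ 1 $ 1" "exp (Re L) * sin (fst x + Im L) = iwasawa x $ 1 $ 2"
    by (simp_all add: row1_def complex_eq_iff Re_exp Im_exp add.commute)
  show ?thesis
    using iwR_eqI(1)[OF iwasawa_SL2[OF x] _ row[symmetric]] by (simp add: toR_def flip: L_def)
qed

lemma continuous_on_toR: "continuous_on Dom toR"
proof -
  have z: "continuous_on Dom zetaL"
    unfolding zetaL_def by (intro continuous_intros continuous_on_row1 continuous_on_iwasawa)
  show ?thesis
    unfolding toR_def
    by (intro continuous_intros z continuous_on_row_shear continuous_on_iwasawa) (auto simp: zetaL_slit iwasawa_SL2)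
qed

lemma toR_shift: "toR (\<theta> + 2 * pi * of_int k, \<rho>, \<nu>) = (fst (toR (\<theta>, \<rho>, \<nu>)) + 2 * pi * of_int k, snd (toR (\<theta>, \<rho>, \<nu>)))"
proof -
  have sc: "sin (\<theta> + 2 * pi * of_int k) = sin \<theta>" "cos (\<theta> + 2 * pi * of_int k) = cos \<theta>"
    by (simp_all add: sin_add cos_add)
  have w: "iwasawa (\<theta> + 2 * pi * of_int k, \<rho>, \<nu>) = iwasawa (\<theta>, \<rho>, \<nu>)"
    by (simp only: iwasawa_eq sc)
  have "exp (- \<i> * of_real (\<theta> + 2 * pi * of_int k)) = exp (- \<i> * of_real \<theta>)"
    by (simp add: complex_eq_iff Re_exp Im_exp sin_diff cos_diff)
  then show ?thesis
    by (simp add: toR_def zetaL_def w)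
qed

text \<open>The entry in row 1 and column 2 is a positive multiple of the sine of either angle, so
  the sines have the same sign; as the angles differ by less than pi, they are positive
  together.\<close>

lemma toR_sign: "x \<in> Dom \<Longrightarrow> fst (toR x) > 0 \<longleftrightarrow> fst x > 0"
proof -
  assume x: "x \<in> Dom"
  then obtain \<theta> \<rho> \<nu> where x': "x = (\<theta>, \<rho>, \<nu>)" "\<rho> > 0" by (auto simp: Dom_def)
  define \<Theta> r where "\<Theta> = fst (toR x)" and "r = fst (snd (toR x))"
  have r: "r > 0" by (simp add: r_def toR_def)
  have "zetaL x \<noteq> 0" using zetaL_slit[OF x] by auto
  then have diff: "\<bar>\<Theta> - \<theta>\<bar> < pi"
    using Im_Ln_less_pi[OF zetaL_slit[OF x]] mpi_less_Im_Ln[of "zetaL x"]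
    by (simp add: \<Theta>_def toR_def x'(1) abs_less_iff)
  have "iwR (toR x) $ 1 $ 2 = r * sin \<Theta>"
    by (simp add: iwR_def split_beta r_def \<Theta>_def)
  then have s: "r * sin \<Theta> = sin \<theta> / sqrt \<rho>"
    using iwR_toR[OF x] by (simp add: iwasawa_eq x'(1))
  have s1: "sin \<Theta> > 0 \<longleftrightarrow> sin \<theta> > 0"
    using s r x'(2) by (metis divide_pos_pos mult_pos_pos real_sqrt_gt_zero zero_less_divide_iff zero_less_mult_iff less_asym)
  have "\<Theta> > 0 \<longleftrightarrow> \<theta> > 0"
  proof
    assume P: "\<Theta> > 0"
    show "\<theta> > 0"
    proof (cases "\<Theta> < pi")
      case True
      then have "sin \<theta> > 0" using P s1 sin_gt_zero by blast
      show ?thesis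
      proof (rule ccontr)
        assume "\<not> \<theta> > 0"
        then have "sin (- \<theta>) \<ge> 0" using diff P by (intro sin_ge_zero) auto
        then show False using \<open>sin \<theta> > 0\<close> by simp
      qed
    qed (use diff in auto)
  next
    assume P: "\<theta> > 0"
    show "\<Theta> > 0"
    proof (cases "\<theta> < pi")
      case True
      then have "sin \<Theta> > 0" using P s1 sin_gt_zero by blast
      show ?thesis
      proof (rule ccontr)
        assume "\<not> \<Theta> > 0"
        then have "sin (- \<Theta>) \<ge> 0" using diff P by (intro sin_ge_zero) auto
        then show False using \<open>sin \<Theta> > 0\<close> by simp
      qed
    qed (use diff in auto)
  qed
  then show ?thesis by (simp add: \<Theta>_def x')
qed

lemma iwR_eq_imp:
  assumes "(\<theta>, r, \<nu>) \<in> Dom" "(\<theta>', r', \<nu>') \<in> Dom" "iwR (\<theta>, r, \<nu>) = iwR (\<theta>', r', \<nu>')"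
  obtains k :: int where "\<theta> = \<theta>' + 2 * pi * of_int k" "r = r'" "\<nu> = \<nu>'"
proof -
  have r: "r > 0" "r' > 0" using assms by (auto simp: Dom_def)
  have eq: "r = r'" "\<nu> = \<nu>'"
    using iwR_row[OF r(1), of \<theta> \<nu>] iwR_row[OF r(2), of \<theta>' \<nu>'] assms(3) by simp_all
  have "cos \<theta> = cos \<theta>'" "sin \<theta> = sin \<theta>'"
    using arg_cong[OF assms(3), of "\<lambda>A. A $ 1 $ 1"] arg_cong[OF assms(3), of "\<lambda>A. A $ 1 $ 2"] r
    by (simp_all add: iwR_def eq)
  then obtain k :: int where "\<theta> = \<theta>' + 2 * pi * of_int k"
    using sin_cos_eq_iff[of \<theta> \<theta>'] by (auto simp: mult_ac)
  then show ?thesis using that eq by blast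
qed

text \<open>Equality of matrices fixes the coordinates up to full turns of the angle, and a full
  turn of the left angle is a full turn of the right one.\<close>

lemma toR_surj:
  assumes "x \<in> Dom"
  obtains y where "y \<in> Dom" "toR y = x"
proof -
  obtain \<theta> r \<nu> where x: "x = (\<theta>, r, \<nu>)" by (cases x) auto
  obtain y where y: "y \<in> Dom" "iwasawa y = iwR x"
    using iwasawa_surj[OF iwR_SL2[OF assms]] .
  obtain \<theta>' \<rho>' \<nu>' where y': "y = (\<theta>', \<rho>', \<nu>')" by (cases y) auto
  obtain \<theta>2 r2 \<nu>2 where t: "toR y = (\<theta>2, r2, \<nu>2)" by (cases "toR y") auto
  have "iwR (\<theta>, r, \<nu>) = iwR (\<theta>2, r2, \<nu>2)"
    using iwR_toR[OF y(1)] y(2) by (simp add: t x)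
  then obtain k :: int where "\<theta> = \<theta>2 + 2 * pi * of_int k" "r = r2" "\<nu> = \<nu>2"
    using iwR_eq_imp[of \<theta> r \<nu> \<theta>2 r2 \<nu>2] assms toR_Dom[of y] by (auto simp: x t)
  then have "toR (\<theta>' + 2 * pi * of_int k, \<rho>', \<nu>') = x"
    using t unfolding toR_shift y'[symmetric] by (simp add: x)
  moreover have "(\<theta>' + 2 * pi * of_int k, \<rho>', \<nu>') \<in> Dom"
    using y(1) by (simp add: y' Dom_def)
  ultimately show ?thesis using that by blast
qed

section \<open>Both coordinate systems lifted to the covering group\<close>

locale SL2_cover =
  fixes G :: "'g::topological_space set" and p :: "'g \<Rightarrow> real^2^2" and e :: 'g
  assumes universal: "universal_cover_SL2 G p e"
begin

lemma cover: "covering_space G p SL2" and simply: "simply_connected G" and e: "e \<in> G" "p e = mat 1"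
  using universal by (auto simp: universal_cover_SL2_def)

lemma cont_p: "continuous_on G p" and p_SL2: "g \<in> G \<Longrightarrow> p g \<in> SL2"
  using cover covering_space_imp_continuous covering_space_imp_surjective by blast+

lemma base: "(0, 1, 0) \<in> Dom" "iwR (0, 1, 0) = mat 1" "iwasawa (0, 1, 0) = mat 1"
  by (auto simp: Dom_def iwR_def iwasawa_eq mat_1_matrix2)

definition phiR :: "real \<times> real \<times> real \<Rightarrow> 'g" where
  "phiR = (SOME \<phi>. continuous_on Dom \<phi> \<and> \<phi> ` Dom \<subseteq> G \<and> \<phi> (0, 1, 0) = e \<and> (\<forall>x\<in>Dom. p (\<phi> x) = iwR x))"

lemma phiR: "continuous_on Dom phiR" "phiR ` Dom \<subseteq> G" "phiR (0, 1, 0) = e" "x \<in> Dom \<Longrightarrow> p (phiR x) = iwR x"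
proof -
  have "iwR ` Dom \<subseteq> SL2" using iwR_SL2 by blast
  then obtain \<phi> where "continuous_on Dom \<phi>" "\<phi> ` Dom \<subseteq> G" "\<phi> (0, 1, 0) = e" "\<And>x. x \<in> Dom \<Longrightarrow> p (\<phi> x) = iwR x"
    using covering_lift_convex[OF cover convex_Dom base(1) continuous_on_iwR _ e(1)] e(2) base(2) by metis
  then have "\<exists>\<phi>. continuous_on Dom \<phi> \<and> \<phi> ` Dom \<subseteq> G \<and> \<phi> (0, 1, 0) = e \<and> (\<forall>x\<in>Dom. p (\<phi> x) = iwR x)"
    by blast
  from someI_ex[OF this]
  show "continuous_on Dom phiR" "phiR ` Dom \<subseteq> G" "phiR (0, 1, 0) = e" "x \<in> Dom \<Longrightarrow> p (phiR x) = iwR x"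
    unfolding phiR_def by blast+
qed

lemma phi_L: "continuous_on Dom (phi_L G p e)" "phi_L G p e ` Dom \<subseteq> G" "phi_L G p e (0, 1, 0) = e"
  "x \<in> Dom \<Longrightarrow> p (phi_L G p e x) = iwasawa x"
proof -
  have "iwasawa ` Dom \<subseteq> SL2" using iwasawa_SL2 by blast
  then obtain \<phi> where "continuous_on Dom \<phi>" "\<phi> ` Dom \<subseteq> G" "\<phi> (0, 1, 0) = e" "\<And>x. x \<in> Dom \<Longrightarrow> p (\<phi> x) = iwasawa x"
    using covering_lift_convex[OF cover convex_Dom base(1) continuous_on_iwasawa _ e(1)] e(2) base(3) by metis
  then have "\<exists>\<phi>. continuous_on Dom \<phi> \<and> \<phi> ` Dom \<subseteq> G \<and> \<phi> (0, 1, 0) = e \<and> (\<forall>x\<in>Dom. p (\<phi> x) = iwasawa x)"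
    by blast
  from someI_ex[OF this]
  show "continuous_on Dom (phi_L G p e)" "phi_L G p e ` Dom \<subseteq> G" "phi_L G p e (0, 1, 0) = e"
    "x \<in> Dom \<Longrightarrow> p (phi_L G p e x) = iwasawa x"
    unfolding phi_L_def Dom_def by blast+
qed

text \<open>Both sides lift \<open>iwasawa\<close> and agree at the base point of the connected
  domain.\<close>

lemma phi_L_eq:
  assumes "x \<in> Dom"
  shows "phi_L G p e x = phiR (toR x)"
proof (rule covering_lift_unique[OF cover, where T = Dom and a = "(0, 1, 0)" and ?g1.0 = "phi_L G p e" and ?g2.0 = "\<lambda>x. phiR (toR x)"])
  show "continuous_on Dom (\<lambda>x. phiR (toR x))"
    by (rule continuous_on_compose2[OF phiR(1) continuous_on_toR]) (use toR_Dom in blast)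
  show "(\<lambda>x. phiR (toR x)) ` Dom \<subseteq> G"
    using phiR(2) toR_Dom by blast
  show "p (phi_L G p e x) = p (phiR (toR x))" if "x \<in> Dom" for x
    using that by (simp add: phi_L(4) phiR(4) toR_Dom iwR_toR)
  have "toR (0, 1, 0) = (0, 1, 0)"
  proof -
    have "zetaL (0, 1, 0) = 1"
      by (simp add: zetaL_def row1_def iwasawa_eq complex_eq_iff)
    then show ?thesis
      by (simp add: toR_def row_shear_def iwasawa_eq)
  qed
  then show "phi_L G p e (0, 1, 0) = phiR (toR (0, 1, 0))"
    by (simp add: phi_L(3) phiR(3))
qed (use phi_L base assms convex_connected[OF convex_Dom] in auto)

text \<open>Simple connectivity enters here. Equal images turn the segment from x to y into a loop
  in G, which contracts. The first row of its projection therefore contracts in the punctured plane,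
  and the continuous logarithm along it, whose imaginary part is the angle, returns to its initial
  value.\<close>

lemma phiR_inj:
  assumes x: "x \<in> Dom" and y: "y \<in> Dom" and eq: "phiR x = phiR y"
  shows "x = y"
proof -
  obtain \<theta> r \<nu> \<theta>' r' \<nu>' where xy: "x = (\<theta>, r, \<nu>)" "y = (\<theta>', r', \<nu>')" by (cases x, cases y) auto
  have iw: "iwR (\<theta>, r, \<nu>) = iwR (\<theta>', r', \<nu>')"
    using phiR(4)[OF x] phiR(4)[OF y] eq by (simp add: xy)
  have rr: "r = r'" "\<nu> = \<nu>'"
    using iwR_eq_imp[of \<theta> r \<nu> \<theta>' r' \<nu>'] x y iw unfolding xy by metis+
  have seg: "linepath x y t \<in> Dom" if "t \<in> {0..1}" for t
    using that x y convex_Dom by (metis linepath_in_convex_hull hull_same linepath_in_path closed_segment_subset subsetD)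
  define c where "c = (\<lambda>t. phiR (linepath x y t))"
  have cc: "continuous_on {0..1} c"
    unfolding c_def by (rule continuous_on_compose2[OF phiR(1) continuous_on_linepath]) (use seg in blast)
  have cG: "c t \<in> G" if "t \<in> {0..1}" for t
    using seg[OF that] phiR(2) by (auto simp: c_def)
  have "homotopic_loops G c (\<lambda>_. phiR x)"
  proof -
    have "path c" "pathfinish c = pathstart c" "path_image c \<subseteq> G"
      using cc cG eq by (auto simp: path_def pathfinish_def pathstart_def path_image_def c_def linepath_def)
    moreover have "path (\<lambda>_. phiR x)" "pathfinish (\<lambda>_. phiR x) = pathstart (\<lambda>_. phiR x)" "path_image (\<lambda>_. phiR x) \<subseteq> G"
      using x phiR(2) by (auto simp: path_def pathfinish_def pathstart_def path_image_def)
    ultimately show ?thesis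
      using simply unfolding simply_connected_def by blast
  qed
  moreover have cz: "continuous_on G (\<lambda>g. row1 (p g))"
    by (rule continuous_on_row1[OF cont_p])
  ultimately have "homotopic_loops (- {0}) ((\<lambda>g. row1 (p g)) \<circ> c) ((\<lambda>g. row1 (p g)) \<circ> (\<lambda>_. phiR x))"
    by (rule homotopic_loops_continuous_image) (use row1_nonzero p_SL2 in auto)
  then have "homotopic_loops (- {0}) (\<lambda>t. row1 (p (c t))) (linepath (row1 (p (phiR x))) (row1 (p (phiR x))))"
    by (simp add: o_def linepath_refl)
  from homotopic_loops_imp_homotopic_paths_null[OF this]
  have hp: "homotopic_paths (- {0}) (\<lambda>t. row1 (p (c t))) (linepath (row1 (p (phiR x))) (row1 (p (phiR x))))"
    by (simp add: pathstart_def c_def linepath_def)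
  define h1 where "h1 = (\<lambda>t. Complex (ln (fst (snd (linepath x y t)))) (fst (linepath x y t)))"
  have lp: "continuous_on {0..1} (linepath x y)"
    by (rule continuous_on_linepath)
  have pos: "fst (snd (linepath x y t)) > 0" if "t \<in> {0..1}" for t
    using seg[OF that] by (auto simp: Dom_def mem_Times_iff)
  have "pathfinish h1 = pathfinish (\<lambda>_. h1 0)"
  proof (rule covering_space_monodromy[OF covering_space_exp_punctured_plane _ _ _ _ hp])
    show "path (\<lambda>t. row1 (p (c t)))" "path_image (\<lambda>t. row1 (p (c t))) \<subseteq> - {0}"
      using homotopic_paths_imp_path[OF hp] homotopic_paths_imp_subset[OF hp] by auto
    show "path (linepath (row1 (p (phiR x))) (row1 (p (phiR x))))"
      "path_image (linepath (row1 (p (phiR x))) (row1 (p (phiR x)))) \<subseteq> - {0}"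
      using homotopic_paths_imp_path[OF hp] homotopic_paths_imp_subset[OF hp] by auto
    show "path h1"
      unfolding path_def h1_def by (intro continuous_intros lp) (use pos in force)
    show *: "exp (h1 t) = row1 (p (c t))" if "t \<in> {0..1}" for t
      using row1_iwR[OF pos[OF that], of "fst (linepath x y t)" "snd (snd (linepath x y t))"] phiR(4)[OF seg[OF that]]
      by (simp add: h1_def c_def)
    show "exp (h1 0) = linepath (row1 (p (phiR x))) (row1 (p (phiR x))) t" if "t \<in> {0..1}" for t
      using *[of 0] by (simp add: linepath_refl c_def) (simp add: linepath_def)
    show "path (\<lambda>_. h1 0)"
      by (simp add: path_def)
  qed (auto simp: pathstart_def)
  then have "h1 1 = h1 0"
    by (simp add: pathfinish_def)
  then have "\<theta>' = \<theta>"
    by (simp add: h1_def linepath_def xy)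
  then show ?thesis
    using rr by (simp add: xy)
qed

text \<open>The change of coordinates maps the half-space of positive angles onto itself.\<close>

lemma G0_eq: "G0 G p e = phiR ` ({0<..} \<times> {0<..} \<times> UNIV)"
proof -
  have "G0 G p e = phiR ` toR ` ({0<..} \<times> {0<..} \<times> UNIV)"
    unfolding G0_def image_image by (rule image_cong[OF refl], rule phi_L_eq) (auto simp: Dom_def)
  moreover have "toR ` ({0<..} \<times> {0<..} \<times> UNIV) = {0<..} \<times> {0<..} \<times> UNIV"
  proof (intro subset_antisym subsetI)
    fix x assume "x \<in> toR ` ({0<..} \<times> {0<..} \<times> UNIV)"
    then obtain y where y: "x = toR y" "y \<in> Dom" "fst y > 0" by (auto simp: Dom_def)
    then have "fst x > 0" "x \<in> Dom"
      using toR_sign[OF y(2)] toR_Dom by auto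
    then show "x \<in> {0<..} \<times> {0<..} \<times> UNIV"
      by (auto simp: Dom_def mem_Times_iff)
  next
    fix x :: "real \<times> real \<times> real" assume x: "x \<in> {0<..} \<times> {0<..} \<times> UNIV"
    then have "x \<in> Dom" by (auto simp: Dom_def)
    then obtain y where y: "y \<in> Dom" "toR y = x" by (rule toR_surj)
    then have "fst y > 0"
      using toR_sign[OF y(1)] x by auto
    then have "y \<in> {0<..} \<times> {0<..} \<times> UNIV"
      using y(1) by (auto simp: Dom_def mem_Times_iff)
    then show "x \<in> toR ` ({0<..} \<times> {0<..} \<times> UNIV)"
      using y(2) by blast
  qed
  ultimately show ?thesis by simp
qed

text \<open>The continuous choice of the angle of the first row that is \<open>\<theta>\<close> at \<open>(a, b)\<close>.\<close>

definition ang :: "real \<Rightarrow> real \<Rightarrow> real \<Rightarrow> real^2^2 \<Rightarrow> real" where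
  "ang \<theta> a b A = \<theta> + arctan ((A $ 1 $ 2 * a - A $ 1 $ 1 * b) * (1 / (A $ 1 $ 1 * a + A $ 1 $ 2 * b)))"

text \<open>Inverting the coordinates on matrices gives a continuous local section of p through the
  given point of G; where the section stays in one sheet of the covering, it is the inverse of
  p.\<close>

lemma local_coordinates:
  assumes x: "(\<theta>, r, \<nu>) \<in> Dom" and pos: "\<theta> > 0"
  defines "a \<equiv> r * cos \<theta>" and "b \<equiv> r * sin \<theta>"
  obtains V where "openin (top_of_set G) V" "phiR (\<theta>, r, \<nu>) \<in> V" "V \<subseteq> G0 G p e"
    "\<And>g. g \<in> V \<Longrightarrow> p g $ 1 $ 1 * a + p g $ 1 $ 2 * b > 0 \<and> ang \<theta> a b (p g) > 0 \<and>
       g = phiR (ang \<theta> a b (p g), row_length (p g), row_shear (p g))"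
proof -
  have r: "r > 0" using x by (simp add: Dom_def)
  define P where "P = (\<lambda>A::real^2^2. A $ 1 $ 1 * a + A $ 1 $ 2 * b)"
  define H where "H = {A \<in> SL2. P A > 0 \<and> ang \<theta> a b A > 0}"
  define \<sigma>' where "\<sigma>' = (\<lambda>A. (ang \<theta> a b A, row_length A, row_shear A))"
  have cP: "continuous_on S P" for S
    unfolding P_def by (intro continuous_intros)
  have cang: "continuous_on {A. P A > 0} (ang \<theta> a b)"
    unfolding ang_def P_def by (intro continuous_intros) auto
  have iw: "iwR (\<sigma>' A) = A" "\<sigma>' A \<in> Dom" if A: "A \<in> SL2" "P A > 0" for A
  proof -
    define a' b' where "a' = A $ 1 $ 1" and "b' = A $ 1 $ 2"
    \<comment> \<open>As a complex number X + iY is the first row of A times the conjugate of a +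
      ib, so X > 0 lets arctan measure the angle between the two.\<close>
    define X Y where "X = a' * a + b' * b" and "Y = b' * a - a' * b"
    define R where "R = row_length A"
    have X: "X > 0" using A by (simp add: X_def P_def a'_def b'_def)
    have R2: "R\<^sup>2 = a'\<^sup>2 + b'\<^sup>2" by (simp add: R_def row_length_def a'_def b'_def)
    have "R > 0"
      using row1_nonzero[OF A(1)] by (auto simp: R_def row_length_def row1_def complex_eq_iff sum_power2_gt_zero_iff)
    have ab2: "a\<^sup>2 + b\<^sup>2 = r\<^sup>2"
    proof -
      have "a\<^sup>2 + b\<^sup>2 = r\<^sup>2 * ((cos \<theta>)\<^sup>2 + (sin \<theta>)\<^sup>2)"
        by (simp only: a_def b_def power_mult_distrib distrib_left)
      then show ?thesis by simp
    qed
    have "X\<^sup>2 + Y\<^sup>2 = (a'\<^sup>2 + b'\<^sup>2) * (a\<^sup>2 + b\<^sup>2)"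
      by (simp add: X_def Y_def power2_eq_square algebra_simps)
    then have XY: "X\<^sup>2 + Y\<^sup>2 = (R * r)\<^sup>2"
      by (simp add: R2 ab2 power_mult_distrib)
    define \<alpha> where "\<alpha> = arctan (Y * (1 / X))"
    have "sqrt (1 + (Y * (1 / X))\<^sup>2) = R * r / X"
    proof -
      have "1 + (Y * (1 / X))\<^sup>2 = (R * r / X)\<^sup>2"
        using X by (simp add: power_divide power_mult_distrib add_divide_distrib flip: XY[unfolded power_mult_distrib])
      then show ?thesis
        using X \<open>R > 0\<close> r by simp
    qed
    then have ca: "cos \<alpha> = X / (R * r)" and sa: "sin \<alpha> = Y / (R * r)"
      using X by (simp_all add: \<alpha>_def cos_arctan sin_arctan)
    have ang: "ang \<theta> a b A = \<theta> + \<alpha>"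
      by (simp add: ang_def \<alpha>_def X_def Y_def a'_def b'_def)
    have "cos \<theta> = a / r" "sin \<theta> = b / r"
      using r by (simp_all add: a_def b_def)
    then have "R * cos (\<theta> + \<alpha>) = (a * X - b * Y) / r\<^sup>2" "R * sin (\<theta> + \<alpha>) = (b * X + a * Y) / r\<^sup>2"
      using \<open>R > 0\<close> r by (simp_all add: cos_add sin_add ca sa field_simps power2_eq_square)
    moreover have "a * X - b * Y = a' * (a\<^sup>2 + b\<^sup>2)" "b * X + a * Y = b' * (a\<^sup>2 + b\<^sup>2)"
      by (simp_all add: X_def Y_def power2_eq_square algebra_simps)
    ultimately have "a' = R * cos (\<theta> + \<alpha>)" "b' = R * sin (\<theta> + \<alpha>)"
      using r by (simp_all add: ab2)
    from iwR_eqI(1)[OF A(1) \<open>R > 0\<close> this[unfolded a'_def b'_def]]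
    show "iwR (\<sigma>' A) = A"
      by (simp add: \<sigma>'_def ang R_def)
    show "\<sigma>' A \<in> Dom"
      using \<open>R > 0\<close> by (simp add: \<sigma>'_def R_def Dom_def)
  qed
  define A0 where "A0 = iwR (\<theta>, r, \<nu>)"
  have A0: "A0 $ 1 $ 1 = a" "A0 $ 1 $ 2 = b" "A0 \<in> SL2"
    using iwR_SL2[OF x] by (simp_all add: A0_def iwR_def a_def b_def)
  have "P A0 > 0"
  proof -
    have "P A0 = r\<^sup>2 * ((cos \<theta>)\<^sup>2 + (sin \<theta>)\<^sup>2)"
      unfolding P_def A0 by (simp only: a_def b_def power2_eq_square distrib_left mult.assoc mult.left_commute)
    then show ?thesis using r by simp
  qed
  moreover have ang0: "ang \<theta> a b A0 = \<theta>"
    by (simp add: ang_def A0)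
  ultimately have A0H: "A0 \<in> H"
    using pos A0 by (simp add: H_def)
  have \<sigma>'0: "\<sigma>' A0 = (\<theta>, r, \<nu>)"
    using iwR_row(1)[OF r, where \<theta> = \<theta> and \<nu> = \<nu>] iwR_row(2)[OF r, where \<theta> = \<theta> and \<nu> = \<nu>] ang0 by (simp add: \<sigma>'_def A0_def)
  have Hop: "openin (top_of_set SL2) H"
  proof -
    have o1: "open {A. P A > 0}"
      using open_Collect_less[OF continuous_on_const cP, of 0] by simp
    then have "open ({A. P A > 0} \<inter> ang \<theta> a b -` {0<..})"
      using continuous_open_preimage[OF cang o1] by simp
    moreover have "H = SL2 \<inter> ({A. P A > 0} \<inter> ang \<theta> a b -` {0<..})"
      by (auto simp: H_def)
    ultimately show ?thesis
      by (auto simp: openin_open)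
  qed
  define \<sigma> where "\<sigma> = (\<lambda>A. phiR (\<sigma>' A))"
  have c\<sigma>': "continuous_on H \<sigma>'"
    unfolding \<sigma>'_def row_length_def
    by (intro continuous_on_Pair continuous_on_row_shear continuous_on_id continuous_on_subset[OF cang] continuous_intros)
      (auto simp: H_def)
  have c\<sigma>: "continuous_on H \<sigma>"
    unfolding \<sigma>_def by (rule continuous_on_compose2[OF phiR(1) c\<sigma>']) (use iw in \<open>auto simp: H_def\<close>)
  have p\<sigma>: "p (\<sigma> A) = A" "\<sigma> A \<in> G" if "A \<in> H" for A
    using iw[of A] phiR(2) phiR(4)[of "\<sigma>' A"] that by (auto simp: \<sigma>_def H_def)
  have \<sigma>0: "\<sigma> A0 = phiR (\<theta>, r, \<nu>)"
    by (simp add: \<sigma>_def \<sigma>'0)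
  have g0: "phiR (\<theta>, r, \<nu>) \<in> G"
    using x phiR(2) by blast
  obtain T u q where T: "phiR (\<theta>, r, \<nu>) \<in> T" "openin (top_of_set G) T" "homeomorphism T u p q" "openin (top_of_set SL2) u"
    using covering_space_local_homeomorphism[OF cover g0] by metis
  \<comment> \<open>The matrices that the section sends into the sheet T; injectivity of p on T then
    gives \<open>g = \<sigma> (p g)\<close>.\<close>
  define W where "W = H \<inter> \<sigma> -` T"
  have "openin (top_of_set H) W"
    unfolding W_def by (rule continuous_openin_preimage[OF c\<sigma>, of G T]) (use p\<sigma> T in auto)
  then have Wop: "openin (top_of_set SL2) W"
    using Hop openin_trans by blast
  define V where "V = T \<inter> (G \<inter> p -` W)"
  have Vop: "openin (top_of_set G) V"
    unfolding V_def by (intro openin_Int T(2) continuous_openin_preimage[OF cont_p _ Wop]) (use p_SL2 in auto)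
  have Vg: "g = \<sigma> (p g)" "p g \<in> H" if "g \<in> V" for g
  proof -
    have g: "g \<in> T" "p g \<in> W" "g \<in> G" using that by (auto simp: V_def)
    then show H: "p g \<in> H" by (simp add: W_def)
    have "\<sigma> (p g) \<in> T" "p (\<sigma> (p g)) = p g"
      using g p\<sigma>[OF H] by (auto simp: W_def)
    then show "g = \<sigma> (p g)"
      using T(3) g(1) unfolding homeomorphism_def by metis
  qed
  show ?thesis
  proof (rule that[OF Vop])
    have "p (phiR (\<theta>, r, \<nu>)) = A0" by (simp add: phiR(4)[OF x] A0_def)
    then show "phiR (\<theta>, r, \<nu>) \<in> V"
      using T(1) g0 A0H \<sigma>0 by (simp add: V_def W_def)
    show "p g $ 1 $ 1 * a + p g $ 1 $ 2 * b > 0 \<and> ang \<theta> a b (p g) > 0 \<and>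
       g = phiR (ang \<theta> a b (p g), row_length (p g), row_shear (p g))" if "g \<in> V" for g
      using Vg[OF that] by (simp add: H_def P_def \<sigma>_def \<sigma>'_def)
    show "V \<subseteq> G0 G p e"
    proof
      fix g assume "g \<in> V"
      note g = Vg[OF this]
      have "\<sigma>' (p g) \<in> {0<..} \<times> {0<..} \<times> UNIV"
        using g(2) iw(2)[of "p g"] by (auto simp: H_def Dom_def \<sigma>'_def)
      then show "g \<in> G0 G p e"
        unfolding G0_eq using g(1) by (auto simp: \<sigma>_def)
    qed
  qed
qed

subsection \<open>The monodromy in Iwasawa coordinates\<close>

text \<open>The third coordinate is the derivative of the radius exp (- w / 2), because the
  component of the velocity along the position vector is r'.\<close>

definition coordsR :: "H0 \<Rightarrow> real \<Rightarrow> real \<times> real \<times> real" where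
  "coordsR f t = (apply_bcontfun (thetaC f) t, exp (- apply_bcontfun (Jop f) t / 2),
     - apply_bcontfun (Iop f) t / 2 * exp (- apply_bcontfun (Jop f) t / 2))"

lemma coordsR_Dom: "coordsR f t \<in> Dom"
  by (simp add: coordsR_def Dom_def)

lemma iwR_coordsR: "t \<in> {0..2*pi} \<Longrightarrow> iwR (coordsR f t) = PhiM (Kepler f) t"
proof -
  assume t: "t \<in> {0..2*pi}"
  define w where "w = apply_bcontfun (Jop f) t"
  have *: "exp w * (c * exp (- (w / 2))) = c / exp (- (w / 2))" for c
    by (simp add: field_simps flip: exp_add)
  show ?thesis
    by (intro matrix2_eqI) (simp_all add: iwR_def coordsR_def PhiM_def Kepler_solution[OF t] algebra_simps * flip: w_def)
qed

text \<open>The coordinates of the polar curve form a continuous path from the base point, so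
  \<open>phiR\<close> makes the lift of the fundamental matrix explicit; uniqueness of lifts settles
  the description in \<open>monodromy\<close>.\<close>

lemma monodromy_Kepler: "monodromy G p e (Kepler f) = phiR (coordsR f (2*pi))"
  unfolding monodromy_def
proof (rule the_equality)
  define \<Phi>' where "\<Phi>' = (\<lambda>t. phiR (coordsR f t))"
  have cc: "continuous_on {0..2*pi} (coordsR f)"
    unfolding coordsR_def by (intro continuous_intros) auto
  have c: "continuous_on {0..2*pi} \<Phi>'"
    unfolding \<Phi>'_def by (rule continuous_on_compose2[OF phiR(1) cc]) (use coordsR_Dom in blast)
  have im: "\<Phi>' ` {0..2*pi} \<subseteq> G"
    using phiR(2) coordsR_Dom by (auto simp: \<Phi>'_def)
  have st: "\<Phi>' 0 = e"
    by (simp add: \<Phi>'_def coordsR_def thetaC_def Jop_def phiR(3))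
  have lift: "p (\<Phi>' t) = PhiM (Kepler f) t" if "t \<in> {0..2*pi}" for t
    using that by (simp add: \<Phi>'_def phiR(4) coordsR_Dom iwR_coordsR)
  show "\<exists>\<Phi> \<Phi>'. fundamental_matrix (rep_H0 (Kepler f)) \<Phi> \<and> continuous_on {0..2*pi} \<Phi>' \<and> \<Phi>' ` {0..2*pi} \<subseteq> G \<and> \<Phi>' 0 = e \<and>
     (\<forall>t\<in>{0..2*pi}. p (\<Phi>' t) = \<Phi> t) \<and> phiR (coordsR f (2*pi)) = \<Phi>' (2*pi)"
    using fundamental_matrix_PhiM c im st lift
    by (intro exI[of _ "PhiM (Kepler f)"] exI[of _ \<Phi>']) (auto simp: \<Phi>'_def)
  fix g
  assume "\<exists>\<Phi> \<Phi>'. fundamental_matrix (rep_H0 (Kepler f)) \<Phi> \<and> continuous_on {0..2*pi} \<Phi>' \<and> \<Phi>' ` {0..2*pi} \<subseteq> G \<and> \<Phi>' 0 = e \<and>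
     (\<forall>t\<in>{0..2*pi}. p (\<Phi>' t) = \<Phi> t) \<and> g = \<Phi>' (2*pi)"
  then obtain \<Phi> \<Phi>2 where *: "fundamental_matrix (rep_H0 (Kepler f)) \<Phi>" "continuous_on {0..2*pi} \<Phi>2" "\<Phi>2 ` {0..2*pi} \<subseteq> G" "\<Phi>2 0 = e"
     "\<forall>t\<in>{0..2*pi}. p (\<Phi>2 t) = \<Phi> t" "g = \<Phi>2 (2*pi)"
    by blast
  have "\<Phi>2 (2*pi) = \<Phi>' (2*pi)"
    by (rule covering_lift_unique[OF cover, where T = "{0..2*pi}" and a = 0])
      (use * c im st lift fundamental_matrix_unique[OF *(1)] in auto)
  then show "g = phiR (coordsR f (2*pi))"
    using *(6) by (simp add: \<Phi>'_def)
qed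

end

subsection \<open>Prescribing the end values of the primitives\<close>

definition total :: "C \<Rightarrow> real" where
  "total g = integral {0..2*pi} (apply_bcontfun g)"

lemma continuous_on_C [simp]: "continuous_on S (apply_bcontfun (g::C))"
  by (rule continuous_on_apply_bcontfun)

lemma C_integrable: "apply_bcontfun (g::C) integrable_on {0..2*pi}"
  by (rule integrable_continuous_real) simp

lemma inner_emb: "inner f (emb g) = integral {0..2*pi} (\<lambda>t. rep_H0 f t * apply_bcontfun g t)"
proof -
  have "square_integrable (\<lambda>t. rep_H0 f t * apply_bcontfun g t)"
    using square_integrable_mulH[of g f] by (simp add: mult.commute)
  moreover have "inner f (emb g) = (\<integral>t. rep_H0 f t * apply_bcontfun g t \<partial>leb)"
    unfolding inner_H0_rep
    using rep_emb[of g] square_integrable_mulH[of g f] square_integrable_mult[OF square_integrable_rep square_integrable_rep, of f "emb g"]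
    by (intro integral_cong_AE) (auto simp: square_integrable_def mult.commute)
  ultimately show ?thesis
    by (simp add: square_integrable_integrable(4))
qed

lemma evalC_Iop: "evalC (2*pi) (Iop f) = inner f (emb oneC)"
  by (simp add: inner_emb evalC_def Iop_apply)

lemma evalC_Iop_emb: "evalC (2*pi) (Iop (emb g)) = total g"
proof -
  have "evalC (2*pi) (Iop (emb g)) = inner (emb oneC) (emb g)"
    by (simp add: evalC_Iop inner_commute)
  also have "\<dots> = (\<integral>t. apply_bcontfun g t \<partial>leb)"
    by (simp add: emb_def inner_abs_H0)
  also have "\<dots> = total g"
    by (simp add: total_def square_integrable_integrable(4))
  finally show ?thesis .
qed

lemma evalC_thetaC: "evalC (2*pi) (thetaC f) = total (expC (Jop f))"
  by (simp add: thetaC_def evalC_Iop_emb)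

lemma bounded_linear_total: "bounded_linear total"
proof -
  have "bounded_linear (\<lambda>g. evalC (2*pi) (Iop (emb g)))"
    by (intro bounded_linear_compose[OF bounded_linear_evalC] bounded_linear_compose[OF bounded_linear_Iop] bounded_linear_emb)
  then show ?thesis by (simp add: evalC_Iop_emb)
qed

lemma total_mono: "(\<And>t. t \<in> {0..2*pi} \<Longrightarrow> apply_bcontfun f t \<le> apply_bcontfun g t) \<Longrightarrow> total f \<le> total g"
  unfolding total_def by (rule integral_le[OF C_integrable C_integrable])

lemma total_pos:
  assumes "\<And>t. t \<in> {0..2*pi} \<Longrightarrow> 0 \<le> apply_bcontfun f t" and t: "t \<in> {0..2*pi}" "apply_bcontfun f t \<noteq> 0"
  shows "0 < total f"
proof -
  have "integral {0..2*pi} (apply_bcontfun f) \<noteq> 0"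
    by (subst integral_eq_0_iff) (use assms in auto)
  moreover have "0 \<le> total f"
    unfolding total_def by (rule integral_nonneg[OF C_integrable]) (use assms in auto)
  ultimately show ?thesis by (simp add: total_def)
qed

lemma ext_apply_continuous: "continuous_on UNIV f \<Longrightarrow> apply_bcontfun (ext f) t = f (clip t)"
  by (rule ext_apply) (erule continuous_on_subset, simp)

definition linC :: C where "linC = ext (\<lambda>t. t - pi)"
definition cosC :: C where "cosC = ext cos"

lemma linC_apply [simp]: "apply_bcontfun linC t = clip t - pi"
  unfolding linC_def by (rule ext_apply_continuous) (intro continuous_intros)

lemma cosC_apply [simp]: "apply_bcontfun cosC t = cos (clip t)"
  unfolding cosC_def by (rule ext_apply_continuous) (intro continuous_intros)

text \<open>Integration by parts moves the weight 2 pi - t onto f, and 2 pi - t = pi - (t - pi)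
  splits it into the two functions.\<close>

lemma evalC_Jop: "evalC (2*pi) (Jop f) = pi * inner f (emb oneC) - inner f (emb linC)"
proof -
  have N: "primitive_of (\<lambda>_. - 1) (\<lambda>t. 2 * pi - t)"
    by (rule primitive_of_C1) (auto intro!: derivative_eq_intros)
  have "primitive_of (\<lambda>t. apply_bcontfun (Iop f) t * (- 1) + rep_H0 f t * (2 * pi - t)) (\<lambda>t. apply_bcontfun (Iop f) t * (2 * pi - t))"
    by (rule primitive_of_mult[OF primitive_of_Iop N])
  then have eq: "integral {0..2*pi} (\<lambda>t. rep_H0 f t * (2 * pi - t) - apply_bcontfun (Iop f) t) = 0"
    by (auto simp: primitive_of_def algebra_simps dest: bspec[of _ _ "2*pi"])
  have int: "(\<lambda>t. rep_H0 f t * apply_bcontfun g t) integrable_on {0..2*pi}" for g :: C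
    using square_integrable_integrable(2)[OF square_integrable_mulH[of g f]] by (simp add: mult.commute)
  have "rep_H0 f integrable_on {0..2*pi}"
    using square_integrable_integrable(2) by simp
  have "integral {0..2*pi} (\<lambda>t. rep_H0 f t * (2 * pi - t) - apply_bcontfun (Iop f) t)
    = integral {0..2*pi} (\<lambda>t. pi * (rep_H0 f t * apply_bcontfun oneC t) - rep_H0 f t * apply_bcontfun linC t - apply_bcontfun (Iop f) t)"
    by (rule integral_cong) (auto simp: algebra_simps)
  also have "\<dots> = pi * inner f (emb oneC) - inner f (emb linC) - total (Iop f)"
    unfolding inner_emb total_def
    by (intro integral_unique has_integral_diff has_integral_mult_right integrable_integral int C_integrable)
  finally show ?thesis
    using eq by (simp add: Jop_def evalC_Iop_emb)
qed

lemma Iop_emb_eq: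
  assumes "\<And>t. t \<in> {0..2*pi} \<Longrightarrow> (M has_vector_derivative apply_bcontfun g t) (at t within {0..2*pi})"
  shows "apply_bcontfun (Iop (emb g)) t = M (clip t) - M 0"
  by (rule Iop_unique[OF primitive_of_C1 rep_emb]) (use assms in auto)

lemma Iop_oneC: "apply_bcontfun (Iop (emb oneC)) t = clip t"
  and Iop_linC: "apply_bcontfun (Iop (emb linC)) t = (clip t)\<^sup>2 / 2 - pi * clip t"
  and Iop_cosC: "apply_bcontfun (Iop (emb cosC)) t = sin (clip t)"
  by (subst Iop_emb_eq[where M = "\<lambda>t. t"] Iop_emb_eq[where M = "\<lambda>t. t\<^sup>2 / 2 - pi * t"] Iop_emb_eq[where M = sin];
      auto intro!: derivative_eq_intros simp: has_real_derivative_iff_has_vector_derivative[symmetric])+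

lemma Jop_cosC: "apply_bcontfun (Jop (emb cosC)) t = 1 - cos (clip t)"
  unfolding Jop_def
  by (subst Iop_emb_eq[where M = "\<lambda>t. - cos t"])
    (auto simp: Iop_cosC has_real_derivative_iff_has_vector_derivative[symmetric] intro!: derivative_eq_intros)

text \<open>The inner products are read off from the end values of known primitives instead of
  integrating products.\<close>

lemma orthogonal_oneC_linC_cosC:
  "inner (emb linC) (emb oneC) = 0" "inner (emb cosC) (emb oneC) = 0" "inner (emb cosC) (emb linC) = 0"
proof -
  show 1: "inner (emb linC) (emb oneC) = 0" "inner (emb cosC) (emb oneC) = 0"
    using evalC_Iop[of "emb linC"] evalC_Iop[of "emb cosC"]
    by (auto simp: evalC_def Iop_linC Iop_cosC power2_eq_square)
  show "inner (emb cosC) (emb linC) = 0"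
    using evalC_Jop[of "emb cosC"] 1 by (simp add: evalC_def Jop_cosC)
qed

lemma emb_nonzero: "emb oneC \<noteq> 0" "emb linC \<noteq> 0" "emb cosC \<noteq> 0"
proof -
  have "emb g \<noteq> 0" if "apply_bcontfun (Iop (emb g)) t \<noteq> 0" for g t
    using that linear_0[OF bounded_linear.linear[OF bounded_linear_Iop]] by auto
  from this[of oneC pi] this[of linC pi] this[of cosC "pi/2"]
  show "emb oneC \<noteq> 0" "emb linC \<noteq> 0" "emb cosC \<noteq> 0"
    by (simp_all add: Iop_oneC Iop_linC Iop_cosC power2_eq_square)
qed

subsection \<open>Elementary smooth functions\<close>

lemma ndf_continuous:
  assumes "\<And>n. ndf n S f"
  shows "continuous_on S f"
proof -
  obtain F' where F': "\<And>x. x \<in> S \<Longrightarrow> has_multilinear_derivative 0 (\<lambda>x _. f x) (F' x) x" "\<And>x. x \<in> S \<Longrightarrow> bounded_multilinear (Suc 0) (F' x)"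
    using assms[of "Suc 0"] by (auto simp: ndf_def)
  have "isCont f x" if x: "x \<in> S" for x
  proof -
    obtain C where C: "\<And>vs. length vs = Suc 0 \<Longrightarrow> norm (F' x vs) \<le> C * prod_list (map norm vs)"
      using F'(2)[OF x] unfolding bounded_multilinear_def by blast
    have "\<forall>\<^sub>F y in nhds x. norm (f y - f x - F' x [y - x]) \<le> 1 * norm (y - x)"
      using F'(1)[OF x, unfolded has_multilinear_derivative_def, rule_format, of 1] by (auto elim: eventually_mono)
    then have ev: "\<forall>\<^sub>F y in nhds x. norm (f y - f x) \<le> (1 + C) * norm (y - x)"
    proof (rule eventually_mono)
      fix y assume "norm (f y - f x - F' x [y - x]) \<le> 1 * norm (y - x)"
      then show "norm (f y - f x) \<le> (1 + C) * norm (y - x)"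
        using C[of "[y - x]"] norm_triangle_ineq[of "f y - f x - F' x [y - x]" "F' x [y - x]"] by (simp add: algebra_simps)
    qed
    have lim: "((\<lambda>y. (1 + C) * norm (y - x)) \<longlongrightarrow> 0) (at x)"
      by (auto intro!: tendsto_eq_intros)
    have "((\<lambda>y. f y - f x) \<longlongrightarrow> 0) (at x)"
      by (rule Lim_null_comparison[OF _ lim]) (use ev in \<open>simp add: eventually_at_filter eventually_mono\<close>)
    then show ?thesis
      by (simp add: isCont_def LIM_zero_iff)
  qed
  then show ?thesis
    by (simp add: continuous_at_imp_continuous_on)
qed

lemma ndf_real_Suc:
  fixes f :: "real \<Rightarrow> real"
  assumes "\<And>x. x \<in> S \<Longrightarrow> (f has_real_derivative f' x) (at x)" "ndf n S f'"
  shows "ndf (Suc n) S f"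
proof (rule ndf_Suc[where f' = "\<lambda>x. f' x *\<^sub>R id_blinfun"])
  show "ndf n S (\<lambda>x. f' x *\<^sub>R id_blinfun)"
    by (rule ndf_bounded_linear_compose[OF bounded_linear_scaleR_left assms(2)])
  show "(f has_derivative blinfun_apply (f' x *\<^sub>R id_blinfun)) (at x)" if "x \<in> S" for x
  proof -
    have "blinfun_apply (f' x *\<^sub>R id_blinfun) = (*) (f' x)"
      by (auto simp: blinfun.scaleR_left)
    then show ?thesis
      using assms(1)[OF that] by (simp add: has_field_derivative_def)
  qed
qed

lemma ndf_reciprocal: "ndf n {x. x \<noteq> 0} (\<lambda>x::real. 1 / x)"
proof (rule ndf_resolvent(1)[OF bounded_bilinear_mult, where a = "\<lambda>x. x" and a' = "\<lambda>_. id_blinfun"])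
  show "open {x. x \<noteq> (0::real)}"
    by (rule open_Collect_neq) (intro continuous_intros)+
qed (auto simp: ndf_id ndf_const field_simps)

lemma ndf_divide:
  fixes f g :: "'a::real_normed_vector \<Rightarrow> real"
  assumes "ndf n S f" "ndf n S g" "\<And>x. x \<in> S \<Longrightarrow> g x \<noteq> 0"
  shows "ndf n S (\<lambda>x. f x / g x)"
proof -
  have "ndf n S (\<lambda>x. f x * (1 / g x))"
    by (intro ndf_mult assms(1) ndf_compose[OF assms(2) ndf_reciprocal]) (use assms(3) in auto)
  then show ?thesis by simp
qed

lemma ndf_ln: "ndf n {0<..} (ln :: real \<Rightarrow> real)"
proof (cases n)
  case (Suc m)
  show ?thesis
    unfolding Suc by (rule ndf_real_Suc[where f' = "\<lambda>x. 1 / x"])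
      (auto intro!: DERIV_ln_divide ndf_subset[OF ndf_reciprocal])
qed (simp add: ndf_0)

lemma ndf_arctan: "ndf n UNIV arctan"
proof (cases n)
  case (Suc m)
  have "ndf m UNIV (\<lambda>x::real. 1 / (1 + x * x))"
    by (intro ndf_divide ndf_add ndf_mult ndf_const ndf_id) (metis add_pos_nonneg less_irrefl zero_le_square zero_less_one)
  then show ?thesis
    unfolding Suc by (intro ndf_real_Suc[where f' = "\<lambda>x. 1 / (1 + x * x)"])
      (auto intro!: derivative_eq_intros simp: power2_eq_square divide_inverse)
qed (simp add: ndf_0)

subsection \<open>Solving for the total angle\<close>

text \<open>The unknown is \<open>s\<close> in \<open>total (expC (B y + s *\<^sub>R W)) = \<Theta>\<close>.\<close>

locale angle_equation =
  fixes B :: "'y::real_normed_vector \<Rightarrow> C" and W :: C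
  assumes B: "bounded_linear B" and W_nonneg: "0 \<le> apply_bcontfun W t"
    and W_pos: "0 < t \<Longrightarrow> t < 2 * pi \<Longrightarrow> 0 < apply_bcontfun W t"
begin

definition K :: "'y \<times> real \<Rightarrow> real" where
  "K z = total (expC (B (fst z) + snd z *\<^sub>R W))"

definition BW :: "('y \<times> real) \<Rightarrow>\<^sub>L C" where
  "BW = Blinfun (\<lambda>z. B (fst z) + snd z *\<^sub>R W)"

lemma BW: "blinfun_apply BW z = B (fst z) + snd z *\<^sub>R W"
  unfolding BW_def
  by (subst bounded_linear_Blinfun_apply)
    (auto intro!: bounded_linear_add bounded_linear_compose[OF B] bounded_linear_fst
      bounded_linear_compose[OF bounded_linear_scaleR_left] bounded_linear_snd)

definition dK :: "'y \<times> real \<Rightarrow> ('y \<times> real) \<Rightarrow>\<^sub>L real" where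
  "dK z = Blinfun total o\<^sub>L (bounded_bilinear.prod_right mulC (expC (blinfun_apply BW z)) o\<^sub>L BW)"

lemma dK_apply: "blinfun_apply (dK z) v = total (mulC (expC (blinfun_apply BW z)) (blinfun_apply BW v))"
  by (simp add: dK_def bounded_linear_Blinfun_apply[OF bounded_linear_total] bounded_bilinear.prod_right.rep_eq[OF bounded_bilinear_mulC])

lemma K_eq: "K z = total (expC (blinfun_apply BW z))"
  by (simp add: K_def BW)

lemma has_derivative_K: "(K has_derivative blinfun_apply (dK z)) (at z)"
proof -
  have "((\<lambda>z. total (expC (blinfun_apply BW z))) has_derivative (\<lambda>v. total (mulC (expC (blinfun_apply BW z)) (blinfun_apply BW v)))) (at z)"
    by (intro bounded_linear.has_derivative[OF bounded_linear_total] has_derivative_compose[OF _ has_derivative_expC]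
        bounded_linear_imp_has_derivative blinfun.bounded_linear_right)
  then show ?thesis
    by (simp add: K_eq[abs_def] dK_apply[abs_def])
qed

lemma ndf_dK: "ndf n UNIV dK"
  unfolding dK_def
  by (intro bounded_bilinear.ndf_prod[OF bounded_bilinear_blinfun_compose] ndf_const
      ndf_bounded_linear_compose[OF bounded_bilinear.bounded_linear_prod_right[OF bounded_bilinear_mulC]]
      ndf_exp ndf_bounded_linear blinfun.bounded_linear_right)

text \<open>The partial derivative of \<open>K\<close> in the unknown s.\<close>

definition k :: "'y \<times> real \<Rightarrow> real" where
  "k z = blinfun_apply (dK z) (0, 1)"

lemma ndf_k: "ndf n UNIV k"
  unfolding k_def by (rule ndf_bounded_linear_compose[OF blinfun.bounded_linear_left ndf_dK])

lemma k_pos: "k z > 0"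
proof -
  have "blinfun_apply BW (0, 1) = W"
    by (simp add: BW linear_0[OF bounded_linear.linear[OF B]])
  then show ?thesis
    unfolding k_def dK_apply
    by (intro total_pos[where t = pi]) (use W_nonneg W_pos[of pi] in auto)
qed

lemma K_strict_mono:
  assumes "s < s'"
  shows "K (y, s) < K (y, s')"
proof (rule DERIV_pos_imp_increasing[OF assms, where f = "\<lambda>s. K (y, s)"])
  fix s
  have "((\<lambda>s. K (y, s)) has_derivative (\<lambda>d. blinfun_apply (dK (y, s)) (0, d))) (at s)"
    by (rule has_derivative_compose[OF _ has_derivative_K, of "\<lambda>s. (y, s)" "\<lambda>d. (0, d)", simplified])
      (auto intro!: derivative_eq_intros)
  moreover have "blinfun_apply (dK (y, s)) (0, d) = k (y, s) * d" for d
    using blinfun.scaleR_right[of "dK (y, s)" d "(0, 1)"] by (simp add: k_def)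
  ultimately have "DERIV (\<lambda>s. K (y, s)) s :> k (y, s)"
    by (simp add: has_field_derivative_def)
  then show "\<exists>d. DERIV (\<lambda>s. K (y, s)) s :> d \<and> 0 < d"
    using k_pos by blast
qed

lemma K_less_iff: "K (y, s) < K (y, s') \<longleftrightarrow> s < s'"
  using K_strict_mono[of s s' y] K_strict_mono[of s' s y] by (cases s s' rule: linorder_cases) auto

lemma isCont_K: "isCont K z"
  using has_derivative_K has_derivative_continuous by blast

text \<open>Since exp u \<ge> u and \<open>B y\<close> is bounded below by - M, growth in s \<ge> 0
  is at least linear with slope \<open>c\<close>.\<close>

lemma K_large: "\<exists>s. K (y, s) > \<Theta>"
proof -
  define M where "M = norm (B y)"
  define c where "c = exp (- M) * total W"
  have "c > 0"
    unfolding c_def by (intro mult_pos_pos total_pos[where t = pi]) (use W_nonneg W_pos[of pi] in auto)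
  define s where "s = (\<bar>\<Theta>\<bar> + 1) / c"
  have s: "s \<ge> 0" using \<open>c > 0\<close> by (simp add: s_def)
  have "total ((exp (- M) * s) *\<^sub>R W) \<le> K (y, s)"
    unfolding K_def
  proof (rule total_mono)
    fix t :: real
    define b u where "b = apply_bcontfun (B y) t" and "u = s * apply_bcontfun W t"
    have "- M \<le> b" "0 \<le> u"
      using abs_apply_C_le[of "B y" t] s W_nonneg by (auto simp: M_def b_def u_def)
    then have "exp (- M) * u \<le> exp b * exp u"
      using order_trans[OF _ exp_ge_add_one_self[of u], of u] by (intro mult_mono) simp_all
    then show "apply_bcontfun ((exp (- M) * s) *\<^sub>R W) t \<le> apply_bcontfun (expC (B (fst (y, s)) + snd (y, s) *\<^sub>R W)) t"
      by (simp add: b_def u_def exp_add mult.assoc)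
  qed
  moreover have "total ((exp (- M) * s) *\<^sub>R W) = s * c"
    by (simp add: linear_scale[OF bounded_linear.linear[OF bounded_linear_total]] c_def)
  moreover have "s * c > \<Theta>"
    using \<open>c > 0\<close> by (simp add: s_def)
  ultimately show ?thesis by (intro exI[of _ s]) linarith
qed

text \<open>As s runs to minus infinity along the integers, the integrand tends to 0 wherever W is
  positive, in particular in the open interval. Dominated convergence, with exp of
  \<open>B y\<close> as majorant, gives the limit 0.\<close>

lemma K_small:
  assumes "\<Theta> > 0"
  shows "\<exists>s. K (y, s) < \<Theta>"
proof -
  define f where "f = (\<lambda>n. apply_bcontfun (expC (B y + (- real n) *\<^sub>R W)))"
  define g where "g = (\<lambda>t. if apply_bcontfun W t = 0 then exp (apply_bcontfun (B y) t) else 0)"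
  have lim: "(\<lambda>n. integral {0..2*pi} (f n)) \<longlonglongrightarrow> integral {0..2*pi} g"
  proof (rule dominated_convergence(2))
    show "f n integrable_on {0..2*pi}" for n
      unfolding f_def by (rule C_integrable)
    show "apply_bcontfun (expC (B y)) integrable_on {0..2*pi}"
      by (rule C_integrable)
    show "norm (f n t) \<le> apply_bcontfun (expC (B y)) t" for n t
      using W_nonneg[of t] by (simp add: f_def)
    show "(\<lambda>n. f n t) \<longlonglongrightarrow> g t" if t: "t \<in> {0..2*pi}" for t
    proof (cases "apply_bcontfun W t = 0")
      case True
      then show ?thesis by (simp add: f_def g_def)
    next
      case False
      define w where "w = apply_bcontfun W t"
      have "w > 0" using False W_nonneg[of t] by (simp add: w_def)
      then have "(\<lambda>n. exp (apply_bcontfun (B y) t + (- real n) * w)) \<longlonglongrightarrow> 0"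
        by real_asymp
      then show ?thesis using False by (simp add: f_def g_def w_def)
    qed
  qed
  have "integral {0..2*pi} g = integral {0..2*pi} (\<lambda>_. 0)"
  proof (rule integral_spike[of "{0, 2*pi}"])
    show "0 = g t" if "t \<in> {0..2*pi} - {0, 2*pi}" for t
      using that W_pos[of t] by (auto simp: g_def)
  qed simp
  then have "(\<lambda>n. K (y, - real n)) \<longlonglongrightarrow> 0"
    using lim by (simp add: K_def total_def f_def)
  from order_tendstoD(2)[OF this assms] show ?thesis
    by (auto simp: eventually_sequentially)
qed

lemma ex_K_eq:
  assumes "\<Theta> > 0"
  shows "\<exists>s. K (y, s) = \<Theta>"
proof -
  obtain s s' where s: "K (y, s) < \<Theta>" "\<Theta> < K (y, s')"
    using K_small[OF assms] K_large by blast
  then have "s \<le> s'"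
    using K_less_iff[of y s s'] by linarith
  moreover have "isCont (\<lambda>s. K (y, s)) x" for x
    by (rule isCont_o2[OF _ isCont_K]) (intro continuous_intros)
  ultimately show ?thesis
    using IVT[of "\<lambda>s. K (y, s)" s \<Theta> s'] s by auto
qed

definition S :: "'y \<times> real \<Rightarrow> real" where
  "S x = (SOME s. K (fst x, s) = snd x)"

lemma K_S: "\<Theta> > 0 \<Longrightarrow> K (y, S (y, \<Theta>)) = \<Theta>"
  unfolding S_def using someI_ex[OF ex_K_eq] by simp

lemma S_unique: "\<Theta> > 0 \<Longrightarrow> K (y, s) = \<Theta> \<Longrightarrow> S (y, \<Theta>) = s"
  using K_S[of \<Theta> y] K_less_iff[of y s "S (y, \<Theta>)"] K_less_iff[of y "S (y, \<Theta>)" s] by linarith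

abbreviation \<Omega> :: "('y \<times> real) set" where "\<Omega> \<equiv> UNIV \<times> {0<..}"

lemma open_\<Omega>: "open \<Omega>"
  by (intro open_Times open_UNIV open_greaterThan)

text \<open>Monotonicity in s gives this: the strict inequalities
  \<open>K (y0, s0 - \<epsilon>) < \<Theta>0\<close> and
  \<open>\<Theta>0 < K (y0, s0 + \<epsilon>)\<close> persist nearby and trap the solution.\<close>

lemma isCont_S:
  assumes x: "x \<in> \<Omega>"
  shows "isCont S x"
proof -
  obtain y0 \<Theta>0 where x0: "x = (y0, \<Theta>0)" "\<Theta>0 > 0" using x by auto
  define s0 where "s0 = S (y0, \<Theta>0)"
  have "\<forall>\<^sub>F x' in at x. dist (S x') (S x) < \<epsilon>" if "\<epsilon> > 0" for \<epsilon>
  proof -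
    have lim: "((\<lambda>x'. K (fst x', s)) \<longlongrightarrow> K (y0, s)) (at x)" for s
    proof -
      have "isCont (\<lambda>x'. (fst x', s)) x" by (intro continuous_intros)
      from isCont_o2[OF this isCont_K] show ?thesis by (simp add: isCont_def x0)
    qed
    have lim2: "(snd \<longlongrightarrow> \<Theta>0) (at x)"
      using tendsto_snd[OF tendsto_ident_at, of x UNIV] by (simp add: x0)
    have "K (y0, s0 - \<epsilon>) < K (y0, s0)" "K (y0, s0) < K (y0, s0 + \<epsilon>)"
      using that by (simp_all add: K_less_iff)
    then have lt: "K (y0, s0 - \<epsilon>) < \<Theta>0" "\<Theta>0 < K (y0, s0 + \<epsilon>)"
      using K_S[OF x0(2), of y0] by (simp_all add: s0_def)
    have d: "((\<lambda>x'. snd x' - K (fst x', s)) \<longlongrightarrow> \<Theta>0 - K (y0, s)) (at x)" for s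
      by (rule tendsto_diff[OF lim2 lim])
    have "\<forall>\<^sub>F x' in at x. 0 < snd x' - K (fst x', s0 - \<epsilon>)"
      by (rule order_tendstoD(1)[OF d]) (use lt in simp)
    moreover have "\<forall>\<^sub>F x' in at x. snd x' - K (fst x', s0 + \<epsilon>) < 0"
      by (rule order_tendstoD(2)[OF d]) (use lt in simp)
    moreover have "\<forall>\<^sub>F x' in at x. 0 < snd x'"
      by (rule order_tendstoD(1)[OF lim2 x0(2)])
    ultimately show ?thesis
    proof eventually_elim
      case (elim x')
      then have "K (fst x', S x') = snd x'"
        using K_S[of "snd x'" "fst x'"] by simp
      then have "K (fst x', s0 - \<epsilon>) < K (fst x', S x')" "K (fst x', S x') < K (fst x', s0 + \<epsilon>)"
        using elim by simp_all
      then show ?case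
        by (simp add: K_less_iff dist_real_def s0_def x0)
    qed
  qed
  then show ?thesis
    by (simp add: isCont_def tendsto_iff)
qed

text \<open>Implicit differentiation of K (y, S) = \<Theta>: the increment of \<Theta>, less what
  the change of y contributes, divided by the derivative in s.\<close>

definition dS :: "'y \<times> real \<Rightarrow> ('y \<times> real) \<Rightarrow>\<^sub>L real" where
  "dS x = (1 / k (fst x, S x)) *\<^sub>R (snd_blinfun - (dK (fst x, S x) o\<^sub>L Blinfun (\<lambda>v. (fst v, 0))))"

lemma bounded_linear_fst_0: "bounded_linear (\<lambda>v::'y \<times> real. (fst v, 0::real))"
  by (intro bounded_linear_Pair bounded_linear_fst bounded_linear_zero)

lemma dS_apply: "blinfun_apply (dS x) v = (snd v - blinfun_apply (dK (fst x, S x)) (fst v, 0)) / k (fst x, S x)"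
  by (simp add: dS_def blinfun.scaleR_left blinfun.diff_left bounded_linear_Blinfun_apply[OF bounded_linear_fst_0])

lemma dK_split: "blinfun_apply (dK z) (v, d) = blinfun_apply (dK z) (v, 0) + d * k z"
  using blinfun.add_right[of "dK z" "(v, 0)" "(0, d)"] blinfun.scaleR_right[of "dK z" d "(0, 1)"]
  by (simp add: k_def)

text \<open>The map (y, \<Theta>) \<mapsto> (y, S) inverts (y, s) \<mapsto> (y, K), whose derivative
  is triangular with the nonzero entry \<open>k\<close>; as the inverse is continuous, it is
  differentiable.\<close>

lemma has_derivative_S:
  assumes x: "x \<in> \<Omega>"
  shows "(S has_derivative blinfun_apply (dS x)) (at x)"
proof -
  have "((\<lambda>x. (fst x, S x)) has_derivative (\<lambda>v. (fst v, blinfun_apply (dS x) v))) (at x)"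
  proof (rule has_derivative_inverse_basic[where f = "\<lambda>z. (fst z, K z)" and f' = "\<lambda>v. (fst v, blinfun_apply (dK (fst x, S x)) v)" and T = \<Omega>])
    show "((\<lambda>z. (fst z, K z)) has_derivative (\<lambda>v. (fst v, blinfun_apply (dK (fst x, S x)) v))) (at (fst x, S x))"
      by (intro has_derivative_Pair has_derivative_K has_derivative_fst has_derivative_ident)
    show "bounded_linear (\<lambda>v. (fst v, blinfun_apply (dS x) v))"
      by (intro bounded_linear_Pair bounded_linear_fst blinfun.bounded_linear_right)
    show "(\<lambda>v. (fst v, blinfun_apply (dS x) v)) \<circ> (\<lambda>v. (fst v, blinfun_apply (dK (fst x, S x)) v)) = id"
    proof
      fix v :: "'y \<times> real"
      obtain a d where v: "v = (a, d)" by (cases v)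
      show "((\<lambda>v. (fst v, blinfun_apply (dS x) v)) \<circ> (\<lambda>v. (fst v, blinfun_apply (dK (fst x, S x)) v))) v = id v"
        using k_pos[of "(fst x, S x)"] unfolding v by (simp add: dS_apply dK_split[of _ a d])
    qed
    show "isCont (\<lambda>x. (fst x, S x)) x"
      by (intro continuous_intros isCont_S x)
    show "(fst (fst z, S z), K (fst z, S z)) = z" if "z \<in> \<Omega>" for z
      using that K_S[of "snd z" "fst z"] by auto
  qed (use x open_\<Omega> in auto)
  from bounded_linear.has_derivative[OF bounded_linear_snd this] show ?thesis
    by simp
qed

text \<open>\<open>dS\<close> is built from S itself and smooth maps, so the order rises by one at
  each step.\<close>

lemma ndf_S: "ndf n \<Omega> S"
proof (induction n)
  case (Suc n)
  have g: "ndf n \<Omega> (\<lambda>x. (fst x, S x))"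
    by (intro ndf_Pair Suc ndf_bounded_linear bounded_linear_fst)
  have "ndf n \<Omega> dS"
    unfolding dS_def
  proof (intro ndf_scaleR ndf_divide ndf_const ndf_diff)
    show "ndf n \<Omega> (\<lambda>x. k (fst x, S x))"
      by (rule ndf_compose[OF g ndf_k]) simp
    show "k (fst x, S x) \<noteq> 0" for x
      using k_pos[of "(fst x, S x)"] by simp
    show "ndf n \<Omega> (\<lambda>x. dK (fst x, S x) o\<^sub>L Blinfun (\<lambda>v. (fst v, 0)))"
      by (intro bounded_bilinear.ndf_prod[OF bounded_bilinear_blinfun_compose] ndf_const ndf_compose[OF g ndf_dK]) simp
  qed
  then show ?case
    by (intro ndf_Suc[where f' = dS] has_derivative_S)
qed (rule ndf_0)

end

subsection \<open>The chart\<close>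

definition e1 :: H0 where "e1 = (1 / norm (emb oneC)) *\<^sub>R emb oneC"
definition e2 :: H0 where "e2 = (1 / norm (emb linC)) *\<^sub>R emb linC"
definition e3 :: H0 where "e3 = (1 / norm (emb cosC)) *\<^sub>R emb cosC"

lemma e_orthogonal: "inner e1 e2 = 0" "inner e1 e3 = 0" "inner e2 e3 = 0"
    "inner e2 e1 = 0" "inner e3 e1 = 0" "inner e3 e2 = 0"
  using orthogonal_oneC_linC_cosC by (simp_all add: e1_def e2_def e3_def inner_commute)

lemma e_normalized: "inner e1 e1 = 1" "inner e2 e2 = 1" "inner e3 e3 = 1"
  using emb_nonzero by (simp_all add: e1_def e2_def e3_def dot_square_norm power2_eq_square)

lemma orthonormal_e: "orthonormal {e1, e2, e3}"
  using e_orthogonal e_normalized by (auto simp: orthonormal_def norm_eq_sqrt_inner)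

lemma sum_e: "(\<Sum>e\<in>{e1, e2, e3}. inner x e *\<^sub>R e) = inner x e1 *\<^sub>R e1 + inner x e2 *\<^sub>R e2 + inner x e3 *\<^sub>R e3"
proof -
  have "e1 \<noteq> e2" "e1 \<noteq> e3" "e2 \<noteq> e3"
    using e_orthogonal e_normalized by auto
  then show ?thesis by simp
qed

lemma evalC_Iop_e: "evalC (2*pi) (Iop f) = norm (emb oneC) * inner f e1"
  and evalC_Jop_e: "evalC (2*pi) (Jop f) = pi * (norm (emb oneC) * inner f e1) - norm (emb linC) * inner f e2"
  using emb_nonzero by (simp_all add: evalC_Iop evalC_Jop e1_def e2_def)

lemma Jop_e3: "apply_bcontfun (Jop e3) t = (1 - cos (clip t)) / norm (emb cosC)"
  by (simp add: e3_def linear_scale[OF bounded_linear.linear[OF bounded_linear_Jop]] Jop_cosC)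

text \<open>The element of the span of \<open>e1\<close> and \<open>e2\<close> whose first and
  second primitives end at a and w; the coefficients invert \<open>evalC_Iop_e\<close> and
  \<open>evalC_Jop_e\<close>.\<close>

definition end_part :: "real \<times> real \<Rightarrow> H0" where
  "end_part = (\<lambda>(a, w). (a / norm (emb oneC)) *\<^sub>R e1 + ((pi * a - w) / norm (emb linC)) *\<^sub>R e2)"

text \<open>The outcome of \<open>Hilbert_space_split\<close> for the three directions that carry
  the end values and the angle.\<close>

locale split =
  fixes U :: "'h::{real_inner, complete_space} \<Rightarrow> H0" and V :: "H0 \<Rightarrow> 'h"
  assumes U: "bounded_linear U" and V: "bounded_linear V" and VU: "V (U h) = h"
    and U_e: "e \<in> {e1, e2, e3} \<Longrightarrow> inner (U h) e = 0" and V_e: "e \<in> {e1, e2, e3} \<Longrightarrow> V e = 0"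
    and UV: "U (V x) = x - (inner x e1 *\<^sub>R e1 + inner x e2 *\<^sub>R e2 + inner x e3 *\<^sub>R e3)"
begin

definition L :: "(real \<times> real) \<times> 'h \<Rightarrow> H0" where
  "L y = U (snd y) + end_part (fst y)"

lemma bounded_linear_L: "bounded_linear L"
proof -
  have "end_part = (\<lambda>z. (fst z / norm (emb oneC)) *\<^sub>R e1 + ((pi * fst z - snd z) / norm (emb linC)) *\<^sub>R e2)"
    by (auto simp: end_part_def)
  moreover have "bounded_linear \<dots>"
    by (intro bounded_linear_add bounded_linear_compose[OF bounded_linear_scaleR_left]
        bounded_linear_compose[OF bounded_linear_divide] bounded_linear_sub
        bounded_linear_compose[OF bounded_linear_mult_right] bounded_linear_fst bounded_linear_snd)
  ultimately have end_part: "bounded_linear end_part" by simp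
  then show ?thesis
    unfolding L_def[abs_def]
    by (intro bounded_linear_add bounded_linear_compose[OF U] bounded_linear_compose[OF end_part] bounded_linear_fst bounded_linear_snd)
qed

sublocale angle_equation "\<lambda>y. Jop (L y)" "Jop e3"
proof (rule angle_equation.intro)
  show "bounded_linear (\<lambda>y. Jop (L y))"
    by (rule bounded_linear_compose[OF bounded_linear_Jop bounded_linear_L])
  show "0 \<le> apply_bcontfun (Jop e3) t" for t
    by (simp add: Jop_e3)
  fix t :: real assume t: "0 < t" "t < 2 * pi"
  have "cos t \<noteq> 1"
  proof
    assume "cos t = 1"
    then obtain n :: int where n: "t = real_of_int n * 2 * pi"
      using cos_one_2pi_int by blast
    have "0 < real_of_int n" "real_of_int n < 1"
      using t by (auto simp: n zero_less_mult_iff)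
    then show False by simp
  qed
  then have "cos t < 1"
    using cos_le_one[of t] by linarith
  then show "0 < apply_bcontfun (Jop e3) t"
    using t emb_nonzero by (simp add: Jop_e3)
qed

definition F :: "((real \<times> real) \<times> 'h) \<times> real \<Rightarrow> H0" where
  "F x = L (fst x) + S x *\<^sub>R e3"

lemma ndf_F: "ndf n \<Omega> F"
  unfolding F_def
  by (intro ndf_add ndf_bounded_linear_compose[OF bounded_linear_scaleR_left] ndf_S
      ndf_bounded_linear bounded_linear_compose[OF bounded_linear_L] bounded_linear_fst)

lemma K_thetaC: "K (y, s) = evalC (2*pi) (thetaC (L y + s *\<^sub>R e3))"
proof -
  have "linear Jop" by (rule bounded_linear.linear[OF bounded_linear_Jop])
  then show ?thesis
    by (simp add: K_def evalC_thetaC linear_add linear_scale)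
qed

lemma inner_L: "inner (L ((a, w), h)) e1 = a / norm (emb oneC)"
  "inner (L ((a, w), h)) e2 = (pi * a - w) / norm (emb linC)"
  by (simp_all add: L_def end_part_def inner_add_left U_e e_orthogonal e_normalized)

lemma F_end_values:
  assumes "\<Theta> > 0"
  shows "evalC (2*pi) (Iop (F (((a, w), h), \<Theta>))) = a" "evalC (2*pi) (Jop (F (((a, w), h), \<Theta>))) = w"
    "evalC (2*pi) (thetaC (F (((a, w), h), \<Theta>))) = \<Theta>" "V (F (((a, w), h), \<Theta>)) = h"
proof -
  have "linear V" by (rule bounded_linear.linear[OF V])
  then show "V (F (((a, w), h), \<Theta>)) = h"
    by (simp add: F_def L_def end_part_def linear_add linear_scale V_e VU)
qed (use K_S[OF assms] emb_nonzero in \<open>simp_all add: evalC_Iop_e evalC_Jop_e F_def inner_add_left inner_L e_orthogonal flip: K_thetaC\<close>)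

lemma thetaC_pos: "evalC (2*pi) (thetaC f) > 0"
  unfolding evalC_thetaC by (rule total_pos[where t = 0]) auto

text \<open>The components along \<open>e1\<close> and \<open>e2\<close> are recovered from the end
  values and the complementary part from \<open>V f\<close>; the component along \<open>e3\<close>
  solves the angle equation, whose solution is unique.\<close>

lemma F_of_end_values: "F (((evalC (2*pi) (Iop f), evalC (2*pi) (Jop f)), V f), evalC (2*pi) (thetaC f)) = f"
proof -
  let ?y = "((evalC (2*pi) (Iop f), evalC (2*pi) (Jop f)), V f)"
  have f: "L ?y + inner f e3 *\<^sub>R e3 = f"
    using emb_nonzero by (simp add: L_def end_part_def UV evalC_Iop_e evalC_Jop_e)
  have "S (?y, evalC (2*pi) (thetaC f)) = inner f e3"
    by (rule S_unique[OF thetaC_pos]) (simp only: K_thetaC f)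
  then show ?thesis
    by (simp add: F_def f)
qed

end

subsection \<open>The trivialization of the monodromy\<close>

locale trivialization = SL2_cover G p e + split U V
  for G :: "'g::topological_space set" and p :: "'g \<Rightarrow> real^2^2" and e :: 'g
    and U :: "'h::{real_inner, complete_space} \<Rightarrow> H0" and V :: "H0 \<Rightarrow> 'h"
begin

text \<open>At the end point r = exp (- w / 2) and \<nu> = - (w' / 2) r; solving for the end values
  gives w' = - 2 \<nu> / r and w = - 2 ln r.\<close>

definition \<Psi> :: "'g \<times> 'h \<Rightarrow> H0" where
  "\<Psi> = (\<lambda>(g, h). case inv_into Dom phiR g of (\<theta>, r, \<nu>) \<Rightarrow> Kepler (F (((- (2 * \<nu> / r), - (2 * ln r)), h), \<theta>)))"

text \<open>The inverse of \<open>\<Psi>\<close>, written explicitly so that its smoothness can be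
  read off.\<close>

definition \<Xi> :: "H0 \<Rightarrow> 'g \<times> 'h" where
  "\<Xi> q = (phiR (coordsR (Kepler_inv q) (2*pi)), V (Kepler_inv q))"

lemma \<Psi>_phiR: "(\<theta>, r, \<nu>) \<in> Dom \<Longrightarrow> \<Psi> (phiR (\<theta>, r, \<nu>), h) = Kepler (F (((- (2 * \<nu> / r), - (2 * ln r)), h), \<theta>))"
proof -
  assume x: "(\<theta>, r, \<nu>) \<in> Dom"
  have "inj_on phiR Dom"
    using phiR_inj by (auto intro: inj_onI)
  then have "inv_into Dom phiR (phiR (\<theta>, r, \<nu>)) = (\<theta>, r, \<nu>)"
    using x by (rule inv_into_f_f)
  then show ?thesis by (simp add: \<Psi>_def)
qed

lemma coordsR_F:
  assumes "\<theta> > 0" "r > 0"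
  shows "coordsR (F (((- (2 * \<nu> / r), - (2 * ln r)), h), \<theta>)) (2*pi) = (\<theta>, r, \<nu>)"
  using F_end_values(1-3)[OF assms(1), of "- (2 * \<nu> / r)" "- (2 * ln r)" h] assms(2)
  by (simp add: coordsR_def evalC_def)

lemma G0_cases:
  assumes "g \<in> G0 G p e"
  obtains \<theta> r \<nu> where "g = phiR (\<theta>, r, \<nu>)" "\<theta> > 0" "r > 0" "(\<theta>, r, \<nu>) \<in> Dom"
  using assms unfolding G0_eq Dom_def by auto

lemma coordsR_pos: "coordsR f (2*pi) \<in> {0<..} \<times> {0<..} \<times> UNIV"
  using thetaC_pos[of f] by (simp add: coordsR_def evalC_def)

lemma \<Xi>_G0: "fst (\<Xi> q) \<in> G0 G p e"
  unfolding G0_eq \<Xi>_def using coordsR_pos by auto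

lemma \<Psi>_\<Xi>: "\<Psi> (\<Xi> q) = q"
proof -
  define f where "f = Kepler_inv q"
  define w where "w = apply_bcontfun (Jop f) (2*pi)"
  have "\<Psi> (\<Xi> q) = Kepler (F (((- (2 * (- apply_bcontfun (Iop f) (2*pi) / 2 * exp (- w / 2)) / exp (- w / 2)), - (2 * ln (exp (- w / 2)))), V f),
      apply_bcontfun (thetaC f) (2*pi)))"
    using \<Psi>_phiR coordsR_Dom[of f "2*pi"] by (simp only: \<Xi>_def coordsR_def f_def w_def)
  also have "\<dots> = Kepler (F (((apply_bcontfun (Iop f) (2*pi), w), V f), apply_bcontfun (thetaC f) (2*pi)))"
    by simp
  also have "\<dots> = q"
    using F_of_end_values[of f] by (simp add: w_def evalC_def f_def Kepler_Kepler_inv)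
  finally show ?thesis .
qed

lemma \<Xi>_\<Psi>: "g \<in> G0 G p e \<Longrightarrow> \<Xi> (\<Psi> (g, h)) = (g, h)"
  by (erule G0_cases) (simp add: \<Psi>_phiR \<Xi>_def Kepler_inv_Kepler coordsR_F F_end_values(4))

lemma monodromy_\<Psi>: "g \<in> G0 G p e \<Longrightarrow> monodromy G p e (\<Psi> (g, h)) = g"
  by (erule G0_cases) (simp add: \<Psi>_phiR monodromy_Kepler coordsR_F)

lemma bij_\<Psi>: "bij_betw \<Psi> (G0 G p e \<times> UNIV) UNIV"
  by (rule bij_betw_byWitness[where f' = \<Xi>]) (use \<Psi>_\<Xi> \<Xi>_\<Psi> \<Xi>_G0 in \<open>auto simp: mem_Times_iff image_subset_iff simp del: mem_Sigma_iff\<close>)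

lemma inv_\<Psi>: "inv_into (G0 G p e \<times> UNIV) \<Psi> = \<Xi>"
proof
  fix q
  have "\<Xi> q \<in> G0 G p e \<times> UNIV"
    using \<Xi>_G0 by (simp add: mem_Times_iff)
  then show "inv_into (G0 G p e \<times> UNIV) \<Psi> q = \<Xi> q"
    by (rule inv_into_f_eq[OF bij_betw_imp_inj_on[OF bij_\<Psi>] _ \<Psi>_\<Xi>])
qed

text \<open>Applied to the first component, p yields the fundamental matrix at 2 pi, whose entries
  are smooth in q by the Volterra resolvent; the second component is smooth because
  \<open>Kepler_inv\<close> is.\<close>

lemma smooth_into_\<Xi>: "smooth_into_cover G p (G0 G p e) \<Xi>"
  unfolding smooth_into_cover_def
proof (intro conjI)
  show "range \<Xi> \<subseteq> G0 G p e \<times> UNIV"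
    using \<Xi>_G0 by (simp add: mem_Times_iff image_subset_iff)
  show "G0 G p e \<subseteq> G"
    using phiR(2) by (auto simp: Dom_def elim!: G0_cases)
  have cont: "continuous_on UNIV (\<lambda>q. apply_bcontfun (T (Kepler_inv q)) (2*pi))" if "\<And>n. ndf n UNIV T" for T :: "H0 \<Rightarrow> C"
  proof -
    have "ndf n UNIV (\<lambda>q. evalC (2*pi) (T (Kepler_inv q)))" for n
      by (rule ndf_bounded_linear_compose[OF bounded_linear_evalC ndf_compose[OF ndf_Kepler_inv that]]) simp
    from ndf_continuous[OF this] show ?thesis
      by (simp add: evalC_def)
  qed
  have "continuous_on UNIV (\<lambda>q. coordsR (Kepler_inv q) (2*pi))"
    unfolding coordsR_def
    by (intro continuous_intros cont ndf_Iop ndf_Jop ndf_id) (auto simp: thetaC_def intro!: ndf_Iop ndf_emb ndf_exp ndf_Jop ndf_id)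
  then show "continuous_on UNIV (fst \<circ> \<Xi>)"
    unfolding \<Xi>_def o_def fst_conv
    by (rule continuous_on_compose2[OF phiR(1)]) (use coordsR_Dom in blast)
  have "p (fst (\<Xi> q)) = PhiM q (2*pi)" for q
    by (simp add: \<Xi>_def phiR(4)[OF coordsR_Dom] iwR_coordsR Kepler_Kepler_inv)
  moreover have "ndf n UNIV (\<lambda>q. PhiM q (2*pi))" for n
    unfolding PhiM_def
    by (subst matrix2_scaleR, unfold evalC_def[symmetric])
      (intro ndf_add ndf_bounded_linear_compose[OF bounded_linear_scaleR_left] ndf_bounded_linear_compose[OF bounded_linear_evalC] ndf_vu)
  ultimately have "ndf n UNIV (p \<circ> fst \<circ> \<Xi>)" for n
    by (simp add: o_def)
  then show "smooth_on UNIV (p \<circ> fst \<circ> \<Xi>)"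
    by (intro ndf_smooth_on open_UNIV)
  have "ndf n UNIV (\<lambda>q. V (Kepler_inv q))" for n
    by (rule ndf_bounded_linear_compose[OF V ndf_Kepler_inv])
  then show "smooth_on UNIV (snd \<circ> \<Xi>)"
    by (intro ndf_smooth_on open_UNIV) (simp add: \<Xi>_def o_def)
qed

text \<open>Near a point of \<open>G0\<close> the coordinates are functions of the matrix
  \<open>p g\<close> by \<open>local_coordinates\<close>, and their formulas are smooth on an open
  set of matrices, off \<open>SL2\<close> as well.\<close>

lemma smooth_from_\<Psi>: "smooth_from_cover G p (G0 G p e) \<Psi>"
  unfolding smooth_from_cover_def
proof (intro ballI allI)
  fix g0 and h0 :: 'h
  assume "g0 \<in> G0 G p e"
  then obtain \<theta> r \<nu> where x: "g0 = phiR (\<theta>, r, \<nu>)" "\<theta> > 0" "r > 0" "(\<theta>, r, \<nu>) \<in> Dom"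
    by (rule G0_cases)
  define a b where "a = r * cos \<theta>" and "b = r * sin \<theta>"
  obtain M where M: "openin (top_of_set G) M" "phiR (\<theta>, r, \<nu>) \<in> M" "M \<subseteq> G0 G p e"
    "\<And>g. g \<in> M \<Longrightarrow> p g $ 1 $ 1 * a + p g $ 1 $ 2 * b > 0 \<and> ang \<theta> a b (p g) > 0 \<and>
       g = phiR (ang \<theta> a b (p g), row_length (p g), row_shear (p g))"
    by (rule local_coordinates[OF x(4,2), folded a_def b_def]) (rule that)
  define P where "P = {A::real^2^2. A $ 1 $ 1 * a + A $ 1 $ 2 * b > 0}"
  define Q where "Q = {A \<in> P. ang \<theta> a b A > 0}"
  \<comment> \<open>The squared length of the first row. In terms of it
    \<open>- (2 * ln (row_length A))\<close> is \<open>- ln (\<rho> A)\<close> and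
    \<open>- (2 * row_shear A / row_length A)\<close> is \<open>\<kappa> A\<close>, which removes
    the square root.\<close>
  define \<rho> where "\<rho> = (\<lambda>A::real^2^2. A $ 1 $ 1 * A $ 1 $ 1 + A $ 1 $ 2 * A $ 1 $ 2)"
  define \<kappa> where "\<kappa> = (\<lambda>A::real^2^2. - (2 * (A $ 1 $ 1 * A $ 2 $ 1 + A $ 1 $ 2 * A $ 2 $ 2) / \<rho> A))"
  define H where "H = (\<lambda>z::(real^2^2) \<times> 'h. Kepler (F (((\<kappa> (fst z), - ln (\<rho> (fst z))), snd z), ang \<theta> a b (fst z))))"
  have \<rho>: "\<rho> A > 0" if "A \<in> P" for A
  proof -
    have "A $ 1 $ 1 \<noteq> 0 \<or> A $ 1 $ 2 \<noteq> 0"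
      using that by (auto simp: P_def)
    then show ?thesis
      by (simp add: \<rho>_def sum_power2_gt_zero_iff flip: power2_eq_square)
  qed
  note entry = ndf_bounded_linear[OF bounded_linear_entry]
  have ndf_ang: "ndf n P (ang \<theta> a b)" for n
    unfolding ang_def
    by (intro ndf_add ndf_const ndf_compose[OF _ ndf_arctan] ndf_mult ndf_diff ndf_divide entry) (auto simp: P_def)
  have ndf_\<rho>: "ndf n P \<rho>" for n
    unfolding \<rho>_def by (intro ndf_add ndf_mult entry)
  have ndf_ln_\<rho>: "ndf n P (\<lambda>A. ln (\<rho> A))" for n
    by (rule ndf_compose[OF ndf_\<rho> ndf_ln]) (use \<rho> in auto)
  have ndf_\<kappa>: "ndf n P \<kappa>" for n
    unfolding \<kappa>_def by (intro ndf_minus ndf_divide ndf_\<rho> ndf_mult ndf_const ndf_add entry) (use \<rho> in force)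
  have oP: "open P"
    unfolding P_def by (intro open_Collect_less continuous_intros)
  have oQ: "open Q"
    using continuous_open_preimage[OF ndf_continuous[OF ndf_ang] oP open_greaterThan[of 0]]
    by (simp add: Q_def vimage_def Int_def)
  have lift: "ndf n (Q \<times> UNIV) (\<lambda>z::(real^2^2) \<times> 'h. T (fst z))" if "ndf n P T" for n and T :: "real^2^2 \<Rightarrow> real"
    by (rule ndf_compose[OF ndf_bounded_linear[OF bounded_linear_fst] that]) (auto simp: Q_def)
  have "ndf n (Q \<times> UNIV) H" for n
    unfolding H_def
    by (intro ndf_compose[OF _ ndf_Kepler[of n UNIV]] ndf_compose[OF _ ndf_F] ndf_Pair ndf_minus lift ndf_\<kappa> ndf_ln_\<rho> ndf_ang
        ndf_bounded_linear[OF bounded_linear_snd]) (auto simp: Q_def)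
  then have smooth: "smooth_on (Q \<times> UNIV) H"
    by (intro ndf_smooth_on open_Times oQ open_UNIV)
  have eq: "\<Psi> (g, h) = H (p g, h)" "p g \<in> Q" if g: "g \<in> M" for g h
  proof -
    define A where "A = p g"
    show "p g \<in> Q"
      using M(4)[OF g] by (simp add: Q_def P_def)
    then have \<rho>A: "\<rho> A > 0"
      using \<rho> by (simp add: A_def Q_def)
    have rl: "row_length A = sqrt (\<rho> A)"
      by (simp add: row_length_def \<rho>_def power2_eq_square)
    have "- (2 * row_shear A / row_length A) = \<kappa> A"
      using \<rho>A by (simp add: row_shear_def rl \<kappa>_def)
    moreover have "- (2 * ln (row_length A)) = - ln (\<rho> A)"
      using \<rho>A by (simp add: rl ln_sqrt)
    moreover have "\<Psi> (phiR (ang \<theta> a b A, row_length A, row_shear A), h)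
        = Kepler (F (((- (2 * row_shear A / row_length A), - (2 * ln (row_length A))), h), ang \<theta> a b A))"
      using \<rho>A by (intro \<Psi>_phiR) (simp add: Dom_def rl)
    ultimately show "\<Psi> (g, h) = H (p g, h)"
      using M(4)[OF g] by (simp add: H_def A_def)
  qed
  show "\<exists>V N W F. openin (top_of_set G) V \<and> g0 \<in> V \<and> V \<subseteq> G0 G p e \<and> open N \<and> h0 \<in> N \<and>
      p ` V \<times> N \<subseteq> W \<and> smooth_on W F \<and> (\<forall>x\<in>V. \<forall>y\<in>N. \<Psi> (x, y) = F (p x, y))"
  proof (intro exI conjI ballI)
    show "p ` M \<times> UNIV \<subseteq> Q \<times> UNIV"
      using eq(2) by auto
    show "\<Psi> (x, y) = H (p x, y)" if "x \<in> M" for x y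
      by (rule eq(1)[OF that])
  qed (use M x smooth in auto)
qed

lemma diffeomorphism_\<Psi>: "diffeomorphism_from_cover G p (G0 G p e) \<Psi>"
  unfolding diffeomorphism_from_cover_def inv_\<Psi>
  using bij_\<Psi> smooth_from_\<Psi> smooth_into_\<Xi> by blast

end

theorem theorem1:
  fixes G :: "'g::topological_space set" and p :: "'g \<Rightarrow> real^2^2" and e :: 'g
  assumes "universal_cover_SL2 G p e"
    and "separable_space (euclidean :: 'h::{real_inner, complete_space} topology)"
    and "\<not> (\<exists>B :: 'h set. finite B \<and> span B = UNIV)"
  shows "\<exists>\<Psi> :: 'g \<times> 'h \<Rightarrow> H0.
           diffeomorphism_from_cover G p (G0 G p e) \<Psi> \<and>
           (\<forall>g\<in>G0 G p e. \<forall>h. monodromy G p e (\<Psi> (g, h)) = g)"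
proof -
  obtain U :: "'h \<Rightarrow> H0" and V where UV: "bounded_linear U" "bounded_linear V" "\<And>h. V (U h) = h"
    "\<And>h e. e \<in> {e1, e2, e3} \<Longrightarrow> inner (U h) e = 0" "\<And>e. e \<in> {e1, e2, e3} \<Longrightarrow> V e = 0"
    "\<And>x. U (V x) = x - (\<Sum>e\<in>{e1, e2, e3}. inner x e *\<^sub>R e)"
    by (rule Hilbert_space_split[OF assms(2,3) orthonormal_e]) (simp, rule that)
  have "split U V"
    by (rule split.intro) (use UV sum_e in auto)
  then interpret trivialization G p e U V
    using assms(1) by (intro trivialization.intro SL2_cover.intro)
  show ?thesis
    using diffeomorphism_\<Psi> monodromy_\<Psi> by blast
qed

end
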